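(* Let $\sqrt n(c_n-c)\to\theta\in\mathbb{R}$ as $n\to\infty$, where $c>0$. Then the following holds. 1. The sequence $\sqrt n(\alpha^n/n-\alpha)$, $n\in\mathbb{N}$, converges in distribution in $\mathbb{R}$ as $n\to\infty$ to a Gaussian random variable $\tilde\alpha$ with $\mathbf{E}\tilde\alpha=-\theta(1-\beta^2)/2$ and $\mathbf{Var}\,\tilde\alpha=\beta(1-\beta)+c(1-\beta)^2/2$. 2. If, in addition, $c>1$, then the sequence $\bigl(\sqrt n(\alpha^n/n-\alpha),\sqrt n(\beta^n/n-\beta),\sqrt n(\gamma^n/n-\gamma)\bigr)$, $n\in\mathbb{N}$, converges in distribution in $\mathbb{R}^3$ as $n\to\infty$ to a Gaussian random variable $(\tilde\alpha,\tilde\beta,\tilde\gamma)$, where $\tilde\alpha$ has the mean and variance given in part 1, and $\mathbf{E}\tilde\beta=\theta\beta(1-\beta)/(1-c(1-\beta))$, $\mathbf{E}\tilde\gamma=\theta\beta^2/2$, $\mathbf{Var}\,\tilde\beta=\beta(1-\beta)/(1-c(1-\beta))^2$, $\mathbf{Var}\,\tilde\gamma=\beta(1-\beta)+c\beta(3\beta/2-1)$, $\mathbf{Cov}(\tilde\alpha,\tilde\beta)=-\beta(1-\beta)/(1-c(1-\beta))$, $\mathbf{Cov}(\tilde\alpha,\tilde\gamma)=-\beta(1-\beta)(c-1)$, and $\mathbf{Cov}(\tilde\beta,\tilde\gamma)=\beta(1-\beta)(c-1)/(1-c(1-\beta))$.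
   Context: $\mathcal{G}(n,c_n/n)$ is the random graph on $n$ vertices in which every two vertices are independently connected by an edge with probability $c_n/n$ ($c_n/n\in[0,1]$ for all large $n$). $\alpha^n$ is the number of its connected components, $\beta^n$ is the size (number of vertices) of its largest connected component (ties broken arbitrarily), and $\gamma^n$ is the number of excess edges of the largest component, where the number of excess edges of a connected component with $v$ vertices and $e$ edges is $e-(v-1)$. If $c>1$, $\beta\in(0,1)$ is the positive solution of $1-\beta=\exp(-\beta c)$; if $c\le1$, $\beta=0$. Further, $\alpha=1-\beta-c(1-\beta)^2/2$ and $\gamma=(c-1)\beta-c\beta^2/2$. *)

theory Defs
  imports "HOL-Probability.Probability"
begin

text \<open>A graph on the vertices 1, ..., n is identified with its edge set, a set of two-element
  subsets of {1..n}.\<close>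

definition all_edges :: "nat \<Rightarrow> nat set set" where
  "all_edges n = {e. e \<subseteq> {1..n} \<and> card e = 2}"

definition adjacency :: "nat set set \<Rightarrow> (nat \<times> nat) set" where
  "adjacency E = {(u, v). {u, v} \<in> E}"

definition connected_rel :: "nat \<Rightarrow> nat set set \<Rightarrow> (nat \<times> nat) set" where
  "connected_rel n E = {(u, v). u \<in> {1..n} \<and> v \<in> {1..n} \<and> (u, v) \<in> (adjacency E)\<^sup>*}"

definition graph_components :: "nat \<Rightarrow> nat set set \<Rightarrow> nat set set" where
  "graph_components n E = {1..n} // connected_rel n E"

definition is_largest_component :: "nat \<Rightarrow> nat set set \<Rightarrow> nat set \<Rightarrow> bool" where
  "is_largest_component n E C \<longleftrightarrow>
     C \<in> graph_components n E \<and> (\<forall>D\<in>graph_components n E. card D \<le> card C)"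

text \<open>The value is an integer: natural-number subtraction would truncate.\<close>

definition excess_edges :: "nat set set \<Rightarrow> nat set \<Rightarrow> int" where
  "excess_edges E C = int (card {e \<in> E. e \<subseteq> C}) - (int (card C) - 1)"

text \<open>The library's \<^const>\<open>bernoulli_pmf\<close> truncates its parameter to the unit interval, so this
  is the usual binomial random graph exactly when \<open>p\<close> lies between 0 and 1.\<close>

definition random_graph :: "nat \<Rightarrow> real \<Rightarrow> nat set set pmf" where
  "random_graph n p =
     map_pmf (\<lambda>f. {e \<in> all_edges n. f e}) (Pi_pmf (all_edges n) False (\<lambda>_. bernoulli_pmf p))"

text \<open>A law is Gaussian if all its one-dimensional projections are normal; point masses count as
  (degenerate) normal laws, so that singular covariance matrices are admitted.\<close>

definition gaussian_law :: "'a::euclidean_space measure \<Rightarrow> bool" where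
  "gaussian_law N \<longleftrightarrow> prob_space N \<and> sets N = sets borel \<and>
     (\<forall>u. (\<exists>m. distr N borel (\<lambda>x. u \<bullet> x) = return borel m) \<or>
          (\<exists>m s. s > 0 \<and> distributed N lborel (\<lambda>x. u \<bullet> x) (normal_density m s)))"

definition covariance :: "'a measure \<Rightarrow> ('a \<Rightarrow> real) \<Rightarrow> ('a \<Rightarrow> real) \<Rightarrow> real" where
  "covariance M X Y =
     prob_space.expectation M
       (\<lambda>w. (X w - prob_space.expectation M X) * (Y w - prob_space.expectation M Y))"

text \<open>The library's \<^const>\<open>weak_conv_m\<close> is confined to the real line.\<close>

definition weak_conv_law :: "(nat \<Rightarrow> 'a::euclidean_space measure) \<Rightarrow> 'a measure \<Rightarrow> bool" where
  "weak_conv_law M N \<longleftrightarrow>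
     (\<forall>f :: 'a \<Rightarrow> real. continuous_on UNIV f \<longrightarrow> bounded (range f) \<longrightarrow>
        (\<lambda>n. integral\<^sup>L (M n) f) \<longlonglongrightarrow> integral\<^sup>L N f)"

lemma weak_conv_law_real_iff:
  assumes "\<And>n. real_distribution (M n)" and "real_distribution N"
  shows "weak_conv_law M N \<longleftrightarrow> weak_conv_m M N"
proof
  assume "weak_conv_law M N"
  then show "weak_conv_m M N"
    by (intro integral_bdd_continuous_conv_imp_weak_conv)
       (auto simp: weak_conv_law_def bounded_iff assms intro!: continuous_at_imp_continuous_on)
next
  assume "weak_conv_m M N"
  then show "weak_conv_law M N"
    by (auto simp: weak_conv_law_def bounded_iff continuous_on_eq_continuous_at
             intro!: weak_conv_imp_integral_bdd_continuous_conv assms)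
qed

end

theory Submission
  imports Defs "HOL-Complex_Analysis.Complex_Analysis" "HOL-Real_Asymp.Real_Asymp"
begin

text \<open>Let \<open>T\<close> be the size of the component of a fixed vertex. Given its vertex set \<open>S\<close>, the
  edges inside \<open>S\<close> and the edges outside are independent, so exponential moments of sizes and
  edge counts, summed over the components, reduce to the law of \<open>T\<close> under a tilted edge
  probability. With \<open>q = 1 - p\<close> this law satisfies
  \<open>E (1 - x q\<^sup>-\<^sup>T)\<^sup>n\<^sup>-\<^sup>T = (1 - x)\<^sup>n\<^sup>-\<^sup>1\<close> for every real \<open>x\<close>. The choice
  \<open>x = \<mu> / \<surd>n\<close> makes the identity a statement about the exponential moments of
  \<open>(T - \<beta> n) / \<surd>n\<close> near \<open>\<beta> n\<close>, and excludes components of any other size that is neither bounded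
  nor small; fixed values of \<open>x\<close> give the probability that \<open>T\<close> is small.

  If \<open>c > 1\<close>, there is therefore exactly one component of size near \<open>\<beta> n\<close> with probability tending
  to 1, and the joint exponential moments of its size, its edges and the edges outside converge to
  Gaussian ones. The number of the other components is the number of the remaining vertices minus
  that of the remaining edges, up to the number of independent cycles outside the giant, which is
  \<open>o(\<surd>n)\<close> since the complement is subcritical. If \<open>c \<le> 1\<close>, the same bound on the cycles
  leaves only the binomial number of edges.\<close>

no_notation fps_nth (infixl "$" 75)

section \<open>Components of a random subset of edges\<close>

text \<open>The identity does the work of both a branching process comparison and a local limit
  theorem. Its integrand, divided by (1 - x)^(n-1), has mean 1. At x = \<mu>/sqrt n this normalised
  integrand is close to 1 at small sizes; near \<beta> n it is exp (\<mu> Y - \<mu>^2/2 V), where Y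
  is nearly affine in (s - \<beta> n)/sqrt n and V nearly constant. So once the small sizes are
  known to carry mass 1 - \<beta>, the other \<beta> must carry Gaussian exponential moments. That
  mass is read off at x = -\<beta>/(1 - \<beta>), where the integrand is flat to first order at
  small sizes and negligible at sizes of order n; the total 1/(1 - x) is then 1 - \<beta>. Weighting
  edges with exp (\<nu>/sqrt n) moves p only by order n^(-3/2): this shifts \<theta> and leaves c
  and \<beta> alone, so one analysis serves all joint moments.

  The obstacle is that independence gives expectations of sums over components, not the law of the
  giant. Sums over components of size near \<beta> n are therefore treated throughout, and a second
  moment bound shows at the end that such a sum has one term.\<close>

definition pairs :: "nat set \<Rightarrow> nat set set" where
  "pairs V = {e. e \<subseteq> V \<and> card e = 2}"

text \<open>The random subset contains each element independently with probability \<open>p\<close>.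
  As a finite sum it obeys algebraic rules for every real \<open>p\<close>; only inequalities ask
  for \<open>p\<close> in [0, 1]. \<open>expectation_random_graph\<close> ties it to the
  measure.\<close>

definition gexp :: "real \<Rightarrow> 'a set \<Rightarrow> ('a set \<Rightarrow> real) \<Rightarrow> real" where
  "gexp p P f = (\<Sum>E\<in>Pow P. p ^ card E * (1 - p) ^ card (P - E) * f E)"

lemma gexp_empty [simp]: "gexp p {} f = f {}"
  by (simp add: gexp_def)

lemma gexp_cong: "P = Q \<Longrightarrow> (\<And>E. E \<subseteq> P \<Longrightarrow> f E = g E) \<Longrightarrow> gexp p P f = gexp p Q g"
  by (auto simp: gexp_def intro!: sum.cong)

lemma gexp_cmult: "gexp p P (\<lambda>E. c * f E) = c * gexp p P f"
  unfolding gexp_def sum_distrib_left by (intro sum.cong refl) simp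

lemma gexp_mult_right: "gexp p P (\<lambda>E. f E * c) = gexp p P f * c"
  unfolding gexp_def sum_distrib_right by (intro sum.cong refl) simp

lemma gexp_add: "gexp p P (\<lambda>E. f E + g E) = gexp p P f + gexp p P g"
  by (simp add: gexp_def sum.distrib algebra_simps)

lemma gexp_diff: "gexp p P (\<lambda>E. f E - g E) = gexp p P f - gexp p P g"
  by (simp add: gexp_def sum_subtractf algebra_simps)

lemma gexp_sum: "gexp p P (\<lambda>E. \<Sum>i\<in>I. f i E) = (\<Sum>i\<in>I. gexp p P (f i))"
  unfolding gexp_def by (subst sum.swap) (simp add: sum_distrib_left)

lemma gexp_mono:
  assumes "0 \<le> p" "p \<le> 1" "\<And>E. E \<subseteq> P \<Longrightarrow> f E \<le> g E"
  shows "gexp p P f \<le> gexp p P g"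
  unfolding gexp_def using assms by (intro sum_mono mult_left_mono) auto

lemma gexp_nonneg:
  assumes "0 \<le> p" "p \<le> 1" "\<And>E. E \<subseteq> P \<Longrightarrow> 0 \<le> f E"
  shows "0 \<le> gexp p P f"
  unfolding gexp_def using assms by (intro sum_nonneg mult_nonneg_nonneg) auto

lemma gexp_insert:
  assumes "finite P" "e \<notin> P"
  shows "gexp p (insert e P) f = (1 - p) * gexp p P f + p * gexp p P (\<lambda>E. f (insert e E))"
proof -
  have "gexp p (insert e P) f =
      (\<Sum>E\<in>Pow P. p ^ card E * (1 - p) ^ card (insert e P - E) * f E) +
      (\<Sum>E\<in>insert e ` Pow P. p ^ card E * (1 - p) ^ card (insert e P - E) * f E)"
    unfolding gexp_def Pow_insert using assms by (intro sum.union_disjoint) auto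
  also have "(\<Sum>E\<in>Pow P. p ^ card E * (1 - p) ^ card (insert e P - E) * f E) =
      (1 - p) * gexp p P f"
    unfolding gexp_def sum_distrib_left
  proof (intro sum.cong refl)
    fix E assume E: "E \<in> Pow P"
    then have "insert e P - E = insert e (P - E)" using assms by auto
    then have "card (insert e P - E) = Suc (card (P - E))" using assms by simp
    then show "p ^ card E * (1 - p) ^ card (insert e P - E) * f E =
        (1 - p) * (p ^ card E * (1 - p) ^ card (P - E) * f E)" by simp
  qed
  also have "(\<Sum>E\<in>insert e ` Pow P. p ^ card E * (1 - p) ^ card (insert e P - E) * f E) =
      (\<Sum>E\<in>Pow P. p ^ card (insert e E) * (1 - p) ^ card (insert e P - insert e E) * f (insert e E))"
    using assms by (intro sum.reindex_cong[of "insert e"]) (auto intro!: inj_onI)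
  also have "\<dots> = p * gexp p P (\<lambda>E. f (insert e E))"
    unfolding gexp_def sum_distrib_left
  proof (intro sum.cong refl)
    fix E assume E: "E \<in> Pow P"
    then have "insert e P - insert e E = P - E" "card (insert e E) = Suc (card E)"
      using assms finite_subset[of E P] by (auto intro!: card_insert_disjoint)
    then show "p ^ card (insert e E) * (1 - p) ^ card (insert e P - insert e E) * f (insert e E) =
        p * (p ^ card E * (1 - p) ^ card (P - E) * f (insert e E))" by simp
  qed
  finally show ?thesis .
qed

lemma gexp_const: "finite P \<Longrightarrow> gexp p P (\<lambda>_. c) = c"
  by (induction P rule: finite_induct) (simp_all add: gexp_insert algebra_simps)

text \<open>Independence of the choices on disjoint sets, in the form of an iterated
  expectation.\<close>

lemma gexp_Un:
  assumes "finite P" "finite Q" "P \<inter> Q = {}"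
  shows "gexp p (P \<union> Q) f = gexp p P (\<lambda>E1. gexp p Q (\<lambda>E2. f (E1 \<union> E2)))"
  using assms(2,1,3)
proof (induction Q arbitrary: f rule: finite_induct)
  case (insert e Q)
  have "gexp p (P \<union> insert e Q) f = gexp p (insert e (P \<union> Q)) f" by simp
  also have "\<dots> = (1 - p) * gexp p (P \<union> Q) f + p * gexp p (P \<union> Q) (\<lambda>E. f (insert e E))"
    using insert by (intro gexp_insert) auto
  also have "\<dots> = gexp p P (\<lambda>E1. gexp p (insert e Q) (\<lambda>E2. f (E1 \<union> E2)))"
    using insert by (simp add: gexp_insert gexp_cmult gexp_add)
  finally show ?case .
qed simp

lemma gexp_only_empty:
  assumes "finite P"
  shows "gexp p P (\<lambda>E. of_bool (E = {}) * f E) = (1 - p) ^ card P * f {}"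
proof -
  have "gexp p P (\<lambda>E. of_bool (E = {}) * f E) =
      (\<Sum>E\<in>{{}}. p ^ card E * (1 - p) ^ card (P - E) * (of_bool (E = {}) * f E))"
    unfolding gexp_def using assms by (intro sum.mono_neutral_right) auto
  then show ?thesis by simp
qed

text \<open>A factor \<open>r\<close> per chosen element replaces the weights p and 1 - p by p r and
  1 - p. Dividing by their sum makes them Bernoulli weights again, at the cost of one normalising
  factor per element of \<open>P\<close>. Exponential moments of edge counts become expectations at
  another edge probability.\<close>

lemma gexp_tilt:
  assumes "finite P" "1 - p + p * r \<noteq> 0"
  shows "gexp p P (\<lambda>E. r ^ card E * f E) =
    (1 - p + p * r) ^ card P * gexp (p * r / (1 - p + p * r)) P f"
  unfolding gexp_def sum_distrib_left
proof (intro sum.cong refl)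
  fix E assume E: "E \<in> Pow P"
  let ?\<rho> = "1 - p + p * r"
  have fin: "finite E" using E assms finite_subset by auto
  have c: "card P = card E + card (P - E)"
    using E assms fin by (metis Pow_iff card_Diff_subset card_mono le_add_diff_inverse)
  have "1 - p * r / ?\<rho> = (1 - p) / ?\<rho>" using assms by (simp add: field_simps)
  then have "?\<rho> ^ card P * ((p * r / ?\<rho>) ^ card E * (1 - p * r / ?\<rho>) ^ card (P - E) * f E)
     = (?\<rho> ^ card E * (p * r / ?\<rho>) ^ card E) * (?\<rho> ^ card (P - E) * ((1 - p) / ?\<rho>) ^ card (P - E)) * f E"
    unfolding c by (simp add: power_add mult_ac)
  also have "\<dots> = (p * r) ^ card E * (1 - p) ^ card (P - E) * f E"
    using assms(2) by (simp flip: power_mult_distrib)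
  also have "\<dots> = p ^ card E * (1 - p) ^ card (P - E) * (r ^ card E * f E)"
    by (simp add: power_mult_distrib)
  finally show "p ^ card E * (1 - p) ^ card (P - E) * (r ^ card E * f E) =
      ?\<rho> ^ card P * ((p * r / ?\<rho>) ^ card E * (1 - p * r / ?\<rho>) ^ card (P - E) * f E)"
    by (rule sym)
qed

lemma gexp_subset_mono:
  assumes "0 \<le> p" "p \<le> 1" "finite Q" "P \<subseteq> Q"
    and "\<And>E1 E2. E1 \<subseteq> P \<Longrightarrow> E2 \<subseteq> Q - P \<Longrightarrow> f E1 \<le> f (E1 \<union> E2)"
  shows "gexp p P f \<le> gexp p Q f"
proof -
  have "gexp p P f = gexp p P (\<lambda>E1. gexp p (Q - P) (\<lambda>_. f E1))"
    using assms by (simp add: gexp_const)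
  also have "\<dots> \<le> gexp p P (\<lambda>E1. gexp p (Q - P) (\<lambda>E2. f (E1 \<union> E2)))"
    using assms by (intro gexp_mono) auto
  also have "\<dots> = gexp p (P \<union> (Q - P)) f"
    using assms by (subst gexp_Un) (auto intro: finite_subset)
  also have "P \<union> (Q - P) = Q" using assms by auto
  finally show ?thesis .
qed

section \<open>Vertex pairs, connected components and their factorisation\<close>

lemma finite_pairs [simp]: "finite V \<Longrightarrow> finite (pairs V)"
  unfolding pairs_def by (rule finite_subset[of _ "Pow V"]) auto

lemma card_pairs: "finite V \<Longrightarrow> card (pairs V) = card V choose 2"
  unfolding pairs_def by (rule n_subsets)

lemma pairs_doubleton: "{u, v} \<in> pairs V \<longleftrightarrow> u \<in> V \<and> v \<in> V \<and> u \<noteq> v"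
  by (auto simp: pairs_def card_insert_if)

lemma pairs_mono: "S \<subseteq> V \<Longrightarrow> pairs S \<subseteq> pairs V"
  by (auto simp: pairs_def)

lemma pairs_disjoint:
  assumes "S \<inter> T = {}"
  shows "pairs S \<inter> pairs T = {}"
proof (rule equals0I)
  fix e assume "e \<in> pairs S \<inter> pairs T"
  then have "e \<subseteq> S \<inter> T" "card e = 2" by (simp_all add: pairs_def)
  then show False using assms by simp
qed

text \<open>The vertex set is arbitrary because, once a component \<open>S\<close> is split off, the
  remaining graph lives on \<open>V - S\<close>.\<close>

definition conn :: "nat set \<Rightarrow> nat set set \<Rightarrow> (nat \<times> nat) set" where
  "conn V E = {(u, v). u \<in> V \<and> v \<in> V \<and> (u, v) \<in> (adjacency E)\<^sup>*}"

definition comps :: "nat set \<Rightarrow> nat set set \<Rightarrow> nat set set" where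
  "comps V E = V // conn V E"

definition connd :: "nat set \<Rightarrow> nat set set \<Rightarrow> bool" where
  "connd S E \<longleftrightarrow> (\<forall>u\<in>S. \<forall>v\<in>S. (u, v) \<in> (adjacency E)\<^sup>*)"

lemma sym_adjacency: "sym (adjacency E)"
  by (auto simp: sym_def adjacency_def insert_commute)

lemma equiv_conn: "equiv V (conn V E)"
proof (rule equivI)
  show "conn V E \<subseteq> V \<times> V" by (auto simp: conn_def)
  show "refl_on V (conn V E)" by (auto simp: refl_on_def conn_def)
  show "sym (conn V E)"
    using sym_rtrancl[OF sym_adjacency, of E] by (auto simp: sym_def conn_def)
  show "trans (conn V E)" by (auto simp: trans_def conn_def)
qed

lemma graph_components_eq: "graph_components n E = comps {1..n} E"
  by (simp add: graph_components_def comps_def connected_rel_def conn_def)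

lemma all_edges_eq: "all_edges n = pairs {1..n}"
  by (simp add: all_edges_def pairs_def)

lemma finite_comps [simp]: "finite V \<Longrightarrow> finite (comps V E)"
  unfolding comps_def by (rule finite_quotient) (auto simp: conn_def)

lemma comps_subset: "S \<in> comps V E \<Longrightarrow> S \<subseteq> V"
  unfolding comps_def by (auto simp: quotient_def conn_def)

lemma comps_nonempty: "S \<in> comps V E \<Longrightarrow> S \<noteq> {}"
  unfolding comps_def using equiv_conn in_quotient_imp_non_empty by blast

lemma Union_comps: "\<Union> (comps V E) = V"
  unfolding comps_def by (rule Union_quotient[OF equiv_conn])

lemma comps_disjoint: "S \<in> comps V E \<Longrightarrow> T \<in> comps V E \<Longrightarrow> S \<noteq> T \<Longrightarrow> S \<inter> T = {}"
  unfolding comps_def using quotient_disj[OF equiv_conn] by blast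

lemma comps_closed:
  "S \<in> comps V E \<Longrightarrow> u \<in> S \<Longrightarrow> v \<in> V \<Longrightarrow> (u, v) \<in> (adjacency E)\<^sup>* \<Longrightarrow> v \<in> S"
  unfolding comps_def
  by (auto elim!: quotientE simp: conn_def intro: rtrancl_trans)

lemma comps_connected:
  "S \<in> comps V E \<Longrightarrow> u \<in> S \<Longrightarrow> v \<in> S \<Longrightarrow> (u, v) \<in> (adjacency E)\<^sup>*"
  using in_quotient_imp_in_rel[OF equiv_conn, of S V E u v] by (auto simp: comps_def conn_def)

lemma compsI:
  assumes "S \<subseteq> V" "S \<noteq> {}" "\<And>u v. u \<in> S \<Longrightarrow> v \<in> S \<Longrightarrow> (u, v) \<in> (adjacency E)\<^sup>*"
    and "\<And>u v. u \<in> S \<Longrightarrow> v \<in> V \<Longrightarrow> (u, v) \<in> (adjacency E)\<^sup>* \<Longrightarrow> v \<in> S"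
  shows "S \<in> comps V E"
proof -
  obtain u where u: "u \<in> S" using assms(2) by auto
  have "S = conn V E `` {u}"
  proof (intro set_eqI iffI)
    fix v assume "v \<in> S"
    then show "v \<in> conn V E `` {u}" using u assms(1) assms(3)[OF u] by (simp add: conn_def subset_iff)
  next
    fix v assume "v \<in> conn V E `` {u}"
    then show "v \<in> S" using assms(4)[OF u] by (simp add: conn_def)
  qed
  then show ?thesis unfolding comps_def using u assms(1) by (metis quotientI subsetD)
qed

lemma adjacency_mono: "E \<subseteq> F \<Longrightarrow> adjacency E \<subseteq> adjacency F"
  by (auto simp: adjacency_def)

text \<open>No edge leaves \<open>S\<close>, so no walk does, and it uses edges inside
  \<open>S\<close> only. This is applied to a component as well as to the complement of one.\<close>

lemma walk_in_set:
  assumes "(u, v) \<in> (adjacency E)\<^sup>*" "u \<in> S" "E \<subseteq> pairs V"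
    and "\<And>x y. x \<in> S \<Longrightarrow> {x, y} \<in> E \<Longrightarrow> y \<in> S"
  shows "v \<in> S \<and> (u, v) \<in> (adjacency (E \<inter> pairs S))\<^sup>*"
  using assms(1)
proof (induction rule: rtrancl_induct)
  case (step y z)
  then have yz: "{y, z} \<in> E" by (auto simp: adjacency_def)
  moreover from yz step have "z \<in> S" using assms(4) by blast
  moreover have "{y, z} \<in> pairs S"
    using yz \<open>z \<in> S\<close> step assms(3) pairs_doubleton[of y z] by blast
  ultimately show ?case using step
    by (auto simp: adjacency_def intro: rtrancl_into_rtrancl)
qed (use assms in auto)

text \<open>The condition involves the edges inside \<open>S\<close> and the crossing edges only, in
  separate conjuncts. Since the three classes of pairs are disjoint, the event has product form and
  leaves the graph on \<open>V - S\<close> unconditioned.\<close>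

lemma in_comps_iff:
  assumes "E \<subseteq> pairs V" "S \<subseteq> V"
  shows "S \<in> comps V E \<longleftrightarrow>
    S \<noteq> {} \<and> E - (pairs S \<union> pairs (V - S)) = {} \<and> connd S (E \<inter> pairs S)"
proof
  assume S: "S \<in> comps V E"
  have cl: "y \<in> S" if "x \<in> S" "{x, y} \<in> E" for x y
  proof -
    have "y \<in> V" using that assms(1) pairs_doubleton[of x y V] by blast
    moreover have "(x, y) \<in> (adjacency E)\<^sup>*"
      using that(2) by (intro r_into_rtrancl) (simp add: adjacency_def)
    ultimately show ?thesis using comps_closed[OF S that(1)] by simp
  qed
  have "e \<in> pairs S \<union> pairs (V - S)" if eE: "e \<in> E" for e
  proof -
    have "e \<subseteq> V" "card e = 2" using eE assms(1) by (auto simp: pairs_def)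
    then obtain x y where e: "e = {x, y}" "x \<noteq> y" "x \<in> V" "y \<in> V"
      by (auto simp: card_2_iff)
    have "{x, y} \<in> E" "{y, x} \<in> E" using eE e(1) by (simp_all add: insert_commute)
    then have "x \<in> S \<longleftrightarrow> y \<in> S" using cl[of x y] cl[of y x] by blast
    then show ?thesis unfolding e(1) using e(2-4) by (auto simp: pairs_doubleton)
  qed
  moreover have "connd S (E \<inter> pairs S)"
    unfolding connd_def
  proof (intro ballI)
    fix u v assume "u \<in> S" "v \<in> S"
    then have "(u, v) \<in> (adjacency E)\<^sup>*" by (rule comps_connected[OF S])
    from walk_in_set[OF this \<open>u \<in> S\<close> assms(1) cl]
    show "(u, v) \<in> (adjacency (E \<inter> pairs S))\<^sup>*" by simp
  qed
  ultimately show "S \<noteq> {} \<and> E - (pairs S \<union> pairs (V - S)) = {} \<and> connd S (E \<inter> pairs S)"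
    using comps_nonempty[OF S] by blast
next
  assume R: "S \<noteq> {} \<and> E - (pairs S \<union> pairs (V - S)) = {} \<and> connd S (E \<inter> pairs S)"
  have cl: "y \<in> S" if "x \<in> S" "{x, y} \<in> E" for x y
  proof -
    have "{x, y} \<in> pairs S \<union> pairs (V - S)" using R that by blast
    then show ?thesis using that by (auto simp: pairs_doubleton)
  qed
  show "S \<in> comps V E"
  proof (rule compsI)
    fix u v assume uv: "u \<in> S" "v \<in> S"
    then have "(u, v) \<in> (adjacency (E \<inter> pairs S))\<^sup>*" using R by (auto simp: connd_def)
    then show "(u, v) \<in> (adjacency E)\<^sup>*"
      using rtrancl_mono[OF adjacency_mono[of "E \<inter> pairs S" E]] by blast
  next
    fix u v assume u: "u \<in> S" and "v \<in> V" and uv: "(u, v) \<in> (adjacency E)\<^sup>*"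
    show "v \<in> S" using walk_in_set[OF uv u assms(1) cl] by simp
  qed (use R assms in auto)
qed

text \<open>Makes first moment arguments applicable a second time, to the graph left after one
  component: for the cycles outside the giant and for a second large component.\<close>

lemma comps_remove:
  assumes "E \<subseteq> pairs V" "S \<in> comps V E"
  shows "comps V E - {S} = comps (V - S) (E \<inter> pairs (V - S))"
proof -
  let ?W = "V - S" and ?F = "E \<inter> pairs (V - S)"
  have cl: "y \<in> ?W" if "x \<in> ?W" "{x, y} \<in> E" for x y
  proof -
    have "y \<in> V" using that assms(1) pairs_doubleton[of x y V] by blast
    moreover have "(y, x) \<in> (adjacency E)\<^sup>*"
      using that(2) by (intro r_into_rtrancl) (simp add: adjacency_def insert_commute)
    then have "y \<notin> S" using comps_closed[OF assms(2), of y x] that by blast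
    ultimately show ?thesis by blast
  qed
  have walk: "(u, v) \<in> (adjacency E)\<^sup>* \<longleftrightarrow> (u, v) \<in> (adjacency ?F)\<^sup>*" if "u \<in> ?W" for u v
    using walk_in_set[OF _ that assms(1) cl, of v]
      rtrancl_mono[OF adjacency_mono[of ?F E]] by auto
  have img: "conn V E `` {u} = conn ?W ?F `` {u}" if u: "u \<in> ?W" for u
  proof (intro set_eqI iffI)
    fix v assume "v \<in> conn V E `` {u}"
    then have "(u, v) \<in> (adjacency E)\<^sup>*" by (simp add: conn_def)
    from walk_in_set[OF this u assms(1) cl] show "v \<in> conn ?W ?F `` {u}"
      using u by (simp add: conn_def)
  next
    fix v assume "v \<in> conn ?W ?F `` {u}"
    then show "v \<in> conn V E `` {u}" using walk[OF u, of v] u by (simp add: conn_def)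
  qed
  have l: "T \<in> comps V E - {S} \<longleftrightarrow> (\<exists>u\<in>?W. T = conn V E `` {u})" for T
  proof
    assume T: "T \<in> comps V E - {S}"
    then obtain u where u: "u \<in> V" "T = conn V E `` {u}" by (auto simp: comps_def elim: quotientE)
    then have "u \<in> T" by (simp add: conn_def)
    then have "u \<notin> S" using T comps_disjoint[OF assms(2), of T] by blast
    then show "\<exists>u\<in>?W. T = conn V E `` {u}" using u by auto
  next
    assume "\<exists>u\<in>?W. T = conn V E `` {u}"
    then obtain u where u: "u \<in> ?W" "T = conn V E `` {u}" by auto
    then have "T \<in> comps V E" by (simp add: comps_def quotientI)
    moreover have "u \<in> T" using u by (simp add: conn_def)
    ultimately show "T \<in> comps V E - {S}" using u(1) by blast
  qed
  have r: "T \<in> comps ?W ?F \<longleftrightarrow> (\<exists>u\<in>?W. T = conn V E `` {u})" for T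
  proof -
    have "comps ?W ?F = (\<Union>u\<in>?W. {conn V E `` {u}})"
      unfolding comps_def quotient_def using img by (intro SUP_cong refl) simp
    then show ?thesis by simp
  qed
  show ?thesis by (intro set_eqI) (simp only: l r)
qed

lemma card_cross_pairs:
  assumes "finite V" "S \<subseteq> V"
  shows "card (pairs V - (pairs S \<union> pairs (V - S))) = card S * card (V - S)"
proof -
  have "bij_betw (\<lambda>(u, v). {u, v}) (S \<times> (V - S)) (pairs V - (pairs S \<union> pairs (V - S)))"
  proof (rule bij_betwI')
    fix x y assume "x \<in> S \<times> (V - S)" "y \<in> S \<times> (V - S)"
    then show "(case x of (u, v) \<Rightarrow> {u, v}) = (case y of (u, v) \<Rightarrow> {u, v}) \<longleftrightarrow> x = y"
      by (auto simp: doubleton_eq_iff)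
  next
    fix x assume "x \<in> S \<times> (V - S)"
    then show "(case x of (u, v) \<Rightarrow> {u, v}) \<in> pairs V - (pairs S \<union> pairs (V - S))"
      using assms by (auto simp: pairs_doubleton)
  next
    fix e assume e: "e \<in> pairs V - (pairs S \<union> pairs (V - S))"
    then obtain x y where xy: "e = {x, y}" "x \<noteq> y" "x \<in> V" "y \<in> V"
      by (auto simp: pairs_def card_2_iff)
    then show "\<exists>x\<in>S \<times> (V - S). e = (case x of (u, v) \<Rightarrow> {u, v})"
      using e by (auto simp: pairs_doubleton intro: bexI[of _ "(x, y)"] bexI[of _ "(y, x)"])
  qed
  then show ?thesis using bij_betw_same_card card_cartesian_product by metis
qed

text \<open>The sum over components is a sum over all nonempty vertex sets with the indicator of
  \<open>in_comps_iff\<close>. By independence each term factors: the power of 1 - p is the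
  probability that no crossing edge is present, and the inner expectations run over the edges inside
  and outside of \<open>S\<close>.\<close>

lemma gexp_sum_comps:
  assumes fin: "finite V"
  shows "gexp p (pairs V) (\<lambda>E. \<Sum>S\<in>comps V E. F S (E \<inter> pairs S) (E \<inter> pairs (V - S))) =
    (\<Sum>S\<in>Pow V - {{}}. (1 - p) ^ (card S * card (V - S)) *
        gexp p (pairs S) (\<lambda>E1. of_bool (connd S E1) * gexp p (pairs (V - S)) (F S E1)))"
proof -
  have "gexp p (pairs V) (\<lambda>E. \<Sum>S\<in>comps V E. F S (E \<inter> pairs S) (E \<inter> pairs (V - S))) =
      gexp p (pairs V) (\<lambda>E. \<Sum>S\<in>Pow V - {{}}. of_bool (S \<in> comps V E) *
        F S (E \<inter> pairs S) (E \<inter> pairs (V - S)))"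
  proof (intro gexp_cong refl)
    fix E
    have "comps V E \<subseteq> Pow V - {{}}" using comps_subset comps_nonempty by blast
    then show "(\<Sum>S\<in>comps V E. F S (E \<inter> pairs S) (E \<inter> pairs (V - S))) =
        (\<Sum>S\<in>Pow V - {{}}. of_bool (S \<in> comps V E) * F S (E \<inter> pairs S) (E \<inter> pairs (V - S)))"
      using fin by (intro sum.mono_neutral_cong_left) auto
  qed
  also have "\<dots> = (\<Sum>S\<in>Pow V - {{}}. gexp p (pairs V) (\<lambda>E. of_bool (S \<in> comps V E) *
        F S (E \<inter> pairs S) (E \<inter> pairs (V - S))))" by (rule gexp_sum)
  also have "\<dots> = (\<Sum>S\<in>Pow V - {{}}. (1 - p) ^ (card S * card (V - S)) *
        gexp p (pairs S) (\<lambda>E1. of_bool (connd S E1) * gexp p (pairs (V - S)) (F S E1)))"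
  proof (intro sum.cong refl)
    fix S assume "S \<in> Pow V - {{}}"
    then have S: "S \<subseteq> V" "S \<noteq> {}" by auto
    let ?A = "pairs S" and ?B = "pairs (V - S)"
    let ?C = "pairs V - (?A \<union> ?B)"
    have finS: "finite S" using S fin finite_subset by auto
    have AB: "?A \<inter> ?B = {}" by (rule pairs_disjoint) auto
    have V: "pairs V = ?A \<union> (?B \<union> ?C)" using pairs_mono[OF S(1)] pairs_mono[of "V - S" V] by auto
    have fA: "finite ?A" and fB: "finite ?B" and fC: "finite ?C" using fin finS by auto
    let ?f = "\<lambda>E. of_bool (S \<in> comps V E) * F S (E \<inter> ?A) (E \<inter> ?B)"
    have "gexp p (pairs V) ?f = gexp p (?A \<union> (?B \<union> ?C)) ?f" using V by simp
    also have "\<dots> = gexp p ?A (\<lambda>E1. gexp p ?B (\<lambda>E2. gexp p ?C (\<lambda>E3. ?f (E1 \<union> (E2 \<union> E3)))))"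
      using fA fB fC AB by (subst gexp_Un, auto, subst gexp_Un, auto)
    also have "\<dots> = gexp p ?A (\<lambda>E1. gexp p ?B (\<lambda>E2.
        gexp p ?C (\<lambda>E3. of_bool (E3 = {}) * (of_bool (connd S E1) * F S E1 E2))))"
    proof (intro gexp_cong refl)
      fix E1 E2 E3 assume E: "E1 \<subseteq> ?A" "E2 \<subseteq> ?B" "E3 \<subseteq> ?C"
      have sub: "E1 \<union> (E2 \<union> E3) \<subseteq> pairs V" using E V by auto
      have eq: "(E1 \<union> (E2 \<union> E3)) \<inter> ?A = E1" "(E1 \<union> (E2 \<union> E3)) \<inter> ?B = E2"
        "E1 \<union> (E2 \<union> E3) - (?A \<union> ?B) = E3" using E AB by auto
      show "?f (E1 \<union> (E2 \<union> E3)) = of_bool (E3 = {}) * (of_bool (connd S E1) * F S E1 E2)"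
        unfolding in_comps_iff[OF sub S(1)] eq using S by auto
    qed
    also have "\<dots> = (1 - p) ^ (card S * card (V - S)) *
        gexp p ?A (\<lambda>E1. of_bool (connd S E1) * gexp p ?B (F S E1))"
      unfolding gexp_only_empty[OF fC] card_cross_pairs[OF fin S(1)] gexp_cmult ..
    finally show "gexp p (pairs V) ?f = (1 - p) ^ (card S * card (V - S)) *
        gexp p ?A (\<lambda>E1. of_bool (connd S E1) * gexp p ?B (F S E1))" .
  qed
  finally show ?thesis .
qed

section \<open>The law of the size of the component of a vertex\<close>

lemma sum_Pow_card:
  fixes g :: "nat \<Rightarrow> real"
  assumes "finite V"
  shows "(\<Sum>S\<in>Pow V. g (card S)) = (\<Sum>s\<le>card V. real (card V choose s) * g s)"
proof -
  have "(\<Sum>S\<in>Pow V. g (card S)) = (\<Sum>s\<le>card V. \<Sum>S\<in>{S\<in>Pow V. card S = s}. g (card S))"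
    using assms
    by (intro sum.group[of "Pow V" "{..card V}" card "\<lambda>S. g (card S)", symmetric])
      (auto intro: card_mono)
  also have "\<dots> = (\<Sum>s\<le>card V. real (card V choose s) * g s)"
    using n_subsets[OF assms] by (intro sum.cong) auto
  finally show ?thesis .
qed

lemma sum_Pow_card_nonempty:
  fixes g :: "nat \<Rightarrow> real"
  assumes "finite V"
  shows "(\<Sum>S\<in>Pow V - {{}}. g (card S)) = (\<Sum>s=1..card V. real (card V choose s) * g s)"
proof -
  have "(\<Sum>S\<in>Pow V - {{}}. g (card S)) = (\<Sum>S\<in>Pow V. g (card S)) - g 0"
    using assms by (simp add: sum_diff1)
  also have "\<dots> = (\<Sum>s\<in>{..card V} - {0}. real (card V choose s) * g s)"
    by (simp add: sum_Pow_card[OF assms] sum_diff1)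
  also have "{..card V} - {0} = {1..card V}" by auto
  finally show ?thesis .
qed

lemma sum_Pow_card_member:
  fixes g :: "nat \<Rightarrow> real"
  assumes "finite V" "v \<in> V"
  shows "(\<Sum>S | S \<subseteq> V \<and> v \<in> S. g (card S)) =
    (\<Sum>s=1..card V. real ((card V - 1) choose (s - 1)) * g s)"
proof -
  have "(\<Sum>S | S \<subseteq> V \<and> v \<in> S. g (card S)) = (\<Sum>S\<in>Pow (V - {v}). g (card (insert v S)))"
    using assms
    by (intro sum.reindex_bij_witness[of _ "insert v" "\<lambda>S. S - {v}"]) (auto simp: insert_absorb)
  also have "\<dots> = (\<Sum>S\<in>Pow (V - {v}). g (Suc (card S)))"
    using assms by (intro sum.cong refl) (subst card_insert_disjoint; auto intro: finite_subset)
  also have "\<dots> = (\<Sum>s\<le>card (V - {v}). real (card (V - {v}) choose s) * g (Suc s))"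
    using assms by (intro sum_Pow_card[where g="\<lambda>k. g (Suc k)"]) auto
  also have "\<dots> = (\<Sum>s=1..card V. real ((card V - 1) choose (s - 1)) * g s)"
    using assms card_gt_0_iff[of V]
    by (intro sum.reindex_bij_witness[of _ "\<lambda>s. s - 1" Suc]) auto
  finally show ?thesis .
qed

definition kappa :: "real \<Rightarrow> nat \<Rightarrow> real" where
  "kappa p s = gexp p (pairs {1..s}) (\<lambda>E. of_bool (connd {1..s} E))"

text \<open>The probability that the component of a fixed vertex of the graph on \<open>n\<close> vertices has
  size \<open>s\<close>.\<close>

definition cluster_wt :: "real \<Rightarrow> nat \<Rightarrow> nat \<Rightarrow> real" where
  "cluster_wt p n s = real ((n - 1) choose (s - 1)) * kappa p s * (1 - p) ^ (s * (n - s))"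

text \<open>Exactly one component contains \<open>v\<close>; this constant 1 is expanded by
  \<open>gexp_sum_comps\<close>.\<close>

lemma connected_total:
  assumes "finite V" "v \<in> V"
  shows "(\<Sum>S | S \<subseteq> V \<and> v \<in> S. (1 - p) ^ (card S * card (V - S)) *
    gexp p (pairs S) (\<lambda>E. of_bool (connd S E))) = 1"
proof -
  have one: "(\<Sum>S\<in>comps V E. of_bool (v \<in> S) :: real) = 1" for E
  proof -
    obtain C where C: "C \<in> comps V E" "v \<in> C" using assms Union_comps[of V E] by auto
    have "(\<Sum>S\<in>comps V E. of_bool (v \<in> S) :: real) = (\<Sum>S\<in>{C}. of_bool (v \<in> S))"
      using C comps_disjoint[OF C(1)] assms by (intro sum.mono_neutral_right) auto
    then show ?thesis using C by simp
  qed
  have "1 = gexp p (pairs V) (\<lambda>E. \<Sum>S\<in>comps V E. of_bool (v \<in> S))"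
    using one assms by (simp add: gexp_const)
  also have "\<dots> = (\<Sum>S\<in>Pow V - {{}}. of_bool (v \<in> S) * ((1 - p) ^ (card S * card (V - S)) *
      gexp p (pairs S) (\<lambda>E1. of_bool (connd S E1))))"
    unfolding gexp_sum_comps[OF assms(1), where F="\<lambda>S E1 E2. of_bool (v \<in> S)"]
    using assms by (intro sum.cong refl) (simp add: gexp_const gexp_mult_right)
  also have "\<dots> = (\<Sum>S | S \<subseteq> V \<and> v \<in> S. (1 - p) ^ (card S * card (V - S)) *
      gexp p (pairs S) (\<lambda>E1. of_bool (connd S E1)))"
    using assms by (intro sum.mono_neutral_cong_right) auto
  finally show ?thesis by simp
qed

text \<open>\<open>connected_total\<close> is a recursion: it expresses the probability of
  connectedness on \<open>V\<close> by those on smaller sets. Strong induction on the cardinality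
  then gives invariance without transporting graphs along a bijection.\<close>

lemma gexp_connd_aux:
  assumes "finite V" "finite W" "card V = card W" "V \<noteq> {}"
  shows "gexp p (pairs V) (\<lambda>E. of_bool (connd V E)) = gexp p (pairs W) (\<lambda>E. of_bool (connd W E))"
  using assms
proof (induction "card V" arbitrary: V W rule: less_induct)
  case less
  let ?K = "\<lambda>S. gexp p (pairs S) (\<lambda>E. of_bool (connd S E))"
  let ?n = "card V"
  \<comment> \<open>The value 0 at the top size removes the unknown term from the recursion while
    the sum keeps its full range.\<close>
  define g where "g s = (if s = ?n then 0 else (1 - p) ^ (s * (?n - s)) * kappa p s)" for s
  have *: "?K U = 1 - (\<Sum>s=1..?n. real ((?n - 1) choose (s - 1)) * g s)"
    if U: "finite U" "card U = ?n" for U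
  proof -
    have "U \<noteq> {}" using U less.prems by auto
    then obtain v where v: "v \<in> U" by auto
    let ?D = "{S. S \<subseteq> U \<and> v \<in> S}"
    have finD: "finite ?D" using U by auto
    have "1 = (\<Sum>S\<in>?D. (1 - p) ^ (card S * card (U - S)) * ?K S)"
      using connected_total[OF U(1) v, of p] by simp
    also have "\<dots> = (1 - p) ^ (card U * card (U - U)) * ?K U +
        (\<Sum>S\<in>?D - {U}. (1 - p) ^ (card S * card (U - S)) * ?K S)"
      using finD v by (intro sum.remove) auto
    also have "(\<Sum>S\<in>?D - {U}. (1 - p) ^ (card S * card (U - S)) * ?K S) =
        (\<Sum>S\<in>?D - {U}. g (card S))"
    proof (intro sum.cong refl)
      fix S assume S: "S \<in> ?D - {U}"
      then have "finite S" "card S < ?n" using U psubset_card_mono[of U S] finite_subset[of S U] by auto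
      moreover have "card (U - S) = ?n - card S" using S U \<open>finite S\<close> by (simp add: card_Diff_subset)
      moreover have "?K S = kappa p (card S)"
        unfolding kappa_def using less.hyps[OF \<open>card S < ?n\<close> \<open>finite S\<close>, of "{1..card S}"] S by auto
      ultimately show "(1 - p) ^ (card S * card (U - S)) * ?K S = g (card S)"
        by (simp add: g_def)
    qed
    also have "\<dots> = (\<Sum>S\<in>?D. g (card S))"
      using finD U by (subst (2) sum.remove[of _ U]) (auto simp: v g_def)
    also have "\<dots> = (\<Sum>s=1..?n. real ((?n - 1) choose (s - 1)) * g s)"
      using sum_Pow_card_member[OF U(1) v, of g] U by simp
    finally show ?thesis by simp
  qed
  show ?case using *[of V] *[of W] less.prems by simp
qed

lemma gexp_connd:
  assumes "finite S" "S \<noteq> {}"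
  shows "gexp p (pairs S) (\<lambda>E. of_bool (connd S E)) = kappa p (card S)"
  unfolding kappa_def using assms by (intro gexp_connd_aux) auto

lemma sum_cluster_wt:
  assumes "n \<ge> 1"
  shows "(\<Sum>s=1..n. cluster_wt p n s) = 1"
proof -
  let ?g = "\<lambda>s. (1 - p) ^ (s * (n - s)) * kappa p s"
  have "1 = (\<Sum>S | S \<subseteq> {1..n} \<and> 1 \<in> S. (1 - p) ^ (card S * card ({1..n} - S)) *
    gexp p (pairs S) (\<lambda>E. of_bool (connd S E)))"
    using connected_total[of "{1..n}" 1 p] assms by simp
  also have "\<dots> = (\<Sum>S | S \<subseteq> {1..n} \<and> 1 \<in> S. ?g (card S))"
  proof (intro sum.cong refl)
    fix S :: "nat set" assume S: "S \<in> {S. S \<subseteq> {1..n} \<and> 1 \<in> S}"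
    then have "finite S" using finite_subset by auto
    then show "(1 - p) ^ (card S * card ({1..n} - S)) * gexp p (pairs S) (\<lambda>E. of_bool (connd S E)) =
        ?g (card S)" using S by (subst gexp_connd) (auto simp: card_Diff_subset)
  qed
  also have "\<dots> = (\<Sum>s=1..n. real ((n - 1) choose (s - 1)) * ?g s)"
    using sum_Pow_card_member[of "{1..n}" 1 ?g] assms by simp
  finally show ?thesis by (simp add: cluster_wt_def mult_ac)
qed

lemma kappa_nonneg: "0 \<le> p \<Longrightarrow> p \<le> 1 \<Longrightarrow> 0 \<le> kappa p s"
  unfolding kappa_def by (intro gexp_nonneg) auto

lemma cluster_wt_nonneg: "0 \<le> p \<Longrightarrow> p \<le> 1 \<Longrightarrow> 0 \<le> cluster_wt p n s"
  unfolding cluster_wt_def by (simp add: kappa_nonneg)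

lemma binomial_times_n: "1 \<le> s \<Longrightarrow> s \<le> n \<Longrightarrow>
  real (n choose s) = real n / real s * real ((n - 1) choose (s - 1))"
  using times_binomial_minus1_eq[of s n] by (simp add: field_simps flip: of_nat_mult)

text \<open>A component of size \<open>s\<close> is seen from \<open>s\<close> of the
  \<open>n\<close> vertices, so the expected number of components of size \<open>s\<close> is n/s
  times the probability that a fixed vertex lies in one. This is the source of every factor n/s
  below.\<close>

lemma gexp_sum_comps_card:
  assumes fin: "finite V"
    and F: "\<And>S E1. S \<subseteq> V \<Longrightarrow> S \<noteq> {} \<Longrightarrow> E1 \<subseteq> pairs S \<Longrightarrow>
      gexp p (pairs (V - S)) (F S E1) = g (card S)"
  shows "gexp p (pairs V) (\<lambda>E. \<Sum>S\<in>comps V E. F S (E \<inter> pairs S) (E \<inter> pairs (V - S))) =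
    (\<Sum>s=1..card V. real (card V) / real s * cluster_wt p (card V) s * g s)"
proof -
  let ?n = "card V"
  have "gexp p (pairs V) (\<lambda>E. \<Sum>S\<in>comps V E. F S (E \<inter> pairs S) (E \<inter> pairs (V - S))) =
      (\<Sum>S\<in>Pow V - {{}}. (1 - p) ^ (card S * (?n - card S)) * kappa p (card S) * g (card S))"
    unfolding gexp_sum_comps[OF fin]
  proof (intro sum.cong refl)
    fix S assume "S \<in> Pow V - {{}}"
    then have S: "S \<subseteq> V" "S \<noteq> {}" "finite S" using fin finite_subset by auto
    have "gexp p (pairs S) (\<lambda>E1. of_bool (connd S E1) * gexp p (pairs (V - S)) (F S E1)) =
        gexp p (pairs S) (\<lambda>E1. of_bool (connd S E1) * g (card S))"
      using F S by (intro gexp_cong) auto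
    also have "\<dots> = kappa p (card S) * g (card S)"
      using S by (simp add: gexp_mult_right gexp_connd)
    finally show "(1 - p) ^ (card S * card (V - S)) *
         gexp p (pairs S) (\<lambda>E1. of_bool (connd S E1) * gexp p (pairs (V - S)) (F S E1)) =
         (1 - p) ^ (card S * (?n - card S)) * kappa p (card S) * g (card S)"
      using S by (simp add: card_Diff_subset)
  qed
  also have "\<dots> = (\<Sum>s=1..?n. real (?n choose s) * ((1 - p) ^ (s * (?n - s)) * kappa p s * g s))"
    by (rule sum_Pow_card_nonempty[OF fin])
  also have "\<dots> = (\<Sum>s=1..?n. real ?n / real s * cluster_wt p ?n s * g s)"
    by (intro sum.cong refl) (auto simp: binomial_times_n cluster_wt_def)
  finally show ?thesis .
qed

text \<open>Edges inside carry weight \<open>r1\<close>, edges outside \<open>r2\<close>. The law on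
  the right is the one at \<open>tilted_p\<close>, whose crossing factor (1 - tilted_p)^(s (n - s))
  is too large; compensating for it costs one normalising factor per crossing pair, whence the
  exponent s (n - s) + (s choose 2) instead of s choose 2 alone.\<close>

lemma gexp_sum_comps_tilt:
  assumes fin: "finite V" and \<rho>: "1 - p + p * r1 > 0" "1 - p + p * r2 > 0" and p: "p < 1"
  defines "tilted_p \<equiv> p * r1 / (1 - p + p * r1)"
  defines "n \<equiv> card V"
  shows "gexp p (pairs V) (\<lambda>E. \<Sum>S\<in>comps V E.
      f (card S) * r1 ^ card (E \<inter> pairs S) * r2 ^ card (E \<inter> pairs (V - S))) =
    (\<Sum>s=1..n. real n / real s * cluster_wt tilted_p n s *
      (f s * (1 - p + p * r1) ^ (s * (n - s) + (s choose 2)) * (1 - p + p * r2) ^ ((n - s) choose 2)))"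
proof -
  let ?a = "1 - p + p * r1" and ?b = "1 - p + p * r2"
  \<comment> \<open>An absent edge is not weighted, so its unnormalised weight is still 1 -
    p.\<close>
  have q: "?a * (1 - tilted_p) = 1 - p" using \<rho> by (simp add: tilted_p_def field_simps)
  have "gexp p (pairs V) (\<lambda>E. \<Sum>S\<in>comps V E.
      f (card S) * r1 ^ card (E \<inter> pairs S) * r2 ^ card (E \<inter> pairs (V - S))) =
    (\<Sum>S\<in>Pow V - {{}}. (1 - p) ^ (card S * (n - card S)) *
       (f (card S) * ?a ^ (card S choose 2) * kappa tilted_p (card S) * ?b ^ ((n - card S) choose 2)))"
    unfolding gexp_sum_comps[OF fin, where F="\<lambda>S E1 E2. f (card S) * r1 ^ card E1 * r2 ^ card E2"]
  proof (intro sum.cong refl)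
    fix S assume "S \<in> Pow V - {{}}"
    then have S: "S \<subseteq> V" "S \<noteq> {}" "finite S" using fin finite_subset by auto
    have c: "card (V - S) = n - card S" using S by (simp add: card_Diff_subset n_def)
    have "gexp p (pairs S) (\<lambda>E1. of_bool (connd S E1) *
          gexp p (pairs (V - S)) (\<lambda>E2. f (card S) * r1 ^ card E1 * r2 ^ card E2)) =
        gexp p (pairs S) (\<lambda>E1. r1 ^ card E1 * of_bool (connd S E1) *
          (f (card S) * gexp p (pairs (V - S)) (\<lambda>E2. r2 ^ card E2 * 1)))"
      by (simp add: gexp_cmult mult_ac)
    also have "\<dots> = ?a ^ card (pairs S) * kappa tilted_p (card S) *
        (f (card S) * (?b ^ card (pairs (V - S)) * 1))"
      unfolding gexp_mult_right
      using S fin \<rho> gexp_tilt[of "pairs S" p r1 "\<lambda>E1. of_bool (connd S E1)"]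
        gexp_tilt[of "pairs (V - S)" p r2 "\<lambda>_. 1"]
      by (simp add: gexp_const gexp_connd tilted_p_def)
    finally show "(1 - p) ^ (card S * card (V - S)) * gexp p (pairs S) (\<lambda>E1. of_bool (connd S E1) *
          gexp p (pairs (V - S)) (\<lambda>E2. f (card S) * r1 ^ card E1 * r2 ^ card E2)) =
      (1 - p) ^ (card S * (n - card S)) *
       (f (card S) * ?a ^ (card S choose 2) * kappa tilted_p (card S) * ?b ^ ((n - card S) choose 2))"
      using S fin c by (simp add: card_pairs)
  qed
  also have "\<dots> = (\<Sum>s=1..n. real (n choose s) * ((1 - p) ^ (s * (n - s)) *
       (f s * ?a ^ (s choose 2) * kappa tilted_p s * ?b ^ ((n - s) choose 2))))"
    unfolding n_def by (rule sum_Pow_card_nonempty[OF fin])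
  also have "\<dots> = (\<Sum>s=1..n. real n / real s * cluster_wt tilted_p n s *
      (f s * ?a ^ (s * (n - s) + (s choose 2)) * ?b ^ ((n - s) choose 2)))"
  proof (intro sum.cong refl)
    fix s assume "s \<in> {1..n}"
    then have b: "real (n choose s) = real n / real s * real ((n - 1) choose (s - 1))"
      by (simp add: binomial_times_n)
    have q': "(1 - p) ^ (s * (n - s)) = ?a ^ (s * (n - s)) * (1 - tilted_p) ^ (s * (n - s))"
      by (subst q[symmetric]) (rule power_mult_distrib)
    show "real (n choose s) * ((1 - p) ^ (s * (n - s)) *
        (f s * ?a ^ (s choose 2) * kappa tilted_p s * ?b ^ ((n - s) choose 2))) =
      real n / real s * cluster_wt tilted_p n s *
        (f s * ?a ^ (s * (n - s) + (s choose 2)) * ?b ^ ((n - s) choose 2))"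
      unfolding b cluster_wt_def q' power_add by (simp only: mult_ac)
  qed
  finally show ?thesis .
qed

section \<open>Independent cycles and the cluster size identity\<close>

text \<open>The cyclomatic number, the dimension of the cycle space; real-valued because the formula
  contains a difference.\<close>

definition cyc :: "nat set \<Rightarrow> nat set set \<Rightarrow> real" where
  "cyc V E = real (card E) + real (card (comps V E)) - real (card V)"

definition joined :: "nat set \<Rightarrow> nat set set \<Rightarrow> nat set \<Rightarrow> bool" where
  "joined V E e \<longleftrightarrow> (\<exists>S\<in>comps V E. e \<subseteq> S)"

lemma comps_eq_image: "comps V E = (\<lambda>w. conn V E `` {w}) ` V"
  by (auto simp: comps_def quotient_def)

lemma joined_iff:
  assumes "u \<in> V" "v \<in> V"
  shows "joined V E {u, v} \<longleftrightarrow> (u, v) \<in> (adjacency E)\<^sup>*"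
proof
  assume "joined V E {u, v}"
  then show "(u, v) \<in> (adjacency E)\<^sup>*" unfolding joined_def using comps_connected by auto
next
  assume uv: "(u, v) \<in> (adjacency E)\<^sup>*"
  have "conn V E `` {u} \<in> comps V E" using assms by (simp add: comps_eq_image)
  moreover have "{u, v} \<subseteq> conn V E `` {u}" using uv assms by (simp add: conn_def)
  ultimately show "joined V E {u, v}" unfolding joined_def by blast
qed

lemma rtrancl_adjacency_insert:
  "(x, y) \<in> (adjacency (insert {u, v} E))\<^sup>* \<longleftrightarrow> (x, y) \<in> (adjacency E)\<^sup>* \<or>
    (x, u) \<in> (adjacency E)\<^sup>* \<and> (v, y) \<in> (adjacency E)\<^sup>* \<or>
    (x, v) \<in> (adjacency E)\<^sup>* \<and> (u, y) \<in> (adjacency E)\<^sup>*"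
proof -
  have "adjacency (insert {u, v} E) = insert (u, v) (insert (v, u) (adjacency E))"
    by (auto simp: adjacency_def doubleton_eq_iff)
  then show ?thesis
    using sym_rtrancl[OF sym_adjacency, of E]
    by (simp add: rtrancl_insert) (meson rtrancl_trans)
qed

text \<open>If the endpoints are joined already, the connectivity relation does not change.
  Otherwise their two classes are replaced by the union, and every other class survives.\<close>

lemma card_comps_insert:
  assumes fin: "finite V" and uv: "u \<in> V" "v \<in> V"
  shows "real (card (comps V (insert {u, v} E))) =
    real (card (comps V E)) - (if joined V E {u, v} then 0 else 1)"
proof (cases "joined V E {u, v}")
  case True
  then have j: "(u, v) \<in> (adjacency E)\<^sup>*" using joined_iff uv by simp
  then have j': "(v, u) \<in> (adjacency E)\<^sup>*"
    using sym_rtrancl[OF sym_adjacency, of E] by (meson symE)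
  have "(x, y) \<in> (adjacency (insert {u, v} E))\<^sup>* \<longleftrightarrow> (x, y) \<in> (adjacency E)\<^sup>*" for x y
    unfolding rtrancl_adjacency_insert using j j' by (meson rtrancl_trans)
  then have "conn V (insert {u, v} E) = conn V E" by (simp add: conn_def)
  then show ?thesis using True by (simp add: comps_def)
next
  case False
  then have nj: "(u, v) \<notin> (adjacency E)\<^sup>*" using joined_iff uv by simp
  have sym: "(x, y) \<in> (adjacency E)\<^sup>* \<longleftrightarrow> (y, x) \<in> (adjacency E)\<^sup>*" for x y
    using sym_rtrancl[OF sym_adjacency, of E] by (meson symE)
  let ?C = "\<lambda>w. conn V E `` {w}" and ?C' = "\<lambda>w. conn V (insert {u, v} E) `` {w}"
  let ?U = "?C u \<union> ?C v"
  have C'1: "?C' w = ?U" if "w \<in> ?U" for w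
  proof (intro set_eqI)
    fix y
    have w: "w \<in> V" "(w, u) \<in> (adjacency E)\<^sup>* \<or> (w, v) \<in> (adjacency E)\<^sup>*"
      using that sym by (auto simp: conn_def)
    have "y \<in> ?C' w \<longleftrightarrow> y \<in> V \<and> ((w, y) \<in> (adjacency E)\<^sup>* \<or>
        (w, u) \<in> (adjacency E)\<^sup>* \<and> (v, y) \<in> (adjacency E)\<^sup>* \<or>
        (w, v) \<in> (adjacency E)\<^sup>* \<and> (u, y) \<in> (adjacency E)\<^sup>*)"
      using w by (simp add: conn_def rtrancl_adjacency_insert)
    also have "\<dots> \<longleftrightarrow> y \<in> V \<and> ((u, y) \<in> (adjacency E)\<^sup>* \<or> (v, y) \<in> (adjacency E)\<^sup>*)"
      using w(2) sym rtrancl_trans by metis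
    also have "\<dots> \<longleftrightarrow> y \<in> ?U" using uv by (auto simp: conn_def)
    finally show "y \<in> ?C' w \<longleftrightarrow> y \<in> ?U" .
  qed
  have C'2: "?C' w = ?C w" if "w \<in> V" "w \<notin> ?U" for w
  proof -
    have "(w, u) \<notin> (adjacency E)\<^sup>*" "(w, v) \<notin> (adjacency E)\<^sup>*"
      using that uv sym by (auto simp: conn_def)
    then show ?thesis using that by (auto simp: conn_def rtrancl_adjacency_insert)
  qed
  have Cu: "?C u \<in> comps V E" "?C v \<in> comps V E" using uv by (simp_all add: comps_eq_image)
  have self: "w \<in> ?C w" if "w \<in> V" for w using that by (simp add: conn_def)
  have ne: "?C u \<noteq> ?C v" using nj self[OF uv(2)] uv by (auto simp: conn_def)
  have "comps V (insert {u, v} E) = insert ?U (comps V E - {?C u, ?C v})"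
  proof (intro equalityI subsetI)
    fix T assume "T \<in> comps V (insert {u, v} E)"
    then obtain w where w: "w \<in> V" "T = ?C' w" by (auto simp: comps_eq_image)
    show "T \<in> insert ?U (comps V E - {?C u, ?C v})"
    proof (cases "w \<in> ?U")
      case False
      then have "T = ?C w" using w C'2 by simp
      moreover have "?C w \<in> comps V E" using w by (simp add: comps_eq_image)
      moreover have "?C w \<noteq> ?C u" "?C w \<noteq> ?C v" using False self[OF w(1)] by auto
      ultimately show ?thesis by simp
    qed (use w C'1 in simp)
  next
    fix T assume T: "T \<in> insert ?U (comps V E - {?C u, ?C v})"
    show "T \<in> comps V (insert {u, v} E)"
    proof (cases "T = ?U")
      case True
      then have "T = ?C' u" using C'1[of u] self[OF uv(1)] by simp
      then show ?thesis using uv by (simp add: comps_eq_image)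
    next
      case nU: False
      then obtain w where w: "w \<in> V" "T = ?C w" "?C w \<noteq> ?C u" "?C w \<noteq> ?C v"
        using T by (auto simp: comps_eq_image)
      have "?C w \<in> comps V E" using w by (simp add: comps_eq_image)
      then have "w \<notin> ?U" using self[OF w(1)] comps_disjoint[of "?C w" V E] Cu w by blast
      then have "T = ?C' w" using w C'2 by simp
      then show ?thesis using w by (simp add: comps_eq_image)
    qed
  qed
  moreover have "?U \<notin> comps V E - {?C u, ?C v}"
  proof
    assume "?U \<in> comps V E - {?C u, ?C v}"
    then show False using comps_disjoint[OF _ Cu(1), of ?U] self[OF uv(1)] by blast
  qed
  moreover have "card (comps V E - {?C u, ?C v}) = card (comps V E) - 2"
    using Cu ne by (subst card_Diff_subset) auto
  moreover have "card (comps V E) \<ge> 2"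
    using card_mono[of "comps V E" "{?C u, ?C v}"] Cu ne fin by simp
  ultimately have "card (comps V (insert {u, v} E)) = Suc (card (comps V E) - 2)"
    using fin by simp
  then show ?thesis using False \<open>card (comps V E) \<ge> 2\<close> by simp
qed

lemma card_comps_empty: "card (comps V {}) = card V"
proof -
  have "conn V {} `` {w} = {w}" if "w \<in> V" for w
    using that by (auto simp: conn_def adjacency_def)
  then have "comps V {} = (\<lambda>w. {w}) ` V" by (simp add: comps_eq_image)
  then show ?thesis by (simp add: card_image)
qed

lemma cyc_insert:
  assumes "finite V" "finite E" "e \<in> pairs V" "e \<notin> E"
  shows "cyc V (insert e E) = cyc V E + of_bool (joined V E e)"
proof -
  obtain u v where "e = {u, v}" "u \<in> V" "v \<in> V"
    using assms(3) by (auto simp: pairs_def card_2_iff)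
  then show ?thesis using card_comps_insert[of V u v E] assms by (simp add: cyc_def)
qed

lemma cyc_nonneg:
  assumes "finite V" "E \<subseteq> pairs V"
  shows "0 \<le> cyc V E"
proof -
  have "finite E" using assms finite_subset by fastforce
  then show ?thesis using assms(2)
  proof (induction E rule: finite_induct)
    case empty
    then show ?case by (simp add: cyc_def card_comps_empty)
  next
    case (insert e E)
    then show ?case using cyc_insert[of V E e] assms(1) by simp
  qed
qed

lemma joined_mono:
  assumes "e \<in> pairs V" "E \<subseteq> F" "joined V E e"
  shows "joined V F e"
proof -
  obtain u v where "e = {u, v}" "u \<in> V" "v \<in> V"
    using assms(1) by (auto simp: pairs_def card_2_iff)
  then show ?thesis using assms(3) rtrancl_mono[OF adjacency_mono[OF assms(2)]] joined_iff by blast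
qed

text \<open>Inserting the edges one by one, a new edge closes a cycle iff its endpoints are already joined.\<close>

lemma gexp_cyc_le_joined:
  assumes "finite V" "0 \<le> p" "p \<le> 1" "P \<subseteq> pairs V"
  shows "gexp p P (cyc V) \<le> p * (\<Sum>e\<in>P. gexp p (pairs V) (\<lambda>E. of_bool (joined V E e)))"
proof -
  have "finite P" using assms finite_subset by fastforce
  then show ?thesis using assms(4)
  proof (induction P rule: finite_induct)
    case empty
    then show ?case by (simp add: cyc_def card_comps_empty)
  next
    case (insert e P)
    have fP: "finite E" if "E \<subseteq> P" for E using that insert finite_subset by blast
    have "gexp p P (\<lambda>E. cyc V (insert e E)) = gexp p P (\<lambda>E. cyc V E + of_bool (joined V E e))"
      using insert assms(1) fP by (intro gexp_cong refl cyc_insert) auto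
    then have eq: "gexp p (insert e P) (cyc V) =
        gexp p P (cyc V) + p * gexp p P (\<lambda>E. of_bool (joined V E e))"
      using insert by (simp add: gexp_insert gexp_add algebra_simps)
    \<comment> \<open>Being joined is increasing in the edge set, so the part of the graph built so
      far may be replaced by the whole graph, whose law does not depend on the order of
      insertion.\<close>
    have le: "gexp p P (\<lambda>E. of_bool (joined V E e)) \<le>
        gexp p (pairs V) (\<lambda>E. of_bool (joined V E e))"
    proof (rule gexp_subset_mono)
      fix E1 E2 :: "nat set set"
      show "of_bool (joined V E1 e) \<le> (of_bool (joined V (E1 \<union> E2) e) :: real)"
        using joined_mono[of e V E1 "E1 \<union> E2"] insert.prems by auto
    qed (use insert assms in auto)
    have "gexp p (insert e P) (cyc V) \<le>
        gexp p P (cyc V) + p * gexp p (pairs V) (\<lambda>E. of_bool (joined V E e))"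
      unfolding eq using le assms(2) by (intro add_left_mono mult_left_mono)
    moreover have "gexp p P (cyc V) \<le> p * (\<Sum>e\<in>P. gexp p (pairs V) (\<lambda>E. of_bool (joined V E e)))"
      using insert by simp
    ultimately show ?case using insert.hyps by (simp add: distrib_left)
  qed
qed

lemma sum_joined_le:
  assumes "finite V"
  shows "(\<Sum>e\<in>pairs V. of_bool (joined V E e)) \<le> (\<Sum>S\<in>comps V E. real (card S choose 2))"
proof -
  have sub: "finite S" if "S \<in> comps V E" for S using comps_subset[OF that] assms finite_subset by blast
  have "(\<Sum>e\<in>pairs V. of_bool (joined V E e)) = real (card {e \<in> pairs V. joined V E e})"
    using assms by (subst sum_of_bool_eq) (auto simp: Int_def)
  also have "\<dots> \<le> real (card (\<Union>S\<in>comps V E. pairs S))"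
    using assms sub by (intro of_nat_mono card_mono) (auto simp: joined_def pairs_def)
  also have "\<dots> \<le> real (\<Sum>S\<in>comps V E. card (pairs S))"
    using assms by (intro of_nat_mono card_UN_le) auto
  also have "\<dots> = (\<Sum>S\<in>comps V E. real (card S choose 2))"
    using sub by (simp add: card_pairs)
  finally show ?thesis .
qed

text \<open>The expected number of joined pairs is a sum of (card S choose 2) over the components,
  and the factor n/s turns s choose 2 into at most n s/2. With p n bounded, a mean cluster size of
  o(sqrt n) leaves o(sqrt n) independent cycles.\<close>

lemma gexp_cyc_le:
  assumes "finite V" "0 \<le> p" "p \<le> 1"
  shows "gexp p (pairs V) (cyc V) \<le>
    p * real (card V) / 2 * (\<Sum>s=1..card V. real s * cluster_wt p (card V) s)"
proof -
  let ?n = "card V"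
  have "gexp p (pairs V) (cyc V) \<le>
      p * (\<Sum>e\<in>pairs V. gexp p (pairs V) (\<lambda>E. of_bool (joined V E e)))"
    using assms by (intro gexp_cyc_le_joined) auto
  also have "\<dots> = p * gexp p (pairs V) (\<lambda>E. \<Sum>e\<in>pairs V. of_bool (joined V E e))"
    by (simp add: gexp_sum)
  also have "\<dots> \<le> p * gexp p (pairs V) (\<lambda>E. \<Sum>S\<in>comps V E. real (card S choose 2))"
    using assms sum_joined_le by (intro mult_left_mono gexp_mono) auto
  also have "\<dots> = p * (\<Sum>s=1..?n. real ?n / real s * cluster_wt p ?n s * real (s choose 2))"
    using assms by (subst gexp_sum_comps_card[where F="\<lambda>S E1 E2. real (card S choose 2)"
        and g="\<lambda>s. real (s choose 2)"]) (auto simp: gexp_const finite_subset)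
  also have "\<dots> \<le> p * (\<Sum>s=1..?n. real ?n / 2 * (real s * cluster_wt p ?n s))"
  proof (intro mult_left_mono sum_mono assms)
    fix s assume "s \<in> {1..?n}"
    then have s: "real s \<ge> 1" by simp
    have "real (s choose 2) / real s \<le> real s / 2"
    proof -
      have "real (s choose 2) * 2 \<le> real (s * (s - 1))"
        unfolding choose_two of_nat_mult[symmetric] of_nat_le_iff by (metis div_times_less_eq_dividend of_nat_le_iff of_nat_mult of_nat_numeral)
      also have "\<dots> \<le> real s * real s" by (simp add: mult_left_mono)
      finally show ?thesis using s by (simp add: field_simps)
    qed
    then have "real ?n * cluster_wt p ?n s * (real (s choose 2) / real s) \<le>
        real ?n * cluster_wt p ?n s * (real s / 2)"
      using assms by (intro mult_left_mono mult_nonneg_nonneg cluster_wt_nonneg) auto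
    then show "real ?n / real s * cluster_wt p ?n s * real (s choose 2) \<le>
        real ?n / 2 * (real s * cluster_wt p ?n s)" by (simp add: mult_ac)
  qed
  finally show ?thesis by (simp add: sum_distrib_left mult_ac)
qed

text \<open>An identity of Abel type. Differentiating the case n + 1 in \<open>x\<close> gives -n
  times the case n on both sides, and at x = 0 both sides are 1 since the weights sum to 1.\<close>

lemma cluster_wt_identity:
  assumes "n \<ge> 1" "p \<noteq> 1"
  shows "(\<Sum>s=1..n. cluster_wt p n s * (1 - x / (1 - p) ^ s) ^ (n - s)) = (1 - x) ^ (n - 1)"
  using assms(1)
proof (induction n arbitrary: x rule: dec_induct)
  case base
  then show ?case using sum_cluster_wt[of 1 p] by simp
next
  case (step n)
  have q: "1 - p \<noteq> 0" using assms by simp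
  let ?f = "\<lambda>x. \<Sum>s=1..Suc n. cluster_wt p (Suc n) s * (1 - x / (1 - p) ^ s) ^ (Suc n - s)"
  let ?g = "\<lambda>x. (1 - x) ^ n"
  \<comment> \<open>The exponent n + 1 - s brought down by the derivative is absorbed into the
    binomial coefficient, and the inner derivative q^(-s) lowers the crossing factor from n + 1 - s
    to n - s outside vertices. The summand s = n + 1 is constant in \<open>x\<close>.\<close>
  have coeff: "cluster_wt p (Suc n) s * real (Suc n - s) * (1 / (1 - p) ^ s) =
      real n * cluster_wt p n s" if "s \<in> {1..n}" for s
  proof -
    have "Suc n - s = Suc (n - s)" using that by auto
    then have pw: "(1 - p) ^ (s * (Suc n - s)) / (1 - p) ^ s = (1 - p) ^ (s * (n - s))"
      using q by (simp add: power_add)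
    have "n - (s - 1) = Suc n - s" using that by auto
    then have "(n choose (s - 1)) * (Suc n - s) = n * ((n - 1) choose (s - 1))"
      using binomial_absorb_comp[of n "s - 1"] by (simp add: mult.commute)
    then have b: "real (n choose (s - 1)) * real (Suc n - s) = real n * real ((n - 1) choose (s - 1))"
      by (metis of_nat_mult)
    have "cluster_wt p (Suc n) s * real (Suc n - s) * (1 / (1 - p) ^ s) =
        (real (n choose (s - 1)) * real (Suc n - s)) * kappa p s *
        ((1 - p) ^ (s * (Suc n - s)) / (1 - p) ^ s)"
      unfolding cluster_wt_def by simp
    then show ?thesis unfolding b pw cluster_wt_def by simp
  qed
  have df: "(?f has_real_derivative - real n * (1 - x) ^ (n - 1)) (at x)" for x
  proof -
    have "(?f has_real_derivative (\<Sum>s=1..Suc n. cluster_wt p (Suc n) s *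
        (real (Suc n - s) * (1 - x / (1 - p) ^ s) ^ (Suc n - s - 1) * - (1 / (1 - p) ^ s)))) (at x)"
    proof (rule DERIV_sum)
      fix s
      show "((\<lambda>x. cluster_wt p (Suc n) s * (1 - x / (1 - p) ^ s) ^ (Suc n - s)) has_real_derivative
        cluster_wt p (Suc n) s *
        (real (Suc n - s) * (1 - x / (1 - p) ^ s) ^ (Suc n - s - 1) * - (1 / (1 - p) ^ s))) (at x)"
      proof -
        have "((\<lambda>x. 1 - x / (1 - p) ^ s) has_real_derivative - (1 / (1 - p) ^ s)) (at x)"
          using DERIV_diff[OF DERIV_const[of 1] DERIV_cdivide[OF DERIV_ident, of "(1 - p) ^ s"]]
          by simp
        from DERIV_cmult[OF DERIV_power[OF this, of "Suc n - s"], of "cluster_wt p (Suc n) s"]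
        show ?thesis by (simp add: mult_ac)
      qed
    qed
    also have "(\<Sum>s=1..Suc n. cluster_wt p (Suc n) s *
        (real (Suc n - s) * (1 - x / (1 - p) ^ s) ^ (Suc n - s - 1) * - (1 / (1 - p) ^ s))) =
        (\<Sum>s=1..n. cluster_wt p (Suc n) s *
        (real (Suc n - s) * (1 - x / (1 - p) ^ s) ^ (Suc n - s - 1) * - (1 / (1 - p) ^ s)))"
      by simp
    also have "\<dots> = (\<Sum>s=1..n. - real n * (cluster_wt p n s * (1 - x / (1 - p) ^ s) ^ (n - s)))"
    proof (intro sum.cong refl)
      fix s assume s: "s \<in> {1..n}"
      have "cluster_wt p (Suc n) s *
        (real (Suc n - s) * (1 - x / (1 - p) ^ s) ^ (Suc n - s - 1) * - (1 / (1 - p) ^ s)) =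
        - (cluster_wt p (Suc n) s * real (Suc n - s) * (1 / (1 - p) ^ s)) * (1 - x / (1 - p) ^ s) ^ (n - s)"
        by simp
      also have "\<dots> = - real n * (cluster_wt p n s * (1 - x / (1 - p) ^ s) ^ (n - s))"
        unfolding coeff[OF s] by simp
      finally show "cluster_wt p (Suc n) s *
        (real (Suc n - s) * (1 - x / (1 - p) ^ s) ^ (Suc n - s - 1) * - (1 / (1 - p) ^ s)) =
        - real n * (cluster_wt p n s * (1 - x / (1 - p) ^ s) ^ (n - s))" .
    qed
    also have "\<dots> = - real n * (1 - x) ^ (n - 1)"
      unfolding sum_distrib_left[symmetric] by (subst step.IH) simp
    finally show ?thesis .
  qed
  have dg: "(?g has_real_derivative - real n * (1 - x) ^ (n - 1)) (at x)" for x
    by (auto intro!: derivative_eq_intros)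
  have "((\<lambda>x. ?f x - ?g x) has_real_derivative 0) (at x)" for x
    using DERIV_diff[OF df dg, of x] by simp
  then have "?f x - ?g x = ?f 0 - ?g 0"
    using DERIV_isconst_all[of "\<lambda>x. ?f x - ?g x"] by blast
  also have "\<dots> = 0" using sum_cluster_wt[of "Suc n" p] by simp
  finally show ?case by simp
qed

lemma expectation_random_graph:
  assumes "0 \<le> p" "p \<le> 1"
  shows "measure_pmf.expectation (random_graph n p) f = gexp p (pairs {1..n}) f"
proof -
  let ?P = "pairs {1..n}"
  let ?M = "Pi_pmf ?P False (\<lambda>_. bernoulli_pmf p)"
  let ?h = "\<lambda>f. {e \<in> ?P. f e}"
  have fin: "finite ?P" by simp
  have sub: "set_pmf (random_graph n p) \<subseteq> Pow ?P"
    by (auto simp: random_graph_def all_edges_eq)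
  have pmf: "pmf (random_graph n p) E = p ^ card E * (1 - p) ^ card (?P - E)" if E: "E \<in> Pow ?P" for E
  proof -
    \<comment> \<open>On the support the Boolean function is \<open>False\<close> off the pairs, so
      it is determined by the edge set.\<close>
    have "?h -` {E} \<inter> set_pmf ?M = {\<lambda>e. e \<in> E} \<inter> set_pmf ?M"
    proof (intro equalityI subsetI)
      fix f assume f: "f \<in> ?h -` {E} \<inter> set_pmf ?M"
      then have "f \<in> {f. \<forall>x. x \<notin> ?P \<longrightarrow> f x = False}"
        using set_Pi_pmf_subset[OF fin, of False "\<lambda>_. bernoulli_pmf p"] by blast
      then have "f e \<longleftrightarrow> e \<in> ?P \<and> f e" for e by auto
      moreover have "E = ?h f" using f by simp
      ultimately have "f = (\<lambda>e. e \<in> E)" by simp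
      then show "f \<in> {\<lambda>e. e \<in> E} \<inter> set_pmf ?M" using f by simp
    next
      fix f assume f: "f \<in> {\<lambda>e. e \<in> E} \<inter> set_pmf ?M"
      have "?h (\<lambda>e. e \<in> E) = E" using E by auto
      then show "f \<in> ?h -` {E} \<inter> set_pmf ?M" using f by auto
    qed
    then have "pmf (random_graph n p) E = pmf ?M (\<lambda>e. e \<in> E)"
      unfolding random_graph_def all_edges_eq pmf_map
      by (subst (1) measure_Int_set_pmf[symmetric]) (simp add: measure_Int_set_pmf measure_pmf_single)
    also have "\<dots> = (\<Prod>e\<in>?P. if e \<in> E then p else 1 - p)"
      using E assms fin by (subst pmf_Pi') (auto intro!: prod.cong)
    also have "\<dots> = p ^ card (?P \<inter> E) * (1 - p) ^ card (?P \<inter> - E)"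
      using fin by (subst prod.If_cases) auto
    also have "?P \<inter> E = E" using E by auto
    also have "?P \<inter> - E = ?P - E" by auto
    finally show ?thesis .
  qed
  have "measure_pmf.expectation (random_graph n p) f = (\<Sum>E\<in>Pow ?P. f E * pmf (random_graph n p) E)"
    using fin sub by (intro integral_measure_pmf_real) auto
  also have "\<dots> = gexp p ?P f"
    unfolding gexp_def using pmf by (intro sum.cong refl) auto
  finally show ?thesis .
qed

section \<open>Asymptotics of cluster sizes\<close>

text \<open>Here \<open>h = - n ln (1 - p)\<close>, so that \<open>exp (h s / n) = q\<^sup>-\<^sup>s\<close>. No other property of the cluster size enters
  the asymptotic analysis.\<close>

definition cluster_law :: "nat \<Rightarrow> real \<Rightarrow> (nat \<Rightarrow> real) \<Rightarrow> bool" where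
  "cluster_law n h w \<longleftrightarrow> (\<forall>s\<in>{1..n}. 0 \<le> w s) \<and>
     (\<forall>x. (\<Sum>s=1..n. w s * (1 - x * exp (h * real s / real n)) ^ (n - s)) = (1 - x) ^ (n - 1))"

lemma cluster_law_nonneg: "cluster_law n h w \<Longrightarrow> s \<in> {1..n} \<Longrightarrow> 0 \<le> w s"
  by (simp add: cluster_law_def)

lemma cluster_law_identity: "cluster_law n h w \<Longrightarrow>
    (\<Sum>s=1..n. w s * (1 - x * exp (h * real s / real n)) ^ (n - s)) = (1 - x) ^ (n - 1)"
  by (simp add: cluster_law_def)

lemma cluster_law_sum: "cluster_law n h w \<Longrightarrow> (\<Sum>s=1..n. w s) = 1"
  using cluster_law_identity[of n h w 0] by simp

text \<open>The derivative of the identity at x = 0.\<close>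

lemma cluster_law_moment:
  assumes "cluster_law n h w" "n \<ge> 1"
  shows "(\<Sum>s=1..n. w s * (real n - (real n - real s) * exp (h * real s / real n))) = 1"
proof -
  let ?f = "\<lambda>x. \<Sum>s=1..n. w s * (1 - x * exp (h * real s / real n)) ^ (n - s)"
  have 1: "(?f has_real_derivative (\<Sum>s=1..n. w s * (- real (n - s) * exp (h * real s / real n)))) (at 0)"
  proof (rule DERIV_sum)
    fix s
    have "((\<lambda>x. 1 - x * exp (h * real s / real n)) has_real_derivative - exp (h * real s / real n)) (at 0)"
      by (auto intro!: derivative_eq_intros)
    from DERIV_cmult[OF DERIV_power[OF this, of "n - s"], of "w s"]
    show "((\<lambda>x. w s * (1 - x * exp (h * real s / real n)) ^ (n - s)) has_real_derivative
        w s * (- real (n - s) * exp (h * real s / real n))) (at 0)"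
      by (simp add: mult_ac)
  qed
  have "((\<lambda>x. 1 - x) has_real_derivative - 1) (at (0::real))"
    by (auto intro!: derivative_eq_intros)
  from DERIV_power[OF this, of "n - 1"]
  have 2: "((\<lambda>x. (1 - x) ^ (n - 1)) has_real_derivative - real (n - 1)) (at (0::real))" by simp
  have "?f = (\<lambda>x. (1 - x) ^ (n - 1))" using cluster_law_identity[OF assms(1)] by auto
  then have "(\<Sum>s=1..n. w s * (- real (n - s) * exp (h * real s / real n))) = - real (n - 1)"
    using DERIV_unique[OF 1] 2 by simp
  moreover have "(\<Sum>s=1..n. w s * (real n - (real n - real s) * exp (h * real s / real n))) =
      real n * (\<Sum>s=1..n. w s) + (\<Sum>s=1..n. w s * (- real (n - s) * exp (h * real s / real n)))"
    unfolding sum_distrib_left sum.distrib[symmetric]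
    by (intro sum.cong refl) (auto simp: of_nat_diff algebra_simps)
  ultimately show ?thesis using cluster_law_sum[OF assms(1)] assms(2) by (simp add: of_nat_diff)
qed

section \<open>Bounds for cluster sizes at and below criticality\<close>

lemma exp_mean_le:
  fixes b u :: real
  assumes "0 \<le> b" "b \<le> 1"
  shows "exp (b * u) \<le> 1 - b + b * exp u"
  using convex_onD[OF exp_convex, of b 0 u] assms by simp

text \<open>The convex function u \<mapsto> ln (1 + z exp u) lies above its tangent at 0.\<close>

lemma ln_exp_lower:
  fixes z u :: real
  assumes "0 < z"
  shows "ln (1 + z) + z / (1 + z) * u \<le> ln (1 + z * exp u)"
proof -
  let ?b = "z / (1 + z)"
  have "exp (?b * u) \<le> 1 - ?b + ?b * exp u" using assms by (intro exp_mean_le) auto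
  also have "\<dots> = (1 + z * exp u) / (1 + z)" using assms by (simp add: field_simps)
  finally have "(1 + z) * exp (?b * u) \<le> 1 + z * exp u" using assms by (simp add: field_simps)
  moreover have "0 < 1 + z * exp u" using assms by (simp add: add_pos_pos)
  ultimately have "ln ((1 + z) * exp (?b * u)) \<le> ln (1 + z * exp u)"
    using assms by (subst ln_le_cancel_iff) auto
  then show ?thesis using assms by (simp add: ln_mult)
qed

text \<open>With b = z/(1 + z), the second-order coefficient of the left side at \<sigma> = 0 is h b
  (h/(1 + z)/2 - 1). The assumption h \<le> 1 + z makes it at most -h b/2, which is the quadratic
  term subtracted here; the sign of the derivative extends the comparison to all of [0, 1].\<close>

lemma ln_exp_upper:
  fixes z h \<sigma> :: real
  assumes z: "0 < z" and h: "0 \<le> h" "h \<le> 1 + z" and \<sigma>: "0 \<le> \<sigma>" "\<sigma> \<le> 1"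
  shows "(1 - \<sigma>) * ln (1 + z * exp (h * \<sigma>)) \<le>
    ln (1 + z) + \<sigma> * (h * (z / (1 + z)) - ln (1 + z)) - h * (z / (1 + z)) / 2 * \<sigma>\<^sup>2"
proof -
  define b where "b = z / (1 + z)"
  define l where "l t = ln (1 + z * exp (h * t))" for t
  define f where "f t = ln (1 + z) + t * (h * b - ln (1 + z)) - h * b / 2 * t\<^sup>2 - (1 - t) * l t" for t
  define g where "g t = z * exp (h * t) / (1 + z * exp (h * t))" for t
  define f' where "f' t = h * b - ln (1 + z) - h * b * t + l t -
      (1 - t) * (h * g t)" for t
  have pos: "0 < 1 + z * exp (h * t)" for t using z by (simp add: add_pos_pos)
  have dl: "(l has_real_derivative h * g t) (at t)" for t
    unfolding l_def g_def using pos[of t] by (auto intro!: derivative_eq_intros)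
  have d: "(f has_real_derivative f' t) (at t)" for t
    unfolding f_def f'_def by (auto intro!: derivative_eq_intros dl simp: algebra_simps)
  have nonneg: "0 \<le> f' t" if t: "0 \<le> t" "t \<le> 1" for t
  proof -
    have 1: "ln (1 + z) + b * (h * t) \<le> l t" unfolding l_def b_def by (rule ln_exp_lower[OF z])
    have "exp (h * t) * (1 - t * (1 + z)) \<le> 1"
    proof -
      have "1 - t * (1 + z) \<le> 1 - h * t" using mult_right_mono[OF h(2) t(1)] by (simp add: mult.commute)
      also have "\<dots> \<le> exp (- (h * t))" using exp_ge_add_one_self[of "- (h * t)"] by simp
      finally have "exp (h * t) * (1 - t * (1 + z)) \<le> exp (h * t) * exp (- (h * t))"
        by (intro mult_left_mono) auto
      then show ?thesis by (simp flip: exp_add)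
    qed
    then have "(1 - t) * exp (h * t) * (1 + z) \<le> 1 + z * exp (h * t)" by (simp add: algebra_simps)
    then have "(1 - t) * g t \<le> b"
    proof -
      have "(1 - t) * exp (h * t) * (1 + z) * z \<le> (1 + z * exp (h * t)) * z"
        using \<open>(1 - t) * exp (h * t) * (1 + z) \<le> 1 + z * exp (h * t)\<close> z
        by (intro mult_right_mono) auto
      then have "(1 - t) * (z * exp (h * t)) * (1 + z) \<le> z * (1 + z * exp (h * t))"
        by (simp only: mult_ac)
      then have "(1 - t) * (z * exp (h * t)) / (1 + z * exp (h * t)) \<le> z / (1 + z)"
        using z pos[of t] by (subst frac_le_eq) (auto simp: divide_le_0_iff)
      then show ?thesis by (simp add: g_def b_def)
    qed
    then have "h * ((1 - t) * g t) \<le> h * b"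
      by (intro mult_left_mono h)
    then have "(1 - t) * (h * g t) \<le> h * b"
      by (simp only: mult_ac)
    then show ?thesis using 1 unfolding f'_def by (simp add: mult_ac)
  qed
  have "f 0 \<le> f \<sigma>"
  proof (rule DERIV_nonneg_imp_nondecreasing[OF \<sigma>(1)])
    fix t assume "0 \<le> t" "t \<le> \<sigma>"
    then show "\<exists>y. (f has_real_derivative y) (at t) \<and> 0 \<le> y" using d nonneg \<sigma> by force
  qed
  then show ?thesis by (simp add: f_def l_def b_def)
qed

lemma one_minus_exp_le:
  fixes t :: real
  assumes "0 \<le> t"
  shows "(1 - t) * exp t \<le> 1 - t\<^sup>2 / 2"
proof -
  have "(1 - 0\<^sup>2 / 2) - (1 - 0) * exp 0 \<le> (1 - t\<^sup>2 / 2) - (1 - t) * exp t"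
  proof (rule DERIV_nonneg_imp_nondecreasing[OF assms, of "\<lambda>t. (1 - t\<^sup>2 / 2) - (1 - t) * exp t"])
    fix x :: real assume "0 \<le> x" "x \<le> t"
    moreover have "((\<lambda>t. (1 - t\<^sup>2 / 2) - (1 - t) * exp t) has_real_derivative x * (exp x - 1)) (at x)"
      by (auto intro!: derivative_eq_intros simp: algebra_simps)
    ultimately show "\<exists>y. ((\<lambda>t. (1 - t\<^sup>2 / 2) - (1 - t) * exp t) has_real_derivative y) (at x) \<and> 0 \<le> y"
      by (intro exI[of _ "x * (exp x - 1)"]) auto
  qed
  then show ?thesis by simp
qed

lemma exp_le_quadratic: "0 \<le> x \<Longrightarrow> x \<le> 1 \<Longrightarrow> exp x \<le> 1 + 2 * x" for x :: real
  using exp_bound[of x] mult_left_le[of x x] by (simp add: power2_eq_square)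

text \<open>By (1 - \<sigma>) exp \<sigma> \<le> 1 - \<sigma>^2/2 the integrand of
  \<open>cluster_law_moment\<close> is at least of order s^2/n up to a bounded error, while its mean
  is 1. The excess of \<open>h\<close> over 1 contributes a drift of order s/sqrt n, which a square
  absorbs.\<close>

lemma cluster_law_second_moment:
  assumes cl: "cluster_law n h w" and n: "n \<ge> 1" and h: "0 \<le> h" "h \<le> 1 + A / sqrt (real n)"
    and A: "0 \<le> A" "A \<le> sqrt (real n)"
  shows "(\<Sum>s=1..n. w s * (real s)\<^sup>2) \<le> 4 * real n * (1 + 4 * A\<^sup>2)"
proof -
  let ?r = "sqrt (real n)"
  have r: "?r > 0" "?r * ?r = real n" using n by auto
  have pt: "(real s)\<^sup>2 / (4 * real n) - 4 * A\<^sup>2 \<le> real n - (real n - real s) * exp (h * real s / real n)"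
    if s: "s \<in> {1..n}" for s
  proof -
    define \<sigma> where "\<sigma> = real s / real n"
    have \<sigma>: "0 \<le> \<sigma>" "\<sigma> \<le> 1" using s by (auto simp: \<sigma>_def)
    have \<eta>: "0 \<le> A / ?r" "A / ?r \<le> 1" using A r by (auto simp: field_simps)
    have \<eta>\<sigma>: "0 \<le> A / ?r * \<sigma>" "A / ?r * \<sigma> \<le> 1"
      using mult_nonneg_nonneg[OF \<eta>(1) \<sigma>(1)] mult_le_one[OF \<eta>(2) \<sigma>(1,2)] by blast+
    have "(1 - \<sigma>) * exp (h * \<sigma>) \<le> (1 - \<sigma>) * exp (\<sigma> + A / ?r * \<sigma>)"
    proof (intro mult_left_mono)
      have "h * \<sigma> \<le> (1 + A / ?r) * \<sigma>" using h \<sigma> by (intro mult_right_mono) auto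
      then show "exp (h * \<sigma>) \<le> exp (\<sigma> + A / ?r * \<sigma>)" by (simp add: algebra_simps)
    qed (use \<sigma> in auto)
    also have "\<dots> = ((1 - \<sigma>) * exp \<sigma>) * exp (A / ?r * \<sigma>)" by (simp add: exp_add)
    also have "\<dots> \<le> (1 - \<sigma>\<^sup>2 / 2) * (1 + 2 * (A / ?r * \<sigma>))"
      using \<sigma> \<eta>\<sigma> power_le_one[of \<sigma> 2]
      by (intro mult_mono one_minus_exp_le exp_le_quadratic) auto
    also have "\<dots> \<le> 1 - \<sigma>\<^sup>2 / 2 + 2 * (A / ?r * \<sigma>)"
      using mult_nonneg_nonneg[OF zero_le_power2[of \<sigma>] \<eta>\<sigma>(1)]
      by (simp only: distrib_left left_diff_distrib)
    finally have "\<sigma>\<^sup>2 / 2 - 2 * (A / ?r * \<sigma>) \<le> 1 - (1 - \<sigma>) * exp (h * \<sigma>)" by simp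
    then have "real n * (\<sigma>\<^sup>2 / 2 - 2 * (A / ?r * \<sigma>)) \<le> real n * (1 - (1 - \<sigma>) * exp (h * \<sigma>))"
      by (intro mult_left_mono) auto
    moreover have "real n * (1 - (1 - \<sigma>) * exp (h * \<sigma>)) =
        real n - (real n - real s) * exp (h * real s / real n)"
      using n by (simp add: \<sigma>_def field_simps)
    \<comment> \<open>Completing the square: half of s^2/(2 n) absorbs the drift 2 A s/sqrt n at the
      price of the constant 4 A^2.\<close>
    moreover have "real n * (\<sigma>\<^sup>2 / 2 - 2 * (A / ?r * \<sigma>)) =
        (real s)\<^sup>2 / (4 * real n) - 4 * A\<^sup>2 + (real s / (2 * ?r) - 2 * A)\<^sup>2"
    proof -
      have "real n * (\<sigma>\<^sup>2 / 2 - 2 * (A / ?r * \<sigma>)) = (real s)\<^sup>2 / (2 * real n) - 2 * A * real s / ?r"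
        using n by (simp add: \<sigma>_def field_simps power2_eq_square)
      moreover have "(real s / (2 * ?r) - 2 * A)\<^sup>2 =
          (real s)\<^sup>2 / (4 * real n) - 2 * A * real s / ?r + 4 * A\<^sup>2"
        using r by (simp add: power2_diff power_divide power_mult_distrib)
      ultimately show ?thesis by (simp add: field_simps)
    qed
    ultimately show ?thesis using zero_le_power2[of "real s / (2 * ?r) - 2 * A"] by linarith
  qed
  have "(\<Sum>s=1..n. w s * ((real s)\<^sup>2 / (4 * real n) - 4 * A\<^sup>2)) \<le>
      (\<Sum>s=1..n. w s * (real n - (real n - real s) * exp (h * real s / real n)))"
    using pt cluster_law_nonneg[OF cl] by (intro sum_mono mult_left_mono) auto
  also have "\<dots> = 1" by (rule cluster_law_moment[OF cl n])
  finally have "(\<Sum>s=1..n. w s * (real s)\<^sup>2) / (4 * real n) - 4 * A\<^sup>2 * (\<Sum>s=1..n. w s) \<le> 1"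
    by (simp add: right_diff_distrib sum_subtractf sum_divide_distrib sum_distrib_left mult_ac)
  then have "(\<Sum>s=1..n. w s * (real s)\<^sup>2) / (4 * real n) \<le> 1 + 4 * A\<^sup>2"
    using cluster_law_sum[OF cl] by simp
  then show ?thesis using n by (simp add: field_simps)
qed

lemma power_of_ln: "0 < x \<Longrightarrow> x ^ m = exp (real m * ln x)" for x :: real
  by (simp add: exp_of_nat_mult)

text \<open>At x = -z the integrand is at most (1 + z)^n exp (-\<kappa> s), so the mean of exp
  (-\<kappa> T) is at least 1/(1 + z) \<ge> 1 - z. It is also at most the probability of T \<le> K
  plus exp (-\<kappa> K). A positive \<kappa> is possible for \<open>h\<close> slightly above 1,
  because z/(1 + z) < ln (1 + z).\<close>

lemma cluster_law_tail:
  assumes cl: "cluster_law n h w" and n: "n \<ge> 1" and z: "0 < z" and h: "0 \<le> h" "h \<le> 1 + z"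
    and \<kappa>: "0 \<le> \<kappa>" "h * (z / (1 + z)) \<le> ln (1 + z) - \<kappa>"
  shows "(\<Sum>s | s \<in> {1..n} \<and> K < real s. w s) \<le> z + exp (- \<kappa> * K)"
proof -
  have w: "0 \<le> w s" if "s \<in> {1..n}" for s using cluster_law_nonneg[OF cl that] .
  have pt: "(1 + z * exp (h * real s / real n)) ^ (n - s) \<le> (1 + z) ^ n * exp (- \<kappa> * real s)"
    if s: "s \<in> {1..n}" for s
  proof -
    define \<sigma> where "\<sigma> = real s / real n"
    have \<sigma>: "0 \<le> \<sigma>" "\<sigma> \<le> 1" "real n * \<sigma> = real s" using s by (auto simp: \<sigma>_def)
    have "(1 - \<sigma>) * ln (1 + z * exp (h * \<sigma>)) \<le>
      ln (1 + z) + \<sigma> * (h * (z / (1 + z)) - ln (1 + z)) - h * (z / (1 + z)) / 2 * \<sigma>\<^sup>2"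
      by (rule ln_exp_upper[OF z h \<sigma>(1,2)])
    also have "\<dots> \<le> ln (1 + z) + \<sigma> * (- \<kappa>) - 0"
      using \<kappa> \<sigma> h z by (intro diff_mono add_mono mult_left_mono) auto
    finally have "real n * ((1 - \<sigma>) * ln (1 + z * exp (h * \<sigma>))) \<le> real n * (ln (1 + z) - \<sigma> * \<kappa>)"
      by (intro mult_left_mono) auto
    also have "real n * ((1 - \<sigma>) * ln (1 + z * exp (h * \<sigma>))) =
        real (n - s) * ln (1 + z * exp (h * real s / real n))"
      using s by (simp add: \<sigma>_def field_simps of_nat_diff)
    also have "real n * (ln (1 + z) - \<sigma> * \<kappa>) = real n * ln (1 + z) - \<kappa> * real s"
      using \<sigma>(3) by (simp add: algebra_simps)
    finally have "exp (real (n - s) * ln (1 + z * exp (h * real s / real n))) \<le>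
        exp (real n * ln (1 + z) - \<kappa> * real s)" by simp
    moreover have "0 < 1 + z * exp (h * real s / real n)" using z by (simp add: add_pos_pos)
    ultimately show ?thesis using z
      by (simp add: power_of_ln exp_diff exp_minus divide_inverse)
  qed
  let ?B = "{s. s \<in> {1..n} \<and> K < real s}"
  have "(1 + z) ^ (n - 1) = (\<Sum>s=1..n. w s * (1 + z * exp (h * real s / real n)) ^ (n - s))"
    using cluster_law_identity[OF cl, of "- z"] by simp
  also have "\<dots> \<le> (\<Sum>s=1..n. w s * ((1 + z) ^ n * exp (- \<kappa> * real s)))"
    using pt w by (intro sum_mono mult_left_mono) auto
  also have "\<dots> = (1 + z) ^ n * (\<Sum>s=1..n. w s * exp (- \<kappa> * real s))"
    by (simp add: sum_distrib_left mult_ac)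
  also have "(1 + z) ^ n = (1 + z) ^ (n - 1) * (1 + z)" using n by (metis le_add_diff_inverse2 power_add power_one_right)
  finally have "1 \<le> (1 + z) * (\<Sum>s=1..n. w s * exp (- \<kappa> * real s))" using z by simp
  moreover have "(1 + z) * (1 - z) \<le> 1" using zero_le_square[of z] by (simp add: algebra_simps)
  ultimately have "(1 + z) * (1 - z) \<le> (1 + z) * (\<Sum>s=1..n. w s * exp (- \<kappa> * real s))" by linarith
  then have "1 - z \<le> (\<Sum>s=1..n. w s * exp (- \<kappa> * real s))"
    using z by (subst (asm) mult_le_cancel_left_pos) auto
  also have "\<dots> \<le> (\<Sum>s=1..n. w s * ((1 - of_bool (K < real s)) + exp (- \<kappa> * K)))"
  proof (intro sum_mono mult_left_mono w)
    fix s
    have "exp (- \<kappa> * real s) \<le> exp 0" using \<kappa> by (subst exp_le_cancel_iff) simp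
    then have "exp (- \<kappa> * real s) \<le> 1" by simp
    moreover have "exp (- \<kappa> * real s) \<le> exp (- \<kappa> * K)" if "K < real s"
      using that \<kappa> by (simp add: mult_left_mono)
    ultimately show "exp (- \<kappa> * real s) \<le> 1 - of_bool (K < real s) + exp (- \<kappa> * K)"
      using exp_gt_zero[of "- \<kappa> * K"] by (cases "K < real s") (simp, simp only: of_bool_eq if_False)
  qed
  also have "\<dots> = (\<Sum>s=1..n. w s) - (\<Sum>s=1..n. w s * of_bool (K < real s)) + exp (- \<kappa> * K) * (\<Sum>s=1..n. w s)"
    by (simp add: distrib_left right_diff_distrib sum.distrib sum_subtractf sum_distrib_left mult_ac)
  also have "(\<Sum>s=1..n. w s * of_bool (K < real s)) = (\<Sum>s\<in>?B. w s)"
    by (intro sum.mono_neutral_cong_right) auto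
  finally show ?thesis using cluster_law_sum[OF cl] by simp
qed

lemma ln_gt_div: "0 < z \<Longrightarrow> z / (1 + z) < ln (1 + z)" for z :: real
proof -
  assume z: "0 < z"
  have "ln (1 / (1 + z)) \<le> 1 / (1 + z) - 1" using z by (intro ln_le_minus_one) auto
  moreover have "ln (1 / (1 + z)) \<noteq> 1 / (1 + z) - 1"
    using ln_eq_minus_one[of "1 / (1 + z)"] z by (auto simp: field_simps)
  ultimately show ?thesis using z by (simp add: ln_div field_simps)
qed

text \<open>The second moment alone gives only O(sqrt n). Large sizes are moreover rare by
  \<open>cluster_law_tail\<close>, and an inequality of Cauchy-Schwarz type between the two gains
  the factor \<epsilon>. The threshold is uniform in \<open>h\<close> and \<open>w\<close>, so that
  the bound also applies to the random remaining graph; the window of width A/sqrt n is what the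
  critical case needs.\<close>

lemma cluster_law_mean_small:
  assumes A: "0 \<le> A" and \<epsilon>: "0 < \<epsilon>"
  shows "\<exists>m0. \<forall>n\<ge>m0. \<forall>h w. cluster_law n h w \<longrightarrow> 0 \<le> h \<longrightarrow> h \<le> 1 + A / sqrt (real n) \<longrightarrow>
    (\<Sum>s=1..n. real s * w s) \<le> \<epsilon> * sqrt (real n)"
proof -
  \<comment> \<open>The final bound has three shares of \<epsilon> sqrt n: a quarter for
    \<open>K\<close>, a quarter for the second moment through 4 \<delta> (1 + 4 A^2) = \<epsilon>/4,
    and a half for the tail through 2 z/\<delta> = \<epsilon>/2. In \<kappa> half of the gap ln (1 +
    z) - z/(1 + z) is held back to pay for \<open>h\<close> exceeding 1.\<close>
  define \<delta> where "\<delta> = \<epsilon> / (16 * (1 + 4 * A\<^sup>2))"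
  define z where "z = \<delta> * \<epsilon> / 4"
  define \<kappa> where "\<kappa> = (ln (1 + z) - z / (1 + z)) / 2"
  have A2: "1 + 4 * A\<^sup>2 > 0" using zero_le_power2[of A] by linarith
  have \<delta>: "\<delta> > 0" using \<epsilon> A2 by (simp add: \<delta>_def)
  have z: "z > 0" using \<delta> \<epsilon> by (simp add: z_def)
  have \<kappa>: "\<kappa> > 0" using ln_gt_div[OF z] by (simp add: \<kappa>_def)
  define K where "K = max 1 ((1 - ln z) / \<kappa>)"
  have "\<kappa> * K \<ge> 1 - ln z" using \<kappa> by (simp add: K_def field_simps max_def)
  then have "exp (- \<kappa> * K) < exp (ln z)" by (subst exp_less_cancel_iff) simp
  then have K: "exp (- \<kappa> * K) < z" "K > 0" using z by (simp_all add: K_def)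
  have "\<forall>\<^sub>F n in sequentially. A / sqrt (real n) \<le> min z \<kappa> \<and> A \<le> sqrt (real n) \<and>
      K \<le> \<epsilon> / 4 * sqrt (real n) \<and> n \<ge> 1"
  proof (intro eventually_conj)
    have "(\<lambda>n. A / sqrt (real n)) \<longlonglongrightarrow> 0" by real_asymp
    then show "\<forall>\<^sub>F n in sequentially. A / sqrt (real n) \<le> min z \<kappa>"
      by (intro eventually_mono[OF order_tendstoD(2)[of _ 0 _ "min z \<kappa>"]]) (use z \<kappa> in auto)
    have "filterlim (\<lambda>n. sqrt (real n)) at_top sequentially" by real_asymp
    then show "\<forall>\<^sub>F n in sequentially. A \<le> sqrt (real n)" by (simp add: filterlim_at_top)
    have "filterlim (\<lambda>n. \<epsilon> / 4 * sqrt (real n)) at_top sequentially" using \<epsilon> by real_asymp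
    then show "\<forall>\<^sub>F n in sequentially. K \<le> \<epsilon> / 4 * sqrt (real n)" by (simp add: filterlim_at_top)
  qed (rule eventually_ge_at_top)
  then obtain m0 where m0: "\<And>n. n \<ge> m0 \<Longrightarrow> A / sqrt (real n) \<le> min z \<kappa> \<and> A \<le> sqrt (real n) \<and>
      K \<le> \<epsilon> / 4 * sqrt (real n) \<and> n \<ge> 1"
    unfolding eventually_sequentially by blast
  show ?thesis
  proof (intro exI[of _ m0] allI impI)
    fix n h w assume n: "n \<ge> m0" and cl: "cluster_law n h w" and h: "0 \<le> h" "h \<le> 1 + A / sqrt (real n)"
    note m = m0[OF n]
    let ?r = "sqrt (real n)"
    have r: "?r > 0" using m by auto
    have w: "0 \<le> w s" if "s \<in> {1..n}" for s using cluster_law_nonneg[OF cl that] .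
    let ?B = "{s. s \<in> {1..n} \<and> K < real s}"
    have tail: "(\<Sum>s\<in>?B. w s) \<le> z + exp (- \<kappa> * K)"
    proof (rule cluster_law_tail[OF cl _ z h(1)])
      have b: "0 \<le> z / (1 + z)" "z / (1 + z) \<le> 1" using z by auto
      have "h * (z / (1 + z)) \<le> (1 + \<kappa>) * (z / (1 + z))"
        using h m b by (intro mult_right_mono) auto
      also have "\<dots> \<le> z / (1 + z) + \<kappa>" using mult_left_le[OF b(2), of \<kappa>] \<kappa> unfolding distrib_right by linarith
      also have "\<dots> = ln (1 + z) - \<kappa>" by (simp add: \<kappa>_def field_simps)
      finally show "h * (z / (1 + z)) \<le> ln (1 + z) - \<kappa>" .
    qed (use m h \<kappa> in auto)
    have M2: "(\<Sum>s=1..n. w s * (real s)\<^sup>2) \<le> 4 * real n * (1 + 4 * A\<^sup>2)"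
      using m h A by (intro cluster_law_second_moment[OF cl]) auto
    have "(\<Sum>s=1..n. real s * w s) \<le>
        (\<Sum>s=1..n. K * w s + \<delta> / ?r * (w s * (real s)\<^sup>2) + ?r / \<delta> * (w s * of_bool (K < real s)))"
    proof (intro sum_mono)
      fix s assume s: "s \<in> {1..n}"
      have "real s \<le> K + \<delta> / ?r * (real s)\<^sup>2 + ?r / \<delta> * of_bool (K < real s)"
      proof (cases "K < real s")
        case True
        \<comment> \<open>The arithmetic-geometric mean inequality; the quadratic term meets the
          second moment, the constant one the tail probability.\<close>
        have "2 * real s \<le> \<delta> / r * (real s)\<^sup>2 + r / \<delta>" if "r > 0" for r :: real
        proof -
          have "0 \<le> (\<delta> * real s - r)\<^sup>2 / (\<delta> * r)" using \<delta> that by simp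
          also have "\<dots> = \<delta> / r * (real s)\<^sup>2 + r / \<delta> - 2 * real s"
            using \<delta> that by (simp add: power2_eq_square field_simps)
          finally show ?thesis by simp
        qed
        from this[OF r] have "2 * real s \<le> \<delta> / ?r * (real s)\<^sup>2 + ?r / \<delta>" .
        then show ?thesis using True K(2) by simp
      next
        case False
        have "0 \<le> \<delta> / ?r * (real s)\<^sup>2" using \<delta> r by simp
        then show ?thesis using False by simp
      qed
      then have "w s * real s \<le> w s * (K + \<delta> / ?r * (real s)\<^sup>2 + ?r / \<delta> * of_bool (K < real s))"
        using w[OF s] by (intro mult_left_mono)
      then show "real s * w s \<le> K * w s + \<delta> / ?r * (w s * (real s)\<^sup>2) + ?r / \<delta> * (w s * of_bool (K < real s))"
        by (simp add: algebra_simps)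
    qed
    also have "\<dots> = K * (\<Sum>s=1..n. w s) + \<delta> / ?r * (\<Sum>s=1..n. w s * (real s)\<^sup>2) +
        ?r / \<delta> * (\<Sum>s=1..n. w s * of_bool (K < real s))"
      unfolding sum.distrib sum_distrib_left ..
    also have "(\<Sum>s=1..n. w s * of_bool (K < real s)) = (\<Sum>s\<in>?B. w s)"
      by (intro sum.mono_neutral_cong_right) auto
    also have "K * (\<Sum>s=1..n. w s) + \<delta> / ?r * (\<Sum>s=1..n. w s * (real s)\<^sup>2) + ?r / \<delta> * (\<Sum>s\<in>?B. w s) \<le>
        K * 1 + \<delta> / ?r * (4 * real n * (1 + 4 * A\<^sup>2)) + ?r / \<delta> * (2 * z)"
      using tail K M2 \<delta> r cluster_law_sum[OF cl]
      by (intro add_mono mult_left_mono) auto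
    also have "\<delta> / ?r * (4 * real n * (1 + 4 * A\<^sup>2)) = \<epsilon> / 4 * ?r"
    proof -
      have nr: "real n / ?r = ?r" using r by (simp add: real_div_sqrt)
      have "\<delta> / ?r * (4 * real n * (1 + 4 * A\<^sup>2)) = 4 * \<delta> * (1 + 4 * A\<^sup>2) * (real n / ?r)"
        by (simp add: mult_ac)
      then have "\<delta> / ?r * (4 * real n * (1 + 4 * A\<^sup>2)) = 4 * \<delta> * (1 + 4 * A\<^sup>2) * ?r"
        unfolding nr .
      moreover have "4 * \<delta> * (1 + 4 * A\<^sup>2) = \<epsilon> / 4" using A2 by (simp add: \<delta>_def field_simps)
      ultimately show ?thesis by simp
    qed
    also have "?r / \<delta> * (2 * z) = \<epsilon> / 2 * ?r" using \<delta> by (simp add: z_def)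
    also have "K * 1 + \<epsilon> / 4 * ?r + \<epsilon> / 2 * ?r \<le> \<epsilon> * ?r" using m by simp
    finally show "(\<Sum>s=1..n. real s * w s) \<le> \<epsilon> * ?r" .
  qed
qed

section \<open>Elementary estimates around the survival equation\<close>

lemma ln_one_minus_quadratic:
  fixes u :: real
  assumes "\<bar>u\<bar> \<le> 1 / 2"
  shows "\<bar>ln (1 - u) + u + u\<^sup>2 / 2\<bar> \<le> 2 * \<bar>u\<bar> ^ 3"
proof -
  let ?f = "\<lambda>x::real. ln (1 - x) + x + x\<^sup>2 / 2"
  let ?S = "{- \<bar>u\<bar>..\<bar>u\<bar>}"
  have "norm (?f u - ?f 0) \<le> (2 * u\<^sup>2) * norm (u - 0)"
  proof (rule field_differentiable_bound[of ?S])
    fix x assume x: "x \<in> ?S"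
    then have x1: "\<bar>x\<bar> \<le> \<bar>u\<bar>" "1 - x \<ge> 1 / 2" using assms by auto
    show "(?f has_field_derivative - x\<^sup>2 / (1 - x)) (at x within ?S)"
      using x1 by (auto intro!: derivative_eq_intros simp: field_simps power2_eq_square)
    have "x\<^sup>2 / (1 - x) \<le> u\<^sup>2 / (1 / 2)"
      using x1 by (intro frac_le) (auto simp: abs_le_square_iff)
    then show "norm (- x\<^sup>2 / (1 - x)) \<le> 2 * u\<^sup>2"
      using x1 by (simp add: abs_div)
  qed auto
  then show ?thesis by (simp add: power3_eq_cube power2_eq_square abs_mult)
qed

lemma abs_exp_diff_le:
  fixes a b M :: real
  assumes "a \<le> M" "b \<le> M"
  shows "\<bar>exp a - exp b\<bar> \<le> exp M * \<bar>a - b\<bar>"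
proof -
  have "norm (exp a - exp b) \<le> exp M * norm (a - b)"
  proof (rule field_differentiable_bound[of "{..M}"])
    show "(exp has_field_derivative exp z) (at z within {..M})" for z :: real
      by (auto intro!: derivative_eq_intros)
  qed (use assms in auto)
  then show ?thesis by simp
qed

lemma abs_exp_minus_linear_le:
  fixes u :: real
  assumes "\<bar>u\<bar> \<le> 1"
  shows "\<bar>exp u - 1 - u\<bar> \<le> 3 * u\<^sup>2"
proof -
  let ?f = "\<lambda>x::real. exp x - x"
  let ?S = "{- \<bar>u\<bar>..\<bar>u\<bar>}"
  have "norm (?f u - ?f 0) \<le> (3 * \<bar>u\<bar>) * norm (u - 0)"
  proof (rule field_differentiable_bound[of ?S])
    fix x assume x: "x \<in> ?S"
    show "(?f has_field_derivative exp x - 1) (at x within ?S)"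
      by (auto intro!: derivative_eq_intros)
    have "\<bar>exp x - exp 0\<bar> \<le> exp 1 * \<bar>x - 0\<bar>" using x assms by (intro abs_exp_diff_le) auto
    also have "\<dots> \<le> 3 * \<bar>u\<bar>" using x exp_le by (intro mult_mono) auto
    finally show "norm (exp x - 1) \<le> 3 * \<bar>u\<bar>" by simp
  qed auto
  then show ?thesis by (simp add: power2_eq_square abs_mult_self_eq mult.assoc)
qed

text \<open>Quantifies that (1 - \<sigma>) exp (c \<sigma>) = 1 has only the solutions 0 and \<beta>
  on [0, 1]. Both are zeros of c \<sigma> + ln (1 - \<sigma>), and comparison with the chord through
  them bounds this expression away from 0 elsewhere.\<close>

lemma survival_away:
  fixes c \<beta> \<sigma> :: real
  assumes \<beta>: "0 < \<beta>" "\<beta> < 1" "1 - \<beta> = exp (- \<beta> * c)" and \<sigma>: "0 \<le> \<sigma>" "\<sigma> \<le> 1"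
  shows "\<sigma> * \<bar>\<sigma> - \<beta>\<bar> / 4 \<le> \<bar>(1 - \<sigma>) * exp (c * \<sigma>) - 1\<bar>"
proof (cases "\<sigma> = 1")
  case True
  then show ?thesis using \<beta> by simp
next
  case False
  then have \<sigma>1: "\<sigma> < 1" using \<sigma> by simp
  \<comment> \<open>-ln (1 - x) has second derivative at least 1, so it stays convex after x^2/2 is
    subtracted. That surplus of convexity is the gap \<sigma> |\<sigma> - \<beta>|/2 in the chord
    inequalities.\<close>
  define k where "k x = - ln (1 - x) - x\<^sup>2 / 2" for x :: real
  have conv: "convex_on {0..<1} k"
  proof (rule f''_ge0_imp_convex)
    fix x :: real assume x: "x \<in> {0..<1}"
    show "(k has_real_derivative (1 / (1 - x) - x)) (at x)"
      unfolding k_def using x by (auto intro!: derivative_eq_intros)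
    show "((\<lambda>x. 1 / (1 - x) - x) has_real_derivative (1 / (1 - x)\<^sup>2 - 1)) (at x)"
      using x by (auto intro!: derivative_eq_intros simp: power2_eq_square)
    have "0 < (1 - x)\<^sup>2" "(1 - x)\<^sup>2 \<le> 1" using x by (auto intro: power_le_one)
    then show "0 \<le> 1 / (1 - x)\<^sup>2 - 1" by (simp add: field_simps)
  qed auto
  have k0: "k 0 = 0" by (simp add: k_def)
  have k\<beta>: "k \<beta> = \<beta> * c - \<beta>\<^sup>2 / 2" using \<beta>(3) by (simp add: k_def)
  have e: "(1 - \<sigma>) * exp (c * \<sigma>) = exp (c * \<sigma> + ln (1 - \<sigma>))" using \<sigma>1 by (simp add: exp_add)
  show ?thesis
  proof (cases "\<sigma> \<le> \<beta>")
    case True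
    have "k ((1 - \<sigma> / \<beta>) *\<^sub>R 0 + (\<sigma> / \<beta>) *\<^sub>R \<beta>) \<le> (1 - \<sigma> / \<beta>) * k 0 + \<sigma> / \<beta> * k \<beta>"
      using True \<sigma> \<beta> by (intro convex_onD[OF conv]) auto
    then have "k \<sigma> \<le> \<sigma> / \<beta> * (\<beta> * c - \<beta>\<^sup>2 / 2)" using \<beta>(1) by (simp add: k0 k\<beta>)
    also have "\<dots> = \<sigma> * (c - \<beta> / 2)" using \<beta>(1) by (simp add: power2_eq_square field_simps)
    finally have "k \<sigma> \<le> \<sigma> * (c - \<beta> / 2)" .
    then have "\<sigma> * (\<beta> - \<sigma>) / 2 \<le> c * \<sigma> + ln (1 - \<sigma>)"
      by (simp add: k_def power2_eq_square algebra_simps)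
    also have "\<dots> \<le> exp (c * \<sigma> + ln (1 - \<sigma>)) - 1"
      using exp_ge_add_one_self[of "c * \<sigma> + ln (1 - \<sigma>)"] by linarith
    finally have "\<sigma> * (\<beta> - \<sigma>) / 2 \<le> (1 - \<sigma>) * exp (c * \<sigma>) - 1" by (simp add: e)
    moreover have "0 \<le> \<sigma> * (\<beta> - \<sigma>)" using True \<sigma> by simp
    moreover have "\<bar>\<sigma> - \<beta>\<bar> = \<beta> - \<sigma>" using True by simp
    ultimately show ?thesis using abs_ge_self[of "(1 - \<sigma>) * exp (c * \<sigma>) - 1"] by simp
  next
    case False
    then have lt: "\<beta> < \<sigma>" by simp
    have "k ((1 - \<beta> / \<sigma>) *\<^sub>R 0 + (\<beta> / \<sigma>) *\<^sub>R \<sigma>) \<le> (1 - \<beta> / \<sigma>) * k 0 + \<beta> / \<sigma> * k \<sigma>"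
      using lt \<sigma> \<sigma>1 \<beta> by (intro convex_onD[OF conv]) auto
    then have "k \<beta> * \<sigma> \<le> \<beta> * k \<sigma>" using \<beta> lt unfolding k0 by (simp add: field_simps)
    then have "\<beta> * ((c - \<beta> / 2) * \<sigma>) \<le> \<beta> * k \<sigma>" unfolding k\<beta> by (simp add: power2_eq_square algebra_simps)
    then have "(c - \<beta> / 2) * \<sigma> \<le> k \<sigma>" using \<beta> by simp
    then have up: "c * \<sigma> + ln (1 - \<sigma>) \<le> - (\<sigma> * (\<sigma> - \<beta>) / 2)"
      unfolding k_def power2_eq_square by (simp add: field_simps)
    define t where "t = \<sigma> * (\<sigma> - \<beta>) / 2"
    have t: "0 \<le> t" using lt \<sigma> by (simp add: t_def)
    have "\<sigma> * (\<sigma> - \<beta>) \<le> 1" using lt \<sigma> \<beta> by (intro mult_le_one) auto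
    then have t1: "t \<le> 1 / 2" by (simp add: t_def)
    have "exp (c * \<sigma> + ln (1 - \<sigma>)) \<le> exp (- t)" using up by (simp add: t_def)
    also have "\<dots> \<le> 1 - t / 2"
    proof -
      have "exp (- t) = 1 / exp t" by (simp add: exp_minus divide_inverse)
      also have "\<dots> \<le> 1 / (1 + t)" using t exp_ge_add_one_self[of t] by (intro divide_left_mono) auto
      also have "\<dots> \<le> 1 - t / 2"
      proof -
        have "0 \<le> t * (1 - t)" using t t1 by simp
        then show ?thesis using t by (simp add: field_simps)
      qed
      finally show ?thesis .
    qed
    finally have "t / 2 \<le> 1 - (1 - \<sigma>) * exp (c * \<sigma>)" by (simp add: e)
    moreover have "\<bar>\<sigma> - \<beta>\<bar> = \<sigma> - \<beta>" using lt by simp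
    ultimately show ?thesis using abs_ge_minus_self[of "(1 - \<sigma>) * exp (c * \<sigma>) - 1"]
      by (simp add: t_def)
  qed
qed

text \<open>The strict inequality ln y < y - 1 at y = 1/(1 - \<beta>). The product c (1 - \<beta>)
  is the mean degree of the graph left after removal of the giant.\<close>

lemma dual_subcritical:
  fixes c \<beta> :: real
  assumes \<beta>: "0 < \<beta>" "\<beta> < 1" "1 - \<beta> = exp (- \<beta> * c)"
  shows "c * (1 - \<beta>) < 1"
proof -
  have c: "\<beta> * c = - ln (1 - \<beta>)" using \<beta> by simp
  have "ln (1 / (1 - \<beta>)) \<le> 1 / (1 - \<beta>) - 1" using \<beta>(1,2) by (intro ln_le_minus_one) auto
  moreover have "ln (1 / (1 - \<beta>)) \<noteq> 1 / (1 - \<beta>) - 1"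
  proof
    assume "ln (1 / (1 - \<beta>)) = 1 / (1 - \<beta>) - 1"
    then have "1 / (1 - \<beta>) = 1" by (rule ln_eq_minus_one[rotated]) (use \<beta> in simp)
    then show False using \<beta>(1,2) by simp
  qed
  ultimately have "\<beta> * c < 1 / (1 - \<beta>) - 1" using c \<beta>(1,2) by (simp add: ln_div)
  also have "1 / (1 - \<beta>) - 1 = \<beta> / (1 - \<beta>)" using \<beta>(1,2) by (simp add: field_simps)
  finally have "\<beta> * (c * (1 - \<beta>)) < \<beta> * 1" using \<beta>(1,2) by (simp add: field_simps)
  then show ?thesis using \<beta>(1) by (subst (asm) mult_less_cancel_left_pos)
qed

section \<open>Supercritical cluster sizes: the identity at scale n^(-1/2)\<close>

lemma sum_squeeze:
  fixes w F G :: "nat \<Rightarrow> nat \<Rightarrow> real"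
  assumes lim: "(\<lambda>n. \<Sum>s\<in>A n. w n s * F n s) \<longlonglongrightarrow> L" and q: "q \<longlonglongrightarrow> 0"
    and ev: "\<forall>\<^sub>F n in sequentially. \<forall>s\<in>A n. 0 \<le> w n s \<and> F n s * exp (- q n) \<le> G n s \<and>
      G n s \<le> F n s * exp (q n)"
  shows "(\<lambda>n. \<Sum>s\<in>A n. w n s * G n s) \<longlonglongrightarrow> L"
proof (rule tendsto_sandwich)
  let ?X = "\<lambda>n. \<Sum>s\<in>A n. w n s * F n s"
  have "(\<lambda>n. ?X n * exp (- q n)) \<longlonglongrightarrow> L * exp (- 0)"
    by (intro tendsto_intros lim q)
  then show "(\<lambda>n. ?X n * exp (- q n)) \<longlonglongrightarrow> L" by simp
  have "(\<lambda>n. ?X n * exp (q n)) \<longlonglongrightarrow> L * exp 0"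
    by (intro tendsto_intros lim q)
  then show "(\<lambda>n. ?X n * exp (q n)) \<longlonglongrightarrow> L" by simp
  show "\<forall>\<^sub>F n in sequentially. ?X n * exp (- q n) \<le> (\<Sum>s\<in>A n. w n s * G n s)"
    using ev
  proof eventually_elim
    case (elim n)
    have "(\<Sum>s\<in>A n. w n s * (F n s * exp (- q n))) \<le> (\<Sum>s\<in>A n. w n s * G n s)"
      using elim by (intro sum_mono mult_left_mono) auto
    then show ?case by (simp add: sum_distrib_right mult.assoc)
  qed
  show "\<forall>\<^sub>F n in sequentially. (\<Sum>s\<in>A n. w n s * G n s) \<le> ?X n * exp (q n)"
    using ev
  proof eventually_elim
    case (elim n)
    have "(\<Sum>s\<in>A n. w n s * G n s) \<le> (\<Sum>s\<in>A n. w n s * (F n s * exp (q n)))"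
      using elim by (intro sum_mono mult_left_mono) auto
    then show ?case by (simp add: sum_distrib_right mult.assoc)
  qed
qed

text \<open>Edge probabilities enter through \<open>h\<close> and \<open>w\<close> only, so that the
  results can be instantiated again for tilted edge probabilities, with another \<theta> but the
  same c and \<beta>.\<close>

locale supercritical =
  fixes c \<beta> \<theta> :: real and h :: "nat \<Rightarrow> real" and w :: "nat \<Rightarrow> nat \<Rightarrow> real"
  assumes c: "1 < c" and \<beta>: "0 < \<beta>" "\<beta> < 1" "1 - \<beta> = exp (- \<beta> * c)"
    and h_lim: "(\<lambda>n. sqrt (real n) * (h n - c)) \<longlonglongrightarrow> \<theta>"
    and law: "\<forall>\<^sub>F n in sequentially. cluster_law n (h n) (w n)"
begin

text \<open>\<open>Y\<close> and -\<open>V\<close> are the coefficients of \<mu> and of \<mu>^2/2 in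
  ln (\<open>ratio\<close> \<mu> n s), up to O(1/sqrt n).\<close>

definition Y :: "nat \<Rightarrow> nat \<Rightarrow> real" where
  "Y n s = (real n - (real n - real s) * exp (h n * real s / real n)) / sqrt (real n)"

definition V :: "nat \<Rightarrow> nat \<Rightarrow> real" where
  "V n s = ((real n - real s) * exp (2 * h n * real s / real n) - real n) / real n"

text \<open>The integrand of the identity at x = \<mu>/sqrt n, normalised to have mean 1.\<close>

definition ratio :: "real \<Rightarrow> nat \<Rightarrow> nat \<Rightarrow> real" where
  "ratio \<mu> n s = (1 - \<mu> / sqrt (real n) * exp (h n * real s / real n)) ^ (n - s) /
     (1 - \<mu> / sqrt (real n)) ^ (n - 1)"

text \<open>\<open>B\<close> bounds exp (h s/n) and \<open>C0\<close> bounds |sqrt n (h - c)|, both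
  for large \<open>n\<close>; see \<open>exp_le_B\<close> and \<open>ev_basic\<close>.\<close>

definition B :: real where "B = exp (c + 1)"

definition C0 :: real where "C0 = \<bar>\<theta>\<bar> + 1"

lemma ev_basic: "\<forall>\<^sub>F n in sequentially. n \<ge> 1 \<and> cluster_law n (h n) (w n) \<and> \<bar>h n - c\<bar> \<le> C0 / sqrt (real n) \<and>
    1 \<le> h n \<and> h n \<le> c + 1"
proof -
  have 1: "\<forall>\<^sub>F n in sequentially. \<bar>sqrt (real n) * (h n - c)\<bar> < C0"
    using tendsto_rabs[OF h_lim] by (rule order_tendstoD) (simp add: C0_def)
  have C0: "C0 > 0" by (simp add: C0_def)
  have "(\<lambda>n. C0 / sqrt (real n)) \<longlonglongrightarrow> 0" by real_asymp
  then have 2: "\<forall>\<^sub>F n in sequentially. C0 / sqrt (real n) < min 1 (c - 1)"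
    by (rule order_tendstoD) (use c in auto)
  show ?thesis
    using 1 2 law eventually_ge_at_top[of 1]
  proof eventually_elim
    case (elim n)
    then have "sqrt (real n) * \<bar>h n - c\<bar> \<le> C0" by (simp only: abs_mult) simp
    then have "\<bar>h n - c\<bar> \<le> C0 / sqrt (real n)" using elim
      by (subst pos_le_divide_eq) (auto simp: mult.commute)
    then show ?case using elim by linarith
  qed
qed

lemma exp_le_B:
  assumes "1 \<le> h n" "h n \<le> c + 1" "s \<in> {1..n}"
  shows "exp (h n * real s / real n) \<le> B" "1 \<le> exp (h n * real s / real n)"
proof -
  have "h n * (real s / real n) \<le> (c + 1) * 1" using assms c by (intro mult_mono) auto
  then show "exp (h n * real s / real n) \<le> B" by (simp add: B_def)
  show "1 \<le> exp (h n * real s / real n)" using assms by simp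
qed

lemma B_ge_1: "1 \<le> B" using c by (simp add: B_def)

lemma V_bounds:
  assumes "1 \<le> h n" "h n \<le> c + 1" "s \<in> {1..n}"
  shows "- 1 \<le> V n s" "V n s \<le> B\<^sup>2"
proof -
  let ?e = "exp (h n * real s / real n)"
  have n: "real n > 0" using assms by auto
  have e2: "exp (2 * h n * real s / real n) = ?e\<^sup>2"
    by (simp flip: exp_double add: mult.assoc)
  have "0 \<le> (real n - real s) * exp (2 * h n * real s / real n)" using assms by auto
  then show "- 1 \<le> V n s" using n by (simp add: V_def field_simps)
  have "(real n - real s) * ?e\<^sup>2 \<le> real n * B\<^sup>2"
    using assms exp_le_B[OF assms] by (intro mult_mono power_mono) auto
  then have "(real n - real s) * exp (2 * h n * real s / real n) - real n \<le> B\<^sup>2 * real n"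
    unfolding e2 by (simp add: mult.commute)
  then show "V n s \<le> B\<^sup>2" unfolding V_def using n by (subst pos_divide_le_eq) auto
qed

text \<open>Second-order expansion of the two logarithms. The cubic remainders are multiplied by at
  most \<open>n\<close>, and n |x|^3 is of order 1/sqrt n, uniformly in \<open>s\<close> because exp
  (h s/n) is bounded.\<close>

lemma ratio_expansion:
  "\<exists>C>0. \<forall>\<^sub>F n in sequentially. 0 < 1 - \<mu> / sqrt (real n) \<and> (\<forall>s\<in>{1..n}. \<exists>r. \<bar>r\<bar> \<le> C / sqrt (real n) \<and>
     ratio \<mu> n s = exp (\<mu> * Y n s - \<mu>\<^sup>2 / 2 * V n s + r))"
proof -
  define C where "C = 2 * \<bar>\<mu>\<bar> ^ 3 * (B ^ 3 + 1) + 2 * \<bar>\<mu>\<bar> + 1"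
  have C: "C > 0" using B_ge_1 by (auto simp: C_def intro!: add_nonneg_pos mult_nonneg_nonneg add_nonneg_nonneg)
  have "(\<lambda>n. \<bar>\<mu>\<bar> * B / sqrt (real n)) \<longlonglongrightarrow> 0" by real_asymp
  then have ev: "\<forall>\<^sub>F n in sequentially. \<bar>\<mu>\<bar> * B / sqrt (real n) < 1 / 2"
    by (rule order_tendstoD) auto
  show ?thesis
  proof (intro exI[of _ C] conjI C)
    show "\<forall>\<^sub>F n in sequentially. 0 < 1 - \<mu> / sqrt (real n) \<and> (\<forall>s\<in>{1..n}. \<exists>r. \<bar>r\<bar> \<le> C / sqrt (real n) \<and>
     ratio \<mu> n s = exp (\<mu> * Y n s - \<mu>\<^sup>2 / 2 * V n s + r))"
      using ev ev_basic
    proof eventually_elim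
      case (elim n)
      define x where "x = \<mu> / sqrt (real n)"
      have n: "real n > 0" using elim by auto
      have xB: "\<bar>x\<bar> * B \<le> 1 / 2" using elim by (simp add: x_def)
      have "\<bar>x\<bar> * 1 \<le> \<bar>x\<bar> * B" using B_ge_1 by (intro mult_left_mono) auto
      then have x: "\<bar>x\<bar> \<le> 1 / 2" using xB by linarith
      have nx2: "real n * x\<^sup>2 = \<mu>\<^sup>2" using n by (simp add: x_def power_divide)
      have nx3: "real n * \<bar>x\<bar> ^ 3 = \<bar>\<mu>\<bar> ^ 3 / sqrt (real n)"
        using n by (simp add: x_def power_divide power3_eq_cube)
      show ?case
      proof (intro conjI ballI)
        show "0 < 1 - \<mu> / sqrt (real n)" using x unfolding x_def by linarith
        fix s assume s: "s \<in> {1..n}"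
        define e where "e = exp (h n * real s / real n)"
        define u where "u = x * e"
        have e: "1 \<le> e" "e \<le> B" using exp_le_B[of n s] elim s by (auto simp: e_def)
        have "\<bar>u\<bar> = \<bar>x\<bar> * e" using e by (simp add: u_def abs_mult)
        also have "\<dots> \<le> \<bar>x\<bar> * B" using e by (intro mult_left_mono) auto
        finally have uB: "\<bar>u\<bar> \<le> \<bar>x\<bar> * B" .
        then have u: "\<bar>u\<bar> \<le> 1 / 2" using xB by linarith
        define e1 where "e1 = ln (1 - u) + u + u\<^sup>2 / 2"
        define e2 where "e2 = ln (1 - x) + x + x\<^sup>2 / 2"
        have "\<bar>u\<bar> ^ 3 \<le> (\<bar>x\<bar> * B) ^ 3" using uB by (intro power_mono) auto
        then have e1: "\<bar>e1\<bar> \<le> 2 * (\<bar>x\<bar> ^ 3 * B ^ 3)"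
          using ln_one_minus_quadratic[OF u] by (simp add: e1_def power_mult_distrib)
        have e2: "\<bar>e2\<bar> \<le> 2 * \<bar>x\<bar> ^ 3" using ln_one_minus_quadratic[OF x] by (simp add: e2_def)
        \<comment> \<open>Besides the cubic errors, \<open>r\<close> contains -x - x^2/2, the
          difference between the exponents n - 1 and n in the normalisation.\<close>
        define r where "r = (real n - real s) * e1 - (real n - 1) * e2 - x - x\<^sup>2 / 2"
        have "\<bar>(real n - real s) * e1\<bar> \<le> real n * (2 * (\<bar>x\<bar> ^ 3 * B ^ 3))"
          unfolding abs_mult using s e1 by (intro mult_mono) auto
        moreover have "\<bar>(real n - 1) * e2\<bar> \<le> real n * (2 * \<bar>x\<bar> ^ 3)"
          unfolding abs_mult using elim e2 by (intro mult_mono) auto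
        moreover have "x\<^sup>2 \<le> \<bar>x\<bar>" using x mult_left_le[of "\<bar>x\<bar>" "\<bar>x\<bar>"] by (simp add: power2_eq_square)
        ultimately have calc: "\<bar>(real n - real s) * e1\<bar> + \<bar>(real n - 1) * e2\<bar> + \<bar>x\<bar> + x\<^sup>2 \<le>
            real n * (2 * (\<bar>x\<bar> ^ 3 * B ^ 3)) + real n * (2 * \<bar>x\<bar> ^ 3) + 2 * \<bar>x\<bar>" by linarith
        have "\<bar>P - Q - x - x\<^sup>2 / 2\<bar> \<le> \<bar>P\<bar> + \<bar>Q\<bar> + \<bar>x\<bar> + x\<^sup>2" for P Q
          using zero_le_power2[of x] by linarith
        from this[of "(real n - real s) * e1" "(real n - 1) * e2"] calc
        have "\<bar>r\<bar> \<le> real n * (2 * (\<bar>x\<bar> ^ 3 * B ^ 3)) + real n * (2 * \<bar>x\<bar> ^ 3) + 2 * \<bar>x\<bar>"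
          unfolding r_def[symmetric] by linarith
        also have "\<dots> = 2 * B ^ 3 * (real n * \<bar>x\<bar> ^ 3) + 2 * (real n * \<bar>x\<bar> ^ 3) + 2 * \<bar>x\<bar>"
          by (simp add: mult_ac)
        also have "\<dots> = (2 * \<bar>\<mu>\<bar> ^ 3 * (B ^ 3 + 1) + 2 * \<bar>\<mu>\<bar>) / sqrt (real n)"
          unfolding nx3 by (simp add: x_def add_divide_distrib distrib_left mult_ac)
        also have "\<dots> \<le> C / sqrt (real n)" by (intro divide_right_mono) (auto simp: C_def)
        finally have r: "\<bar>r\<bar> \<le> C / sqrt (real n)" .
        have pos: "0 < 1 - u" "0 < 1 - x" using u x by auto
        have "ratio \<mu> n s = (1 - u) ^ (n - s) / (1 - x) ^ (n - 1)"
          by (simp add: ratio_def u_def x_def e_def)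
        also have "\<dots> = exp ((real n - real s) * ln (1 - u) - (real n - 1) * ln (1 - x))"
          using pos s by (simp add: power_of_ln exp_diff of_nat_diff)
        also have "(real n - real s) * ln (1 - u) - (real n - 1) * ln (1 - x) =
            (real n * x - (real n - real s) * u) - ((real n - real s) * u\<^sup>2 - real n * x\<^sup>2) / 2 + r"
          by (simp add: r_def e1_def e2_def field_simps)
        also have "real n * x - (real n - real s) * u = \<mu> * Y n s"
          using n unfolding Y_def u_def x_def e_def[symmetric] by (simp add: field_simps)
        also have "((real n - real s) * u\<^sup>2 - real n * x\<^sup>2) / 2 = \<mu>\<^sup>2 / 2 * V n s"
        proof -
          have "exp (2 * h n * real s / real n) = e\<^sup>2"
            unfolding e_def by (simp flip: exp_double add: mult.assoc)
          then have "\<mu>\<^sup>2 / 2 * V n s = (real n * x\<^sup>2) / 2 * (((real n - real s) * e\<^sup>2 - real n) / real n)"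
            unfolding V_def nx2 by simp
          also have "\<dots> = ((real n - real s) * u\<^sup>2 - real n * x\<^sup>2) / 2"
            using n by (simp add: u_def power_mult_distrib field_simps)
          finally show ?thesis by simp
        qed
        finally show "\<exists>r. \<bar>r\<bar> \<le> C / sqrt (real n) \<and>
            ratio \<mu> n s = exp (\<mu> * Y n s - \<mu>\<^sup>2 / 2 * V n s + r)" using r by auto
      qed
    qed
  qed
qed

lemma sum_ratio: "\<forall>\<^sub>F n in sequentially. (\<Sum>s=1..n. w n s * ratio \<mu> n s) = 1"
proof -
  obtain C where "\<forall>\<^sub>F n in sequentially. 0 < 1 - \<mu> / sqrt (real n) \<and> (\<forall>s\<in>{1..n}. \<exists>r. \<bar>r\<bar> \<le> C / sqrt (real n) \<and>
     ratio \<mu> n s = exp (\<mu> * Y n s - \<mu>\<^sup>2 / 2 * V n s + r))" using ratio_expansion by blast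
  then show ?thesis using ev_basic
  proof eventually_elim
    case (elim n)
    have "(\<Sum>s=1..n. w n s * ratio \<mu> n s) =
       (\<Sum>s=1..n. w n s * (1 - \<mu> / sqrt (real n) * exp (h n * real s / real n)) ^ (n - s)) /
       (1 - \<mu> / sqrt (real n)) ^ (n - 1)"
      by (simp add: ratio_def sum_divide_distrib)
    then show ?case using cluster_law_identity[of n "h n" "w n" "\<mu> / sqrt (real n)"] elim by simp
  qed
qed

text \<open>\<open>V\<close> is bounded, so exp (\<mu> Y) and \<open>ratio\<close> differ by bounded
  factors. As \<open>ratio\<close> has mean 1, every exponential moment of \<open>Y\<close> is
  bounded in \<open>n\<close>.\<close>

lemma ratio_compare:
  "\<exists>D>0. \<forall>\<^sub>F n in sequentially. \<forall>s\<in>{1..n}. exp (\<mu> * Y n s) \<le> D * ratio \<mu> n s \<and>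
     0 \<le> ratio \<mu> n s \<and> ratio \<mu> n s \<le> D * exp (\<mu> * Y n s)"
proof -
  obtain C where C: "C > 0" "\<forall>\<^sub>F n in sequentially. 0 < 1 - \<mu> / sqrt (real n) \<and> (\<forall>s\<in>{1..n}. \<exists>r. \<bar>r\<bar> \<le> C / sqrt (real n) \<and>
     ratio \<mu> n s = exp (\<mu> * Y n s - \<mu>\<^sup>2 / 2 * V n s + r))" using ratio_expansion by blast
  define D where "D = exp (\<mu>\<^sup>2 / 2 * (B\<^sup>2 + 1) + C)"
  show ?thesis
  proof (intro exI[of _ D] conjI)
    show "D > 0" by (simp add: D_def)
    show "\<forall>\<^sub>F n in sequentially. \<forall>s\<in>{1..n}. exp (\<mu> * Y n s) \<le> D * ratio \<mu> n s \<and>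
     0 \<le> ratio \<mu> n s \<and> ratio \<mu> n s \<le> D * exp (\<mu> * Y n s)"
      using C(2) ev_basic
    proof eventually_elim
      case (elim n)
      show ?case
      proof
        fix s assume s: "s \<in> {1..n}"
        obtain r where r: "\<bar>r\<bar> \<le> C / sqrt (real n)"
          "ratio \<mu> n s = exp (\<mu> * Y n s - \<mu>\<^sup>2 / 2 * V n s + r)" using elim s by blast
        have "C / sqrt (real n) \<le> C" using C(1) elim by (simp add: field_simps)
        then have r': "\<bar>r\<bar> \<le> C" using r by linarith
        have V: "- 1 \<le> V n s" "V n s \<le> B\<^sup>2" using V_bounds elim s by auto
        have V1: "\<mu>\<^sup>2 / 2 * V n s \<le> \<mu>\<^sup>2 / 2 * B\<^sup>2" "- (\<mu>\<^sup>2 / 2) \<le> \<mu>\<^sup>2 / 2 * V n s"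
          using mult_left_mono[OF V(1), of "\<mu>\<^sup>2 / 2"] mult_left_mono[OF V(2), of "\<mu>\<^sup>2 / 2"] by auto
        have B0: "0 \<le> \<mu>\<^sup>2 / 2 * B\<^sup>2" by simp
        define P where "P = \<mu>\<^sup>2 / 2 * V n s"
        have P: "- (\<mu>\<^sup>2 / 2) \<le> P" "P \<le> \<mu>\<^sup>2 / 2 * B\<^sup>2" using V1 by (simp_all add: P_def)
        have D: "D = exp (\<mu>\<^sup>2 / 2 * B\<^sup>2 + \<mu>\<^sup>2 / 2 + C)" by (simp add: D_def distrib_left)
        have r'': "r \<le> C" "- r \<le> C" using r' by auto
        have m0: "0 \<le> \<mu>\<^sup>2 / 2" by simp
        have ra: "ratio \<mu> n s = exp (\<mu> * Y n s - P + r)" by (simp add: r(2) P_def)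
        have 1: "\<mu> * Y n s \<le> (\<mu>\<^sup>2 / 2 * B\<^sup>2 + \<mu>\<^sup>2 / 2 + C) + (\<mu> * Y n s - P + r)"
          using P r'' m0 by linarith
        have 2: "\<mu> * Y n s - P + r \<le> (\<mu>\<^sup>2 / 2 * B\<^sup>2 + \<mu>\<^sup>2 / 2 + C) + \<mu> * Y n s"
          using P r'' m0 B0 by linarith
        show "exp (\<mu> * Y n s) \<le> D * ratio \<mu> n s \<and>
            0 \<le> ratio \<mu> n s \<and> ratio \<mu> n s \<le> D * exp (\<mu> * Y n s)"
          unfolding ra D exp_add[symmetric] exp_le_cancel_iff using 1 2 exp_ge_zero by blast
      qed
    qed
  qed
qed

lemma exp_Y_bounded:
  "\<exists>D>0. \<forall>\<^sub>F n in sequentially. (\<Sum>s=1..n. w n s * exp (\<mu> * Y n s)) \<le> D"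
proof -
  obtain D where D: "D > 0" "\<forall>\<^sub>F n in sequentially. \<forall>s\<in>{1..n}. exp (\<mu> * Y n s) \<le> D * ratio \<mu> n s \<and>
     0 \<le> ratio \<mu> n s \<and> ratio \<mu> n s \<le> D * exp (\<mu> * Y n s)" using ratio_compare by blast
  have "\<forall>\<^sub>F n in sequentially. (\<Sum>s=1..n. w n s * exp (\<mu> * Y n s)) \<le> D"
    using D(2) sum_ratio[of \<mu>] ev_basic
  proof eventually_elim
    case (elim n)
    have "(\<Sum>s=1..n. w n s * exp (\<mu> * Y n s)) \<le> (\<Sum>s=1..n. w n s * (D * ratio \<mu> n s))"
      using elim cluster_law_nonneg by (intro sum_mono mult_left_mono) auto
    also have "\<dots> = D * (\<Sum>s=1..n. w n s * ratio \<mu> n s)" by (simp add: sum_distrib_left mult_ac)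
    finally show ?case using elim by simp
  qed
  then show ?thesis using D(1) by blast
qed

text \<open>Cauchy-Schwarz against the bounded exponential moment of order 2 \<mu>, in additive
  form: a set of sizes of vanishing probability stays negligible under the weight exp (\<mu>
  Y).\<close>

lemma negligible_exp_Y:
  assumes A: "\<And>n. A n \<subseteq> {1..n}" and lim: "(\<lambda>n. \<Sum>s\<in>A n. w n s) \<longlonglongrightarrow> 0"
  shows "(\<lambda>n. \<Sum>s\<in>A n. w n s * exp (\<mu> * Y n s)) \<longlonglongrightarrow> 0"
proof (rule LIMSEQ_I)
  fix e :: real assume e: "e > 0"
  obtain D where D: "D > 0" "\<forall>\<^sub>F n in sequentially. (\<Sum>s=1..n. w n s * exp (2 * \<mu> * Y n s)) \<le> D"
    using exp_Y_bounded[of "2 * \<mu>"] by blast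
  define \<delta> where "\<delta> = e / (2 * D)"
  have \<delta>: "\<delta> > 0" using e D by (simp add: \<delta>_def)
  have "\<forall>\<^sub>F n in sequentially. (\<Sum>s\<in>A n. w n s) < 2 * \<delta> * e"
    using lim by (rule order_tendstoD) (use \<delta> e in auto)
  then have "\<forall>\<^sub>F n in sequentially. norm ((\<Sum>s\<in>A n. w n s * exp (\<mu> * Y n s)) - 0) < e"
    using D(2) ev_basic
  proof eventually_elim
    case (elim n)
    have w: "0 \<le> w n s" if "s \<in> {1..n}" for s using cluster_law_nonneg elim that by blast
    have "(\<Sum>s\<in>A n. w n s * exp (\<mu> * Y n s)) \<le>
        (\<Sum>s\<in>A n. \<delta> * (w n s * exp (2 * \<mu> * Y n s)) + w n s / (4 * \<delta>))"
    proof (intro sum_mono)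
      fix s assume s: "s \<in> A n"
      let ?a = "exp (\<mu> * Y n s)"
      \<comment> \<open>Yields a \<le> \<delta> a^2 + 1/(4 \<delta>). With \<delta> = e/(2 D) the
        moment of order 2 \<mu> contributes at most e/2, and the probability, eventually below 2
        \<delta> e, less than another e/2.\<close>
      have "0 \<le> (2 * \<delta> * ?a - 1)\<^sup>2" by simp
      then have "4 * \<delta> * ?a \<le> 4 * \<delta> * (\<delta> * ?a\<^sup>2 + 1 / (4 * \<delta>))"
        using \<delta> by (simp add: power2_diff power_mult_distrib power2_eq_square algebra_simps)
      then have "?a \<le> \<delta> * ?a\<^sup>2 + 1 / (4 * \<delta>)" using \<delta> by (subst (asm) mult_le_cancel_left_pos) auto
      also have "?a\<^sup>2 = exp (2 * \<mu> * Y n s)" by (simp flip: exp_double add: mult.assoc)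
      finally have "w n s * ?a \<le> w n s * (\<delta> * exp (2 * \<mu> * Y n s) + 1 / (4 * \<delta>))"
        using w[of s] A[of n] s by (intro mult_left_mono) auto
      then show "w n s * ?a \<le> \<delta> * (w n s * exp (2 * \<mu> * Y n s)) + w n s / (4 * \<delta>)"
        by (simp add: algebra_simps)
    qed
    also have "\<dots> = \<delta> * (\<Sum>s\<in>A n. w n s * exp (2 * \<mu> * Y n s)) + (\<Sum>s\<in>A n. w n s) / (4 * \<delta>)"
      by (simp add: sum.distrib sum_distrib_left sum_divide_distrib)
    also have "\<dots> < \<delta> * D + 2 * \<delta> * e / (4 * \<delta>)"
    proof (intro add_le_less_mono mult_left_mono divide_strict_right_mono)
      have "(\<Sum>s\<in>A n. w n s * exp (2 * \<mu> * Y n s)) \<le> (\<Sum>s=1..n. w n s * exp (2 * \<mu> * Y n s))"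
        using A w by (intro sum_mono2) auto
      then show "(\<Sum>s\<in>A n. w n s * exp (2 * \<mu> * Y n s)) \<le> D" using elim by linarith
    qed (use elim \<delta> in auto)
    also have "\<dots> = e" using \<delta> D by (simp add: \<delta>_def field_simps)
    finally have "(\<Sum>s\<in>A n. w n s * exp (\<mu> * Y n s)) < e" .
    moreover have "0 \<le> (\<Sum>s\<in>A n. w n s * exp (\<mu> * Y n s))"
      by (intro sum_nonneg mult_nonneg_nonneg w subsetD[OF A]) auto
    ultimately show ?case by simp
  qed
  then show "\<exists>no. \<forall>n\<ge>no. norm ((\<Sum>s\<in>A n. w n s * exp (\<mu> * Y n s)) - 0) < e"
    by (simp add: eventually_sequentially)
qed

lemma negligible_ratio:
  assumes A: "\<And>n. A n \<subseteq> {1..n}" and lim: "(\<lambda>n. \<Sum>s\<in>A n. w n s) \<longlonglongrightarrow> 0"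
  shows "(\<lambda>n. \<Sum>s\<in>A n. w n s * ratio \<mu> n s) \<longlonglongrightarrow> 0"
proof -
  obtain D where D: "D > 0" "\<forall>\<^sub>F n in sequentially. \<forall>s\<in>{1..n}. exp (\<mu> * Y n s) \<le> D * ratio \<mu> n s \<and>
     0 \<le> ratio \<mu> n s \<and> ratio \<mu> n s \<le> D * exp (\<mu> * Y n s)" using ratio_compare by blast
  show ?thesis
  proof (rule tendsto_sandwich)
    show "\<forall>\<^sub>F n in sequentially. 0 \<le> (\<Sum>s\<in>A n. w n s * ratio \<mu> n s)"
      using D(2) ev_basic
    proof eventually_elim
      case (elim n)
      then show ?case using A[of n] cluster_law_nonneg[of n "h n" "w n"]
        by (intro sum_nonneg mult_nonneg_nonneg) auto
    qed
    show "\<forall>\<^sub>F n in sequentially. (\<Sum>s\<in>A n. w n s * ratio \<mu> n s) \<le>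
        D * (\<Sum>s\<in>A n. w n s * exp (\<mu> * Y n s))"
      using D(2) ev_basic
    proof eventually_elim
      case (elim n)
      have "(\<Sum>s\<in>A n. w n s * ratio \<mu> n s) \<le> (\<Sum>s\<in>A n. w n s * (D * exp (\<mu> * Y n s)))"
        using elim A[of n] cluster_law_nonneg[of n "h n" "w n"] by (intro sum_mono mult_left_mono) auto
      then show ?case by (simp add: sum_distrib_left mult_ac)
    qed
    show "(\<lambda>n. D * (\<Sum>s\<in>A n. w n s * exp (\<mu> * Y n s))) \<longlonglongrightarrow> 0"
      using tendsto_mult_left[OF negligible_exp_Y[OF A lim, of \<mu>], of D] by simp
  qed simp
qed

text \<open>The window has to exceed \<open>\<surd>n\<close>, while second-order terms, of size \<open>(s - \<beta> n)\<^sup>2 / n\<close> times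
  \<open>1 / \<surd>n\<close>, have to vanish: every exponent strictly between 1/2 and 3/4 would do.\<close>

definition near :: "nat \<Rightarrow> nat set" where
  "near n = {s \<in> {1..n}. \<bar>real s - \<beta> * real n\<bar> \<le> real n powr (2/3)}"

definition far :: "real \<Rightarrow> nat \<Rightarrow> nat set" where
  "far \<epsilon> n = {s \<in> {1..n}. \<epsilon> * real n < real s} - near n"

text \<open>Up to sign, \<open>Y\<close> is sqrt n times the function of
  \<open>survival_away\<close> with \<open>h\<close> in place of \<open>c\<close>. The replacement
  costs sqrt n times C0 B/sqrt n, hence a constant.\<close>

lemma Y_lower:
  "\<forall>\<^sub>F n in sequentially. \<forall>s\<in>{1..n}.
     sqrt (real n) * (real s / real n * \<bar>real s / real n - \<beta>\<bar> / 4) - C0 * B \<le> \<bar>Y n s\<bar>"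
  using ev_basic
proof eventually_elim
  case (elim n)
  show ?case
  proof
    fix s assume s: "s \<in> {1..n}"
    define \<sigma> where "\<sigma> = real s / real n"
    have n: "real n > 0" using elim by auto
    have \<sigma>: "0 \<le> \<sigma>" "\<sigma> \<le> 1" using s by (auto simp: \<sigma>_def)
    have "\<bar>exp (h n * \<sigma>) - exp (c * \<sigma>)\<bar> \<le> exp (c + 1) * \<bar>h n * \<sigma> - c * \<sigma>\<bar>"
    proof (rule abs_exp_diff_le)
      show "h n * \<sigma> \<le> c + 1" using mult_mono[of "h n" "c + 1" \<sigma> 1] elim \<sigma> c by simp
      show "c * \<sigma> \<le> c + 1" using mult_left_mono[of \<sigma> 1 c] \<sigma> c by linarith
    qed
    also have "\<bar>h n * \<sigma> - c * \<sigma>\<bar> = \<bar>h n - c\<bar> * \<sigma>"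
      using \<sigma> by (simp add: abs_mult flip: left_diff_distrib)
    also have "exp (c + 1) * (\<bar>h n - c\<bar> * \<sigma>) \<le> B * (C0 / sqrt (real n) * 1)"
      unfolding B_def using elim \<sigma> by (intro mult_left_mono mult_mono) auto
    finally have 1: "\<bar>exp (h n * \<sigma>) - exp (c * \<sigma>)\<bar> \<le> B * C0 / sqrt (real n)" by simp
    have "\<bar>(1 - \<sigma>) * (exp (h n * \<sigma>) - exp (c * \<sigma>))\<bar> \<le> 1 * (B * C0 / sqrt (real n))"
      unfolding abs_mult using \<sigma> 1 by (intro mult_mono) auto
    moreover have "\<sigma> * \<bar>\<sigma> - \<beta>\<bar> / 4 \<le> \<bar>(1 - \<sigma>) * exp (c * \<sigma>) - 1\<bar>"
      by (rule survival_away[OF \<beta> \<sigma>])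
    moreover have "(1 - \<sigma>) * exp (c * \<sigma>) - 1 =
        ((1 - \<sigma>) * exp (h n * \<sigma>) - 1) - (1 - \<sigma>) * (exp (h n * \<sigma>) - exp (c * \<sigma>))"
      by (simp add: algebra_simps)
    then have "\<bar>(1 - \<sigma>) * exp (c * \<sigma>) - 1\<bar> \<le> \<bar>(1 - \<sigma>) * exp (h n * \<sigma>) - 1\<bar> +
        \<bar>(1 - \<sigma>) * (exp (h n * \<sigma>) - exp (c * \<sigma>))\<bar>"
      using abs_triangle_ineq4[of "(1 - \<sigma>) * exp (h n * \<sigma>) - 1"
          "(1 - \<sigma>) * (exp (h n * \<sigma>) - exp (c * \<sigma>))"] by simp
    ultimately have "\<sigma> * \<bar>\<sigma> - \<beta>\<bar> / 4 - B * C0 / sqrt (real n) \<le> \<bar>(1 - \<sigma>) * exp (h n * \<sigma>) - 1\<bar>"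
      by linarith
    then have "sqrt (real n) * (\<sigma> * \<bar>\<sigma> - \<beta>\<bar> / 4 - B * C0 / sqrt (real n)) \<le>
        sqrt (real n) * \<bar>(1 - \<sigma>) * exp (h n * \<sigma>) - 1\<bar>" by (intro mult_left_mono) auto
    also have "\<dots> = \<bar>sqrt (real n) * (1 - (1 - \<sigma>) * exp (h n * \<sigma>))\<bar>"
      by (simp add: abs_mult abs_minus_commute)
    also have "sqrt (real n) * (1 - (1 - \<sigma>) * exp (h n * \<sigma>)) = Y n s"
    proof -
      have "Y n s = real n / sqrt (real n) * (1 - (1 - \<sigma>) * exp (h n * \<sigma>))"
        using n by (simp add: Y_def \<sigma>_def field_simps)
      then show ?thesis by (simp add: real_div_sqrt)
    qed
    finally show "sqrt (real n) * (real s / real n * \<bar>real s / real n - \<beta>\<bar> / 4) - C0 * B \<le> \<bar>Y n s\<bar>"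
      using n by (simp add: \<sigma>_def right_diff_distrib mult.commute)
  qed
qed

text \<open>On these sizes |Y| tends to infinity, and exp |Y| \<le> exp Y + exp (-Y) has bounded
  mean, so Markov's inequality applies.\<close>

lemma far_negligible:
  assumes \<epsilon>: "0 < \<epsilon>"
  shows "(\<lambda>n. \<Sum>s\<in>far \<epsilon> n. w n s) \<longlonglongrightarrow> 0"
proof -
  obtain D1 where D1: "D1 > 0" "\<forall>\<^sub>F n in sequentially. (\<Sum>s=1..n. w n s * exp (1 * Y n s)) \<le> D1"
    using exp_Y_bounded by blast
  obtain D2 where D2: "D2 > 0" "\<forall>\<^sub>F n in sequentially. (\<Sum>s=1..n. w n s * exp (- 1 * Y n s)) \<le> D2"
    using exp_Y_bounded by blast
  \<comment> \<open>The product sqrt n n^(2/3)/n is n^(1/6); its divergence is where the window has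
    to be wider than sqrt n.\<close>
  define b where "b n = exp (C0 * B - \<epsilon> / 4 * (sqrt (real n) * (real n powr (2/3) / real n)))" for n
  show ?thesis
  proof (rule tendsto_sandwich)
    show "\<forall>\<^sub>F n in sequentially. 0 \<le> (\<Sum>s\<in>far \<epsilon> n. w n s)"
      using ev_basic by eventually_elim (auto intro!: sum_nonneg cluster_law_nonneg simp: far_def)
    show "\<forall>\<^sub>F n in sequentially. (\<Sum>s\<in>far \<epsilon> n. w n s) \<le> (D1 + D2) * b n"
      using D1(2) D2(2) Y_lower ev_basic
    proof eventually_elim
      case (elim n)
      have w: "0 \<le> w n s" if "s \<in> {1..n}" for s using cluster_law_nonneg elim that by blast
      have n: "real n > 0" using elim by auto
      have "(\<Sum>s\<in>far \<epsilon> n. w n s) \<le> (\<Sum>s\<in>far \<epsilon> n. (w n s * exp (1 * Y n s) + w n s * exp (- 1 * Y n s)) * b n)"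
      proof (intro sum_mono)
        fix s assume s: "s \<in> far \<epsilon> n"
        then have s1: "s \<in> {1..n}" "\<epsilon> * real n < real s" "real n powr (2/3) \<le> \<bar>real s - \<beta> * real n\<bar>"
          by (auto simp: far_def near_def)
        have "\<epsilon> \<le> real s / real n" using s1 n by (simp add: field_simps)
        moreover have "real n powr (2/3) / real n \<le> \<bar>real s / real n - \<beta>\<bar>"
        proof -
          have "real s / real n - \<beta> = (real s - \<beta> * real n) / real n"
            using n by (simp add: diff_divide_distrib)
          then have "\<bar>real s / real n - \<beta>\<bar> = \<bar>real s - \<beta> * real n\<bar> / real n"
            by (simp only: abs_divide abs_of_nat)
          then show ?thesis using s1 n by (simp add: divide_right_mono)
        qed
        ultimately have "\<epsilon> * (real n powr (2/3) / real n) \<le> real s / real n * \<bar>real s / real n - \<beta>\<bar>"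
          using \<epsilon> by (intro mult_mono) auto
        then have "sqrt (real n) * (\<epsilon> * (real n powr (2/3) / real n)) \<le>
            sqrt (real n) * (real s / real n * \<bar>real s / real n - \<beta>\<bar>)" by (intro mult_left_mono) auto
        moreover have "sqrt (real n) * (real s / real n * \<bar>real s / real n - \<beta>\<bar> / 4) - C0 * B \<le> \<bar>Y n s\<bar>"
          using elim s1 by blast
        moreover have "0 \<le> y + (C0 * B - \<epsilon> / 4 * (r * t))"
          if "r * (\<epsilon> * t) \<le> r * (q * d)" "r * (q * d / 4) - C0 * B \<le> y" for r t q d y :: real
        proof -
          have "\<epsilon> / 4 * (r * t) = r * (\<epsilon> * t) / 4" "r * (q * d / 4) = r * (q * d) / 4" by simp_all
          then show ?thesis using that by linarith
        qed
        ultimately have "0 \<le> \<bar>Y n s\<bar> + (C0 * B - \<epsilon> / 4 * (sqrt (real n) * (real n powr (2/3) / real n)))"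
          by blast
        then have "1 \<le> exp (\<bar>Y n s\<bar> + (C0 * B - \<epsilon> / 4 * (sqrt (real n) * (real n powr (2/3) / real n))))"
          by simp
        also have "\<dots> = exp \<bar>Y n s\<bar> * b n" unfolding b_def by (rule exp_add)
        also have "\<dots> \<le> (exp (1 * Y n s) + exp (- 1 * Y n s)) * b n"
          by (intro mult_right_mono) (auto simp: abs_if b_def)
        finally have "w n s * 1 \<le> w n s * ((exp (1 * Y n s) + exp (- 1 * Y n s)) * b n)"
          using w s1 by (intro mult_left_mono) auto
        then show "w n s \<le> (w n s * exp (1 * Y n s) + w n s * exp (- 1 * Y n s)) * b n"
          by (simp add: algebra_simps)
      qed
      also have "\<dots> \<le> (\<Sum>s=1..n. (w n s * exp (1 * Y n s) + w n s * exp (- 1 * Y n s)) * b n)"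
        using w by (intro sum_mono2) (auto simp: far_def b_def)
      also have "\<dots> = ((\<Sum>s=1..n. w n s * exp (1 * Y n s)) + (\<Sum>s=1..n. w n s * exp (- 1 * Y n s))) * b n"
        unfolding sum_distrib_right[symmetric] sum.distrib ..
      also have "\<dots> \<le> (D1 + D2) * b n" using elim by (intro mult_right_mono) (auto simp: b_def)
      finally show ?case .
    qed
    have "b \<longlonglongrightarrow> 0" unfolding b_def using \<epsilon> by real_asymp
    then show "(\<lambda>n. (D1 + D2) * b n) \<longlonglongrightarrow> 0" by (rule tendsto_mult_right_zero)
  qed simp
qed

end

section \<open>Intermediate cluster sizes and the mass of small ones\<close>

context supercritical
begin

text \<open>The threshold must diverge, to make \<open>mid\<close> negligible, but remain o(sqrt n),
  so that s/sqrt n and s^2/n vanish. With exponent 1/4 all errors are at most n^(-1/4); see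
  \<open>tiny_scale\<close>.\<close>

definition tiny :: "nat \<Rightarrow> nat set" where
  "tiny n = {s \<in> {1..n}. real s \<le> real n powr (1/4)}"

definition mid :: "real \<Rightarrow> nat \<Rightarrow> nat set" where
  "mid \<epsilon> n = {s \<in> {1..n}. real n powr (1/4) < real s \<and> real s \<le> \<epsilon> * real n}"

text \<open>At a fixed x = -z the integrand exceeds (1 + z)^n exp (\<kappa> s) for all sizes up to
  \<epsilon> n, whereas the whole sum is (1 + z)^(n-1). Hence sizes above n^(1/4) in this range have
  probability at most exp (-\<kappa> n^(1/4)). Supercriticality gives the tangent of
  \<open>ln_exp_lower\<close> the slope needed.\<close>

lemma mid_negligible: "\<exists>\<epsilon>>0. \<epsilon> \<le> \<beta> / 2 \<and> (\<lambda>n. \<Sum>s\<in>mid \<epsilon> n. w n s) \<longlonglongrightarrow> 0"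
proof -
  \<comment> \<open>As c = 1 + 2 z, the quantity b c = z + z b exceeds ln (1 + z) \<le> z by at
    least z b. Of this surplus \<epsilon> uses one half, \<open>h\<close> in place of
    \<open>c\<close> one quarter, and the last quarter is \<kappa>.\<close>
  define z where "z = (c - 1) / 2"
  define b where "b = z / (1 + z)"
  define \<epsilon> where "\<epsilon> = min (\<beta> / 2) (z / (2 * c))"
  define \<kappa> where "\<kappa> = z * b / 4"
  have z: "z > 0" and cz: "c = 1 + 2 * z" using c by (simp_all add: z_def field_simps)
  have b: "0 < b" "b \<le> 1" using z by (simp_all add: b_def)
  have \<epsilon>: "0 < \<epsilon>" "\<epsilon> \<le> \<beta> / 2" "\<epsilon> \<le> z / (2 * c)" using \<beta>(1) z c by (simp_all add: \<epsilon>_def)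
  have \<kappa>: "\<kappa> > 0" using z b by (simp add: \<kappa>_def)
  have bc: "z + 2 * \<kappa> \<le> b * c * (1 - \<epsilon>)"
  proof -
    have "b * c = z + z * b" using z by (simp add: b_def cz field_simps)
    moreover have "b * c * \<epsilon> \<le> b * c * (z / (2 * c))" using \<epsilon> b c by (intro mult_left_mono) auto
    moreover have "b * c * (z / (2 * c)) = z * b / 2" using c by simp
    moreover have "b * c * (1 - \<epsilon>) = b * c - b * c * \<epsilon>" by (simp add: algebra_simps)
    ultimately show ?thesis unfolding \<kappa>_def by linarith
  qed
  have "(\<lambda>n. C0 / sqrt (real n)) \<longlonglongrightarrow> 0" by real_asymp
  then have ev: "\<forall>\<^sub>F n in sequentially. C0 / sqrt (real n) < \<kappa>"
    by (rule order_tendstoD) (rule \<kappa>)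
  have "(\<lambda>n. \<Sum>s\<in>mid \<epsilon> n. w n s) \<longlonglongrightarrow> 0"
  proof (rule tendsto_sandwich)
    show "\<forall>\<^sub>F n in sequentially. 0 \<le> (\<Sum>s\<in>mid \<epsilon> n. w n s)"
      using ev_basic by eventually_elim (auto intro!: sum_nonneg cluster_law_nonneg simp: mid_def)
    show "\<forall>\<^sub>F n in sequentially. (\<Sum>s\<in>mid \<epsilon> n. w n s) \<le> exp (- \<kappa> * real n powr (1/4))"
      using ev ev_basic
    proof eventually_elim
      case (elim n)
      have w: "0 \<le> w n s" if "s \<in> {1..n}" for s using cluster_law_nonneg elim that by blast
      have n: "real n > 0" using elim by auto
      have h0: "0 \<le> h n" using elim by linarith
      have hb: "z + \<kappa> \<le> b * h n * (1 - \<epsilon>)"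
      proof -
        have e1: "0 \<le> 1 - \<epsilon>" "1 - \<epsilon> \<le> 1" using \<epsilon> \<beta>(2) by auto
        have "b * (1 - \<epsilon>) * (c - h n) \<le> b * (1 - \<epsilon>) * \<kappa>"
          using elim b e1 by (intro mult_left_mono) auto
        also have "\<dots> \<le> 1 * \<kappa>" using b e1 \<kappa> by (intro mult_right_mono mult_le_one) auto
        finally show ?thesis using bc by (simp add: algebra_simps)
      qed
      let ?E = "exp (\<kappa> * real n powr (1/4))"
      have pt: "(1 + z) ^ n * ?E \<le> (1 + z * exp (h n * real s / real n)) ^ (n - s)" if s: "s \<in> mid \<epsilon> n" for s
      proof -
        define \<sigma> where "\<sigma> = real s / real n"
        have s1: "s \<in> {1..n}" "real n powr (1/4) < real s" "\<sigma> \<le> \<epsilon>" "0 \<le> \<sigma>"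
          using s n by (auto simp: mid_def \<sigma>_def field_simps)
        have ns: "real (n - s) = real n * (1 - \<sigma>)" using s1 n by (simp add: \<sigma>_def of_nat_diff field_simps)
        have "z + \<kappa> \<le> b * h n * (1 - \<epsilon>)" by (rule hb)
        also have "\<dots> \<le> b * h n * (1 - \<sigma>)" using s1 b h0 by (intro mult_left_mono) auto
        finally have k: "\<kappa> \<le> b * h n * (1 - \<sigma>) - ln (1 + z)"
          using ln_add_one_self_le_self[of z] z by linarith
        have "real n * ln (1 + z) + \<kappa> * real n powr (1/4) \<le> real n * ln (1 + z) + \<kappa> * real s"
          using s1 \<kappa> by simp
        also have "\<dots> \<le> real n * ln (1 + z) + (b * h n * (1 - \<sigma>) - ln (1 + z)) * real s"
          using k by (intro add_left_mono mult_right_mono) auto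
        also have "\<dots> = real (n - s) * (ln (1 + z) + b * (h n * \<sigma>))"
          unfolding ns using n by (simp add: \<sigma>_def field_simps)
        also have "\<dots> \<le> real (n - s) * ln (1 + z * exp (h n * \<sigma>))"
          unfolding b_def by (intro mult_left_mono ln_exp_lower[OF z]) auto
        finally have "exp (real n * ln (1 + z) + \<kappa> * real n powr (1/4)) \<le>
            exp (real (n - s) * ln (1 + z * exp (h n * \<sigma>)))" by simp
        moreover have "0 < 1 + z * exp (h n * \<sigma>)" using z by (simp add: add_pos_pos)
        ultimately show ?thesis using z by (simp add: exp_add power_of_ln \<sigma>_def)
      qed
      have "(1 + z) ^ n * ?E * (\<Sum>s\<in>mid \<epsilon> n. w n s) = (\<Sum>s\<in>mid \<epsilon> n. w n s * ((1 + z) ^ n * ?E))"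
        by (subst sum_distrib_right[symmetric]) (rule mult.commute)
      also have "\<dots> \<le> (\<Sum>s\<in>mid \<epsilon> n. w n s * (1 + z * exp (h n * real s / real n)) ^ (n - s))"
        using w by (intro sum_mono mult_left_mono pt) (auto simp: mid_def)
      also have "\<dots> \<le> (\<Sum>s=1..n. w n s * (1 + z * exp (h n * real s / real n)) ^ (n - s))"
        using w z by (intro sum_mono2) (auto simp: mid_def intro!: mult_nonneg_nonneg add_nonneg_nonneg)
      also have "\<dots> = (1 + z) ^ (n - 1)" using cluster_law_identity[of n "h n" "w n" "- z"] elim by simp
      also have "\<dots> \<le> (1 + z) ^ n" using z by (intro power_increasing) auto
      finally have "(1 + z) ^ n * (?E * (\<Sum>s\<in>mid \<epsilon> n. w n s)) \<le> (1 + z) ^ n * 1" by (simp add: mult.assoc)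
      then have "?E * (\<Sum>s\<in>mid \<epsilon> n. w n s) \<le> 1" using z by (subst (asm) mult_le_cancel_left_pos) auto
      then show ?case by (simp add: exp_minus field_simps)
    qed
    show "(\<lambda>n. exp (- \<kappa> * real n powr (1/4))) \<longlonglongrightarrow> 0" using \<kappa> by real_asymp
  qed simp
  then show ?thesis using \<epsilon> by blast
qed

lemma fourth_root:
  assumes "n \<ge> 1"
  defines "t \<equiv> real n powr (1/4)"
  shows "1 \<le> t" "sqrt (real n) = t\<^sup>2" "real n = t ^ 4"
proof -
  show "1 \<le> t" using assms by (simp add: t_def ge_one_powr_ge_zero)
  have "t\<^sup>2 = real n powr (1/2)" unfolding t_def using assms by (simp add: powr_power)
  then show "sqrt (real n) = t\<^sup>2" using assms by (simp add: powr_half_sqrt)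
  show "real n = t ^ 4" unfolding t_def using assms by (simp add: powr_power)
qed

lemma tiny_scale:
  assumes "n \<ge> 1" "s \<in> tiny n"
  defines "t \<equiv> real n powr (1/4)"
  shows "real s / sqrt (real n) \<le> 1 / t" "(real s)\<^sup>2 / real n \<le> 1 / t" "real s / real n \<le> 1 / t"
    "1 / sqrt (real n) \<le> 1 / t"
proof -
  note r = fourth_root[OF assms(1), folded t_def]
  have s: "real s \<le> t" using assms by (simp add: tiny_def t_def)
  have t1: "t ^ 1 \<le> t ^ 2" "t ^ 2 \<le> t ^ 3" using r(1) by (intro power_increasing; simp)+
  have t: "t > 0" using r by linarith
  have "real s / t\<^sup>2 \<le> t / t\<^sup>2" using s t by (intro divide_right_mono) auto
  then show "real s / sqrt (real n) \<le> 1 / t" unfolding r(2) using t by (simp add: power2_eq_square)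
  have "(real s)\<^sup>2 \<le> t\<^sup>2" using s t by (intro power_mono) auto
  then have "(real s)\<^sup>2 / t ^ 4 \<le> t\<^sup>2 / t ^ 4" using t by (intro divide_right_mono) auto
  also have "\<dots> = 1 / t\<^sup>2" using t by (simp add: power2_eq_square power4_eq_xxxx)
  also have "\<dots> \<le> 1 / t" using t t1 by (intro divide_left_mono) auto
  finally show "(real s)\<^sup>2 / real n \<le> 1 / t" unfolding r(3) .
  have "real s / t ^ 4 \<le> t / t ^ 4" using s t by (intro divide_right_mono) auto
  also have "\<dots> = 1 / t ^ 3" using t by (simp add: power3_eq_cube power4_eq_xxxx)
  also have "\<dots> \<le> 1 / t" using t t1 by (intro divide_left_mono) auto
  finally show "real s / real n \<le> 1 / t" unfolding r(3) .
  show "1 / sqrt (real n) \<le> 1 / t" unfolding r(2) using t t1 by (intro divide_left_mono) auto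
qed

lemma \<beta>_exp: "exp (c * \<beta>) * (1 - \<beta>) = 1" "exp (\<beta> * c) * (1 - \<beta>) = 1"
  unfolding \<beta>(3) by (simp_all flip: exp_add)

lemma cover:
  assumes \<epsilon>: "0 < \<epsilon>" "\<epsilon> \<le> \<beta> / 2"
  shows "\<forall>\<^sub>F n in sequentially. \<forall>f :: nat \<Rightarrow> real. (\<Sum>s=1..n. f s) =
    (\<Sum>s\<in>tiny n. f s) + (\<Sum>s\<in>mid \<epsilon> n. f s) + (\<Sum>s\<in>far \<epsilon> n. f s) + (\<Sum>s\<in>near n. f s)"
proof -
  have "\<forall>\<^sub>F n in sequentially. real n powr (1/4) < \<epsilon> * real n" using \<epsilon>(1) by real_asymp
  moreover have "\<forall>\<^sub>F n in sequentially. real n powr (2/3) < \<beta> / 2 * real n" using \<beta>(1) by real_asymp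
  ultimately show ?thesis
  proof eventually_elim
    case (elim n)
    have near: "\<epsilon> * real n < real s" if "s \<in> near n" for s
    proof -
      have "\<epsilon> * real n \<le> \<beta> / 2 * real n" using \<epsilon> by (intro mult_right_mono) auto
      moreover have "\<beta> * real n - real s \<le> real n powr (2/3)" using that by (auto simp: near_def abs_le_iff)
      moreover have "\<beta> * real n = \<beta> / 2 * real n + \<beta> / 2 * real n" by simp
      ultimately show ?thesis using elim by linarith
    qed
    have far: "\<epsilon> * real n < real s" if "s \<in> far \<epsilon> n" for s using that by (simp add: far_def)
    have 1: "{1..n} = ((tiny n \<union> mid \<epsilon> n) \<union> far \<epsilon> n) \<union> near n"
      unfolding tiny_def mid_def far_def by (auto simp: near_def)
    have 2: "((tiny n \<union> mid \<epsilon> n) \<union> far \<epsilon> n) \<inter> near n = {}"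
      using near elim by (fastforce simp: tiny_def mid_def far_def)
    have 3: "(tiny n \<union> mid \<epsilon> n) \<inter> far \<epsilon> n = {}"
      using far elim by (fastforce simp: tiny_def mid_def)
    have 4: "tiny n \<inter> mid \<epsilon> n = {}" by (auto simp: tiny_def mid_def)
    have fin: "finite (tiny n)" "finite (mid \<epsilon> n)" "finite (far \<epsilon> n)" "finite (near n)"
      by (auto simp: tiny_def mid_def far_def near_def)
    show ?case
      unfolding 1 using fin 2 3 4 by (simp add: sum.union_disjoint)
  qed
qed

text \<open>For the \<open>z\<close> below, the normalised integrand \<open>\<rho>\<close> has total
  1 - \<beta>, is near 1 on small sizes, bounded on intermediate ones, and exponentially small from
  \<epsilon> n on. The small sizes therefore account for the whole total.\<close>

lemma tiny_mass: "(\<lambda>n. \<Sum>s\<in>tiny n. w n s) \<longlonglongrightarrow> 1 - \<beta>"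
proof -
  obtain \<epsilon> where \<epsilon>: "0 < \<epsilon>" "\<epsilon> \<le> \<beta> / 2" and mid0: "(\<lambda>n. \<Sum>s\<in>mid \<epsilon> n. w n s) \<longlonglongrightarrow> 0"
    using mid_negligible by blast
  \<comment> \<open>Chosen so that z/(1 + z) = \<beta> and ln (1 + z) = c \<beta>. The linear term
    \<sigma> (h z/(1 + z) - ln (1 + z)) becomes \<sigma> \<beta> (h - c), which cancels in the
    limit.\<close>
  define z where "z = \<beta> / (1 - \<beta>)"
  have z: "z > 0" using \<beta>(1,2) by (simp add: z_def)
  have z1: "1 + z = 1 / (1 - \<beta>)" "z / (1 + z) = \<beta>" using \<beta>(1,2) by (simp_all add: z_def field_simps)
  have lnz: "ln (1 + z) = c * \<beta>"
  proof -
    have "1 + z = exp (c * \<beta>)" using \<beta>_exp(1) \<beta>(1,2) unfolding z1 by (simp add: field_simps)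
    then show ?thesis by simp
  qed
  define \<rho> where "\<rho> n s = (1 + z * exp (h n * real s / real n)) ^ (n - s) / (1 + z) ^ n" for n s
  have C0: "C0 > 0" by (simp add: C0_def)
  \<comment> \<open>The assumption of \<open>ln_exp_upper\<close>; as 1 + z = 1/(1 - \<beta>), it is
    eventually ensured by \<open>dual_subcritical\<close>.\<close>
  have h_small: "\<forall>\<^sub>F n in sequentially. h n \<le> 1 + z"
  proof -
    have "c < 1 + z" using dual_subcritical[OF \<beta>] \<beta>(1,2) unfolding z1 by (simp add: field_simps)
    then have "0 < 1 + z - c" by simp
    moreover have "(\<lambda>n. C0 / sqrt (real n)) \<longlonglongrightarrow> 0" by real_asymp
    ultimately have "\<forall>\<^sub>F n in sequentially. C0 / sqrt (real n) < 1 + z - c"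
      by (intro order_tendstoD(2))
    then show ?thesis using ev_basic by eventually_elim linarith
  qed
  have \<rho>_ln: "\<rho> n s = exp (real (n - s) * ln (1 + z * exp (h n * (real s / real n))) - real n * ln (1 + z))" for n s
  proof -
    have "0 < 1 + z * exp (h n * (real s / real n))" using z by (simp add: add_pos_pos)
    then show ?thesis using z by (simp add: \<rho>_def power_of_ln exp_diff)
  qed
  have upper: "\<forall>\<^sub>F n in sequentially. \<forall>s\<in>{1..n}.
      \<rho> n s \<le> exp (\<beta> * C0 * (real s / sqrt (real n)) - \<beta> / 2 * ((real s)\<^sup>2 / real n))"
    using ev_basic h_small
  proof eventually_elim
    case (elim n)
    show ?case
    proof
      fix s assume s: "s \<in> {1..n}"
      define \<sigma> where "\<sigma> = real s / real n"
      have n: "real n > 0" using elim by auto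
      have \<sigma>: "0 \<le> \<sigma>" "\<sigma> \<le> 1" using s by (auto simp: \<sigma>_def)
      have ns: "real (n - s) = real n * (1 - \<sigma>)" using s n by (simp add: \<sigma>_def of_nat_diff field_simps)
      have "(1 - \<sigma>) * ln (1 + z * exp (h n * \<sigma>)) \<le>
          ln (1 + z) + \<sigma> * (h n * (z / (1 + z)) - ln (1 + z)) - h n * (z / (1 + z)) / 2 * \<sigma>\<^sup>2"
        using elim \<sigma> by (intro ln_exp_upper[OF z]) auto
      also have "\<dots> \<le> ln (1 + z) + \<sigma> * (\<beta> * (C0 / sqrt (real n))) - \<beta> / 2 * \<sigma>\<^sup>2"
      proof -
        have "h n - c \<le> C0 / sqrt (real n)" using elim by linarith
        then have "\<beta> * (h n - c) \<le> \<beta> * (C0 / sqrt (real n))" using \<beta>(1) by (intro mult_left_mono) auto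
        then have "\<sigma> * (h n * \<beta> - c * \<beta>) \<le> \<sigma> * (\<beta> * (C0 / sqrt (real n)))"
          using \<sigma> by (intro mult_left_mono) (auto simp: algebra_simps)
        moreover have "1 * (\<beta> / 2 * \<sigma>\<^sup>2) \<le> h n * (\<beta> / 2 * \<sigma>\<^sup>2)"
          using elim \<beta>(1) by (intro mult_right_mono) auto
        ultimately show ?thesis unfolding z1(2) lnz by (simp add: mult_ac)
      qed
      finally have "real n * ((1 - \<sigma>) * ln (1 + z * exp (h n * \<sigma>))) \<le>
          real n * (ln (1 + z) + \<sigma> * (\<beta> * (C0 / sqrt (real n))) - \<beta> / 2 * \<sigma>\<^sup>2)"
        by (intro mult_left_mono) auto
      also have "\<dots> = real n * ln (1 + z) + (\<beta> * C0 * (real s / sqrt (real n)) - \<beta> / 2 * ((real s)\<^sup>2 / real n))"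
        using n by (simp add: \<sigma>_def power2_eq_square distrib_left right_diff_distrib)
      finally show "\<rho> n s \<le> exp (\<beta> * C0 * (real s / sqrt (real n)) - \<beta> / 2 * ((real s)\<^sup>2 / real n))"
        unfolding \<rho>_ln exp_le_cancel_iff ns \<sigma>_def[symmetric] by (simp add: mult.assoc)
    qed
  qed
  have lower: "\<forall>\<^sub>F n in sequentially. \<forall>s\<in>{1..n}.
      exp (- (\<beta> * C0 * (real s / sqrt (real n)) + \<beta> * (c + 1) * ((real s)\<^sup>2 / real n))) \<le> \<rho> n s"
    using ev_basic
  proof eventually_elim
    case (elim n)
    show ?case
    proof
      fix s assume s: "s \<in> {1..n}"
      define \<sigma> where "\<sigma> = real s / real n"
      have n: "real n > 0" using elim by auto
      have \<sigma>: "0 \<le> \<sigma>" "\<sigma> \<le> 1" using s by (auto simp: \<sigma>_def)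
      have ns: "real (n - s) = real n * (1 - \<sigma>)" using s n by (simp add: \<sigma>_def of_nat_diff field_simps)
      have "- (C0 / sqrt (real n)) \<le> h n - c" using elim by linarith
      then have 1: "\<beta> * real s * - (C0 / sqrt (real n)) \<le> \<beta> * real s * (h n - c)"
        using \<beta>(1) by (intro mult_left_mono) auto
      have 2: "\<beta> * ((real s)\<^sup>2 / real n) * h n \<le> \<beta> * ((real s)\<^sup>2 / real n) * (c + 1)"
        using elim \<beta>(1) by (intro mult_left_mono) auto
      have "- (\<beta> * C0 * (real s / sqrt (real n)) + \<beta> * (c + 1) * ((real s)\<^sup>2 / real n)) \<le>
          \<beta> * real s * (h n - c) - \<beta> * ((real s)\<^sup>2 / real n) * h n"
        using 1 2 by (simp add: mult_ac)
      also have "\<dots> = real (n - s) * (ln (1 + z) + z / (1 + z) * (h n * \<sigma>)) - real n * ln (1 + z)"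
        unfolding z1(2) lnz ns using n by (simp add: \<sigma>_def field_simps power2_eq_square)
      also have "\<dots> \<le> real (n - s) * ln (1 + z * exp (h n * \<sigma>)) - real n * ln (1 + z)"
        by (intro diff_mono mult_left_mono ln_exp_lower[OF z]) auto
      finally show "exp (- (\<beta> * C0 * (real s / sqrt (real n)) + \<beta> * (c + 1) * ((real s)\<^sup>2 / real n))) \<le> \<rho> n s"
        unfolding \<rho>_ln exp_le_cancel_iff \<sigma>_def .
    qed
  qed
  have total: "\<forall>\<^sub>F n in sequentially. (\<Sum>s=1..n. w n s * \<rho> n s) = 1 - \<beta>"
    using ev_basic
  proof eventually_elim
    case (elim n)
    have "(\<Sum>s=1..n. w n s * \<rho> n s) = (1 + z) ^ (n - 1) / (1 + z) ^ n"
      using cluster_law_identity[of n "h n" "w n" "- z"] elim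
      by (simp add: \<rho>_def flip: sum_divide_distrib)
    also have "(1 + z) ^ n = (1 + z) ^ (n - 1) * (1 + z)"
      using elim by (metis le_add_diff_inverse2 power_add power_one_right)
    also have "(1 + z) ^ (n - 1) / ((1 + z) ^ (n - 1) * (1 + z)) = 1 / (1 + z)" using z by simp
    also have "\<dots> = 1 - \<beta>" unfolding z1 by simp
    finally show ?case .
  qed
  have \<rho>0: "0 \<le> \<rho> n s" for n s unfolding \<rho>_ln by simp
  have S2: "(\<lambda>n. \<Sum>s\<in>mid \<epsilon> n. w n s * \<rho> n s) \<longlonglongrightarrow> 0"
  proof (rule tendsto_sandwich)
    show "\<forall>\<^sub>F n in sequentially. 0 \<le> (\<Sum>s\<in>mid \<epsilon> n. w n s * \<rho> n s)"
      using ev_basic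
    proof eventually_elim
      case (elim n)
      then have "0 \<le> w n s" if "s \<in> {1..n}" for s using cluster_law_nonneg that by blast
      then show ?case by (intro sum_nonneg mult_nonneg_nonneg \<rho>0) (simp add: mid_def)
    qed
    show "\<forall>\<^sub>F n in sequentially. (\<Sum>s\<in>mid \<epsilon> n. w n s * \<rho> n s) \<le> (\<Sum>s\<in>mid \<epsilon> n. w n s) * exp (\<beta> * C0\<^sup>2 / 2)"
      using ev_basic upper
    proof eventually_elim
      case (elim n)
      have "\<rho> n s \<le> exp (\<beta> * C0\<^sup>2 / 2)" if "s \<in> {1..n}" for s
      proof -
        have "\<rho> n s \<le> exp (\<beta> * C0 * (real s / sqrt (real n)) - \<beta> / 2 * ((real s)\<^sup>2 / real n))"
          using elim that by blast
        \<comment> \<open>The square bounds the exponent uniformly in \<open>s\<close>, although its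
          linear and quadratic parts are both unbounded.\<close>
        also have "\<beta> * C0 * (real s / sqrt (real n)) - \<beta> / 2 * ((real s)\<^sup>2 / real n) =
            \<beta> * C0\<^sup>2 / 2 - \<beta> / 2 * (C0 - real s / sqrt (real n))\<^sup>2"
          by (simp add: power2_diff power_divide algebra_simps)
        also have "\<dots> \<le> \<beta> * C0\<^sup>2 / 2" using \<beta>(1) by simp
        finally show ?thesis by simp
      qed
      then have "(\<Sum>s\<in>mid \<epsilon> n. w n s * \<rho> n s) \<le> (\<Sum>s\<in>mid \<epsilon> n. w n s * exp (\<beta> * C0\<^sup>2 / 2))"
        using elim by (intro sum_mono mult_left_mono) (auto simp: mid_def cluster_law_nonneg)
      then show ?case by (simp add: sum_distrib_right)
    qed
    show "(\<lambda>n. (\<Sum>s\<in>mid \<epsilon> n. w n s) * exp (\<beta> * C0\<^sup>2 / 2)) \<longlonglongrightarrow> 0"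
      by (rule tendsto_mult_left_zero[OF mid0])
  qed simp
  \<comment> \<open>Beyond \<epsilon> n the quadratic term is of order \<open>n\<close> and beats
    the linear one of order sqrt n. This serves \<open>far\<close> and \<open>near\<close>
    alike.\<close>
  have big: "(\<lambda>n. \<Sum>s\<in>D n. w n s * \<rho> n s) \<longlonglongrightarrow> 0"
    if D: "\<And>n s. s \<in> D n \<Longrightarrow> s \<in> {1..n}" and
      Dev: "\<forall>\<^sub>F n in sequentially. \<forall>s\<in>D n. \<epsilon> * real n \<le> real s" for D
  proof (rule tendsto_sandwich)
    show "\<forall>\<^sub>F n in sequentially. 0 \<le> (\<Sum>s\<in>D n. w n s * \<rho> n s)"
      using ev_basic
    proof eventually_elim
      case (elim n)
      then have "0 \<le> w n s" if "s \<in> {1..n}" for s using cluster_law_nonneg that by blast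
      then show ?case by (intro sum_nonneg mult_nonneg_nonneg \<rho>0) (use D in blast)
    qed
    show "\<forall>\<^sub>F n in sequentially. (\<Sum>s\<in>D n. w n s * \<rho> n s) \<le> exp (\<beta> * C0 * sqrt (real n) - \<beta> / 2 * (\<epsilon>\<^sup>2 * real n))"
      using ev_basic upper Dev
    proof eventually_elim
      case (elim n)
      have n: "real n > 0" using elim by auto
      have w: "0 \<le> w n s" if "s \<in> {1..n}" for s using cluster_law_nonneg elim that by blast
      let ?E = "exp (\<beta> * C0 * sqrt (real n) - \<beta> / 2 * (\<epsilon>\<^sup>2 * real n))"
      have "\<rho> n s \<le> ?E" if s: "s \<in> D n" for s
      proof -
        have "\<rho> n s \<le> exp (\<beta> * C0 * (real s / sqrt (real n)) - \<beta> / 2 * ((real s)\<^sup>2 / real n))"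
          using elim D[OF s] by blast
        also have "\<dots> \<le> ?E"
        proof -
          have "real s / sqrt (real n) \<le> real n / sqrt (real n)"
            using D[OF s] by (intro divide_right_mono) auto
          then have 1: "\<beta> * C0 * (real s / sqrt (real n)) \<le> \<beta> * C0 * sqrt (real n)"
            using \<beta>(1) C0 by (intro mult_left_mono) (auto simp: real_div_sqrt)
          have "(\<epsilon> * real n)\<^sup>2 / real n \<le> (real s)\<^sup>2 / real n"
            using elim s \<epsilon> by (intro divide_right_mono power_mono) auto
          then have "\<epsilon>\<^sup>2 * real n \<le> (real s)\<^sup>2 / real n"
            using n by (simp add: power_mult_distrib power2_eq_square)
          then have "\<beta> / 2 * (\<epsilon>\<^sup>2 * real n) \<le> \<beta> / 2 * ((real s)\<^sup>2 / real n)"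
            using \<beta>(1) by (intro mult_left_mono) auto
          then show ?thesis using 1 by simp
        qed
        finally show ?thesis .
      qed
      then have "(\<Sum>s\<in>D n. w n s * \<rho> n s) \<le> (\<Sum>s\<in>D n. w n s * ?E)"
        using w D by (intro sum_mono mult_left_mono) blast+
      also have "\<dots> \<le> (\<Sum>s=1..n. w n s * ?E)"
        using w D by (intro sum_mono2) (auto intro!: mult_nonneg_nonneg)
      also have "\<dots> = ?E" using cluster_law_sum[of n "h n" "w n"] elim by (simp flip: sum_distrib_right)
      finally show ?case .
    qed
    show "(\<lambda>n. exp (\<beta> * C0 * sqrt (real n) - \<beta> / 2 * (\<epsilon>\<^sup>2 * real n))) \<longlonglongrightarrow> 0"
      using \<beta>(1) \<epsilon>(1) by real_asymp
  qed simp
  have S3: "(\<lambda>n. \<Sum>s\<in>far \<epsilon> n. w n s * \<rho> n s) \<longlonglongrightarrow> 0"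
    by (rule big) (auto simp: far_def)
  have S4: "(\<lambda>n. \<Sum>s\<in>near n. w n s * \<rho> n s) \<longlonglongrightarrow> 0"
  proof (rule big)
    have "\<forall>\<^sub>F n in sequentially. real n powr (2/3) < \<beta> / 2 * real n" using \<beta>(1) by real_asymp
    then show "\<forall>\<^sub>F n in sequentially. \<forall>s\<in>near n. \<epsilon> * real n \<le> real s"
    proof eventually_elim
      case (elim n)
      have "\<epsilon> * real n \<le> \<beta> / 2 * real n" using \<epsilon> by (intro mult_right_mono) auto
      moreover have "\<beta> * real n = \<beta> / 2 * real n + \<beta> / 2 * real n" by simp
      ultimately have 1: "\<epsilon> * real n \<le> \<beta> * real n - real n powr (2/3)" using elim by linarith
      show ?case
      proof
        fix s assume "s \<in> near n"
        then have "\<beta> * real n - real s \<le> real n powr (2/3)" by (simp add: near_def abs_le_iff)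
        then show "\<epsilon> * real n \<le> real s" using 1 by linarith
      qed
    qed
  qed (auto simp: near_def)
  have "(\<lambda>n. (1 - \<beta>) - (\<Sum>s\<in>mid \<epsilon> n. w n s * \<rho> n s) - (\<Sum>s\<in>far \<epsilon> n. w n s * \<rho> n s) -
      (\<Sum>s\<in>near n. w n s * \<rho> n s)) \<longlonglongrightarrow> (1 - \<beta>) - 0 - 0 - 0"
    by (intro tendsto_intros S2 S3 S4)
  then have S1: "(\<lambda>n. \<Sum>s\<in>tiny n. w n s * \<rho> n s) \<longlonglongrightarrow> (1 - \<beta>) - 0 - 0 - 0"
  proof (rule Lim_transform_eventually)
    show "\<forall>\<^sub>F n in sequentially. (1 - \<beta>) - (\<Sum>s\<in>mid \<epsilon> n. w n s * \<rho> n s) -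
      (\<Sum>s\<in>far \<epsilon> n. w n s * \<rho> n s) - (\<Sum>s\<in>near n. w n s * \<rho> n s) = (\<Sum>s\<in>tiny n. w n s * \<rho> n s)"
      using total cover[OF \<epsilon>]
    proof eventually_elim
      case (elim n)
      then show ?case using elim(2)[rule_format, of "\<lambda>s. w n s * \<rho> n s"] by linarith
    qed
  qed
  have "(\<lambda>n. \<Sum>s\<in>tiny n. w n s * 1) \<longlonglongrightarrow> (1 - \<beta>) - 0 - 0 - 0"
  proof (rule sum_squeeze[OF S1])
    show "(\<lambda>n. \<beta> * (C0 + c + 1) * (1 / real n powr (1/4))) \<longlonglongrightarrow> 0" by real_asymp
    show "\<forall>\<^sub>F n in sequentially. \<forall>s\<in>tiny n. 0 \<le> w n s \<and>
      \<rho> n s * exp (- (\<beta> * (C0 + c + 1) * (1 / real n powr (1/4)))) \<le> 1 \<and>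
      1 \<le> \<rho> n s * exp (\<beta> * (C0 + c + 1) * (1 / real n powr (1/4)))"
      using ev_basic upper lower
    proof eventually_elim
      case (elim n)
      show ?case
      proof
        fix s assume s: "s \<in> tiny n"
        then have s1: "s \<in> {1..n}" by (simp add: tiny_def)
        define T where "T = 1 / real n powr (1/4)"
        have t: "real s / sqrt (real n) \<le> T" "(real s)\<^sup>2 / real n \<le> T"
          using tiny_scale[of n s] elim s by (auto simp: T_def)
        have b1: "\<beta> * C0 * (real s / sqrt (real n)) \<le> \<beta> * C0 * T"
          using t \<beta>(1) C0 by (intro mult_left_mono) auto
        have b2: "\<beta> * (c + 1) * ((real s)\<^sup>2 / real n) \<le> \<beta> * (c + 1) * T"
          using t \<beta>(1) c by (intro mult_left_mono) auto
        have b3: "0 \<le> \<beta> / 2 * ((real s)\<^sup>2 / real n)" "0 \<le> \<beta> * (c + 1) * T"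
          using \<beta>(1) c by (auto simp: T_def)
        have eq: "\<beta> * (C0 + c + 1) * T = \<beta> * C0 * T + \<beta> * (c + 1) * T" by (simp add: algebra_simps)
        have "\<rho> n s \<le> exp (\<beta> * C0 * (real s / sqrt (real n)) - \<beta> / 2 * ((real s)\<^sup>2 / real n))"
          using elim s1 by blast
        also have "\<dots> \<le> exp (\<beta> * (C0 + c + 1) * T)"
          unfolding exp_le_cancel_iff eq using b1 b3 by linarith
        finally have u: "\<rho> n s \<le> exp (\<beta> * (C0 + c + 1) * T)" .
        have "exp (- (\<beta> * (C0 + c + 1) * T)) \<le>
            exp (- (\<beta> * C0 * (real s / sqrt (real n)) + \<beta> * (c + 1) * ((real s)\<^sup>2 / real n)))"
          unfolding exp_le_cancel_iff eq using b1 b2 by linarith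
        also have "\<dots> \<le> \<rho> n s" using elim s1 by blast
        finally have l: "exp (- (\<beta> * (C0 + c + 1) * T)) \<le> \<rho> n s" .
        define X where "X = \<beta> * (C0 + c + 1) * T"
        have X: "exp X * exp (- X) = 1" by (simp flip: exp_add)
        have "\<rho> n s * exp (- X) \<le> exp X * exp (- X)"
          by (rule mult_right_mono[OF u[folded X_def]]) simp
        moreover have "exp (- X) * exp X \<le> \<rho> n s * exp X"
          by (rule mult_right_mono[OF l[folded X_def]]) simp
        moreover have "0 \<le> w n s" using cluster_law_nonneg elim s1 by blast
        ultimately show "0 \<le> w n s \<and>
          \<rho> n s * exp (- (\<beta> * (C0 + c + 1) * (1 / real n powr (1/4)))) \<le> 1 \<and>
          1 \<le> \<rho> n s * exp (\<beta> * (C0 + c + 1) * (1 / real n powr (1/4)))"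
          unfolding T_def[symmetric] X_def[symmetric] using X by (simp add: mult.commute)
      qed
    qed
  qed
  then show ?thesis by simp
qed

end

section \<open>Gaussian exponential moments near \<beta> n\<close>

context supercritical
begin

text \<open>\<open>Y\<close>, \<open>V\<close> and the remainder vanish uniformly on
  \<open>tiny\<close>, so the weight tends to 1 for every \<mu>: small sizes do not feel the
  tilt.\<close>

lemma tiny_ratio: "(\<lambda>n. \<Sum>s\<in>tiny n. w n s * ratio \<mu> n s) \<longlonglongrightarrow> 1 - \<beta>"
proof -
  obtain C where C: "C > 0" "\<forall>\<^sub>F n in sequentially. 0 < 1 - \<mu> / sqrt (real n) \<and> (\<forall>s\<in>{1..n}. \<exists>r. \<bar>r\<bar> \<le> C / sqrt (real n) \<and>
     ratio \<mu> n s = exp (\<mu> * Y n s - \<mu>\<^sup>2 / 2 * V n s + r))" using ratio_expansion by blast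
  define Q where "Q = \<bar>\<mu>\<bar> * (B * (c + 2)) + \<mu>\<^sup>2 / 2 * (B\<^sup>2 * (2 * c + 3)) + C"
  have lim: "(\<lambda>n. \<Sum>s\<in>tiny n. w n s * 1) \<longlonglongrightarrow> 1 - \<beta>" using tiny_mass by simp
  show ?thesis
  proof (rule sum_squeeze[OF lim])
    show "(\<lambda>n. Q * (1 / real n powr (1/4))) \<longlonglongrightarrow> 0" by real_asymp
    show "\<forall>\<^sub>F n in sequentially. \<forall>s\<in>tiny n. 0 \<le> w n s \<and>
        1 * exp (- (Q * (1 / real n powr (1/4)))) \<le> ratio \<mu> n s \<and>
        ratio \<mu> n s \<le> 1 * exp (Q * (1 / real n powr (1/4)))"
      using ev_basic C(2)
    proof eventually_elim
      case (elim n)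
      show ?case
      proof
        fix s assume s: "s \<in> tiny n"
        then have s1: "s \<in> {1..n}" by (simp add: tiny_def)
        define T where "T = 1 / real n powr (1/4)"
        define \<sigma> where "\<sigma> = real s / real n"
        define u where "u = h n * \<sigma>"
        have n: "real n > 0" using elim by auto
        have t: "real s / sqrt (real n) \<le> T" "\<sigma> \<le> T" "1 / sqrt (real n) \<le> T"
          using tiny_scale[of n s] elim s by (auto simp: T_def \<sigma>_def)
        have \<sigma>: "0 \<le> \<sigma>" "\<sigma> \<le> 1" using s1 by (auto simp: \<sigma>_def)
        have u: "0 \<le> u" "u \<le> (c + 1) * \<sigma>" "u \<le> c + 1"
        proof -
          show "0 \<le> u" using elim \<sigma> by (auto simp: u_def)
          show "u \<le> (c + 1) * \<sigma>" unfolding u_def using elim \<sigma> by (intro mult_right_mono) auto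
          also have "\<dots> \<le> (c + 1) * 1" using c \<sigma> by (intro mult_left_mono) auto
          finally show "u \<le> c + 1" by simp
        qed
        have Beq: "B\<^sup>2 = exp (2 * (c + 1))" unfolding B_def by (rule exp_double[symmetric])
        have B0: "0 < B" "0 < B\<^sup>2" by (simp_all add: B_def)
        have eu: "exp u \<le> B" unfolding B_def using u by simp
        have e2u: "exp (2 * u) \<le> B\<^sup>2" unfolding Beq using u by simp
        have d1: "\<bar>exp u - exp 0\<bar> \<le> B * \<bar>u - 0\<bar>" unfolding B_def using u c by (intro abs_exp_diff_le) auto
        have d2: "\<bar>exp (2 * u) - exp 0\<bar> \<le> B\<^sup>2 * \<bar>2 * u - 0\<bar>"
          unfolding Beq using u c by (intro abs_exp_diff_le) auto
        have split: "\<bar>1 - (1 - \<sigma>) * e\<bar> \<le> \<bar>e - 1\<bar> + \<sigma> * e" if "0 < e" for e :: real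
        proof -
          have "1 - (1 - \<sigma>) * e = \<sigma> * e - (e - 1)" by (simp add: algebra_simps)
          then show ?thesis using abs_triangle_ineq4[of "\<sigma> * e" "e - 1"] \<sigma> that by (simp add: abs_mult)
        qed
        have "\<bar>1 - (1 - \<sigma>) * exp u\<bar> \<le> \<bar>exp u - 1\<bar> + \<sigma> * exp u"
          by (rule split) simp
        also have "\<dots> \<le> B * ((c + 1) * \<sigma>) + \<sigma> * B"
        proof (intro add_mono mult_left_mono \<sigma> eu)
          have "B * u \<le> B * ((c + 1) * \<sigma>)" using u B0 by (intro mult_left_mono) auto
          then show "\<bar>exp u - 1\<bar> \<le> B * ((c + 1) * \<sigma>)" using d1 u by simp
        qed
        also have "\<dots> = B * (c + 2) * \<sigma>" by (simp add: algebra_simps)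
        finally have "sqrt (real n) * \<bar>1 - (1 - \<sigma>) * exp u\<bar> \<le> sqrt (real n) * (B * (c + 2) * \<sigma>)"
          by (intro mult_left_mono) auto
        also have "\<dots> = B * (c + 2) * (real s / sqrt (real n))"
          using n by (simp add: \<sigma>_def field_simps)
        also have "\<dots> \<le> B * (c + 2) * T" using t B0 c by (intro mult_left_mono) auto
        also have "sqrt (real n) * \<bar>1 - (1 - \<sigma>) * exp u\<bar> = \<bar>Y n s\<bar>"
        proof -
          have "Y n s = real n / sqrt (real n) * (1 - (1 - \<sigma>) * exp u)"
            using n by (simp add: Y_def \<sigma>_def u_def field_simps)
          then show ?thesis by (simp add: real_div_sqrt abs_mult)
        qed
        finally have Yb: "\<bar>Y n s\<bar> \<le> B * (c + 2) * T" .
        have "V n s = (1 - \<sigma>) * exp (2 * u) - 1"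
          using n by (simp add: V_def \<sigma>_def u_def field_simps)
        then have "\<bar>V n s\<bar> \<le> \<bar>exp (2 * u) - 1\<bar> + \<sigma> * exp (2 * u)"
          using split[of "exp (2 * u)"] by (simp add: abs_minus_commute)
        also have "\<dots> \<le> B\<^sup>2 * (2 * ((c + 1) * \<sigma>)) + \<sigma> * B\<^sup>2"
        proof (intro add_mono mult_left_mono \<sigma> e2u)
          have "B\<^sup>2 * (2 * u) \<le> B\<^sup>2 * (2 * ((c + 1) * \<sigma>))" using u B0 by (intro mult_left_mono) auto
          moreover have "\<bar>exp (2 * u) - 1\<bar> \<le> B\<^sup>2 * (2 * u)" using d2 u by simp
          ultimately show "\<bar>exp (2 * u) - 1\<bar> \<le> B\<^sup>2 * (2 * ((c + 1) * \<sigma>))" by linarith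
        qed
        also have "\<dots> = B\<^sup>2 * (2 * c + 3) * \<sigma>" by (simp add: algebra_simps)
        also have "\<dots> \<le> B\<^sup>2 * (2 * c + 3) * T" using t B0 c by (intro mult_left_mono) auto
        finally have Vb: "\<bar>V n s\<bar> \<le> B\<^sup>2 * (2 * c + 3) * T" .
        obtain r where r: "\<bar>r\<bar> \<le> C / sqrt (real n)"
          "ratio \<mu> n s = exp (\<mu> * Y n s - \<mu>\<^sup>2 / 2 * V n s + r)" using elim s1 by blast
        have "C * (1 / sqrt (real n)) \<le> C * T" using t C by (intro mult_left_mono) auto
        then have rb: "\<bar>r\<bar> \<le> C * T" using r by simp
        have m1: "\<bar>\<mu> * Y n s\<bar> \<le> \<bar>\<mu>\<bar> * (B * (c + 2) * T)"
          unfolding abs_mult using Yb by (intro mult_left_mono) auto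
        have m2: "\<bar>\<mu>\<^sup>2 / 2 * V n s\<bar> \<le> \<mu>\<^sup>2 / 2 * (B\<^sup>2 * (2 * c + 3) * T)"
        proof -
          have "\<mu>\<^sup>2 / 2 * \<bar>V n s\<bar> \<le> \<mu>\<^sup>2 / 2 * (B\<^sup>2 * (2 * c + 3) * T)" using Vb by (intro mult_left_mono) auto
          then show ?thesis by (simp add: abs_mult)
        qed
        have QT: "Q * T = \<bar>\<mu>\<bar> * (B * (c + 2) * T) + \<mu>\<^sup>2 / 2 * (B\<^sup>2 * (2 * c + 3) * T) + C * T"
          by (simp add: Q_def algebra_simps)
        have "\<bar>\<mu> * Y n s - \<mu>\<^sup>2 / 2 * V n s + r\<bar> \<le> Q * T"
          unfolding QT using m1 m2 rb by linarith
        then have "- (Q * T) \<le> \<mu> * Y n s - \<mu>\<^sup>2 / 2 * V n s + r" "\<mu> * Y n s - \<mu>\<^sup>2 / 2 * V n s + r \<le> Q * T"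
          by linarith+
        moreover have "0 \<le> w n s" using cluster_law_nonneg elim s1 by blast
        ultimately show "0 \<le> w n s \<and>
            1 * exp (- (Q * (1 / real n powr (1/4)))) \<le> ratio \<mu> n s \<and>
            ratio \<mu> n s \<le> 1 * exp (Q * (1 / real n powr (1/4)))"
          unfolding T_def[symmetric] r(2) by simp
      qed
    qed
  qed
qed

text \<open>What remains of the total mean 1 after the small sizes. The limit is \<beta> for every
  \<mu>, and this independence of \<mu> contains the central limit theorem.\<close>

lemma near_ratio: "(\<lambda>n. \<Sum>s\<in>near n. w n s * ratio \<mu> n s) \<longlonglongrightarrow> \<beta>"
proof -
  obtain \<epsilon> where \<epsilon>: "0 < \<epsilon>" "\<epsilon> \<le> \<beta> / 2" and mid0: "(\<lambda>n. \<Sum>s\<in>mid \<epsilon> n. w n s) \<longlonglongrightarrow> 0"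
    using mid_negligible by blast
  have S2: "(\<lambda>n. \<Sum>s\<in>mid \<epsilon> n. w n s * ratio \<mu> n s) \<longlonglongrightarrow> 0"
    by (rule negligible_ratio[OF _ mid0]) (auto simp: mid_def)
  have S3: "(\<lambda>n. \<Sum>s\<in>far \<epsilon> n. w n s * ratio \<mu> n s) \<longlonglongrightarrow> 0"
    by (rule negligible_ratio[OF _ far_negligible[OF \<epsilon>(1)]]) (auto simp: far_def)
  have "(\<lambda>n. 1 - (\<Sum>s\<in>tiny n. w n s * ratio \<mu> n s) - (\<Sum>s\<in>mid \<epsilon> n. w n s * ratio \<mu> n s) -
      (\<Sum>s\<in>far \<epsilon> n. w n s * ratio \<mu> n s)) \<longlonglongrightarrow> 1 - (1 - \<beta>) - 0 - 0"
    by (intro tendsto_intros tiny_ratio S2 S3)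
  then have "(\<lambda>n. \<Sum>s\<in>near n. w n s * ratio \<mu> n s) \<longlonglongrightarrow> 1 - (1 - \<beta>) - 0 - 0"
  proof (rule Lim_transform_eventually)
    show "\<forall>\<^sub>F n in sequentially. 1 - (\<Sum>s\<in>tiny n. w n s * ratio \<mu> n s) -
      (\<Sum>s\<in>mid \<epsilon> n. w n s * ratio \<mu> n s) - (\<Sum>s\<in>far \<epsilon> n. w n s * ratio \<mu> n s) =
      (\<Sum>s\<in>near n. w n s * ratio \<mu> n s)"
      using sum_ratio[of \<mu>] cover[OF \<epsilon>]
    proof eventually_elim
      case (elim n)
      then show ?case using elim(2)[rule_format, of "\<lambda>s. w n s * ratio \<mu> n s"] by linarith
    qed
  qed
  then show ?thesis by simp
qed

text \<open>The limits at \<sigma> = \<beta>: \<open>b\<^sub>0\<close> is (1 - \<beta>) exp (2 c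
  \<beta>) - 1, the value of \<open>V\<close>, and \<open>a\<^sub>0\<close> is the derivative of 1 -
  (1 - \<sigma>) exp (c \<sigma>), the slope of \<open>Y\<close>. The limiting variance of the size
  is \<open>b\<^sub>0 / a\<^sub>0\<^sup>2\<close>.\<close>

definition "b\<^sub>0 = \<beta> / (1 - \<beta>)"

definition "a\<^sub>0 = (1 - c * (1 - \<beta>)) / (1 - \<beta>)"

lemma a\<^sub>0_pos: "a\<^sub>0 > 0" using dual_subcritical[OF \<beta>] \<beta>(2) by (simp add: a\<^sub>0_def)

lemma near_scale:
  assumes "n \<ge> 1" "s \<in> near n"
  shows "\<bar>real s / real n - \<beta>\<bar> \<le> real n powr (-1/3)"
proof -
  have n: "real n > 0" using assms by auto
  have "real s / real n - \<beta> = (real s - \<beta> * real n) / real n" using n by (simp add: diff_divide_distrib)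
  then have "\<bar>real s / real n - \<beta>\<bar> = \<bar>real s - \<beta> * real n\<bar> / real n" by (simp only: abs_divide abs_of_nat)
  also have "\<dots> \<le> real n powr (2/3) / real n" using assms by (intro divide_right_mono) (auto simp: near_def)
  also have "\<dots> = real n powr (2/3) / real n powr 1" using n by simp
  also have "\<dots> = real n powr (-1/3)" by (simp only: powr_diff[symmetric]) simp
  finally show ?thesis .
qed

lemma near_V: "\<exists>q. q \<longlonglongrightarrow> 0 \<and> (\<forall>\<^sub>F n in sequentially. \<forall>s\<in>near n. \<bar>V n s - b\<^sub>0\<bar> \<le> q n)"
proof -
  define q where "q n = B\<^sup>2 * ((1 + 2 * c) * real n powr (-1/3) + 2 * (C0 / sqrt (real n)))" for n :: nat
  have "q \<longlonglongrightarrow> 0" unfolding q_def by real_asymp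
  moreover have "\<forall>\<^sub>F n in sequentially. \<forall>s\<in>near n. \<bar>V n s - b\<^sub>0\<bar> \<le> q n"
    using ev_basic
  proof eventually_elim
    case (elim n)
    show ?case
    proof
      fix s assume s: "s \<in> near n"
      then have s1: "s \<in> {1..n}" by (simp add: near_def)
      define \<sigma> where "\<sigma> = real s / real n"
      define \<delta> where "\<delta> = real n powr (-1/3)"
      have n: "real n > 0" using elim by auto
      have \<sigma>: "0 \<le> \<sigma>" "\<sigma> \<le> 1" "\<bar>\<sigma> - \<beta>\<bar> \<le> \<delta>"
        using s1 near_scale[of n s] s elim by (auto simp: \<sigma>_def \<delta>_def)
      have Beq: "B\<^sup>2 = exp (2 * (c + 1))" unfolding B_def by (rule exp_double[symmetric])
      have h\<sigma>: "h n * \<sigma> \<le> c + 1" using mult_mono[of "h n" "c + 1" \<sigma> 1] elim \<sigma> c by simp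
      have c\<beta>: "c * \<beta> \<le> c + 1" using mult_left_mono[of \<beta> 1 c] \<beta>(2) c by linarith
      have d: "\<bar>h n * \<sigma> - c * \<beta>\<bar> \<le> C0 / sqrt (real n) + c * \<delta>"
      proof -
        have "h n * \<sigma> - c * \<beta> = (h n - c) * \<sigma> + c * (\<sigma> - \<beta>)" by (simp add: algebra_simps)
        then have "\<bar>h n * \<sigma> - c * \<beta>\<bar> \<le> \<bar>h n - c\<bar> * \<sigma> + c * \<bar>\<sigma> - \<beta>\<bar>"
          using abs_triangle_ineq[of "(h n - c) * \<sigma>" "c * (\<sigma> - \<beta>)"] \<sigma> c by (simp add: abs_mult)
        also have "\<dots> \<le> C0 / sqrt (real n) * 1 + c * \<delta>"
          using elim \<sigma> c by (intro add_mono mult_mono mult_left_mono) auto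
        finally show ?thesis by simp
      qed
      have e1: "exp (2 * (h n * \<sigma>)) \<le> B\<^sup>2" unfolding Beq using h\<sigma> by simp
      have e2: "\<bar>exp (2 * (h n * \<sigma>)) - exp (2 * (c * \<beta>))\<bar> \<le> B\<^sup>2 * \<bar>2 * (h n * \<sigma>) - 2 * (c * \<beta>)\<bar>"
        unfolding Beq using h\<sigma> c\<beta> by (intro abs_exp_diff_le) auto
      have b: "b\<^sub>0 = (1 - \<beta>) * exp (2 * (c * \<beta>)) - 1"
      proof -
        define g where "g = 1 / (1 - \<beta>)"
        have g: "g * (1 - \<beta>) = 1" "b\<^sub>0 = \<beta> * g" using \<beta>(1,2) by (simp_all add: g_def b\<^sub>0_def)
        have e: "exp (c * \<beta>) = g" using \<beta>_exp(1) \<beta>(1,2) by (simp add: g_def field_simps)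
        have "(1 - \<beta>) * g\<^sup>2 = g * (g * (1 - \<beta>))" by (simp only: power2_eq_square mult_ac)
        then have "(1 - \<beta>) * g\<^sup>2 = g" unfolding g(1) by simp
        moreover have "g * (1 - \<beta>) = g - \<beta> * g" by (simp only: right_diff_distrib mult.commute mult_1)
        ultimately show ?thesis unfolding exp_double e g(2) using g(1) by linarith
      qed
      have "V n s = (1 - \<sigma>) * exp (2 * (h n * \<sigma>)) - 1"
        using n by (simp add: V_def \<sigma>_def field_simps)
      then have "V n s - b\<^sub>0 = (\<beta> - \<sigma>) * exp (2 * (h n * \<sigma>)) +
          (1 - \<beta>) * (exp (2 * (h n * \<sigma>)) - exp (2 * (c * \<beta>)))"
        unfolding b by (simp add: algebra_simps)
      then have "\<bar>V n s - b\<^sub>0\<bar> \<le> \<bar>\<beta> - \<sigma>\<bar> * exp (2 * (h n * \<sigma>)) +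
          (1 - \<beta>) * \<bar>exp (2 * (h n * \<sigma>)) - exp (2 * (c * \<beta>))\<bar>"
        using abs_triangle_ineq[of "(\<beta> - \<sigma>) * exp (2 * (h n * \<sigma>))"
            "(1 - \<beta>) * (exp (2 * (h n * \<sigma>)) - exp (2 * (c * \<beta>)))"] \<beta>(2) by (simp add: abs_mult)
      also have "\<dots> \<le> \<delta> * B\<^sup>2 + 1 * (B\<^sup>2 * (2 * (C0 / sqrt (real n) + c * \<delta>)))"
      proof (intro add_mono mult_mono e1)
        have "B\<^sup>2 * \<bar>2 * (h n * \<sigma>) - 2 * (c * \<beta>)\<bar> \<le> B\<^sup>2 * (2 * (C0 / sqrt (real n) + c * \<delta>))"
          using d by (intro mult_left_mono) auto
        then show "\<bar>exp (2 * (h n * \<sigma>)) - exp (2 * (c * \<beta>))\<bar> \<le> B\<^sup>2 * (2 * (C0 / sqrt (real n) + c * \<delta>))"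
          using e2 by linarith
      qed (use \<sigma> \<beta>(1) in \<open>auto simp: abs_minus_commute\<close>)
      also have "\<dots> = q n" by (simp add: q_def \<delta>_def algebra_simps)
      finally show "\<bar>V n s - b\<^sub>0\<bar> \<le> q n" .
    qed
  qed
  ultimately show ?thesis by blast
qed

text \<open>Linearisation at \<sigma> = \<beta>. The error is sqrt n times the square of n^(-1/3),
  hence of order n^(-1/6): this is where the window must be narrower than n^(3/4).\<close>

lemma near_Y: "\<exists>q. q \<longlonglongrightarrow> 0 \<and> (\<forall>\<^sub>F n in sequentially. \<forall>s\<in>near n.
    \<bar>Y n s - (a\<^sub>0 * ((real s - \<beta> * real n) / sqrt (real n)) - \<theta> * \<beta>)\<bar> \<le> q n)"
proof -
  define \<upsilon> where "\<upsilon> n = C0 / sqrt (real n) + c * real n powr (-1/3)" for n :: nat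
  define p where "p n = C0 * real n powr (-1/3) +
      sqrt (real n) * real n powr (-1/3) * \<upsilon> n / (1 - \<beta>) + 3 * sqrt (real n) * (\<upsilon> n)\<^sup>2 / (1 - \<beta>)" for n :: nat
  define q where "q n = \<bar>sqrt (real n) * (h n - c) - \<theta>\<bar> * \<beta> + p n" for n
  have "p \<longlonglongrightarrow> 0" unfolding p_def \<upsilon>_def using \<beta>(1,2) c by real_asymp
  moreover have "(\<lambda>n. \<bar>sqrt (real n) * (h n - c) - \<theta>\<bar> * \<beta>) \<longlonglongrightarrow> \<bar>\<theta> - \<theta>\<bar> * \<beta>"
    by (intro tendsto_intros h_lim)
  ultimately have "q \<longlonglongrightarrow> 0" unfolding q_def using tendsto_add[of _ 0 _ p 0] by simp
  moreover have "\<upsilon> \<longlonglongrightarrow> 0" unfolding \<upsilon>_def by real_asymp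
  then have "\<forall>\<^sub>F n in sequentially. \<upsilon> n < 1" by (rule order_tendstoD) simp
  then have "\<forall>\<^sub>F n in sequentially. \<forall>s\<in>near n.
    \<bar>Y n s - (a\<^sub>0 * ((real s - \<beta> * real n) / sqrt (real n)) - \<theta> * \<beta>)\<bar> \<le> q n"
    using ev_basic
  proof eventually_elim
    case (elim n)
    show ?case
    proof
      fix s assume s: "s \<in> near n"
      then have s1: "s \<in> {1..n}" by (simp add: near_def)
      define \<sigma> where "\<sigma> = real s / real n"
      define \<delta> where "\<delta> = real n powr (-1/3)"
      define t where "t = \<sigma> - \<beta>"
      define r where "r = sqrt (real n)"
      define g where "g = 1 / (1 - \<beta>)"
      \<comment> \<open>The increment of the exponent: exp (h \<sigma>) = exp (c \<beta>) exp u with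
        exp (c \<beta>) = g. To first order 1 - (1 - g t) exp u is g t - u, that is (g - c) t - (h -
        c) \<beta>, which yields the slope and the shift -\<theta> \<beta>.\<close>
      define u where "u = (h n - c) * \<sigma> + c * t"
      define R where "R = exp u - 1 - u"
      have n: "real n > 0" using elim by auto
      have r: "r > 0" "r * r = real n" using n by (auto simp: r_def)
      have g: "g > 0" "g * (1 - \<beta>) = 1" using \<beta>(1,2) by (simp_all add: g_def)
      have \<sigma>: "0 \<le> \<sigma>" "\<sigma> \<le> 1" "\<bar>t\<bar> \<le> \<delta>"
        using s1 near_scale[of n s] s elim by (auto simp: \<sigma>_def \<delta>_def t_def)
      have hc: "\<bar>h n - c\<bar> \<le> C0 / r" using elim by (simp add: r_def)
      have ub: "\<bar>u\<bar> \<le> \<upsilon> n"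
      proof -
        have "\<bar>u\<bar> \<le> \<bar>h n - c\<bar> * \<sigma> + c * \<bar>t\<bar>"
          unfolding u_def using abs_triangle_ineq[of "(h n - c) * \<sigma>" "c * t"] \<sigma> c by (simp add: abs_mult)
        also have "\<dots> \<le> C0 / r * 1 + c * \<delta>"
          using hc \<sigma> c by (intro add_mono mult_mono mult_left_mono) auto
        finally show ?thesis by (simp add: \<upsilon>_def r_def \<delta>_def)
      qed
      have Rb: "\<bar>R\<bar> \<le> 3 * (\<upsilon> n)\<^sup>2"
      proof -
        have "\<bar>R\<bar> \<le> 3 * u\<^sup>2" unfolding R_def using ub elim by (intro abs_exp_minus_linear_le) auto
        moreover have "u\<^sup>2 \<le> (\<upsilon> n)\<^sup>2" using ub power_mono[of "\<bar>u\<bar>" "\<upsilon> n" 2] by simp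
        ultimately show ?thesis by linarith
      qed
      have eu: "exp (h n * \<sigma>) = g * exp u"
      proof -
        have "exp (h n * \<sigma>) = exp (c * \<beta>) * exp u" by (simp add: u_def t_def algebra_simps flip: exp_add)
        moreover have "exp (c * \<beta>) = g" using \<beta>_exp(1) \<beta>(1,2) by (simp add: g_def field_simps)
        ultimately show ?thesis by simp
      qed
      have gs: "g * (1 - \<sigma>) = 1 - g * t" using g(2) by (simp add: t_def algebra_simps)
      have Y: "Y n s = r * (1 - (1 - g * t) * exp u)"
      proof -
        have "Y n s = real n / sqrt (real n) * (1 - (1 - \<sigma>) * exp (h n * \<sigma>))"
          using n by (simp add: Y_def \<sigma>_def field_simps)
        also have "\<dots> = r * (1 - g * (1 - \<sigma>) * exp u)" unfolding eu by (simp add: real_div_sqrt r_def mult_ac)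
        finally show ?thesis unfolding gs .
      qed
      have y: "(real s - \<beta> * real n) / sqrt (real n) = r * t"
        using r n by (simp add: t_def \<sigma>_def field_simps flip: r_def) (simp add: r(2)[symmetric])
      have a: "a\<^sub>0 = g - c" using \<beta>(1,2) by (simp add: a\<^sub>0_def g_def field_simps)
      have "Y n s - (a\<^sub>0 * (r * t) - \<theta> * \<beta>) =
          - ((r * (h n - c) - \<theta>) * \<beta>) - (r * (h n - c)) * t + r * (g * t * u) - r * R * (g * (1 - \<sigma>))"
        unfolding Y a gs R_def u_def t_def by (simp add: algebra_simps)
      also have "\<bar>\<dots>\<bar> \<le> \<bar>r * (h n - c) - \<theta>\<bar> * \<beta> + C0 * \<delta> + r * \<delta> * \<upsilon> n / (1 - \<beta>) + 3 * r * (\<upsilon> n)\<^sup>2 / (1 - \<beta>)"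
      proof -
        have 1: "\<bar>(r * (h n - c) - \<theta>) * \<beta>\<bar> = \<bar>r * (h n - c) - \<theta>\<bar> * \<beta>" using \<beta>(1) by (simp add: abs_mult)
        have "r * \<bar>h n - c\<bar> \<le> C0" using hc r by (simp add: field_simps)
        then have "\<bar>r * (h n - c)\<bar> \<le> C0" unfolding abs_mult using r by simp
        then have 2: "\<bar>(r * (h n - c)) * t\<bar> \<le> C0 * \<delta>" unfolding abs_mult[of "r * (h n - c)"]
          using \<sigma> by (intro mult_mono) (auto simp: C0_def)
        have "\<bar>t\<bar> * \<bar>u\<bar> \<le> \<delta> * \<upsilon> n" using \<sigma> ub by (intro mult_mono) (auto simp: \<delta>_def)
        then have "r * g * (\<bar>t\<bar> * \<bar>u\<bar>) \<le> r * g * (\<delta> * \<upsilon> n)" using r g by (intro mult_left_mono) auto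
        moreover have "\<bar>r * (g * t * u)\<bar> = r * g * (\<bar>t\<bar> * \<bar>u\<bar>)" using r g by (simp add: abs_mult)
        moreover have "r * g * (\<delta> * \<upsilon> n) = r * \<delta> * \<upsilon> n / (1 - \<beta>)" by (simp add: g_def)
        ultimately have 3: "\<bar>r * (g * t * u)\<bar> \<le> r * \<delta> * \<upsilon> n / (1 - \<beta>)" by simp
        have "r * \<bar>R\<bar> * (g * (1 - \<sigma>)) \<le> r * (3 * (\<upsilon> n)\<^sup>2) * (g * 1)"
          using r g Rb \<sigma> by (intro mult_mono mult_left_mono) auto
        moreover have "\<bar>r * R * (g * (1 - \<sigma>))\<bar> = r * \<bar>R\<bar> * (g * (1 - \<sigma>))"
          using r g \<sigma> by (simp add: abs_mult)
        moreover have "r * (3 * (\<upsilon> n)\<^sup>2) * (g * 1) = 3 * r * (\<upsilon> n)\<^sup>2 / (1 - \<beta>)" by (simp add: g_def)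
        ultimately have 4: "\<bar>r * R * (g * (1 - \<sigma>))\<bar> \<le> 3 * r * (\<upsilon> n)\<^sup>2 / (1 - \<beta>)" by simp
        show ?thesis using 1 2 3 4 by linarith
      qed
      finally show "\<bar>Y n s - (a\<^sub>0 * ((real s - \<beta> * real n) / sqrt (real n)) - \<theta> * \<beta>)\<bar> \<le> q n"
        unfolding y by (simp add: q_def p_def r_def \<delta>_def)
    qed
  qed
  ultimately show ?thesis by blast
qed

text \<open>With \<mu> = \<open>D / a\<^sub>0\<close> the linear part D y of the exponent equals
  that of \<mu> Y. Hence exp H is \<open>ratio\<close> times an asymptotically constant factor, and
  \<open>near_ratio\<close> gives the limit.\<close>

theorem near_mgf:
  assumes "q \<longlonglongrightarrow> 0" and "\<forall>\<^sub>F n in sequentially. \<forall>s\<in>near n.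
    \<bar>H n s - (A + D * ((real s - \<beta> * real n) / sqrt (real n)))\<bar> \<le> q n"
  shows "(\<lambda>n. \<Sum>s\<in>near n. w n s * exp (H n s)) \<longlonglongrightarrow>
    \<beta> * exp (A + D / a\<^sub>0 * (\<theta> * \<beta>) + (D / a\<^sub>0)\<^sup>2 / 2 * b\<^sub>0)"
proof -
  define \<mu> where "\<mu> = D / a\<^sub>0"
  define K where "K = A + \<mu> * (\<theta> * \<beta>) + \<mu>\<^sup>2 / 2 * b\<^sub>0"
  obtain C where C: "C > 0" "\<forall>\<^sub>F n in sequentially. 0 < 1 - \<mu> / sqrt (real n) \<and> (\<forall>s\<in>{1..n}. \<exists>r. \<bar>r\<bar> \<le> C / sqrt (real n) \<and>
     ratio \<mu> n s = exp (\<mu> * Y n s - \<mu>\<^sup>2 / 2 * V n s + r))" using ratio_expansion by blast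
  obtain qV where qV: "qV \<longlonglongrightarrow> 0" "\<forall>\<^sub>F n in sequentially. \<forall>s\<in>near n. \<bar>V n s - b\<^sub>0\<bar> \<le> qV n"
    using near_V by blast
  obtain qY where qY: "qY \<longlonglongrightarrow> 0" "\<forall>\<^sub>F n in sequentially. \<forall>s\<in>near n.
    \<bar>Y n s - (a\<^sub>0 * ((real s - \<beta> * real n) / sqrt (real n)) - \<theta> * \<beta>)\<bar> \<le> qY n" using near_Y by blast
  define Q where "Q n = q n + \<bar>\<mu>\<bar> * qY n + \<mu>\<^sup>2 / 2 * qV n + C / sqrt (real n)" for n
  have "(\<lambda>n. C / sqrt (real n)) \<longlonglongrightarrow> 0" by real_asymp
  then have "(\<lambda>n. q n + \<bar>\<mu>\<bar> * qY n + \<mu>\<^sup>2 / 2 * qV n + C / sqrt (real n)) \<longlonglongrightarrow> 0 + \<bar>\<mu>\<bar> * 0 + \<mu>\<^sup>2 / 2 * 0 + 0"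
    by (intro tendsto_add tendsto_mult_left assms(1) qY(1) qV(1))
  then have Q: "Q \<longlonglongrightarrow> 0" unfolding Q_def[abs_def] by simp
  have "(\<lambda>n. \<Sum>s\<in>near n. w n s * exp (H n s - K)) \<longlonglongrightarrow> \<beta>"
  proof (rule sum_squeeze[OF near_ratio[of \<mu>] Q])
    show "\<forall>\<^sub>F n in sequentially. \<forall>s\<in>near n. 0 \<le> w n s \<and>
        ratio \<mu> n s * exp (- Q n) \<le> exp (H n s - K) \<and> exp (H n s - K) \<le> ratio \<mu> n s * exp (Q n)"
      using assms(2) C(2) qV(2) qY(2) ev_basic
    proof eventually_elim
      case (elim n)
      show ?case
      proof
        fix s assume s: "s \<in> near n"
        then have s1: "s \<in> {1..n}" by (simp add: near_def)
        define y where "y = (real s - \<beta> * real n) / sqrt (real n)"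
        obtain r where r: "\<bar>r\<bar> \<le> C / sqrt (real n)"
          "ratio \<mu> n s = exp (\<mu> * Y n s - \<mu>\<^sup>2 / 2 * V n s + r)" using elim s1 by blast
        have 1: "\<bar>H n s - (A + D * y)\<bar> \<le> q n" using elim s by (simp add: y_def)
        have "\<bar>Y n s - (a\<^sub>0 * y - \<theta> * \<beta>)\<bar> \<le> qY n" using elim s by (simp add: y_def)
        then have 2: "\<bar>\<mu> * (Y n s - (a\<^sub>0 * y - \<theta> * \<beta>))\<bar> \<le> \<bar>\<mu>\<bar> * qY n"
          unfolding abs_mult by (intro mult_left_mono) auto
        have "\<bar>V n s - b\<^sub>0\<bar> \<le> qV n" using elim s by simp
        then have "\<mu>\<^sup>2 / 2 * \<bar>V n s - b\<^sub>0\<bar> \<le> \<mu>\<^sup>2 / 2 * qV n" by (intro mult_left_mono) auto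
        then have 3: "\<bar>\<mu>\<^sup>2 / 2 * (V n s - b\<^sub>0)\<bar> \<le> \<mu>\<^sup>2 / 2 * qV n" by (simp add: abs_mult)
        have Dy: "D * y = \<mu> * (a\<^sub>0 * y)" using a\<^sub>0_pos by (simp add: \<mu>_def)
        have "H n s - K - (\<mu> * Y n s - \<mu>\<^sup>2 / 2 * V n s + r) =
            (H n s - (A + D * y)) - \<mu> * (Y n s - (a\<^sub>0 * y - \<theta> * \<beta>)) + \<mu>\<^sup>2 / 2 * (V n s - b\<^sub>0) - r"
          unfolding K_def Dy by (simp add: algebra_simps diff_divide_distrib)
        then have "\<bar>H n s - K - (\<mu> * Y n s - \<mu>\<^sup>2 / 2 * V n s + r)\<bar> \<le> Q n"
          unfolding Q_def using 1 2 3 r(1) by linarith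
        then have "- Q n + (\<mu> * Y n s - \<mu>\<^sup>2 / 2 * V n s + r) \<le> H n s - K"
          "H n s - K \<le> Q n + (\<mu> * Y n s - \<mu>\<^sup>2 / 2 * V n s + r)" by linarith+
        moreover have "0 \<le> w n s" using cluster_law_nonneg elim s1 by blast
        ultimately show "0 \<le> w n s \<and>
          ratio \<mu> n s * exp (- Q n) \<le> exp (H n s - K) \<and> exp (H n s - K) \<le> ratio \<mu> n s * exp (Q n)"
          unfolding r(2) exp_add[symmetric] exp_le_cancel_iff by (simp add: add.commute)
      qed
    qed
  qed
  then have "(\<lambda>n. (\<Sum>s\<in>near n. w n s * exp (H n s - K)) * exp K) \<longlonglongrightarrow> \<beta> * exp K"
    by (rule tendsto_mult_right)
  moreover have eq: "(\<Sum>s\<in>near n. w n s * exp (H n s - K)) * exp K = (\<Sum>s\<in>near n. w n s * exp (H n s))" for n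
    unfolding sum_distrib_right by (intro sum.cong refl) (simp add: exp_diff)
  ultimately show ?thesis unfolding eq unfolding K_def \<mu>_def by simp
qed

end

section \<open>Weak convergence and Gaussian laws\<close>

text \<open>The exponential moments extend to entire functions that are locally bounded uniformly in \<open>n\<close>, so
  convergence on the real axis spreads to the imaginary axis.\<close>

lemma mgf_convergence_imp_char:
  fixes A :: "nat \<Rightarrow> 'i set" and wt Z :: "nat \<Rightarrow> 'i \<Rightarrow> real" and C t :: real
  assumes wt: "\<And>n i. 0 \<le> wt n i"
    and lim: "\<And>t. (\<lambda>n. \<Sum>i\<in>A n. wt n i * exp (t * Z n i)) \<longlonglongrightarrow> C * exp (t\<^sup>2 / 2)"
  shows "(\<lambda>n. \<Sum>i\<in>A n. of_real (wt n i) * iexp (t * Z n i)) \<longlonglongrightarrow> of_real (C * exp (- t\<^sup>2 / 2))"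
proof -
  define G where "G n \<zeta> = (\<Sum>i\<in>A n. of_real (wt n i) * exp (\<zeta> * of_real (Z n i)))"
    for n and \<zeta> :: complex
  define L where "L \<zeta> = of_real C * exp (\<zeta>\<^sup>2 / 2)" for \<zeta> :: complex
  have hol: "G n holomorphic_on UNIV" for n
    unfolding G_def by (intro holomorphic_intros)
  \<comment> \<open>|exp (z Z)| = exp (Re z Z) is at most exp (R Z) + exp (-R Z), and the moments at
    R and -R converge.\<close>
  have bnd: "\<exists>b. \<forall>n. \<forall>z\<in>K. norm (G n z) \<le> b" if K: "compact K" for K
  proof -
    obtain R where R: "\<And>z. z \<in> K \<Longrightarrow> norm z \<le> R"
      using compact_imp_bounded[OF K] by (auto simp: bounded_iff)
    obtain b1 where b1: "\<And>n. norm (\<Sum>i\<in>A n. wt n i * exp (R * Z n i)) \<le> b1"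
      using convergent_imp_Bseq[OF convergentI[OF lim[of R]]] by (auto simp: Bseq_def)
    obtain b2 where b2: "\<And>n. norm (\<Sum>i\<in>A n. wt n i * exp (- R * Z n i)) \<le> b2"
      using convergent_imp_Bseq[OF convergentI[OF lim[of "- R"]]] by (auto simp: Bseq_def)
    have "norm (G n z) \<le> b1 + b2" if z: "z \<in> K" for n z
    proof -
      have Re: "\<bar>Re z\<bar> \<le> R" using R[OF z] abs_Re_le_cmod[of z] by linarith
      have "norm (G n z) \<le> (\<Sum>i\<in>A n. norm (of_real (wt n i) * exp (z * of_real (Z n i))))"
        unfolding G_def by (rule norm_sum)
      also have "\<dots> = (\<Sum>i\<in>A n. wt n i * exp (Re z * Z n i))"
        using wt by (simp add: norm_mult)
      also have "\<dots> \<le> (\<Sum>i\<in>A n. wt n i * (exp (R * Z n i) + exp (- R * Z n i)))"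
      proof (intro sum_mono mult_left_mono wt)
        fix i
        have "Re z * Z n i \<le> \<bar>Re z\<bar> * \<bar>Z n i\<bar>" by (metis abs_ge_self abs_mult)
        also have "\<dots> \<le> R * \<bar>Z n i\<bar>" using Re by (intro mult_right_mono) auto
        finally have "exp (Re z * Z n i) \<le> exp (R * \<bar>Z n i\<bar>)" by simp
        also have "\<dots> \<le> exp (R * Z n i) + exp (- R * Z n i)" by (simp add: abs_if)
        finally show "exp (Re z * Z n i) \<le> exp (R * Z n i) + exp (- R * Z n i)" .
      qed
      also have "\<dots> = (\<Sum>i\<in>A n. wt n i * exp (R * Z n i)) + (\<Sum>i\<in>A n. wt n i * exp (- R * Z n i))"
        by (simp add: distrib_left sum.distrib)
      also have "\<dots> \<le> b1 + b2" using b1[of n] b2[of n] by (simp add: abs_le_iff)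
      finally show ?thesis .
    qed
    then show ?thesis by blast
  qed
  have real_lim: "(\<lambda>n. G n (of_real x)) \<longlonglongrightarrow> L (of_real x)" for x
  proof -
    have "(\<lambda>n. complex_of_real (\<Sum>i\<in>A n. wt n i * exp (x * Z n i))) \<longlonglongrightarrow> of_real (C * exp (x\<^sup>2 / 2))"
      by (intro tendsto_of_real lim)
    then show ?thesis by (simp add: G_def L_def exp_of_real[symmetric])
  qed
  have "(\<lambda>n. G n (\<i> * of_real t)) \<longlonglongrightarrow> L (\<i> * of_real t)"
  proof (rule ccontr)
    assume "\<not> ?thesis"
    then obtain e where e: "e > 0" "\<not> (\<forall>\<^sub>F n in sequentially. dist (G n (\<i> * of_real t)) (L (\<i> * of_real t)) < e)"
      by (auto simp: tendsto_iff)
    obtain r :: "nat \<Rightarrow> nat" where r: "strict_mono r" "\<And>n. \<not> dist (G (r n) (\<i> * of_real t)) (L (\<i> * of_real t)) < e"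
      using not_eventually_sequentiallyD[OF e(2)] by metis
    \<comment> \<open>By contradiction along a bad subsequence: Montel's theorem gives a further
      subsequence with an entire limit, which agrees with \<open>L\<close> on the real axis, hence
      everywhere, including at the bad point.\<close>
    obtain g r' where g: "g holomorphic_on UNIV" and r': "strict_mono (r' :: nat \<Rightarrow> nat)"
      and conv: "\<And>x. x \<in> UNIV \<Longrightarrow> ((\<lambda>n. G (r (r' n)) x) \<longlongrightarrow> g x) sequentially"
    proof (rule Montel[of UNIV "range G" "\<lambda>n. G (r n)"])
      show "open (UNIV :: complex set)" by simp
      show "h holomorphic_on UNIV" if "h \<in> range G" for h using that hol by auto
      show "\<exists>b. \<forall>h\<in>range G. \<forall>z\<in>K. norm (h z) \<le> b" if "compact K" for K
        using bnd[OF that] by auto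
    qed auto
    have "g z - L z = 0" for z
    proof (rule analytic_continuation[of "\<lambda>z. g z - L z" UNIV "range of_real" 0 z])
      show "(\<lambda>z. g z - L z) holomorphic_on UNIV"
        unfolding L_def by (intro holomorphic_intros g) auto
      show "(0 :: complex) islimpt range of_real"
      proof (rule islimptI)
        fix T :: "complex set" assume "0 \<in> T" "open T"
        then obtain d where d: "d > 0" "ball 0 d \<subseteq> T" by (auto simp: open_contains_ball)
        then have "complex_of_real (d / 2) \<in> T" by (intro subsetD[OF d(2)]) auto
        moreover have "complex_of_real (d / 2) \<noteq> 0" using d by simp
        ultimately show "\<exists>y\<in>range complex_of_real. y \<in> T \<and> y \<noteq> 0" by blast
      qed
      show "g z - L z = 0" if zr: "z \<in> range of_real" for z
      proof -
        obtain x where x: "z = of_real x" using zr by auto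
        have "(\<lambda>n. G (r (r' n)) z) \<longlonglongrightarrow> L z"
          using LIMSEQ_subseq_LIMSEQ[OF real_lim[of x], of "r \<circ> r'"] r r' x
          strict_mono_o[OF r(1) r'] by (simp add: comp_def)
        then show ?thesis using conv[of z] LIMSEQ_unique by fastforce
      qed
    qed auto
    then have "(\<lambda>n. G (r (r' n)) (\<i> * of_real t)) \<longlonglongrightarrow> L (\<i> * of_real t)"
      using conv[of "\<i> * of_real t"] by simp
    then have "\<forall>\<^sub>F n in sequentially. dist (G (r (r' n)) (\<i> * of_real t)) (L (\<i> * of_real t)) < e"
      using e(1) by (rule tendstoD)
    then show False using r(2) by (auto dest: eventually_happens)
  qed
  then show ?thesis
    by (simp add: G_def L_def power_mult_distrib mult_ac exp_of_real[symmetric])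
qed

text \<open>The weights need not have total mass 1, and \<open>C\<close> may vanish: in the joint
  limit they already contain the test functions and exponentials of the other coordinates.
  Normalising by the total mass reduces the claim to Levy's continuity theorem.\<close>

lemma mgf_convergence:
  fixes A :: "nat \<Rightarrow> 'i set" and wt Z :: "nat \<Rightarrow> 'i \<Rightarrow> real" and C :: real and f :: "real \<Rightarrow> real"
  assumes fin: "\<And>n. finite (A n)"
    and wt: "\<forall>\<^sub>F n in sequentially. \<forall>i\<in>A n. 0 \<le> wt n i" and C: "0 \<le> C"
    and lim: "\<And>t. (\<lambda>n. \<Sum>i\<in>A n. wt n i * exp (t * Z n i)) \<longlonglongrightarrow> C * exp (t\<^sup>2 / 2)"
    and f: "continuous_on UNIV f" "\<And>x. \<bar>f x\<bar> \<le> M"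
  shows "(\<lambda>n. \<Sum>i\<in>A n. wt n i * f (Z n i)) \<longlonglongrightarrow> C * (\<integral>x. f x \<partial>std_normal_distribution)"
proof -
  \<comment> \<open>The weights are nonnegative only eventually, while
    \<open>mgf_convergence_imp_char\<close> asks for it at every index.\<close>
  define v where "v n i = \<bar>wt n i\<bar>" for n i
  have v: "0 \<le> v n i" for n i by (simp add: v_def)
  have ev: "\<forall>\<^sub>F n in sequentially. (\<Sum>i\<in>A n. wt n i * g n i) = (\<Sum>i\<in>A n. v n i * g n i)" for g
    using wt by eventually_elim (auto simp: v_def intro!: sum.cong)
  have limv: "(\<lambda>n. \<Sum>i\<in>A n. v n i * exp (t * Z n i)) \<longlonglongrightarrow> C * exp (t\<^sup>2 / 2)" for t
    by (rule Lim_transform_eventually[OF lim ev])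
  define S where "S n = (\<Sum>i\<in>A n. v n i)" for n
  have S: "S \<longlonglongrightarrow> C" using limv[of 0] by (simp add: S_def[abs_def])
  have "(\<lambda>n. \<Sum>i\<in>A n. v n i * f (Z n i)) \<longlonglongrightarrow> C * (\<integral>x. f x \<partial>std_normal_distribution)"
  proof (cases "C = 0")
    case True
    have "(\<lambda>n. \<Sum>i\<in>A n. v n i * f (Z n i)) \<longlonglongrightarrow> 0"
    proof (rule Lim_null_comparison)
      show "\<forall>\<^sub>F n in sequentially. norm (\<Sum>i\<in>A n. v n i * f (Z n i)) \<le> S n * M"
      proof (intro always_eventually allI)
        fix n
        have "norm (\<Sum>i\<in>A n. v n i * f (Z n i)) \<le> (\<Sum>i\<in>A n. v n i * M)"
          using v f(2) by (intro sum_norm_le) (auto simp: abs_mult intro!: mult_left_mono)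
        then show "norm (\<Sum>i\<in>A n. v n i * f (Z n i)) \<le> S n * M" by (simp add: S_def sum_distrib_right)
      qed
      show "(\<lambda>n. S n * M) \<longlonglongrightarrow> 0" using tendsto_mult_right[OF S, of M] True by simp
    qed
    then show ?thesis using True by simp
  next
    case False
    then have C: "C > 0" using assms(3) by simp
    \<comment> \<open>The standard normal law is a default for the finitely many indices at which
      there is no positive mass to divide by.\<close>
    define \<mu> where "\<mu> n = (if S n > 0 then
        distr (point_measure (A n) (\<lambda>i. ennreal (v n i / S n))) borel (Z n) else std_normal_distribution)" for n
    have prob: "prob_space (point_measure (A n) (\<lambda>i. ennreal (v n i / S n)))" if "S n > 0" for n
    proof (rule prob_spaceI)
      have "emeasure (point_measure (A n) (\<lambda>i. ennreal (v n i / S n))) (A n) = (\<Sum>i\<in>A n. ennreal (v n i / S n))"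
        using fin by (intro emeasure_point_measure_finite) auto
      also have "\<dots> = ennreal (\<Sum>i\<in>A n. v n i / S n)" using v that by (intro sum_ennreal) auto
      also have "(\<Sum>i\<in>A n. v n i / S n) = 1" using that by (simp add: S_def flip: sum_divide_distrib)
      finally show "emeasure (point_measure (A n) (\<lambda>i. ennreal (v n i / S n)))
          (space (point_measure (A n) (\<lambda>i. ennreal (v n i / S n)))) = 1" by (simp add: space_point_measure)
    qed
    have meas: "Z n \<in> point_measure (A n) (\<lambda>i. ennreal (v n i / S n)) \<rightarrow>\<^sub>M borel" for n
      by (simp add: measurable_point_measure_eq1)
    have rd: "real_distribution (\<mu> n)" for n
    proof (cases "S n > 0")
      case True
      interpret prob_space "point_measure (A n) (\<lambda>i. ennreal (v n i / S n))" by (rule prob[OF True])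
      show ?thesis using True meas by (simp add: \<mu>_def real_distribution_distr)
    qed (simp add: \<mu>_def real_dist_normal_dist)
    have int: "integral\<^sup>L (\<mu> n) g = (\<Sum>i\<in>A n. (v n i / S n) *\<^sub>R g (Z n i))"
      if "S n > 0" "g \<in> borel_measurable borel" for n and g :: "real \<Rightarrow> 'b::{banach, second_countable_topology}"
    proof -
      have "integral\<^sup>L (\<mu> n) g = (\<integral>i. g (Z n i) \<partial>point_measure (A n) (\<lambda>i. ennreal (v n i / S n)))"
        using that meas by (simp add: \<mu>_def integral_distr)
      also have "\<dots> = (\<Sum>i\<in>A n. (v n i / S n) *\<^sub>R g (Z n i))"
        using that v fin by (intro lebesgue_integral_point_measure_finite) auto
      finally show ?thesis .
    qed
    have Spos: "\<forall>\<^sub>F n in sequentially. S n > 0" using S C by (rule order_tendstoD)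
    have "weak_conv_m \<mu> std_normal_distribution"
    proof (rule levy_continuity[OF rd real_dist_normal_dist])
      fix t
      have "(\<lambda>n. (\<Sum>i\<in>A n. of_real (v n i) * iexp (t * Z n i)) / of_real (S n)) \<longlonglongrightarrow>
          of_real (C * exp (- t\<^sup>2 / 2)) / of_real C"
        using C by (intro tendsto_divide mgf_convergence_imp_char v limv tendsto_of_real S) auto
      then have "(\<lambda>n. (\<Sum>i\<in>A n. of_real (v n i) * iexp (t * Z n i)) / of_real (S n)) \<longlonglongrightarrow>
          char std_normal_distribution t"
        using C by (simp add: char_std_normal_distribution)
      then show "(\<lambda>n. char (\<mu> n) t) \<longlonglongrightarrow> char std_normal_distribution t"
      proof (rule Lim_transform_eventually)
        show "\<forall>\<^sub>F n in sequentially. (\<Sum>i\<in>A n. of_real (v n i) * iexp (t * Z n i)) / of_real (S n) =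
          char (\<mu> n) t"
          using Spos
        proof eventually_elim
        case (elim n)
        have "char (\<mu> n) t = (\<Sum>i\<in>A n. (v n i / S n) *\<^sub>R iexp (t * Z n i))"
          unfolding char_def using elim by (subst int) auto
        then show ?case by (simp add: sum_divide_distrib scaleR_conv_of_real)
        qed
      qed
    qed
    then have "(\<lambda>n. integral\<^sup>L (\<mu> n) f) \<longlonglongrightarrow> integral\<^sup>L std_normal_distribution f"
      using f by (intro weak_conv_imp_integral_bdd_continuous_conv rd real_dist_normal_dist)
        (auto simp: continuous_on_eq_continuous_at)
    then have "(\<lambda>n. S n * integral\<^sup>L (\<mu> n) f) \<longlonglongrightarrow> C * integral\<^sup>L std_normal_distribution f"
      by (rule tendsto_mult[OF S])
    moreover have "\<forall>\<^sub>F n in sequentially. S n * integral\<^sup>L (\<mu> n) f = (\<Sum>i\<in>A n. v n i * f (Z n i))"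
      using Spos
    proof eventually_elim
      case (elim n)
      have "f \<in> borel_measurable borel" using f(1) by (rule borel_measurable_continuous_onI)
      then show ?case using elim by (subst int) (auto simp: sum_distrib_left)
    qed
    ultimately show ?thesis by (rule Lim_transform_eventually)
  qed
  moreover have "\<forall>\<^sub>F n in sequentially. (\<Sum>i\<in>A n. v n i * f (Z n i)) = (\<Sum>i\<in>A n. wt n i * f (Z n i))"
    using ev[of "\<lambda>n i. f (Z n i)"] by eventually_elim simp
  ultimately show ?thesis by (rule Lim_transform_eventually)
qed

section \<open>Weak convergence from product test functions\<close>

definition clamp :: "real \<Rightarrow> real \<Rightarrow> real" where
  "clamp T t = max (- T) (min T t)"

definition cutoff :: "real \<Rightarrow> real \<Rightarrow> real" where
  "cutoff T t = max 0 (min 1 (T + 1 - \<bar>t\<bar>))"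

lemma uniformly_continuous_clamp: "uniformly_continuous_on UNIV (clamp T)"
proof (rule lipschitz_on_uniformly_continuous)
  show "1-lipschitz_on UNIV (clamp T)"
    by (rule lipschitz_onI) (auto simp: clamp_def dist_real_def)
qed

lemma uniformly_continuous_cutoff: "uniformly_continuous_on UNIV (cutoff T)"
proof (rule lipschitz_on_uniformly_continuous)
  show "1-lipschitz_on UNIV (cutoff T)"
    by (rule lipschitz_onI) (auto simp: cutoff_def dist_real_def max_def min_def abs_if split: if_splits)
qed

lemma cutoff_bounds: "0 \<le> cutoff T t" "cutoff T t \<le> 1"
  by (auto simp: cutoff_def)

lemma clamp_range: "0 \<le> T \<Longrightarrow> clamp T t \<in> {- T..T}"
  by (auto simp: clamp_def)

lemma uniformly_continuous_comp_clamp: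
  assumes f: "continuous_on UNIV (f :: real \<Rightarrow> real)" and T: "0 \<le> T"
  shows "uniformly_continuous_on UNIV (\<lambda>t. f (clamp T t))"
proof -
  have "uniformly_continuous_on {- T..T} f"
    using f by (intro compact_uniformly_continuous) (auto intro: continuous_on_subset)
  then have "uniformly_continuous_on (range (clamp T)) f"
    using clamp_range[OF T] unfolding uniformly_continuous_on_def by (meson image_subset_iff subsetD)
  then show ?thesis
    by (rule uniformly_continuous_on_compose[OF uniformly_continuous_clamp])
qed

text \<open>The algebra spanned by products of one-coordinate functions. Factors are kept in [0, 1],
  the form of the test functions for which limits are known; sums and multiples restore
  generality.\<close>

inductive_set prods :: "(real ^ 'n \<Rightarrow> real) set" where
  prod: "(\<And>i. continuous_on UNIV (f i)) \<Longrightarrow> (\<And>i t. 0 \<le> f i t \<and> f i t \<le> 1) \<Longrightarrow>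
    (\<lambda>x. \<Prod>i\<in>UNIV. f i (x $ i)) \<in> prods"
| add: "g \<in> prods \<Longrightarrow> h \<in> prods \<Longrightarrow> (\<lambda>x. g x + h x) \<in> prods"
| scale: "g \<in> prods \<Longrightarrow> (\<lambda>x. c * g x) \<in> prods"

lemma prods_mult_prod:
  assumes "h \<in> prods" "\<And>i. continuous_on UNIV (f i)" "\<And>i t. 0 \<le> f i t \<and> f i t \<le> 1"
  shows "(\<lambda>x. (\<Prod>i\<in>UNIV. f i (x $ i)) * h x) \<in> prods"
  using assms(1)
proof induction
  case (prod k)
  have "(\<lambda>x. \<Prod>i\<in>UNIV. (\<lambda>t. f i t * k i t) (x $ i)) \<in> prods"
  proof (rule prods.prod)
    show "continuous_on UNIV (\<lambda>t. f i t * k i t)" for i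
      using assms(2) prod(1) by (intro continuous_intros)
    show "0 \<le> f i t * k i t \<and> f i t * k i t \<le> 1" for i t
      using assms(3)[of i t] prod(2)[of i t] by (auto intro: mult_le_one)
  qed
  then show ?case by (simp add: prod.distrib)
next
  case (add g h)
  then show ?case using prods.add by (simp add: distrib_left)
next
  case (scale g c)
  then show ?case using prods.scale[of _ c] by (simp add: mult.left_commute)
qed

lemma prods_mult: "g \<in> prods \<Longrightarrow> h \<in> prods \<Longrightarrow> (\<lambda>x. g x * h x) \<in> prods"
proof (induction rule: prods.induct)
  case (prod f)
  then show ?case by (intro prods_mult_prod) auto
next
  case (add g1 g2)
  then show ?case using prods.add by (simp add: distrib_right)
next
  case (scale g c)
  then show ?case using prods.scale[of _ c] by (simp add: mult.assoc)
qed

lemma prods_continuous: "g \<in> prods \<Longrightarrow> continuous_on UNIV g"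
proof (induction rule: prods.induct)
  case (prod f)
  show ?case
  proof (intro continuous_intros)
    fix i
    show "continuous_on UNIV (\<lambda>x::real^'a. f i (x $ i))"
      by (rule continuous_on_compose2[OF prod(1)]) (auto intro: continuous_intros)
  qed
qed (auto intro: continuous_intros)

lemma function_ring_prods:
  assumes "compact (K :: (real ^ 'n) set)"
  shows "function_ring_on prods K"
proof
  show "compact K" by fact
  show "continuous_on K f" if "f \<in> prods" for f :: "real ^ 'n \<Rightarrow> real"
    using prods_continuous[OF that] continuous_on_subset by blast
  show "(\<lambda>x. f x + g x) \<in> prods" if "f \<in> prods" "g \<in> prods" for f g :: "real ^ 'n \<Rightarrow> real"
    using that by (rule prods.add)
  show "(\<lambda>x. f x * g x) \<in> prods" if "f \<in> prods" "g \<in> prods" for f g :: "real ^ 'n \<Rightarrow> real"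
    using that by (rule prods_mult)
  show "(\<lambda>_. c) \<in> prods" for c
    using prods.scale[OF prods.prod[of "\<lambda>i t. 1"], of c] by simp
  fix x y :: "real ^ 'n" assume "x \<noteq> y"
  then obtain j where j: "x $ j \<noteq> y $ j" by (auto simp: vec_eq_iff)
  \<comment> \<open>A bounded injective function of one coordinate, scaled into [0, 1].\<close>
  define f where "f i = (if i = j then (\<lambda>t::real. 1 / 2 + arctan t / pi) else (\<lambda>t. 1))" for i
  have "(\<lambda>x. \<Prod>i\<in>UNIV. f i (x $ i)) \<in> prods"
  proof (rule prods.prod)
    show "continuous_on UNIV (f i)" for i unfolding f_def by (auto intro!: continuous_intros)
    show "0 \<le> f i t \<and> f i t \<le> 1" for i t
      using arctan_lbound[of t] arctan_ubound[of t] by (auto simp: f_def field_simps)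
  qed
  moreover have "(\<Prod>i\<in>UNIV. f i (z $ i)) = 1 / 2 + arctan (z $ j) / pi" for z
  proof -
    have "(\<Prod>i\<in>UNIV. f i (z $ i)) = (\<Prod>i\<in>UNIV. if i = j then 1 / 2 + arctan (z $ j) / pi else 1)"
      by (intro prod.cong) (auto simp: f_def)
    then show ?thesis by (simp add: prod.delta)
  qed
  ultimately show "\<exists>f\<in>prods. f x \<noteq> f y" using j by (intro bexI) (auto simp: arctan_eq_iff)
qed

text \<open>Products of cutoffs control the mass outside a cube for all large \<open>n\<close>. On
  the cube, Stone-Weierstrass approximates \<open>F\<close> by an element of \<open>prods\<close>,
  and composition with the projection onto the cube extends the approximant boundedly to the whole
  space.\<close>

lemma weak_conv_product:
  fixes M :: "nat \<Rightarrow> (real ^ 'n) measure" and N :: "(real ^ 'n) measure"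
  assumes prob: "\<And>n. prob_space (M n)" "prob_space N"
    and sets: "\<And>n. sets (M n) = sets borel" "sets N = sets borel"
    and lim: "\<And>f :: 'n \<Rightarrow> real \<Rightarrow> real. (\<And>i. uniformly_continuous_on UNIV (f i)) \<Longrightarrow> (\<And>i t. 0 \<le> f i t \<and> f i t \<le> 1) \<Longrightarrow>
      (\<lambda>n. \<integral>x. (\<Prod>i\<in>UNIV. f i (x $ i)) \<partial>M n) \<longlonglongrightarrow> (\<integral>x. (\<Prod>i\<in>UNIV. f i (x $ i)) \<partial>N)"
  shows "weak_conv_law M N"
  unfolding weak_conv_law_def
proof (intro allI impI)
  fix F :: "real ^ 'n \<Rightarrow> real"
  assume F: "continuous_on UNIV F" and "bounded (range F)"
  then obtain B where B: "B > 0" "\<And>x. \<bar>F x\<bar> \<le> B" by (auto simp: bounded_pos)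
  have int: "integrable P g" if "prob_space P" "sets P = sets borel" "continuous_on UNIV g" "\<And>x. \<bar>g x\<bar> \<le> b"
    for P :: "(real ^ 'n) measure" and g :: "real ^ 'n \<Rightarrow> real" and b
  proof -
    interpret prob_space P by fact
    have "g \<in> borel_measurable P"
      using borel_measurable_continuous_onI[OF that(3)] measurable_cong_sets[OF that(2) refl] by blast
    then show ?thesis using that(4) by (intro integrable_const_bound[of _ b]) auto
  qed
  define \<psi> where "\<psi> T x = (\<Prod>i\<in>UNIV. cutoff T (x $ i))" for T and x :: "real ^ 'n"
  have \<psi>01: "0 \<le> \<psi> T x" "\<psi> T x \<le> 1" for T x
    unfolding \<psi>_def using cutoff_bounds by (auto intro: prod_nonneg prod_le_1)
  have \<psi>cont: "continuous_on UNIV (\<psi> T)" for T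
    unfolding \<psi>_def
  proof (intro continuous_intros)
    show "continuous_on UNIV (\<lambda>x::real^'n. cutoff T (x $ i))" for i
      by (rule continuous_on_compose2[OF uniformly_continuous_imp_continuous[OF uniformly_continuous_cutoff]])
        (auto intro: continuous_intros)
  qed
  have \<psi>lim: "(\<lambda>n. \<integral>x. \<psi> T x \<partial>M n) \<longlonglongrightarrow> (\<integral>x. \<psi> T x \<partial>N)" for T
    unfolding \<psi>_def using lim[of "\<lambda>_. cutoff T"] by (simp add: cutoff_bounds uniformly_continuous_cutoff)
  interpret N: prob_space N by (rule prob)
  have "(\<lambda>k. \<integral>x. \<psi> (real k) x \<partial>N) \<longlonglongrightarrow> (\<integral>x. 1 \<partial>N)"
  proof (rule integral_dominated_convergence[where w="\<lambda>_. 1"])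
    show "\<psi> (real k) \<in> borel_measurable N" for k
      using borel_measurable_continuous_onI[OF \<psi>cont] measurable_cong_sets[OF sets(2) refl] by blast
    show "AE x in N. (\<lambda>k. \<psi> (real k) x) \<longlonglongrightarrow> 1"
    proof (intro AE_I2)
      fix x :: "real ^ 'n"
      obtain k0 :: nat where k0: "norm x \<le> real k0" using real_arch_simple by blast
      have "\<forall>\<^sub>F k in sequentially. \<psi> (real k) x = 1"
        using eventually_ge_at_top[of k0]
      proof eventually_elim
        case (elim k)
        have "cutoff (real k) (x $ i) = 1" for i
          using component_le_norm_cart[of x i] k0 elim by (simp add: cutoff_def)
        then show ?case by (simp add: \<psi>_def)
      qed
      then show "(\<lambda>k. \<psi> (real k) x) \<longlonglongrightarrow> 1" by (rule tendsto_eventually)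
    qed
    show "AE x in N. norm (\<psi> (real k) x) \<le> 1" for k using \<psi>01 by simp
  qed auto
  then have \<psi>N: "(\<lambda>k. \<integral>x. \<psi> (real k) x \<partial>N) \<longlonglongrightarrow> 1" by (simp add: N.prob_space)
  show "(\<lambda>n. integral\<^sup>L (M n) F) \<longlonglongrightarrow> integral\<^sup>L N F"
  proof (rule tendstoI)
    fix e0 :: real assume e0: "e0 > 0"
    \<comment> \<open>The total error is e for the convergence and e + 2 B e for each of the two
      laws, less than (8 B + 4) e.\<close>
    define e where "e = e0 / (8 * B + 4)"
    have e: "e > 0" using e0 B by (simp add: e_def)
    have "\<forall>\<^sub>F k in sequentially. 1 - e < (\<integral>x. \<psi> (real k) x \<partial>N)"
      using \<psi>N e by (intro order_tendstoD(1)) auto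
    then obtain k where k: "1 - e < (\<integral>x. \<psi> (real k) x \<partial>N)" by (auto dest: eventually_happens)
    \<comment> \<open>One more than \<open>k\<close>, since the cutoff is nonzero up to k + 1:
      wherever \<psi> does not vanish, the projection \<open>cl\<close> is the identity.\<close>
    define T where "T = real k + 1"
    define cl :: "real ^ 'n \<Rightarrow> real ^ 'n" where "cl x = (\<chi> i. clamp T (x $ i))" for x
    have T: "0 \<le> T" by (simp add: T_def)
    define K :: "(real ^ 'n) set" where "K = cbox (\<chi> i. - T) (\<chi> i. T)"
    have clK: "cl x \<in> K" for x
      using clamp_range[OF T] by (auto simp: K_def cl_def mem_box_cart)
    interpret R: function_ring_on prods K
      by (rule function_ring_prods) (simp add: K_def compact_cbox)
    obtain g where g: "g \<in> prods" "\<And>x. x \<in> K \<Longrightarrow> \<bar>F x - g x\<bar> < e"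
      using R.Stone_Weierstrass_basic[of F e] F e continuous_on_subset by blast
    have clcont: "continuous_on UNIV cl"
      unfolding cl_def
    proof (intro continuous_on_vec_lambda)
      show "continuous_on UNIV (\<lambda>x::real^'n. clamp T (x $ i))" for i
        by (rule continuous_on_compose2[OF uniformly_continuous_imp_continuous[OF uniformly_continuous_clamp]])
          (auto intro: continuous_intros)
    qed
    have comp: "continuous_on UNIV (\<lambda>x. G (cl x))" if "continuous_on UNIV G" for G :: "real ^ 'n \<Rightarrow> real"
      by (rule continuous_on_compose2[OF that clcont]) auto
    \<comment> \<open>Boundedness goes through the induction because additivity of the integral
      needs integrable summands. Clamping makes each factor uniformly continuous, as the assumed
      limit requires.\<close>
    have conv: "(\<exists>b. \<forall>x. \<bar>h (cl x)\<bar> \<le> b) \<and> (\<lambda>n. \<integral>x. h (cl x) \<partial>M n) \<longlonglongrightarrow> (\<integral>x. h (cl x) \<partial>N)"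
      if "h \<in> prods" for h
      using that
    proof (induction rule: prods.induct)
      case (prod f)
      have "\<bar>\<Prod>i\<in>UNIV. f i (cl x $ i)\<bar> \<le> 1" for x
        unfolding abs_prod using prod(2) by (intro prod_le_1) auto
      moreover have "(\<lambda>n. \<integral>x. (\<Prod>i\<in>UNIV. (\<lambda>t. f i (clamp T t)) (x $ i)) \<partial>M n) \<longlonglongrightarrow>
          (\<integral>x. (\<Prod>i\<in>UNIV. (\<lambda>t. f i (clamp T t)) (x $ i)) \<partial>N)"
        using prod T by (intro lim[of "\<lambda>i t. f i (clamp T t)"] uniformly_continuous_comp_clamp) auto
      ultimately show ?case by (auto simp: cl_def)
    next
      case (add g h)
      then obtain b1 b2 where b: "\<And>x. \<bar>g (cl x)\<bar> \<le> b1" "\<And>x. \<bar>h (cl x)\<bar> \<le> b2" by blast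
      have i: "integrable P (\<lambda>x. g (cl x))" "integrable P (\<lambda>x. h (cl x))"
        if "prob_space P" "sets P = sets borel" for P
        using int[OF that comp[OF prods_continuous[OF add.hyps(1)]] b(1)]
          int[OF that comp[OF prods_continuous[OF add.hyps(2)]] b(2)] by auto
      have "\<bar>g (cl x) + h (cl x)\<bar> \<le> b1 + b2" for x using b[of x] by linarith
      then have 1: "\<exists>b. \<forall>x. \<bar>g (cl x) + h (cl x)\<bar> \<le> b" by blast
      have "(\<lambda>n. (\<integral>x. g (cl x) \<partial>M n) + (\<integral>x. h (cl x) \<partial>M n)) \<longlonglongrightarrow>
          (\<integral>x. g (cl x) \<partial>N) + (\<integral>x. h (cl x) \<partial>N)"
        using add.IH by (intro tendsto_add) auto
      then show ?case using 1 i prob sets by simp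
    next
      case (scale g c)
      then obtain b where b: "\<And>x. \<bar>g (cl x)\<bar> \<le> b" by blast
      have "\<bar>c * g (cl x)\<bar> \<le> \<bar>c\<bar> * b" for x unfolding abs_mult using b by (intro mult_left_mono) auto
      then have 1: "\<exists>b. \<forall>x. \<bar>c * g (cl x)\<bar> \<le> b" by blast
      have "(\<lambda>n. c * (\<integral>x. g (cl x) \<partial>M n)) \<longlonglongrightarrow> c * (\<integral>x. g (cl x) \<partial>N)"
        using scale.IH by (intro tendsto_mult_left) auto
      then show ?case using 1 by simp
    qed
    have pt: "\<bar>F x - g (cl x)\<bar> \<le> e + 2 * B * (1 - \<psi> (real k) x)" for x
    proof (cases "\<psi> (real k) x = 0")
      case True
      have "\<bar>F x - g (cl x)\<bar> \<le> \<bar>F x - F (cl x)\<bar> + \<bar>F (cl x) - g (cl x)\<bar>" by linarith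
      also have "\<dots> \<le> 2 * B + e" using B(2)[of x] B(2)[of "cl x"] g(2)[OF clK, of x] by linarith
      finally show ?thesis using True by simp
    next
      case False
      then have "cutoff (real k) (x $ i) \<noteq> 0" for i by (auto simp: \<psi>_def)
      then have "\<bar>x $ i\<bar> \<le> T" for i by (smt (verit) cutoff_def T_def)
      then have "cl x = x" by (auto simp: cl_def vec_eq_iff clamp_def abs_le_iff min_def max_def) (smt (verit))+
      then have "\<bar>F x - g (cl x)\<bar> < e" using g(2)[OF clK, of x] by simp
      moreover have "0 \<le> 2 * B * (1 - \<psi> (real k) x)" using B \<psi>01 by simp
      ultimately show ?thesis by linarith
    qed
    obtain b where b: "\<And>x. \<bar>g (cl x)\<bar> \<le> b" using conv[OF g(1)] by blast
    have diff: "\<bar>integral\<^sup>L P F - (\<integral>x. g (cl x) \<partial>P)\<bar> \<le> e + 2 * B * (1 - (\<integral>x. \<psi> (real k) x \<partial>P))"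
      if P: "prob_space P" "sets P = sets borel" for P
    proof -
      interpret P: prob_space P by fact
      have iF: "integrable P F" by (rule int[OF P F B(2)])
      have ig: "integrable P (\<lambda>x. g (cl x))" by (rule int[OF P comp[OF prods_continuous[OF g(1)]] b])
      have "\<bar>\<psi> (real k) x\<bar> \<le> 1" for x using \<psi>01[of "real k" x] by simp
      then have i\<psi>: "integrable P (\<psi> (real k))" by (rule int[OF P \<psi>cont])
      have "integral\<^sup>L P F - (\<integral>x. g (cl x) \<partial>P) = (\<integral>x. F x - g (cl x) \<partial>P)"
        using iF ig by simp
      also have "\<bar>\<dots>\<bar> \<le> (\<integral>x. \<bar>F x - g (cl x)\<bar> \<partial>P)" by (rule integral_abs_bound)
      also have "\<dots> \<le> (\<integral>x. e + 2 * B * (1 - \<psi> (real k) x) \<partial>P)"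
        using iF ig i\<psi> pt by (intro integral_mono) auto
      also have "\<dots> = e + 2 * B * (1 - (\<integral>x. \<psi> (real k) x \<partial>P))"
        using i\<psi> by (simp add: P.prob_space)
      finally show ?thesis .
    qed
    have "\<forall>\<^sub>F n in sequentially. 1 - e < (\<integral>x. \<psi> (real k) x \<partial>M n)"
      using \<psi>lim k by (rule order_tendstoD(1))
    moreover have "\<forall>\<^sub>F n in sequentially. dist (\<integral>x. g (cl x) \<partial>M n) (\<integral>x. g (cl x) \<partial>N) < e"
      using conv[OF g(1)] e by (auto intro: tendstoD)
    ultimately show "\<forall>\<^sub>F n in sequentially. dist (integral\<^sup>L (M n) F) (integral\<^sup>L N F) < e0"
    proof eventually_elim
      case (elim n)
      have 1: "2 * B * (1 - (\<integral>x. \<psi> (real k) x \<partial>M n)) \<le> 2 * B * e"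
        using elim B by (intro mult_left_mono) auto
      have 2: "2 * B * (1 - (\<integral>x. \<psi> (real k) x \<partial>N)) \<le> 2 * B * e"
        using k B by (intro mult_left_mono) auto
      have "\<bar>integral\<^sup>L (M n) F - integral\<^sup>L N F\<bar> < (e + 2 * B * e) + e + (e + 2 * B * e)"
        using diff[OF prob(1) sets(1), of n] diff[OF prob(2) sets(2)] 1 2 elim(2)
        unfolding dist_real_def by linarith
      also have "\<dots> \<le> e * (8 * B + 4)" using e B by (simp add: algebra_simps)
      also have "\<dots> = e0" using B by (simp add: e_def)
      finally show ?case by (simp add: dist_real_def)
    qed
  qed
qed

section \<open>Standard Gaussian vectors and their affine images\<close>

interpretation std_normal: real_distribution std_normal_distribution
  by (rule real_dist_normal_dist)

definition std_gauss :: "(real ^ 'n) measure" where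
  "std_gauss = distr (PiM UNIV (\<lambda>_. std_normal_distribution)) borel (\<lambda>\<omega>. \<chi> i. \<omega> i)"

lemma measurable_vec_lambda_std:
  "(\<lambda>\<omega>. \<chi> i. \<omega> i) \<in> PiM (UNIV :: 'n::finite set) (\<lambda>_. std_normal_distribution) \<rightarrow>\<^sub>M (borel :: (real ^ 'n) measure)"
proof (subst borel_measurable_euclidean_space, intro ballI)
  fix b :: "real ^ 'n" assume "b \<in> Basis"
  then obtain i where b: "b = axis i 1" by (auto simp: Basis_vec_def)
  have "(\<lambda>\<omega>. \<omega> i) \<in> PiM (UNIV :: 'n set) (\<lambda>_. std_normal_distribution) \<rightarrow>\<^sub>M std_normal_distribution"
    by (rule measurable_component_singleton) simp
  then show "(\<lambda>\<omega>. (\<chi> i. \<omega> i) \<bullet> b) \<in> borel_measurable (PiM (UNIV :: 'n set) (\<lambda>_. std_normal_distribution))"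
    by (simp add: b inner_axis)
qed

lemma prob_space_std_gauss: "prob_space (std_gauss :: (real ^ 'n) measure)"
proof -
  have "prob_space (PiM (UNIV :: 'n set) (\<lambda>_. std_normal_distribution))"
    by (rule prob_space_PiM) (rule std_normal.prob_space_axioms)
  then show ?thesis
    unfolding std_gauss_def by (rule prob_space.prob_space_distr[OF _ measurable_vec_lambda_std])
qed

lemma sets_std_gauss [simp, measurable_cong]: "sets std_gauss = sets borel"
  by (simp add: std_gauss_def)

lemma measurable_nth [measurable]: "(\<lambda>x :: real ^ 'n. x $ i) \<in> borel_measurable borel"
  by (intro borel_measurable_continuous_onI continuous_intros)

lemma integral_prod_std_gauss:
  fixes f :: "'n::finite \<Rightarrow> real \<Rightarrow> 'b::{real_normed_field, banach, second_countable_topology}"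
  assumes "\<And>i. integrable std_normal_distribution (f i)"
  shows "(\<integral>x. (\<Prod>i\<in>UNIV. f i (x $ i)) \<partial>std_gauss) = (\<Prod>i\<in>UNIV. integral\<^sup>L std_normal_distribution (f i))"
proof -
  interpret product_sigma_finite "\<lambda>_::'n. std_normal_distribution"
    by (rule product_sigma_finite.intro) (rule std_normal.sigma_finite_measure_axioms)
  have "f i \<in> borel_measurable borel" for i using borel_measurable_integrable[OF assms] by simp
  then have m: "(\<lambda>x. f i (x $ i)) \<in> borel_measurable borel" for i
    using measurable_compose[OF measurable_nth] by blast
  then have "(\<lambda>x. \<Prod>i\<in>UNIV. f i (x $ i)) \<in> borel_measurable borel"
    by (intro borel_measurable_prod) auto
  then have "(\<integral>x. (\<Prod>i\<in>UNIV. f i (x $ i)) \<partial>std_gauss) =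
      (\<integral>\<omega>. (\<Prod>i\<in>UNIV. f i (\<omega> i)) \<partial>PiM UNIV (\<lambda>_. std_normal_distribution))"
    unfolding std_gauss_def by (subst integral_distr[OF measurable_vec_lambda_std]) auto
  also have "\<dots> = (\<Prod>i\<in>UNIV. integral\<^sup>L std_normal_distribution (f i))"
    using assms by (intro product_integral_prod) auto
  finally show ?thesis .
qed

text \<open>An image law rather than a density, so that s = 0 gives the point mass without a case
  distinction.\<close>

definition normal_law :: "real \<Rightarrow> real \<Rightarrow> real measure" where
  "normal_law m s = distr std_normal_distribution borel (\<lambda>x. m + s * x)"

lemma real_distribution_normal_law: "real_distribution (normal_law m s)"
  unfolding normal_law_def by (rule std_normal.real_distribution_distr) simp

lemma real_distribution_std_gauss:
  "f \<in> borel_measurable borel \<Longrightarrow> real_distribution (distr std_gauss borel f)"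
  by (rule prob_space.real_distribution_distr[OF prob_space_std_gauss])
    (simp add: measurable_cong_sets[OF sets_std_gauss refl])

text \<open>The characteristic function factors over the independent coordinates, and the exponents
  add up to the sum of squares.\<close>

lemma affine_law:
  fixes c :: "'n::finite \<Rightarrow> real"
  shows "distr std_gauss borel (\<lambda>x. K + (\<Sum>j\<in>UNIV. c j * x $ j)) =
    normal_law K (sqrt (\<Sum>j\<in>UNIV. (c j)\<^sup>2))"
proof (rule Levy_uniqueness[OF _ real_distribution_normal_law])
  show "real_distribution (distr std_gauss borel (\<lambda>x. K + (\<Sum>j\<in>UNIV. c j * x $ j)))"
    by (rule real_distribution_std_gauss) measurable
  show "char (distr std_gauss borel (\<lambda>x. K + (\<Sum>j\<in>UNIV. c j * x $ j))) =
    char (normal_law K (sqrt (\<Sum>j\<in>UNIV. (c j)\<^sup>2)))"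
  proof
    fix t :: real
    let ?s = "sqrt (\<Sum>j\<in>UNIV. (c j)\<^sup>2)"
    have int: "integrable std_normal_distribution (\<lambda>x. iexp (a * x))" for a
      by (intro std_normal.integrable_iexp) auto
    have "char (distr std_gauss borel (\<lambda>x. K + (\<Sum>j\<in>UNIV. c j * x $ j))) t =
        (\<integral>x. iexp (t * (K + (\<Sum>j\<in>UNIV. c j * x $ j))) \<partial>std_gauss)"
      unfolding char_def by (subst integral_distr) auto
    also have "\<dots> = (\<integral>x. iexp (t * K) * (\<Prod>j\<in>UNIV. iexp (t * c j * x $ j)) \<partial>std_gauss)"
      by (intro Bochner_Integration.integral_cong refl)
        (simp add: exp_sum[symmetric] distrib_left sum_distrib_left exp_add mult_ac)
    also have "\<dots> = iexp (t * K) * (\<integral>x. (\<Prod>j\<in>UNIV. iexp (t * c j * x $ j)) \<partial>std_gauss)"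
      by simp
    also have "(\<integral>x. (\<Prod>j\<in>UNIV. iexp (t * c j * x $ j)) \<partial>(std_gauss :: (real ^ 'n) measure)) =
        (\<Prod>j\<in>UNIV. char std_normal_distribution (t * c j))"
      unfolding char_def by (rule integral_prod_std_gauss[where f="\<lambda>j x. iexp (t * c j * x)"]) (rule int)
    also have "\<dots> = char std_normal_distribution (t * ?s)"
    proof -
      have "(\<Sum>j\<in>UNIV. - (t * c j)\<^sup>2 / 2) = - (t * ?s)\<^sup>2 / 2"
        by (simp add: power_mult_distrib sum_nonneg sum_distrib_left sum_divide_distrib sum_negf)
      then show ?thesis
        by (simp add: char_std_normal_distribution exp_sum[symmetric] flip: of_real_prod)
    qed
    also have "iexp (t * K) * char std_normal_distribution (t * ?s) = char (normal_law K ?s) t"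
      unfolding char_def normal_law_def
      by (subst integral_distr) (auto simp: exp_add distrib_left mult_ac)
    finally show "char (distr std_gauss borel (\<lambda>x. K + (\<Sum>j\<in>UNIV. c j * x $ j))) t =
      char (normal_law K ?s) t" .
  qed
qed

lemma std_normal_moments:
  "integrable std_normal_distribution (\<lambda>x. x)" "(\<integral>x. x \<partial>std_normal_distribution) = 0"
  "integrable std_normal_distribution (\<lambda>x. x\<^sup>2)" "(\<integral>x. x\<^sup>2 \<partial>std_normal_distribution) = 1"
  using integrable_std_normal_distribution_moment[of 1] integral_std_normal_distribution_moment_odd[of 1]
    integrable_std_normal_distribution_moment[of 2] std_normal_distribution_even_moments(1)[of 1]
  by simp_all

lemma normal_law_moments:
  "integrable (normal_law m s) (\<lambda>x. x)" "(\<integral>x. x \<partial>normal_law m s) = m"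
  "integrable (normal_law m s) (\<lambda>x. (x - m)\<^sup>2)" "(\<integral>x. (x - m)\<^sup>2 \<partial>normal_law m s) = s\<^sup>2"
proof -
  have meas: "(\<lambda>x. m + s * x) \<in> std_normal_distribution \<rightarrow>\<^sub>M borel" by simp
  note i1 = std_normal_moments(1) and i2 = std_normal_moments(3)
  show "integrable (normal_law m s) (\<lambda>x. x)"
    unfolding normal_law_def by (subst integrable_distr_eq[OF meas]) (auto intro!: i1)
  show "(\<integral>x. x \<partial>normal_law m s) = m"
    unfolding normal_law_def using std_normal_moments(2) std_normal.prob_space
    by (subst integral_distr[OF meas]) (auto simp: i1)
  have eq: "(m + s * x - m)\<^sup>2 = s\<^sup>2 * x\<^sup>2" for x by (simp add: power_mult_distrib)
  show "integrable (normal_law m s) (\<lambda>x. (x - m)\<^sup>2)"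
    unfolding normal_law_def by (subst integrable_distr_eq[OF meas]) (auto simp only: eq intro!: i2 integrable_mult_right, measurable)
  show "(\<integral>x. (x - m)\<^sup>2 \<partial>normal_law m s) = s\<^sup>2"
    unfolding normal_law_def using std_normal_moments(4)
    by (subst integral_distr[OF meas], measurable) (simp only: eq integral_mult_right_zero mult_1_right)
qed

lemma normal_law_degenerate: "normal_law m 0 = return borel m"
  unfolding normal_law_def by (simp add: std_normal.distr_const)

lemma distributed_normal_law:
  assumes "s > 0"
  shows "normal_law m s = density lborel (normal_density m s)"
proof -
  have "distributed std_normal_distribution lborel (\<lambda>x. x) (normal_density 0 1)"
    unfolding distributed_def by (subst distr_id2) auto
  from std_normal.normal_density_affine[OF this, of s m] assms
  have "distributed std_normal_distribution lborel (\<lambda>x. m + s * x) (normal_density m s)" by simp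
  then show ?thesis
    unfolding distributed_def normal_law_def by (metis distr_cong sets_lborel)
qed

lemma gaussian_lawI:
  assumes "prob_space N" "sets N = sets borel"
    and "\<And>u. \<exists>m s. s \<ge> 0 \<and> distr N borel (\<lambda>x. u \<bullet> x) = normal_law m s"
  shows "gaussian_law N"
  unfolding gaussian_law_def
proof (intro conjI allI assms(1,2))
  fix u
  obtain m s where s: "s \<ge> 0" "distr N borel (\<lambda>x. u \<bullet> x) = normal_law m s" using assms(3) by blast
  show "(\<exists>m. distr N borel ((\<bullet>) u) = return borel m) \<or>
      (\<exists>m s. 0 < s \<and> distributed N lborel ((\<bullet>) u) (normal_density m s))"
  proof (cases "s = 0")
    case True
    then show ?thesis using s normal_law_degenerate by auto
  next
    case False
    then have "s > 0" using s by simp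
    have "distr N lborel ((\<bullet>) u) = distr N borel (\<lambda>x. u \<bullet> x)"
      by (intro distr_cong) auto
    also have "\<dots> = density lborel (normal_density m s)"
      unfolding s(2) by (rule distributed_normal_law) fact
    finally have "distributed N lborel ((\<bullet>) u) (normal_density m s)"
      using assms(2) by (auto simp: distributed_def measurable_cong_sets[OF assms(2) refl])
    then show ?thesis using \<open>s > 0\<close> by blast
  qed
qed

definition lin :: "('n::finite \<Rightarrow> real) \<Rightarrow> real ^ 'n \<Rightarrow> real" where
  "lin c x = (\<Sum>j\<in>UNIV. c j * x $ j)"

lemma measurable_lin [measurable]: "lin c \<in> borel_measurable borel"
  unfolding lin_def[abs_def] by measurable

lemma lin_moments:
  "integrable std_gauss (lin c)" "(\<integral>x. lin c x \<partial>std_gauss) = 0"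
  "integrable std_gauss (\<lambda>x. (lin c x)\<^sup>2)" "(\<integral>x. (lin c x)\<^sup>2 \<partial>std_gauss) = (\<Sum>j\<in>UNIV. (c j)\<^sup>2)"
proof -
  have law: "distr std_gauss borel (lin c) = normal_law 0 (sqrt (\<Sum>j\<in>UNIV. (c j)\<^sup>2))"
    using affine_law[of 0 c] by (simp add: lin_def[abs_def])
  have m: "lin c \<in> std_gauss \<rightarrow>\<^sub>M borel" by measurable
  note mom = normal_law_moments[of 0 "sqrt (\<Sum>j\<in>UNIV. (c j)\<^sup>2)", folded law]
  show "integrable std_gauss (lin c)" "(\<integral>x. lin c x \<partial>std_gauss) = 0"
    "integrable std_gauss (\<lambda>x. (lin c x)\<^sup>2)" "(\<integral>x. (lin c x)\<^sup>2 \<partial>std_gauss) = (\<Sum>j\<in>UNIV. (c j)\<^sup>2)"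
    using mom m by (simp_all add: integrable_distr_eq integral_distr sum_nonneg)
qed

text \<open>Polarisation of the second moments in \<open>lin_moments\<close>.\<close>

lemma lin_product:
  "integrable std_gauss (\<lambda>x. lin c x * lin d x)"
  "(\<integral>x. lin c x * lin d x \<partial>std_gauss) = (\<Sum>j\<in>UNIV. c j * d j)"
proof -
  have eq: "lin c x * lin d x = ((lin (\<lambda>j. c j + d j) x)\<^sup>2 - (lin c x)\<^sup>2 - (lin d x)\<^sup>2) / 2" for x
  proof -
    have "lin (\<lambda>j. c j + d j) x = lin c x + lin d x"
      by (simp add: lin_def distrib_right sum.distrib)
    then show ?thesis by (simp add: power2_sum)
  qed
  show "integrable std_gauss (\<lambda>x. lin c x * lin d x)"
    unfolding eq
    by (intro integrable_divide_zero Bochner_Integration.integrable_diff lin_moments(3))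
  have "(\<integral>x. lin c x * lin d x \<partial>std_gauss) =
      ((\<Sum>j\<in>UNIV. (c j + d j)\<^sup>2) - (\<Sum>j\<in>UNIV. (c j)\<^sup>2) - (\<Sum>j\<in>UNIV. (d j)\<^sup>2)) / 2"
    unfolding eq
    by (subst integral_divide_zero, subst Bochner_Integration.integral_diff,
        intro Bochner_Integration.integrable_diff lin_moments(3), rule lin_moments(3),
        subst Bochner_Integration.integral_diff, rule lin_moments(3), rule lin_moments(3))
      (simp only: lin_moments(4))
  also have "\<dots> = (\<Sum>j\<in>UNIV. c j * d j)"
    by (simp add: power2_sum sum.distrib mult.assoc sum_distrib_left[symmetric])
  finally show "(\<integral>x. lin c x * lin d x \<partial>std_gauss) = (\<Sum>j\<in>UNIV. c j * d j)" .
qed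

text \<open>The law of m + A x for a standard Gaussian x. A prescribed covariance matrix is obtained
  by giving a square root \<open>A\<close>, in the sense that it equals \<open>A\<close> times its
  transpose.\<close>

definition affine_gauss :: "real ^ 'm \<Rightarrow> ('m \<Rightarrow> 'n::finite \<Rightarrow> real) \<Rightarrow> (real ^ 'm) measure" where
  "affine_gauss m A = distr (std_gauss :: (real ^ 'n) measure) borel (\<lambda>x. \<chi> i. m $ i + lin (A i) x)"

lemma measurable_affine: "(\<lambda>x. \<chi> i. m $ i + lin (A i) x) \<in> std_gauss \<rightarrow>\<^sub>M (borel :: (real ^ 'm::finite) measure)"
proof -
  have "continuous_on UNIV (\<lambda>x. \<chi> i. m $ i + lin (A i) x)"
    unfolding lin_def by (intro continuous_on_vec_lambda continuous_intros)
  then show ?thesis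
    using borel_measurable_continuous_onI measurable_cong_sets[OF sets_std_gauss refl] by blast
qed

lemma prob_space_affine_gauss: "prob_space (affine_gauss m A)"
  unfolding affine_gauss_def by (rule prob_space.prob_space_distr[OF prob_space_std_gauss measurable_affine])

lemma affine_gauss_moments:
  "prob_space.expectation (affine_gauss m A) (\<lambda>x. x $ i) = m $ i"
  "covariance (affine_gauss m A) (\<lambda>x. x $ i) (\<lambda>x. x $ j) = (\<Sum>k\<in>UNIV. A i k * A j k)"
  "prob_space.variance (affine_gauss m A) (\<lambda>x. x $ i) = (\<Sum>k\<in>UNIV. (A i k)\<^sup>2)"
proof -
  interpret G: prob_space "std_gauss" by (rule prob_space_std_gauss)
  show e: "prob_space.expectation (affine_gauss m A) (\<lambda>x. x $ i) = m $ i" for i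
    unfolding affine_gauss_def
    by (subst integral_distr[OF measurable_affine]) (auto simp: lin_moments G.prob_space[simplified])
  show "covariance (affine_gauss m A) (\<lambda>x. x $ i) (\<lambda>x. x $ j) = (\<Sum>k\<in>UNIV. A i k * A j k)"
    unfolding covariance_def e unfolding affine_gauss_def
    by (subst integral_distr[OF measurable_affine]) (auto simp: lin_product)
  show "prob_space.variance (affine_gauss m A) (\<lambda>x. x $ i) = (\<Sum>k\<in>UNIV. (A i k)\<^sup>2)"
    unfolding e unfolding affine_gauss_def
    by (subst integral_distr[OF measurable_affine]) (auto simp: lin_moments)
qed

lemma gaussian_affine_gauss: "gaussian_law (affine_gauss m A)"
proof (rule gaussian_lawI[OF prob_space_affine_gauss])
  show "sets (affine_gauss m A) = sets borel" by (simp add: affine_gauss_def)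
  fix u :: "real ^ 'a"
  let ?c = "\<lambda>j. \<Sum>i\<in>UNIV. u $ i * A i j"
  have eq: "u \<bullet> (\<chi> i. m $ i + lin (A i) x) = u \<bullet> m + (\<Sum>j\<in>UNIV. ?c j * x $ j)" for x
  proof -
    have "u \<bullet> (\<chi> i. m $ i + lin (A i) x) = u \<bullet> m + (\<Sum>i\<in>UNIV. \<Sum>j\<in>UNIV. u $ i * (A i j * x $ j))"
      by (simp add: inner_vec_def lin_def distrib_left sum.distrib sum_distrib_left)
    also have "(\<Sum>i\<in>UNIV. \<Sum>j\<in>UNIV. u $ i * (A i j * x $ j)) = (\<Sum>j\<in>UNIV. ?c j * x $ j)"
      by (subst sum.swap) (simp add: sum_distrib_right mult.assoc)
    finally show ?thesis .
  qed
  have "distr (affine_gauss m A) borel (\<lambda>x. u \<bullet> x) =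
      distr std_gauss borel (\<lambda>x. u \<bullet> (\<chi> i. m $ i + lin (A i) x))"
    unfolding affine_gauss_def by (subst distr_distr[OF _ measurable_affine]) (auto simp: comp_def)
  also have "\<dots> = normal_law (u \<bullet> m) (sqrt (\<Sum>j\<in>UNIV. (?c j)\<^sup>2))"
    unfolding eq by (rule affine_law)
  finally show "\<exists>m' s. s \<ge> 0 \<and> distr (affine_gauss m A) borel (\<lambda>x. u \<bullet> x) = normal_law m' s"
    by (intro exI conjI) (auto simp: sum_nonneg)
qed

lemma distr_affine_gauss_nth:
  "distr (affine_gauss m A) borel (\<lambda>x. x $ i) = normal_law (m $ i) (sqrt (\<Sum>j\<in>UNIV. (A i j)\<^sup>2))"
proof -
  have "distr (affine_gauss m A) borel (\<lambda>x. x $ i) = distr std_gauss borel (\<lambda>x. m $ i + (\<Sum>j\<in>UNIV. A i j * x $ j))"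
    unfolding affine_gauss_def
    by (subst distr_distr[OF _ measurable_affine]) (auto simp: comp_def lin_def)
  then show ?thesis by (simp add: affine_law)
qed

lemma gaussian_normal_law: "gaussian_law (normal_law m s)"
proof (rule gaussian_lawI)
  interpret real_distribution "normal_law m s" by (rule real_distribution_normal_law)
  show "prob_space (normal_law m s)" by (rule prob_space_axioms)
  show "sets (normal_law m s) = sets borel" by simp
  fix u :: real
  have "distr (normal_law m s) borel (\<lambda>x. u \<bullet> x) = normal_law (u * m) (u * s)"
    unfolding normal_law_def by (subst distr_distr) (auto simp: comp_def algebra_simps)
  \<comment> \<open>The detour through one-dimensional vectors replaces u s, which may be negative,
    by the square root of its square.\<close>
  also have "\<dots> = distr (distr std_gauss borel (\<lambda>x :: real ^ 1. 0 + (\<Sum>j\<in>UNIV. 1 * x $ j))) borel (\<lambda>x. u * m + (u * s) * x)"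
    by (subst affine_law) (simp add: normal_law_def distr_id2)
  also have "\<dots> = distr std_gauss borel (\<lambda>x :: real ^ 1. u * m + (\<Sum>j\<in>UNIV. (u * s) * x $ j))"
    by (subst distr_distr) (auto simp: comp_def sum_distrib_left)
  also have "\<dots> = normal_law (u * m) (sqrt (\<Sum>j\<in>(UNIV :: 1 set). (u * s)\<^sup>2))"
    by (rule affine_law)
  finally show "\<exists>m' s'. s' \<ge> 0 \<and> distr (normal_law m s) borel (\<lambda>x. u \<bullet> x) = normal_law m' s'"
    by (intro exI conjI) (auto simp: sum_nonneg)
qed

lemma cluster_law_cluster_wt:
  assumes "0 \<le> p" "p < 1" "n \<ge> 1"
  shows "cluster_law n (- real n * ln (1 - p)) (cluster_wt p n)"
proof -
  have e: "exp (- real n * ln (1 - p) * real s / real n) = 1 / (1 - p) ^ s" for s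
  proof -
    have eq: "- real n * ln (1 - p) * real s / real n = - (real s * ln (1 - p))" using assms(3) by simp
    show ?thesis unfolding eq using assms(2) by (simp add: exp_minus exp_of_nat_mult divide_inverse)
  qed
  show ?thesis
    unfolding cluster_law_def e
    using cluster_wt_identity[of n p] assms cluster_wt_nonneg[of p n] by simp
qed

text \<open>Given that \<open>S\<close> is a component, the rest of the graph is an unconditioned
  random graph on \<open>V - S\<close>. A uniform bound on its expectation therefore multiplies the
  expected number of admissible components.\<close>

lemma gexp_sum_comps_le:
  assumes fin: "finite V" and p: "0 \<le> p" "p \<le> 1"
    and F: "\<And>S. S \<subseteq> V \<Longrightarrow> S \<noteq> {} \<Longrightarrow> P (card S) \<Longrightarrow> gexp p (pairs (V - S)) (F S) \<le> b"
  shows "gexp p (pairs V) (\<lambda>E. \<Sum>S\<in>comps V E. of_bool (P (card S)) * F S (E \<inter> pairs (V - S))) \<le>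
    b * (\<Sum>s=1..card V. real (card V) / real s * cluster_wt p (card V) s * of_bool (P s))"
proof -
  let ?n = "card V"
  have "gexp p (pairs V) (\<lambda>E. \<Sum>S\<in>comps V E. of_bool (P (card S)) * F S (E \<inter> pairs (V - S))) =
      (\<Sum>S\<in>Pow V - {{}}. (1 - p) ^ (card S * card (V - S)) * gexp p (pairs S) (\<lambda>E1.
        of_bool (connd S E1) * gexp p (pairs (V - S)) (\<lambda>E2. of_bool (P (card S)) * F S E2)))"
    by (rule gexp_sum_comps[OF fin, where F="\<lambda>S E1 E2. of_bool (P (card S)) * F S E2"])
  also have "\<dots> \<le> (\<Sum>S\<in>Pow V - {{}}. (1 - p) ^ (card S * card (V - S)) * gexp p (pairs S) (\<lambda>E1.
        of_bool (connd S E1) * gexp p (pairs (V - S)) (\<lambda>E2. of_bool (P (card S)) * b)))"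
  proof (rule sum_mono)
    fix S assume S: "S \<in> Pow V - {{}}"
    have le: "gexp p (pairs (V - S)) (\<lambda>E2. of_bool (P (card S)) * F S E2) \<le>
        gexp p (pairs (V - S)) (\<lambda>E2. of_bool (P (card S)) * b)"
      using F[of S] S fin by (cases "P (card S)") (auto simp: gexp_const)
    show "(1 - p) ^ (card S * card (V - S)) * gexp p (pairs S) (\<lambda>E1.
        of_bool (connd S E1) * gexp p (pairs (V - S)) (\<lambda>E2. of_bool (P (card S)) * F S E2)) \<le>
      (1 - p) ^ (card S * card (V - S)) * gexp p (pairs S) (\<lambda>E1.
        of_bool (connd S E1) * gexp p (pairs (V - S)) (\<lambda>E2. of_bool (P (card S)) * b))"
    proof (rule mult_left_mono[OF gexp_mono[OF p]])
      fix E1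
      show "of_bool (connd S E1) * gexp p (pairs (V - S)) (\<lambda>E2. of_bool (P (card S)) * F S E2) \<le>
          of_bool (connd S E1) * gexp p (pairs (V - S)) (\<lambda>E2. of_bool (P (card S)) * b)"
        using le by (rule mult_left_mono) simp
    qed (use p in simp)
  qed
  also have "\<dots> = gexp p (pairs V) (\<lambda>E. \<Sum>S\<in>comps V E. of_bool (P (card S)) * b)"
    by (rule gexp_sum_comps[OF fin, where F="\<lambda>S E1 E2. of_bool (P (card S)) * b", symmetric])
  also have "\<dots> = (\<Sum>s=1..?n. real ?n / real s * cluster_wt p ?n s * (of_bool (P s) * b))"
    by (rule gexp_sum_comps_card[OF fin, where F="\<lambda>S E1 E2. of_bool (P (card S)) * b"])
      (use fin in \<open>auto simp: gexp_const\<close>)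
  also have "\<dots> = b * (\<Sum>s=1..?n. real ?n / real s * cluster_wt p ?n s * of_bool (P s))"
    by (simp add: sum_distrib_left mult_ac)
  finally show ?thesis .
qed

lemma gexp_sum_card_sq:
  assumes "finite V"
  shows "gexp p (pairs V) (\<lambda>E. \<Sum>S\<in>comps V E. (real (card S))\<^sup>2) =
    real (card V) * (\<Sum>s=1..card V. real s * cluster_wt p (card V) s)"
proof -
  have "gexp p (pairs V) (\<lambda>E. \<Sum>S\<in>comps V E. (real (card S))\<^sup>2) =
      (\<Sum>s=1..card V. real (card V) / real s * cluster_wt p (card V) s * (real s)\<^sup>2)"
    by (rule gexp_sum_comps_card[OF assms, where F="\<lambda>S E1 E2. (real (card S))\<^sup>2"])
      (use assms in \<open>auto simp: gexp_const\<close>)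
  also have "\<dots> = real (card V) * (\<Sum>s=1..card V. real s * cluster_wt p (card V) s)"
    unfolding sum_distrib_left by (intro sum.cong refl) (auto simp: power2_eq_square)
  finally show ?thesis .
qed

section \<open>Exponential tilting\<close>

locale sparse =
  fixes cn :: "nat \<Rightarrow> real" and c \<theta> :: real
  assumes c_pos: "c > 0" and cn_lim: "(\<lambda>n. sqrt (real n) * (cn n - c)) \<longlonglongrightarrow> \<theta>"
begin

definition p :: "nat \<Rightarrow> real" where "p n = cn n / real n"

lemma cn_tendsto: "cn \<longlonglongrightarrow> c"
proof -
  have "(\<lambda>n. 1 / sqrt (real n)) \<longlonglongrightarrow> 0" by real_asymp
  then have "(\<lambda>n. 1 / sqrt (real n) * (sqrt (real n) * (cn n - c)) + c) \<longlonglongrightarrow> 0 * \<theta> + c"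
    by (intro tendsto_intros cn_lim)
  moreover have "\<forall>\<^sub>F n in sequentially. 1 / sqrt (real n) * (sqrt (real n) * (cn n - c)) + c = cn n"
    using eventually_gt_at_top[of 0] by eventually_elim simp
  ultimately show ?thesis by (simp add: Lim_transform_eventually)
qed

lemma p_tendsto: "p \<longlonglongrightarrow> 0"
proof -
  have "(\<lambda>n. 1 / real n) \<longlonglongrightarrow> 0" by real_asymp
  then have "(\<lambda>n. cn n * (1 / real n)) \<longlonglongrightarrow> c * 0" by (intro tendsto_intros cn_tendsto)
  then show ?thesis by (simp add: p_def[abs_def])
qed

lemma ev_p: "\<forall>\<^sub>F n in sequentially. n \<ge> 1 \<and> 0 < p n \<and> p n < 1 / 2 \<and> real n * p n = cn n"
proof -
  have 1: "\<forall>\<^sub>F n in sequentially. 0 < cn n" using cn_tendsto c_pos by (rule order_tendstoD)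
  have 2: "\<forall>\<^sub>F n in sequentially. p n < 1 / 2" using p_tendsto by (rule order_tendstoD) simp
  show ?thesis using 1 2 eventually_ge_at_top[of 1] by eventually_elim (auto simp: p_def)
qed

definition rho :: "real \<Rightarrow> nat \<Rightarrow> real" where
  "rho \<nu> n = 1 - p n + p n * exp (\<nu> / sqrt (real n))"

lemma rho_pos: "\<forall>\<^sub>F n in sequentially. 0 < rho \<nu> n"
  using ev_p by eventually_elim (auto simp: rho_def add_pos_pos)

text \<open>The power of \<open>rho\<close> is a number of pairs, of order n^2, so the logarithm is
  needed up to o(n^(-2)). The term \<theta> \<nu> comes from p = c/n + \<theta> n^(-3/2) +
  o(n^(-3/2)), the term c \<nu>^2/2 from the second order of the exponential.\<close>

lemma ln_rho: "(\<lambda>n. (real n)\<^sup>2 * ln (rho \<nu> n) - sqrt (real n) * (c * \<nu>)) \<longlonglongrightarrow> \<theta> * \<nu> + c * \<nu>\<^sup>2 / 2"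
proof -
  define x where "x n = p n * (exp (\<nu> / sqrt (real n)) - 1)" for n
  have A: "(\<lambda>n. real n * (exp (\<nu> / sqrt (real n)) - 1) - sqrt (real n) * \<nu>) \<longlonglongrightarrow> \<nu>\<^sup>2 / 2"
    by real_asymp (simp add: power2_eq_square)?
  have "(\<lambda>n. sqrt (real n) * (cn n - c) * \<nu> + cn n * (real n * (exp (\<nu> / sqrt (real n)) - 1) - sqrt (real n) * \<nu>))
      \<longlonglongrightarrow> \<theta> * \<nu> + c * (\<nu>\<^sup>2 / 2)"
    by (intro tendsto_intros cn_lim cn_tendsto A)
  moreover have "\<forall>\<^sub>F n in sequentially. sqrt (real n) * (cn n - c) * \<nu> + cn n * (real n * (exp (\<nu> / sqrt (real n)) - 1) - sqrt (real n) * \<nu>) =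
      (real n)\<^sup>2 * x n - sqrt (real n) * (c * \<nu>)"
    using ev_p
  proof eventually_elim
    case (elim n)
    have "(real n)\<^sup>2 * x n = (real n * p n) * (real n * (exp (\<nu> / sqrt (real n)) - 1))"
      by (simp add: x_def power2_eq_square)
    then have "(real n)\<^sup>2 * x n = cn n * (real n * (exp (\<nu> / sqrt (real n)) - 1))" using elim by simp
    then show ?case by (simp add: algebra_simps)
  qed
  ultimately have main: "(\<lambda>n. (real n)\<^sup>2 * x n - sqrt (real n) * (c * \<nu>)) \<longlonglongrightarrow> \<theta> * \<nu> + c * (\<nu>\<^sup>2 / 2)"
    by (rule Lim_transform_eventually)
  have "(\<lambda>n. real n * (exp (\<nu> / sqrt (real n)) - 1) * (1 / real n)) \<longlonglongrightarrow> 0" by real_asymp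
  then have "(\<lambda>n. cn n * (real n * (exp (\<nu> / sqrt (real n)) - 1) * (1 / real n))) \<longlonglongrightarrow> c * 0"
    by (intro tendsto_intros cn_tendsto)
  moreover have "\<forall>\<^sub>F n in sequentially. cn n * (real n * (exp (\<nu> / sqrt (real n)) - 1) * (1 / real n)) = real n * x n"
    using ev_p
  proof eventually_elim
    case (elim n)
    have "real n * x n = cn n * (exp (\<nu> / sqrt (real n)) - 1)"
      unfolding x_def using elim by (metis mult.assoc)
    then show ?case using elim by simp
  qed
  ultimately have nx: "(\<lambda>n. real n * x n) \<longlonglongrightarrow> 0" by (simp add: Lim_transform_eventually)
  have "(\<lambda>n. 1 / real n * (real n * x n)) \<longlonglongrightarrow> 0 * 0"
    by (intro tendsto_mult nx) real_asymp
  moreover have "\<forall>\<^sub>F n in sequentially. 1 / real n * (real n * x n) = x n"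
    using eventually_gt_at_top[of 0] by eventually_elim simp
  ultimately have "x \<longlonglongrightarrow> 0" by (simp add: Lim_transform_eventually)
  then have "(\<lambda>n. \<bar>x n\<bar>) \<longlonglongrightarrow> 0" by (rule tendsto_rabs_zero)
  then have xsmall: "\<forall>\<^sub>F n in sequentially. \<bar>x n\<bar> < 1 / 2" by (rule order_tendstoD) simp
  \<comment> \<open>n x vanishes, so the quadratic term of the logarithm does not contribute even
    after multiplication by n^2.\<close>
  have err: "(\<lambda>n. (real n)\<^sup>2 * (ln (1 + x n) - x n)) \<longlonglongrightarrow> 0"
  proof (rule Lim_null_comparison)
    show "\<forall>\<^sub>F n in sequentially. norm ((real n)\<^sup>2 * (ln (1 + x n) - x n)) \<le> 2 * (real n * x n)\<^sup>2"
      using xsmall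
    proof eventually_elim
      case (elim n)
      then have "\<bar>ln (1 + x n) - x n\<bar> \<le> 2 * (x n)\<^sup>2" by (intro abs_ln_one_plus_x_minus_x_bound) auto
      then have "(real n)\<^sup>2 * \<bar>ln (1 + x n) - x n\<bar> \<le> (real n)\<^sup>2 * (2 * (x n)\<^sup>2)"
        by (intro mult_left_mono) auto
      then show ?case by (simp add: abs_mult power_mult_distrib)
    qed
    have "(\<lambda>n. 2 * (real n * x n)\<^sup>2) \<longlonglongrightarrow> 2 * 0\<^sup>2" by (intro tendsto_intros nx)
    then show "(\<lambda>n. 2 * (real n * x n)\<^sup>2) \<longlonglongrightarrow> 0" by simp
  qed
  have "rho \<nu> n = 1 + x n" for n by (simp add: rho_def x_def algebra_simps)
  then have eq: "(real n)\<^sup>2 * ln (rho \<nu> n) - sqrt (real n) * (c * \<nu>) =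
      ((real n)\<^sup>2 * x n - sqrt (real n) * (c * \<nu>)) + (real n)\<^sup>2 * (ln (1 + x n) - x n)" for n
    by (simp add: algebra_simps)
  show ?thesis unfolding eq using tendsto_add[OF main err] by simp
qed

text \<open>The parameter \<open>h\<close> of \<open>cluster_law\<close>; it differs from
  \<open>cn\<close> by O(1/n).\<close>

definition rate :: "nat \<Rightarrow> real" where "rate n = - real n * ln (1 - p n)"

lemma rate_lim: "(\<lambda>n. sqrt (real n) * (rate n - c)) \<longlonglongrightarrow> \<theta>"
proof -
  have err: "(\<lambda>n. sqrt (real n) * (rate n - cn n)) \<longlonglongrightarrow> 0"
  proof (rule Lim_null_comparison)
    show "\<forall>\<^sub>F n in sequentially. norm (sqrt (real n) * (rate n - cn n)) \<le> 2 * (cn n)\<^sup>2 * (1 / sqrt (real n))"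
      using ev_p
    proof eventually_elim
      case (elim n)
      have n: "real n > 0" using elim by auto
      have "\<bar>ln (1 + - p n) - - p n\<bar> \<le> 2 * (- p n)\<^sup>2"
        using elim by (intro abs_ln_one_plus_x_minus_x_bound) auto
      then have b: "\<bar>ln (1 - p n) + p n\<bar> \<le> 2 * (p n)\<^sup>2" by simp
      have "rate n - cn n = - (real n * (ln (1 - p n) + p n))"
        using elim by (simp add: rate_def distrib_left)
      then have "\<bar>rate n - cn n\<bar> = real n * \<bar>ln (1 - p n) + p n\<bar>" by (simp add: abs_mult)
      also have "\<dots> \<le> real n * (2 * (p n)\<^sup>2)" using b by (intro mult_left_mono) auto
      also have "\<dots> = 2 * (real n * p n)\<^sup>2 / real n" using n by (simp add: power2_eq_square)
      finally have "\<bar>rate n - cn n\<bar> \<le> 2 * (cn n)\<^sup>2 / real n" using elim by simp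
      then have "sqrt (real n) * \<bar>rate n - cn n\<bar> \<le> sqrt (real n) * (2 * (cn n)\<^sup>2 / real n)"
        by (intro mult_left_mono) auto
      also have "\<dots> = 2 * (cn n)\<^sup>2 * (sqrt (real n) / real n)" by simp
      also have "sqrt (real n) / real n = 1 / sqrt (real n)" using n by (simp add: sqrt_divide_self_eq inverse_eq_divide)
      finally show ?case by (simp add: abs_mult)
    qed
    have "(\<lambda>n. 2 * (cn n)\<^sup>2 * (1 / sqrt (real n))) \<longlonglongrightarrow> 2 * c\<^sup>2 * 0"
      by (intro tendsto_intros cn_tendsto) real_asymp
    then show "(\<lambda>n. 2 * (cn n)\<^sup>2 * (1 / sqrt (real n))) \<longlonglongrightarrow> 0" by simp
  qed
  have "(\<lambda>n. sqrt (real n) * (rate n - cn n) + sqrt (real n) * (cn n - c)) \<longlonglongrightarrow> 0 + \<theta>"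
    by (rule tendsto_add[OF err cn_lim])
  then show ?thesis by (simp add: algebra_simps)
qed

lemma rate_tendsto: "rate \<longlonglongrightarrow> c"
proof -
  have "(\<lambda>n. 1 / sqrt (real n)) \<longlonglongrightarrow> 0" by real_asymp
  then have "(\<lambda>n. 1 / sqrt (real n) * (sqrt (real n) * (rate n - c)) + c) \<longlonglongrightarrow> 0 * \<theta> + c"
    by (intro tendsto_intros rate_lim)
  moreover have "\<forall>\<^sub>F n in sequentially. 1 / sqrt (real n) * (sqrt (real n) * (rate n - c)) + c = rate n"
    using eventually_gt_at_top[of 0] by eventually_elim simp
  ultimately show ?thesis by (simp add: Lim_transform_eventually)
qed

text \<open>The edge probability after weighting every edge with \<open>exp (\<nu> / \<surd>n)\<close>, with normalising constant
  \<open>rho \<nu> n\<close>.\<close>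

definition tilted_p :: "real \<Rightarrow> nat \<Rightarrow> real" where
  "tilted_p \<nu> n = p n * exp (\<nu> / sqrt (real n)) / rho \<nu> n"

definition tilted_rate :: "real \<Rightarrow> nat \<Rightarrow> real" where "tilted_rate \<nu> n = - real n * ln (1 - tilted_p \<nu> n)"

lemma tilted_p_bounds: "\<forall>\<^sub>F n in sequentially. 0 < tilted_p \<nu> n \<and> tilted_p \<nu> n < 1 \<and> 1 - tilted_p \<nu> n = (1 - p n) / rho \<nu> n"
  using ev_p rho_pos[of \<nu>]
proof eventually_elim
  case (elim n)
  have eq: "1 - tilted_p \<nu> n = (1 - p n) / rho \<nu> n"
    using elim by (simp add: tilted_p_def rho_def field_simps)
  moreover have "0 < (1 - p n) / rho \<nu> n" using elim by simp
  moreover have "0 < tilted_p \<nu> n" using elim by (simp add: tilted_p_def)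
  ultimately show ?case by simp
qed

text \<open>The tilted rate is \<open>rate\<close> plus n ln (\<open>rho\<close>), and the latter is
  c \<nu>/sqrt n to leading order: tilting only shifts \<theta>.\<close>

lemma tilted_rate_lim: "(\<lambda>n. sqrt (real n) * (tilted_rate \<nu> n - c)) \<longlonglongrightarrow> \<theta> + c * \<nu>"
proof -
  have "(\<lambda>n. 1 / sqrt (real n)) \<longlonglongrightarrow> 0" by real_asymp
  then have "(\<lambda>n. sqrt (real n) * (rate n - c) +
      (((real n)\<^sup>2 * ln (rho \<nu> n) - sqrt (real n) * (c * \<nu>)) * (1 / sqrt (real n)) + c * \<nu>)) \<longlonglongrightarrow>
      \<theta> + ((\<theta> * \<nu> + c * \<nu>\<^sup>2 / 2) * 0 + c * \<nu>)"
    by (intro tendsto_intros rate_lim ln_rho)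
  moreover have "\<forall>\<^sub>F n in sequentially. sqrt (real n) * (rate n - c) +
      (((real n)\<^sup>2 * ln (rho \<nu> n) - sqrt (real n) * (c * \<nu>)) * (1 / sqrt (real n)) + c * \<nu>) =
      sqrt (real n) * (tilted_rate \<nu> n - c)"
    using ev_p rho_pos[of \<nu>] tilted_p_bounds[of \<nu>]
  proof eventually_elim
    case (elim n)
    have n: "real n > 0" using elim by auto
    have e: "ln (1 - tilted_p \<nu> n) = ln (1 - p n) - ln (rho \<nu> n)"
    proof -
      have "1 - p n \<noteq> 0 \<and> rho \<nu> n \<noteq> 0" using elim by linarith
      then show ?thesis using elim ln_div[of "1 - p n" "rho \<nu> n"] by metis
    qed
    have "tilted_rate \<nu> n = rate n + real n * ln (rho \<nu> n)"
      unfolding tilted_rate_def rate_def e by (simp add: algebra_simps)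
    moreover have "(real n)\<^sup>2 * (1 / sqrt (real n)) = sqrt (real n) * real n"
    proof -
      have "real n * (1 / sqrt (real n)) = sqrt (real n)" by (simp add: real_div_sqrt)
      then show ?thesis unfolding power2_eq_square mult.assoc by (simp only: mult.commute)
    qed
    then have "(real n)\<^sup>2 * ln (rho \<nu> n) * (1 / sqrt (real n)) = sqrt (real n) * (real n * ln (rho \<nu> n))"
      by (metis mult.assoc mult.commute)
    moreover have "sqrt (real n) * (c * \<nu>) * (1 / sqrt (real n)) = c * \<nu>" using n by simp
    ultimately show ?case by (simp only: left_diff_distrib) (simp add: algebra_simps)
  qed
  ultimately show ?thesis by (simp add: Lim_transform_eventually)
qed

end

lemma abs_ln_diff_le:
  fixes x y m :: real
  assumes "0 < m" "m \<le> x" "m \<le> y"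
  shows "\<bar>ln x - ln y\<bar> \<le> \<bar>x - y\<bar> / m"
proof -
  have *: "ln a - ln b \<le> \<bar>a - b\<bar> / m" if "m \<le> a" "m \<le> b" for a b :: real
  proof -
    have "ln a - ln b = ln (a / b)" using that assms(1) by (simp add: ln_div)
    also have "\<dots> \<le> a / b - 1" using that assms(1) by (intro ln_le_minus_one) auto
    also have "\<dots> = (a - b) / b" using that assms(1) by (simp add: field_simps)
    also have "\<dots> \<le> \<bar>a - b\<bar> / b" using that assms(1) by (intro divide_right_mono) auto
    also have "\<dots> \<le> \<bar>a - b\<bar> / m" using that assms(1) by (intro divide_left_mono) auto
    finally show ?thesis .
  qed
  show ?thesis using *[OF assms(2,3)] *[OF assms(3,2)] by (simp add: abs_le_iff abs_minus_commute)
qed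

lemma real_choose_two: "real (n choose 2) = real n * (real n - 1) / 2"
proof (cases n)
  case (Suc k)
  have "even (Suc k * k)" by simp
  then have "2 * (Suc k choose 2) = Suc k * k" unfolding choose_two by simp
  then have "2 * real (Suc k choose 2) = real (Suc k) * real k" by (metis of_nat_mult of_nat_numeral)
  then show ?thesis using Suc by simp
qed simp

section \<open>Joint exponential moments of the size and the edges inside and outside\<close>

locale giant = sparse +
  fixes \<beta> \<alpha> \<gamma> :: real
  assumes c_super: "1 < c"
    and \<beta>: "0 < \<beta>" "\<beta> < 1" "1 - \<beta> = exp (- \<beta> * c)"
    and \<alpha>: "\<alpha> = 1 - \<beta> - c * (1 - \<beta>)\<^sup>2 / 2"
    and \<gamma>: "\<gamma> = (c - 1) * \<beta> - c * \<beta>\<^sup>2 / 2"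
begin

text \<open>The same c and \<beta> for every \<nu>, so the window \<open>near\<close> and the
  constants \<open>a\<^sub>0\<close>, \<open>b\<^sub>0\<close> are shared by all tilts.\<close>

lemma supercritical_tilted: "supercritical c \<beta> (\<theta> + c * \<nu>) (tilted_rate \<nu>) (\<lambda>n. cluster_wt (tilted_p \<nu> n) n)"
proof
  show "\<forall>\<^sub>F n in sequentially. cluster_law n (tilted_rate \<nu> n) (cluster_wt (tilted_p \<nu> n) n)"
    using tilted_p_bounds[of \<nu>] ev_p
  proof eventually_elim
    case (elim n)
    then show ?case unfolding tilted_rate_def by (intro cluster_law_cluster_wt) linarith+
  qed
qed (use c_super \<beta> tilted_rate_lim in auto)

sublocale supercritical c \<beta> \<theta> rate "\<lambda>n. cluster_wt (p n) n"
proof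
  show "\<forall>\<^sub>F n in sequentially. cluster_law n (rate n) (cluster_wt (p n) n)"
    using ev_p
  proof eventually_elim
    case (elim n)
    then show ?case unfolding rate_def by (intro cluster_law_cluster_wt) linarith+
  qed
qed (use c_super \<beta> rate_lim in auto)

text \<open>One minus the mean degree of the graph outside the giant.\<close>

definition \<tau> :: real where "\<tau> = 1 - c * (1 - \<beta>)"

lemma \<tau>_pos: "\<tau> > 0" using dual_subcritical[OF \<beta>] by (simp add: \<tau>_def)

text \<open>\<open>Va\<close> counts the components as if the graph outside the component of size \<open>s\<close>, which has \<open>e2\<close>
  edges, were a forest.\<close>

definition Va :: "nat \<Rightarrow> nat \<Rightarrow> real \<Rightarrow> real" where
  "Va n s e2 = (1 + real n - real s - e2 - \<alpha> * real n) / sqrt (real n)"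

definition Vb :: "nat \<Rightarrow> nat \<Rightarrow> real" where
  "Vb n s = (real s - \<beta> * real n) / sqrt (real n)"

definition Vc :: "nat \<Rightarrow> nat \<Rightarrow> real \<Rightarrow> real" where
  "Vc n s e1 = (e1 - real s + 1 - \<gamma> * real n) / sqrt (real n)"

text \<open>A sum over all components of near size, because such sums factorise by independence; no
  choice of a giant component is involved yet.\<close>

definition near_exp :: "nat \<Rightarrow> (nat \<Rightarrow> real \<Rightarrow> real \<Rightarrow> real) \<Rightarrow> real" where
  "near_exp n f = gexp (p n) (pairs {1..n}) (\<lambda>E. \<Sum>S\<in>comps {1..n} E. of_bool (card S \<in> near n) *
     f (card S) (real (card (E \<inter> pairs S))) (real (card (E \<inter> pairs ({1..n} - S)))))"

text \<open>The powers of \<open>rho\<close> are the normalising constants left over when the weight of the cluster size \<open>s\<close> is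
  tilted from \<open>p\<close> to \<open>tilted_p l3\<close>.\<close>

definition near_exponent :: "real \<Rightarrow> real \<Rightarrow> real \<Rightarrow> nat \<Rightarrow> nat \<Rightarrow> real" where
  "near_exponent l1 l2 l3 n s = ln (real n / real s) +
     (l1 * (1 + real n - real s - \<alpha> * real n) + l2 * (real s - \<beta> * real n) + l3 * (1 - real s - \<gamma> * real n)) / sqrt (real n) +
     (real s * (real n - real s) + real s * (real s - 1) / 2) * ln (rho l3 n) +
     (real n - real s) * (real n - real s - 1) / 2 * ln (rho (- l1) n)"

text \<open>\<open>Vc\<close> grows with the inside edges and \<open>Va\<close> falls with the
  outside ones, so their weights per edge are exp (l3/sqrt n) and exp (-l1/sqrt n). Only the inside
  weight alters the law of the cluster size; the outside edges contribute a normalising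
  constant.\<close>

lemma near_exp_mgf:
  "\<forall>\<^sub>F n in sequentially. near_exp n (\<lambda>s e1 e2. exp (l1 * Va n s e2 + l2 * Vb n s + l3 * Vc n s e1)) =
     (\<Sum>s\<in>near n. cluster_wt (tilted_p l3 n) n s * exp (near_exponent l1 l2 l3 n s))"
  using ev_p rho_pos[of l3] rho_pos[of "- l1"]
proof eventually_elim
  case (elim n)
  define r1 where "r1 = exp (l3 / sqrt (real n))"
  define r2 where "r2 = exp (- l1 / sqrt (real n))"
  define L where "L s = (l1 * (1 + real n - real s - \<alpha> * real n) + l2 * (real s - \<beta> * real n) +
     l3 * (1 - real s - \<gamma> * real n)) / sqrt (real n)" for s
  define f where "f s = of_bool (s \<in> near n) * exp (L s)" for s
  have rho1: "1 - p n + p n * r1 = rho l3 n" and rho2: "1 - p n + p n * r2 = rho (- l1) n"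
    by (simp_all add: rho_def r1_def r2_def)
  have pt: "of_bool (s \<in> near n) * exp (l1 * Va n s (real e2) + l2 * Vb n s + l3 * Vc n s (real e1)) =
      f s * r1 ^ e1 * r2 ^ e2" for s e1 e2
  proof -
    have eq: "l1 * Va n s (real e2) + l2 * Vb n s + l3 * Vc n s (real e1) =
        L s + real e1 * (l3 / sqrt (real n)) + real e2 * (- l1 / sqrt (real n))"
      by (simp add: Va_def Vb_def Vc_def L_def add_divide_distrib diff_divide_distrib algebra_simps)
    show ?thesis
      unfolding eq exp_add exp_of_nat_mult f_def r1_def r2_def by (simp only: mult_ac)
  qed
  have "near_exp n (\<lambda>s e1 e2. exp (l1 * Va n s e2 + l2 * Vb n s + l3 * Vc n s e1)) =
      gexp (p n) (pairs {1..n}) (\<lambda>E. \<Sum>S\<in>comps {1..n} E.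
        f (card S) * r1 ^ card (E \<inter> pairs S) * r2 ^ card (E \<inter> pairs ({1..n} - S)))"
    unfolding near_exp_def pt ..
  also have "\<dots> = (\<Sum>s=1..n. real n / real s * cluster_wt (tilted_p l3 n) n s *
      (f s * (rho l3 n) ^ (s * (n - s) + (s choose 2)) * (rho (- l1) n) ^ ((n - s) choose 2)))"
  proof -
    have "tilted_p l3 n = p n * r1 / rho l3 n" by (simp add: tilted_p_def r1_def)
    moreover have "p n < 1" using elim by simp
    ultimately show ?thesis
      using gexp_sum_comps_tilt[of "{1..n}" "p n" r1 r2 f] elim(2,3)
      unfolding rho1 rho2 by simp
  qed
  also have "\<dots> = (\<Sum>s\<in>near n. cluster_wt (tilted_p l3 n) n s * exp (near_exponent l1 l2 l3 n s))"
  proof (rule sum.mono_neutral_cong_right)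
    show "near n \<subseteq> {1..n}" by (auto simp: near_def)
    fix s assume s: "s \<in> near n"
    then have s1: "1 \<le> s" "s \<le> n" by (auto simp: near_def)
    have "(rho l3 n) ^ (s * (n - s) + (s choose 2)) =
        exp ((real s * (real n - real s) + real s * (real s - 1) / 2) * ln (rho l3 n))"
      using elim s1 by (subst power_of_ln) (simp_all add: real_choose_two of_nat_diff)
    moreover have "(rho (- l1) n) ^ ((n - s) choose 2) =
        exp ((real n - real s) * (real n - real s - 1) / 2 * ln (rho (- l1) n))"
      using elim s1 by (subst power_of_ln) (simp_all add: real_choose_two of_nat_diff)
    moreover have "real n / real s = exp (ln (real n / real s))" using s1 by simp
    ultimately show "real n / real s * cluster_wt (tilted_p l3 n) n s *
      (f s * (rho l3 n) ^ (s * (n - s) + (s choose 2)) * (rho (- l1) n) ^ ((n - s) choose 2)) =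
      cluster_wt (tilted_p l3 n) n s * exp (near_exponent l1 l2 l3 n s)"
      using s by (simp add: near_exponent_def L_def[symmetric] f_def exp_add mult_ac)
  qed (auto simp: f_def)
  finally show ?case .
qed

text \<open>\<alpha> and \<gamma> are the constants for which the terms of order sqrt n cancel at s
  = \<beta> n; what is left of that order is linear in the deviation with slope -\<tau> for both.
  The coefficients (1 - \<beta>)^2/2 and \<beta> - \<beta>^2/2 are the numbers of pairs outside the
  giant and of pairs meeting it, divided by n^2.\<close>

lemma near_exponent_expansion:
  "\<exists>q. q \<longlonglongrightarrow> 0 \<and> (\<forall>\<^sub>F n in sequentially. \<forall>s\<in>near n.
    \<bar>near_exponent l1 l2 l3 n s - (((\<theta> * l3 + c * l3\<^sup>2 / 2) * (\<beta> - \<beta>\<^sup>2 / 2) + (- \<theta> * l1 + c * l1\<^sup>2 / 2) * ((1 - \<beta>)\<^sup>2 / 2) - ln \<beta>) +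
       (l2 - \<tau> * l1 - \<tau> * l3) * ((real s - \<beta> * real n) / sqrt (real n)))\<bar> \<le> q n)"
proof -
  define u where "u n = (real n)\<^sup>2 * ln (rho l3 n) - sqrt (real n) * (c * l3)" for n
  define v where "v n = (real n)\<^sup>2 * ln (rho (- l1) n) - sqrt (real n) * (c * - l1)" for n
  define u0 where "u0 = \<theta> * l3 + c * l3\<^sup>2 / 2"
  define v0 where "v0 = - \<theta> * l1 + c * l1\<^sup>2 / 2"
  have u: "u \<longlonglongrightarrow> u0" using ln_rho[of l3] by (simp add: u_def[abs_def] u0_def)
  have v: "v \<longlonglongrightarrow> v0" using ln_rho[of "- l1"] by (simp add: v_def[abs_def] v0_def)
  define q0 where "q0 n = 2 / \<beta> * real n powr (-1/3) + \<bar>l1 + l3\<bar> / sqrt (real n) +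
      c * (\<bar>l1\<bar> + \<bar>l3\<bar>) * (sqrt (real n) * (real n powr (-1/3))\<^sup>2) + (\<bar>u0\<bar> + \<bar>v0\<bar>) * real n powr (-1/3) +
      (c * \<bar>l3\<bar> + c * \<bar>l1\<bar>) / sqrt (real n)" for n
  define q where "q n = q0 n + (\<bar>u n - u0\<bar> + \<bar>v n - v0\<bar>) + (\<bar>u n\<bar> + \<bar>v n\<bar>) * (1 / real n)" for n
  have "q0 \<longlonglongrightarrow> 0" unfolding q0_def using \<beta>(1) c_pos by real_asymp
  moreover have "(\<lambda>n. 1 / real n) \<longlonglongrightarrow> 0" by real_asymp
  ultimately have "q \<longlonglongrightarrow> 0 + (\<bar>u0 - u0\<bar> + \<bar>v0 - v0\<bar>) + (\<bar>u0\<bar> + \<bar>v0\<bar>) * 0"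
    unfolding q_def by (intro tendsto_intros u v)
  then have "q \<longlonglongrightarrow> 0" by simp
  moreover have "\<forall>\<^sub>F n in sequentially. real n powr (-1/3) < \<beta> / 2"
  proof -
    have "(\<lambda>n. real n powr (-1/3)) \<longlonglongrightarrow> 0" by real_asymp
    then show ?thesis by (rule order_tendstoD) (use \<beta>(1) in simp)
  qed
  then have "\<forall>\<^sub>F n in sequentially. \<forall>s\<in>near n.
    \<bar>near_exponent l1 l2 l3 n s - ((u0 * (\<beta> - \<beta>\<^sup>2 / 2) + v0 * ((1 - \<beta>)\<^sup>2 / 2) - ln \<beta>) +
       (l2 - \<tau> * l1 - \<tau> * l3) * ((real s - \<beta> * real n) / sqrt (real n)))\<bar> \<le> q n"
    using eventually_ge_at_top[of 1]
  proof eventually_elim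
    case (elim n)
    show ?case
    proof
      fix s assume s: "s \<in> near n"
      then have s1: "1 \<le> s" "s \<le> n" by (auto simp: near_def)
      define r where "r = sqrt (real n)"
      define \<sigma> where "\<sigma> = real s / real n"
      define t where "t = \<sigma> - \<beta>"
      define \<delta> where "\<delta> = real n powr (-1/3)"
      have n: "real n > 0" using elim by auto
      have r: "r > 0" "real n = r\<^sup>2" using n by (auto simp: r_def)
      have \<sigma>: "0 < \<sigma>" "\<sigma> \<le> 1" using s1 by (auto simp: \<sigma>_def)
      have t: "\<bar>t\<bar> \<le> \<delta>" using near_scale[of n s] s elim by (simp add: t_def \<sigma>_def \<delta>_def)
      have \<delta>: "0 \<le> \<delta>" "\<delta> < \<beta> / 2" using elim by (simp_all add: \<delta>_def)
      have \<sigma>\<beta>: "\<beta> / 2 \<le> \<sigma>" using t \<delta> by (simp add: t_def abs_le_iff)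
      have s_eq: "real s = \<sigma> * r\<^sup>2" using n r by (simp add: \<sigma>_def)
      define lu where "lu = ln (rho l3 n)"
      define lv where "lv = ln (rho (- l1) n)"
      have r4: "r ^ 4 = (real n)\<^sup>2" by (simp add: r(2) flip: power_mult)
      have un: "r ^ 4 * lu = r * (c * l3) + u n"
        unfolding r4 by (simp add: u_def lu_def r_def)
      have vn: "r ^ 4 * lv = - (r * (c * l1)) + v n"
        unfolding r4 by (simp add: v_def lv_def r_def)
      have y: "(real s - \<beta> * real n) / sqrt (real n) = r * t"
        unfolding s_eq r(2) using r(1) by (simp add: r_def[symmetric] t_def power2_eq_square field_simps)
      define L where "L = l1 * (1 - \<sigma> - \<alpha>) + l2 * t + l3 * (- \<sigma> - \<gamma>)"
      have lin: "(l1 * (1 + real n - real s - \<alpha> * real n) + l2 * (real s - \<beta> * real n) + l3 * (1 - real s - \<gamma> * real n)) / sqrt (real n) =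
          r * L + (l1 + l3) / r"
        unfolding s_eq r_def[symmetric] unfolding r(2) L_def t_def using r(1)
        by (simp add: field_simps power2_eq_square)
      have e1: "(real s * (real n - real s) + real s * (real s - 1) / 2) * lu =
          (\<sigma> - \<sigma>\<^sup>2 / 2) * (r * (c * l3) + u n) - \<sigma> / (2 * r\<^sup>2) * (r * (c * l3) + u n)"
        unfolding un[symmetric] s_eq r(2) using r(1)
        by (simp add: field_simps power2_eq_square power4_eq_xxxx)
      have e2: "(real n - real s) * (real n - real s - 1) / 2 * lv =
          ((1 - \<sigma>)\<^sup>2 / 2) * (- (r * (c * l1)) + v n) - (1 - \<sigma>) / (2 * r\<^sup>2) * (- (r * (c * l1)) + v n)"
        unfolding vn[symmetric] s_eq r(2) using r(1)
        by (simp add: field_simps power2_eq_square power4_eq_xxxx)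
      have lnq: "ln (real n / real s) = - ln \<sigma>" using s1 by (simp add: \<sigma>_def ln_div)
      have "near_exponent l1 l2 l3 n s - ((u0 * (\<beta> - \<beta>\<^sup>2 / 2) + v0 * ((1 - \<beta>)\<^sup>2 / 2) - ln \<beta>) + (l2 - \<tau> * l1 - \<tau> * l3) * (r * t)) =
          (ln \<beta> - ln \<sigma>) + (l1 + l3) / r - c * (l1 + l3) / 2 * (r * t\<^sup>2) +
          ((u n - u0) * (\<sigma> - \<sigma>\<^sup>2 / 2) + u0 * (t * (1 - (\<sigma> + \<beta>) / 2))) +
          ((v n - v0) * ((1 - \<sigma>)\<^sup>2 / 2) - v0 * (t * ((2 - \<sigma> - \<beta>) / 2))) -
          \<sigma> / (2 * r\<^sup>2) * (r * (c * l3) + u n) - (1 - \<sigma>) / (2 * r\<^sup>2) * (- (r * (c * l1)) + v n)"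
      proof -
        \<comment> \<open>The cancellation: an exact identity, whose quadratic remainder r t^2 is of
          order n^(-1/6) on the window.\<close>
        have "r * L + (\<sigma> - \<sigma>\<^sup>2 / 2) * (r * (c * l3)) + ((1 - \<sigma>)\<^sup>2 / 2) * (- (r * (c * l1))) =
            (l2 - \<tau> * l1 - \<tau> * l3) * (r * t) - c * (l1 + l3) / 2 * (r * t\<^sup>2)"
          unfolding L_def \<tau>_def t_def \<alpha> \<gamma> by (simp add: field_simps power2_eq_square)
        moreover have "u n * (\<sigma> - \<sigma>\<^sup>2 / 2) = (u n - u0) * (\<sigma> - \<sigma>\<^sup>2 / 2) + u0 * (t * (1 - (\<sigma> + \<beta>) / 2)) + u0 * (\<beta> - \<beta>\<^sup>2 / 2)"
          unfolding t_def by (simp add: field_simps power2_eq_square)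
        moreover have "v n * ((1 - \<sigma>)\<^sup>2 / 2) = (v n - v0) * ((1 - \<sigma>)\<^sup>2 / 2) - v0 * (t * ((2 - \<sigma> - \<beta>) / 2)) + v0 * ((1 - \<beta>)\<^sup>2 / 2)"
          unfolding t_def by (simp add: field_simps power2_eq_square)
        moreover have "near_exponent l1 l2 l3 n s = - ln \<sigma> + (r * L + (l1 + l3) / r) +
            ((\<sigma> - \<sigma>\<^sup>2 / 2) * (r * (c * l3) + u n) - \<sigma> / (2 * r\<^sup>2) * (r * (c * l3) + u n)) +
            (((1 - \<sigma>)\<^sup>2 / 2) * (- (r * (c * l1)) + v n) - (1 - \<sigma>) / (2 * r\<^sup>2) * (- (r * (c * l1)) + v n))"
          unfolding near_exponent_def lin lnq e1[unfolded lu_def] e2[unfolded lv_def] ..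
        ultimately show ?thesis
          by (simp only: distrib_left mult.commute[of "u n"] mult.commute[of "v n"])
      qed
      also have "\<bar>\<dots>\<bar> \<le> q n"
      proof -
        have b1: "\<bar>ln \<beta> - ln \<sigma>\<bar> \<le> 2 / \<beta> * \<delta>"
        proof -
          have "\<bar>ln \<beta> - ln \<sigma>\<bar> \<le> \<bar>\<beta> - \<sigma>\<bar> / (\<beta> / 2)" using \<beta>(1) \<sigma>\<beta> by (intro abs_ln_diff_le) auto
          also have "\<dots> \<le> \<delta> / (\<beta> / 2)" using t \<beta>(1) by (intro divide_right_mono) (auto simp: t_def abs_minus_commute)
          finally show ?thesis by (simp add: mult.commute)
        qed
        have b2: "\<bar>(l1 + l3) / r\<bar> = \<bar>l1 + l3\<bar> / r" using r(1) by simp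
        have b3: "\<bar>c * (l1 + l3) / 2 * (r * t\<^sup>2)\<bar> \<le> c * (\<bar>l1\<bar> + \<bar>l3\<bar>) * (r * \<delta>\<^sup>2)"
        proof -
          have "t\<^sup>2 \<le> \<delta>\<^sup>2" using t power_mono[of "\<bar>t\<bar>" \<delta> 2] by simp
          then have "\<bar>r * t\<^sup>2\<bar> \<le> r * \<delta>\<^sup>2" using r(1) by (simp add: abs_mult)
          moreover have "\<bar>c * (l1 + l3) / 2\<bar> \<le> c * (\<bar>l1\<bar> + \<bar>l3\<bar>)"
          proof -
            have "\<bar>l1 + l3\<bar> / 2 \<le> \<bar>l1\<bar> + \<bar>l3\<bar>" 
              by (rule order_trans[OF _ abs_triangle_ineq]) simp
            then have "c * (\<bar>l1 + l3\<bar> / 2) \<le> c * (\<bar>l1\<bar> + \<bar>l3\<bar>)" using c_pos by (intro mult_left_mono) auto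
            then show ?thesis using c_pos by (simp add: abs_mult)
          qed
          ultimately show ?thesis unfolding abs_mult[of "c * (l1 + l3) / 2"]
            using c_pos by (intro mult_mono) auto
        qed
        have s2: "0 \<le> \<sigma> - \<sigma>\<^sup>2 / 2" "\<sigma> - \<sigma>\<^sup>2 / 2 \<le> 1"
        proof -
          have "\<sigma>\<^sup>2 \<le> \<sigma>" using \<sigma> mult_left_le[of \<sigma> \<sigma>] by (simp add: power2_eq_square)
          then show "0 \<le> \<sigma> - \<sigma>\<^sup>2 / 2" using \<sigma> by linarith
          show "\<sigma> - \<sigma>\<^sup>2 / 2 \<le> 1" using \<sigma> zero_le_power2[of \<sigma>] by linarith
        qed
        have s3: "0 \<le> (1 - \<sigma>)\<^sup>2 / 2" "(1 - \<sigma>)\<^sup>2 / 2 \<le> 1"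
          using \<sigma> power_le_one[of "1 - \<sigma>" 2] by auto
        have b4: "\<bar>(u n - u0) * (\<sigma> - \<sigma>\<^sup>2 / 2)\<bar> \<le> \<bar>u n - u0\<bar>" "\<bar>(v n - v0) * ((1 - \<sigma>)\<^sup>2 / 2)\<bar> \<le> \<bar>v n - v0\<bar>"
          unfolding abs_mult abs_of_nonneg[OF s2(1)] abs_of_nonneg[OF s3(1)]
          by (rule mult_left_le[OF s2(2) abs_ge_zero] mult_left_le[OF s3(2) abs_ge_zero])+
        have "\<bar>t * (1 - (\<sigma> + \<beta>) / 2)\<bar> \<le> \<delta> * 1" unfolding abs_mult
          using t \<sigma> \<beta>(1,2) \<delta> by (intro mult_mono) auto
        then have b5: "\<bar>u0 * (t * (1 - (\<sigma> + \<beta>) / 2))\<bar> \<le> \<bar>u0\<bar> * \<delta>"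
          unfolding abs_mult[of u0] by (intro mult_left_mono) auto
        have "\<bar>t * ((2 - \<sigma> - \<beta>) / 2)\<bar> \<le> \<delta> * 1" unfolding abs_mult
          using t \<sigma> \<beta>(1,2) \<delta> by (intro mult_mono) auto
        then have b6: "\<bar>v0 * (t * ((2 - \<sigma> - \<beta>) / 2))\<bar> \<le> \<bar>v0\<bar> * \<delta>"
          unfolding abs_mult[of v0] by (intro mult_left_mono) auto
        have gen: "\<bar>k / (2 * r\<^sup>2) * (x + w)\<bar> \<le> \<bar>x\<bar> / r\<^sup>2 + \<bar>w\<bar> * (1 / r\<^sup>2)" if "0 \<le> k" "k \<le> 1" for k x w
        proof -
          have "\<bar>k / (2 * r\<^sup>2)\<bar> \<le> 1 / r\<^sup>2" using that r(1) by (simp add: frac_le)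
          then have "\<bar>k / (2 * r\<^sup>2)\<bar> * \<bar>x + w\<bar> \<le> 1 / r\<^sup>2 * (\<bar>x\<bar> + \<bar>w\<bar>)"
            by (intro mult_mono abs_triangle_ineq) auto
          then show ?thesis unfolding abs_mult[symmetric] by (simp add: add_divide_distrib)
        qed
        have rc: "\<bar>r * (c * l)\<bar> / r\<^sup>2 = c * \<bar>l\<bar> / r" for l
          using r(1) c_pos by (simp add: abs_mult power2_eq_square)
        have b7: "\<bar>\<sigma> / (2 * r\<^sup>2) * (r * (c * l3) + u n)\<bar> \<le> c * \<bar>l3\<bar> / r + \<bar>u n\<bar> * (1 / r\<^sup>2)"
          using gen[of \<sigma> "r * (c * l3)" "u n"] \<sigma> rc[of l3] by simp
        have b8: "\<bar>(1 - \<sigma>) / (2 * r\<^sup>2) * (- (r * (c * l1)) + v n)\<bar> \<le> c * \<bar>l1\<bar> / r + \<bar>v n\<bar> * (1 / r\<^sup>2)"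
          using gen[of "1 - \<sigma>" "- (r * (c * l1))" "v n"] \<sigma> rc[of l1] by simp
        have q: "q n = 2 / \<beta> * \<delta> + \<bar>l1 + l3\<bar> / r + c * (\<bar>l1\<bar> + \<bar>l3\<bar>) * (r * \<delta>\<^sup>2) + (\<bar>u0\<bar> * \<delta> + \<bar>v0\<bar> * \<delta>) +
            (c * \<bar>l3\<bar> / r + c * \<bar>l1\<bar> / r) + (\<bar>u n - u0\<bar> + \<bar>v n - v0\<bar>) + (\<bar>u n\<bar> * (1 / r\<^sup>2) + \<bar>v n\<bar> * (1 / r\<^sup>2))"
        proof -
          have "1 / real n = 1 / r\<^sup>2" by (simp add: r(2))
          then show ?thesis
            unfolding q_def q0_def \<delta>_def[symmetric] r_def[symmetric]
            by (simp only: add_divide_distrib distrib_right)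
        qed
        \<comment> \<open>Stated for abstract reals so that linear arithmetic does not meet the
          products.\<close>
        have tri: "\<bar>x1 + x2 - x3 + (x4 + x5) + (x6 - x7) - x8 - x9\<bar> \<le> A1 + A2 + A3 + (A5 + A7) + (B8 + B9) + (A4 + A6) + (C8 + C9)"
          if "\<bar>x1\<bar> \<le> A1" "\<bar>x2\<bar> \<le> A2" "\<bar>x3\<bar> \<le> A3" "\<bar>x4\<bar> \<le> A4" "\<bar>x5\<bar> \<le> A5" "\<bar>x6\<bar> \<le> A6" "\<bar>x7\<bar> \<le> A7"
            "\<bar>x8\<bar> \<le> B8 + C8" "\<bar>x9\<bar> \<le> B9 + C9"
          for x1 x2 x3 x4 x5 x6 x7 x8 x9 A1 A2 A3 A4 A5 A6 A7 B8 B9 C8 C9 :: real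
          using that unfolding abs_le_iff by linarith
        show ?thesis unfolding q
          by (rule tri[OF b1 eq_refl[OF b2] b3 b4(1) b5 b4(2) b6 b7 b8])
      qed
      finally show "\<bar>near_exponent l1 l2 l3 n s - ((u0 * (\<beta> - \<beta>\<^sup>2 / 2) + v0 * ((1 - \<beta>)\<^sup>2 / 2) - ln \<beta>) +
         (l2 - \<tau> * l1 - \<tau> * l3) * ((real s - \<beta> * real n) / sqrt (real n)))\<bar> \<le> q n" unfolding y .
    qed
  qed
  ultimately show ?thesis unfolding u0_def v0_def by blast
qed

end

text \<open>One coordinate at a time: the exponentials and test functions of the other two count as
  part of the weights, and the limits of the latter multiply since the limiting moment is a
  product.\<close>

lemma mgf_convergence_triple:
  fixes A :: "nat \<Rightarrow> 'i set" and wt X Y Z :: "nat \<Rightarrow> 'i \<Rightarrow> real" and f g h :: "real \<Rightarrow> real"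
  assumes fin: "\<And>n. finite (A n)"
    and wt: "\<forall>\<^sub>F n in sequentially. \<forall>i\<in>A n. 0 \<le> wt n i"
    and lim: "\<And>s t u. (\<lambda>n. \<Sum>i\<in>A n. wt n i * exp (s * X n i + t * Y n i + u * Z n i)) \<longlonglongrightarrow>
      exp (s\<^sup>2 / 2 + t\<^sup>2 / 2 + u\<^sup>2 / 2)"
    and cont: "continuous_on UNIV f" "continuous_on UNIV g" "continuous_on UNIV h"
    and bnd: "\<And>x. f x \<in> {0..1}" "\<And>x. g x \<in> {0..1}" "\<And>x. h x \<in> {0..1}"
  shows "(\<lambda>n. \<Sum>i\<in>A n. wt n i * (f (X n i) * g (Y n i) * h (Z n i))) \<longlonglongrightarrow>
    (\<integral>x. f x \<partial>std_normal_distribution) * (\<integral>x. g x \<partial>std_normal_distribution) * (\<integral>x. h x \<partial>std_normal_distribution)"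
proof -
  let ?I = "\<lambda>f. \<integral>x. f x \<partial>std_normal_distribution"
  have abs: "\<bar>f x\<bar> \<le> 1" "\<bar>g x\<bar> \<le> 1" "\<bar>h x\<bar> \<le> 1" for x using bnd[of x] by auto
  have I: "0 \<le> ?I g" "0 \<le> ?I h" using bnd by (auto intro!: integral_nonneg)
  have 1: "(\<lambda>n. \<Sum>i\<in>A n. (wt n i * exp (s * X n i + t * Y n i)) * h (Z n i)) \<longlonglongrightarrow> exp (s\<^sup>2 / 2 + t\<^sup>2 / 2) * ?I h" for s t
    using lim wt
    by (intro mgf_convergence[where M=1] fin cont abs)
      (auto simp: exp_add mult.assoc elim!: eventually_mono)
  have 2: "(\<lambda>n. \<Sum>i\<in>A n. (wt n i * exp (s * X n i) * h (Z n i)) * g (Y n i)) \<longlonglongrightarrow> (exp (s\<^sup>2 / 2) * ?I h) * ?I g" for s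
  proof (intro mgf_convergence[where M=1] fin cont abs)
    show "\<forall>\<^sub>F n in sequentially. \<forall>i\<in>A n. 0 \<le> wt n i * exp (s * X n i) * h (Z n i)"
      using wt by eventually_elim (use bnd in auto)
    show "(\<lambda>n. \<Sum>i\<in>A n. wt n i * exp (s * X n i) * h (Z n i) * exp (t * Y n i)) \<longlonglongrightarrow>
         exp (s\<^sup>2 / 2) * ?I h * exp (t\<^sup>2 / 2)" for t
      using 1[of s t] by (simp add: exp_add mult_ac)
  qed (use I in auto)
  have "(\<lambda>n. \<Sum>i\<in>A n. (wt n i * h (Z n i) * g (Y n i)) * f (X n i)) \<longlonglongrightarrow> (?I h * ?I g) * ?I f"
  proof (intro mgf_convergence[where M=1] fin cont abs)
    show "\<forall>\<^sub>F n in sequentially. \<forall>i\<in>A n. 0 \<le> wt n i * h (Z n i) * g (Y n i)"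
      using wt by eventually_elim (use bnd in auto)
    show "(\<lambda>n. \<Sum>i\<in>A n. wt n i * h (Z n i) * g (Y n i) * exp (t * X n i)) \<longlonglongrightarrow>
         ?I h * ?I g * exp (t\<^sup>2 / 2)" for t
      using 2[of t] by (simp add: mult_ac)
  qed (use I in auto)
  then show ?thesis by (simp add: mult_ac)
qed

text \<open>The inequality y < sinh y, which makes the third conditional variance positive in
  \<open>sd3\<close>.\<close>

lemma two_mult_less_exp_diff:
  fixes y :: real
  assumes "0 < y"
  shows "2 * y < exp y - exp (- y)"
proof -
  have "(\<lambda>x. exp x - exp (- x) - 2 * x) 0 < (\<lambda>x. exp x - exp (- x) - 2 * x) y"
  proof (rule DERIV_pos_imp_increasing_open[OF assms])
    fix x :: real assume x: "0 < x" "x < y"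
    have "exp x \<noteq> 1" using x by simp
    then have "0 < (exp x - 1)\<^sup>2 / exp x" by simp
    also have "(exp x - 1)\<^sup>2 / exp x = exp x + exp (- x) - 2"
      by (simp add: exp_minus power2_eq_square field_simps)
    finally have "0 < exp x + exp (- x) - 2" .
    moreover have "((\<lambda>x. exp x - exp (- x) - 2 * x) has_real_derivative exp x + exp (- x) - 2) (at x)"
      by (auto intro!: derivative_eq_intros)
    ultimately show "\<exists>d. ((\<lambda>x. exp x - exp (- x) - 2 * x) has_real_derivative d) (at x) \<and> 0 < d" by blast
  qed (intro continuous_intros)
  then show ?thesis by simp
qed

section \<open>The limiting covariance and its standard coordinates\<close>

context giant
begin

definition m1 :: real where "m1 = - \<theta> * (1 - \<beta>\<^sup>2) / 2"
definition m2 :: real where "m2 = \<theta> * \<beta> * (1 - \<beta>) / \<tau>"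
definition m3 :: real where "m3 = \<theta> * \<beta>\<^sup>2 / 2"
text \<open>Square roots from completing the limiting quadratic form to a sum of three squares:
  \<open>sd1\<close> belongs to the size, \<open>sd2\<close> and \<open>sd3\<close> to the component
  count and the excess after their regression on the size, which are uncorrelated in the
  limit.\<close>

definition sd1 :: real where "sd1 = sqrt (\<beta> * (1 - \<beta>)) / \<tau>"
definition sd2 :: real where "sd2 = sqrt (c / 2) * (1 - \<beta>)"
definition sd3 :: real where "sd3 = sqrt (c * \<beta> * (1 - \<beta> / 2 - c * (1 - \<beta>)))"

lemma sd1: "0 < sd1" "sd1\<^sup>2 = \<beta> * (1 - \<beta>) / \<tau>\<^sup>2"
  using \<beta>(1,2) \<tau>_pos by (auto simp: sd1_def power_divide)

lemma sd2: "0 < sd2" "sd2\<^sup>2 = c * (1 - \<beta>)\<^sup>2 / 2"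
  using \<beta>(1,2) c_pos by (auto simp: sd2_def power_mult_distrib)

text \<open>With u = 1 - \<beta> = exp (-\<beta> c), positivity amounts to 2 \<beta> c < 1/u - u,
  which is \<open>two_mult_less_exp_diff\<close> at \<beta> c.\<close>

lemma sd3: "0 < sd3" "sd3\<^sup>2 = c * \<beta> * (1 - \<beta> / 2 - c * (1 - \<beta>))"
proof -
  define u where "u = 1 - \<beta>"
  have u: "0 < u" "exp (- (\<beta> * c)) = u" using \<beta>(2,3) by (auto simp: u_def)
  then have "exp (\<beta> * c) = 1 / u" by (metis exp_minus inverse_eq_divide inverse_inverse_eq)
  moreover have "2 * (\<beta> * c) < exp (\<beta> * c) - exp (- (\<beta> * c))"
    by (rule two_mult_less_exp_diff) (use \<beta>(1) c_pos in simp)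
  ultimately have "2 * (\<beta> * c) < 1 / u - u" using u by simp
  then have "2 * (\<beta> * c) * u < (1 / u - u) * u" using u(1) by (rule mult_strict_right_mono)
  also have "\<dots> = 1 - u\<^sup>2" using u(1) by (simp add: power2_eq_square field_simps)
  also have "\<dots> = \<beta> * (2 - \<beta>)" by (simp add: u_def power2_eq_square algebra_simps)
  finally have "\<beta> * (2 * (c * u)) < \<beta> * (2 - \<beta>)" by (simp add: mult_ac)
  then have "0 < 1 - \<beta> / 2 - c * (1 - \<beta>)" using \<beta>(1) by (simp add: u_def)
  then have "0 < c * \<beta> * (1 - \<beta> / 2 - c * (1 - \<beta>))" using \<beta>(1) c_pos by simp
  then show "0 < sd3" "sd3\<^sup>2 = c * \<beta> * (1 - \<beta> / 2 - c * (1 - \<beta>))" by (simp_all add: sd3_def)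
qed

text \<open>\<open>near_mgf\<close> for the law tilted with \<open>l3\<close>. The factor n/s
  contributes -ln \<beta> to the exponent, which cancels the mass \<beta> of the near sizes, so the
  total mass of the limit is 1.\<close>

lemma near_exp_mgf_limit:
  "(\<lambda>n. near_exp n (\<lambda>s e1 e2. exp (l1 * Va n s e2 + l2 * Vb n s + l3 * Vc n s e1))) \<longlonglongrightarrow>
     exp (l1 * m1 + l2 * m2 + l3 * m3 +
       ((sd1 * (l2 - \<tau> * l1 + (c - 1) * \<tau> * l3))\<^sup>2 + (sd2 * l1)\<^sup>2 + (sd3 * l3)\<^sup>2) / 2)"
proof -
  interpret T: supercritical c \<beta> "\<theta> + c * l3" "tilted_rate l3" "\<lambda>n. cluster_wt (tilted_p l3 n) n"
    by (rule supercritical_tilted)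
  define A where "A = (\<theta> * l3 + c * l3\<^sup>2 / 2) * (\<beta> - \<beta>\<^sup>2 / 2) + (- \<theta> * l1 + c * l1\<^sup>2 / 2) * ((1 - \<beta>)\<^sup>2 / 2)"
  define D where "D = l2 - \<tau> * l1 - \<tau> * l3"
  define q where "q = sd1\<^sup>2"
  have q: "\<tau>\<^sup>2 * q = \<beta> * (1 - \<beta>)" using sd1(2) \<tau>_pos by (simp add: q_def)
  have a0: "D / a\<^sub>0 = D * (1 - \<beta>) / \<tau>" by (simp add: a\<^sub>0_def \<tau>_def)
  have K: "D / a\<^sub>0 * ((\<theta> + c * l3) * \<beta>) = \<tau> * q * D * (\<theta> + c * l3)"
  proof -
    have "D / a\<^sub>0 * ((\<theta> + c * l3) * \<beta>) = (\<beta> * (1 - \<beta>)) / \<tau> * D * (\<theta> + c * l3)" unfolding a0 by simp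
    also have "\<beta> * (1 - \<beta>) / \<tau> = \<tau> * q" unfolding q[symmetric] using \<tau>_pos by (simp add: power2_eq_square)
    finally show ?thesis .
  qed
  have Q: "(D / a\<^sub>0)\<^sup>2 / 2 * b\<^sub>0 = q * D\<^sup>2 / 2"
  proof -
    have "(D / a\<^sub>0)\<^sup>2 / 2 * b\<^sub>0 = (\<beta> * (1 - \<beta>)) * D\<^sup>2 / \<tau>\<^sup>2 / 2"
    proof -
      have "(D * w / \<tau>)\<^sup>2 / 2 * (\<beta> / w) = (\<beta> * w) * D\<^sup>2 / \<tau>\<^sup>2 / 2" if "w \<noteq> 0" for w
        using that \<tau>_pos by (simp add: power2_eq_square field_simps)
      moreover have "1 - \<beta> \<noteq> 0" using \<beta>(2) by simp
      ultimately show ?thesis unfolding a0 b\<^sub>0_def by blast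
    qed
    also have "\<dots> = q * D\<^sup>2 / 2" unfolding q[symmetric] using \<tau>_pos by simp
    finally show ?thesis .
  qed
  obtain e where "e \<longlonglongrightarrow> 0" "\<forall>\<^sub>F n in sequentially. \<forall>s\<in>near n.
      \<bar>near_exponent l1 l2 l3 n s - ((A - ln \<beta>) + D * ((real s - \<beta> * real n) / sqrt (real n)))\<bar> \<le> e n"
    using near_exponent_expansion[of l1 l2 l3] unfolding A_def D_def by blast
  from T.near_mgf[OF this]
  have "(\<lambda>n. \<Sum>s\<in>near n. cluster_wt (tilted_p l3 n) n s * exp (near_exponent l1 l2 l3 n s)) \<longlonglongrightarrow>
      \<beta> * exp (A - ln \<beta> + D / a\<^sub>0 * ((\<theta> + c * l3) * \<beta>) + (D / a\<^sub>0)\<^sup>2 / 2 * b\<^sub>0)" .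
  moreover have "\<beta> * exp (A - ln \<beta> + D / a\<^sub>0 * ((\<theta> + c * l3) * \<beta>) + (D / a\<^sub>0)\<^sup>2 / 2 * b\<^sub>0) =
      exp (A + \<tau> * q * D * (\<theta> + c * l3) + q * D\<^sup>2 / 2)"
    unfolding K Q using \<beta>(1) by (simp add: exp_add exp_diff)
  moreover have "A + \<tau> * q * D * (\<theta> + c * l3) + q * D\<^sup>2 / 2 =
      l1 * m1 + l2 * m2 + l3 * m3 +
       ((sd1 * (l2 - \<tau> * l1 + (c - 1) * \<tau> * l3))\<^sup>2 + (sd2 * l1)\<^sup>2 + (sd3 * l3)\<^sup>2) / 2"
  proof -
    have m2: "m2 = \<theta> * (\<tau> * q)"
    proof -
      have "m2 = \<theta> * (\<tau>\<^sup>2 * q) / \<tau>" unfolding q m2_def by simp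
      then show ?thesis using \<tau>_pos by (simp add: power2_eq_square)
    qed
    \<comment> \<open>Both exponents agree up to a multiple of \<tau>^2 q - \<beta> (1 - \<beta>),
      which is 0. Treating \<open>q\<close> as a free variable keeps the identity polynomial,
      without division by \<tau>.\<close>
    have "2 * (A + \<tau> * q * D * (\<theta> + c * l3) + q * D\<^sup>2 / 2) -
      (2 * (l1 * m1 + l2 * m2 + l3 * m3) +
       (q * (l2 - \<tau> * l1 + (c - 1) * \<tau> * l3)\<^sup>2 + (c * (1 - \<beta>)\<^sup>2 / 2) * l1\<^sup>2 + (c * \<beta> * (1 - \<beta> / 2 - c * (1 - \<beta>))) * l3\<^sup>2)) =
       (- 2 * \<theta> * (l1 + l3) - c\<^sup>2 * l3\<^sup>2) * (\<tau>\<^sup>2 * q - \<beta> * (1 - \<beta>))"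
      unfolding A_def D_def m1_def m2 m3_def by (simp add: field_simps power2_eq_square)
    then have "2 * (A + \<tau> * q * D * (\<theta> + c * l3) + q * D\<^sup>2 / 2) -
      (2 * (l1 * m1 + l2 * m2 + l3 * m3) +
       (q * (l2 - \<tau> * l1 + (c - 1) * \<tau> * l3)\<^sup>2 + (c * (1 - \<beta>)\<^sup>2 / 2) * l1\<^sup>2 + (c * \<beta> * (1 - \<beta> / 2 - c * (1 - \<beta>))) * l3\<^sup>2)) = 0"
      unfolding q by simp
    moreover have "x = y + z / 2" if "2 * x - (2 * y + z) = 0" for x y z :: real using that by linarith
    ultimately show ?thesis unfolding power_mult_distrib sd2(2) sd3(2) q_def[symmetric] by blast
  qed
  ultimately have "(\<lambda>n. \<Sum>s\<in>near n. cluster_wt (tilted_p l3 n) n s * exp (near_exponent l1 l2 l3 n s)) \<longlonglongrightarrow>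
      exp (l1 * m1 + l2 * m2 + l3 * m3 +
       ((sd1 * (l2 - \<tau> * l1 + (c - 1) * \<tau> * l3))\<^sup>2 + (sd2 * l1)\<^sup>2 + (sd3 * l3)\<^sup>2) / 2)" by simp
  then show ?thesis
    by (rule Lim_transform_eventually) (use near_exp_mgf[of l1 l2 l3] in \<open>auto elim: eventually_mono\<close>)
qed

text \<open>Coordinates in which the Gaussian limit is standard.\<close>

definition xi1 :: "nat \<Rightarrow> nat \<Rightarrow> real" where "xi1 n s = (Vb n s - m2) / sd1"

definition xi2 :: "nat \<Rightarrow> nat \<Rightarrow> real \<Rightarrow> real" where
  "xi2 n s e2 = (Va n s e2 - m1 + \<tau> * (Vb n s - m2)) / sd2"

definition xi3 :: "nat \<Rightarrow> nat \<Rightarrow> real \<Rightarrow> real" where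
  "xi3 n s e1 = (Vc n s e1 - m3 - (c - 1) * \<tau> * (Vb n s - m2)) / sd3"

lemma near_exp_xi:
  "(\<lambda>n. near_exp n (\<lambda>s e1 e2. exp (t1 * xi1 n s + t2 * xi2 n s e2 + t3 * xi3 n s e1))) \<longlonglongrightarrow>
     exp (t1\<^sup>2 / 2 + t2\<^sup>2 / 2 + t3\<^sup>2 / 2)"
proof -
  \<comment> \<open>The transpose of the substitution in \<open>xi1\<close>, \<open>xi2\<close>,
    \<open>xi3\<close>; it turns the three squares of the limit into t1, t2 and t3 squared.\<close>
  define l1 l2 l3 where "l1 = t2 / sd2" and "l2 = t1 / sd1 + \<tau> * t2 / sd2 - (c - 1) * \<tau> * t3 / sd3" and "l3 = t3 / sd3"
  define k where "k = l1 * m1 + l2 * m2 + l3 * m3"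
  have eq: "t1 * xi1 n s + t2 * xi2 n s e2 + t3 * xi3 n s e1 = (l1 * Va n s e2 + l2 * Vb n s + l3 * Vc n s e1) - k" for n s e1 e2
    unfolding xi1_def xi2_def xi3_def k_def l1_def l2_def l3_def
    by (simp add: diff_divide_distrib add_divide_distrib algebra_simps)
  have "(\<lambda>n. near_exp n (\<lambda>s e1 e2. exp (l1 * Va n s e2 + l2 * Vb n s + l3 * Vc n s e1)) * exp (- k)) \<longlonglongrightarrow>
     exp (k + ((sd1 * (l2 - \<tau> * l1 + (c - 1) * \<tau> * l3))\<^sup>2 + (sd2 * l1)\<^sup>2 + (sd3 * l3)\<^sup>2) / 2) * exp (- k)"
    unfolding k_def by (intro tendsto_mult near_exp_mgf_limit tendsto_const)
  moreover have "near_exp n (\<lambda>s e1 e2. exp (l1 * Va n s e2 + l2 * Vb n s + l3 * Vc n s e1)) * exp (- k) =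
     near_exp n (\<lambda>s e1 e2. exp (t1 * xi1 n s + t2 * xi2 n s e2 + t3 * xi3 n s e1))" for n
    unfolding near_exp_def gexp_mult_right[symmetric] eq
    by (simp add: sum_distrib_right exp_diff exp_minus divide_inverse mult.assoc)
  moreover have "exp (k + ((sd1 * (l2 - \<tau> * l1 + (c - 1) * \<tau> * l3))\<^sup>2 + (sd2 * l1)\<^sup>2 + (sd3 * l3)\<^sup>2) / 2) * exp (- k) =
     exp (t1\<^sup>2 / 2 + t2\<^sup>2 / 2 + t3\<^sup>2 / 2)"
  proof -
    have "l2 - \<tau> * l1 + (c - 1) * \<tau> * l3 = t1 / sd1" by (simp add: l1_def l2_def l3_def)
    then show ?thesis using sd1(1) sd2(1) sd3(1)
      by (simp add: l1_def l3_def add_divide_distrib flip: exp_add)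
  qed
  ultimately show ?thesis by simp
qed

lemma near_exp_product:
  assumes cont: "continuous_on UNIV f" "continuous_on UNIV g" "continuous_on UNIV h"
    and bnd: "\<And>x. f x \<in> {0..1}" "\<And>x. g x \<in> {0..1}" "\<And>x. h x \<in> {0..(1::real)}"
  shows "(\<lambda>n. near_exp n (\<lambda>s e1 e2. f (xi1 n s) * g (xi2 n s e2) * h (xi3 n s e1))) \<longlonglongrightarrow>
    (\<integral>x. f x \<partial>std_normal_distribution) * (\<integral>x. g x \<partial>std_normal_distribution) * (\<integral>x. h x \<partial>std_normal_distribution)"
proof -
  \<comment> \<open>Expectation and sum over components become one weighted sum over pairs of a
    graph and a component, the format of \<open>mgf_convergence_triple\<close>.\<close>
  define A where "A n = Sigma (Pow (pairs {1..n})) (\<lambda>E. {S \<in> comps {1..n} E. card S \<in> near n})" for n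
  define wt where "wt n i = p n ^ card (fst i) * (1 - p n) ^ card (pairs {1..n} - fst i)" for n and i :: "nat set set \<times> nat set"
  define s where "s i = card (snd i)" for i :: "nat set set \<times> nat set"
  define e1 where "e1 i = real (card (fst i \<inter> pairs (snd i)))" for i :: "nat set set \<times> nat set"
  define e2 where "e2 n i = real (card (fst i \<inter> pairs ({1..n} - snd i)))" for n and i :: "nat set set \<times> nat set"
  have fin: "finite (A n)" for n
    unfolding A_def by (intro finite_SigmaI) (auto simp: finite_pairs finite_comps)
  have eq: "near_exp n F = (\<Sum>i\<in>A n. wt n i * F (s i) (e1 i) (e2 n i))" for n F
  proof -
    have "(\<Sum>i\<in>A n. wt n i * F (s i) (e1 i) (e2 n i)) = (\<Sum>E\<in>Pow (pairs {1..n}). \<Sum>S\<in>{S \<in> comps {1..n} E. card S \<in> near n}.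
        wt n (E, S) * F (s (E, S)) (e1 (E, S)) (e2 n (E, S)))"
      unfolding A_def by (subst sum.Sigma) (auto simp: finite_pairs finite_comps intro!: sum.cong)
    also have "\<dots> = near_exp n F"
      unfolding near_exp_def gexp_def sum_distrib_left
      by (intro sum.cong refl sum.mono_neutral_cong_left)
        (auto simp: finite_comps wt_def s_def e1_def e2_def)
    finally show ?thesis ..
  qed
  have wt: "\<forall>\<^sub>F n in sequentially. \<forall>i\<in>A n. 0 \<le> wt n i"
    using ev_p by eventually_elim (auto simp: wt_def)
  show ?thesis unfolding eq
    by (rule mgf_convergence_triple[OF fin wt near_exp_xi[unfolded eq] cont bnd])
qed

end

section \<open>Uniqueness of the giant component\<close>

text \<open>Besides \<open>S\<close>, the components are those of the rest, and a graph with e edges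
  on m vertices has m - e + \<open>cyc\<close> components. This is the step from the forest count
  \<open>Va\<close> to the true count.\<close>

lemma cyc_comps:
  assumes "finite V" "E \<subseteq> pairs V" "S \<in> comps V E"
  shows "real (card (comps V E)) = 1 + real (card V) - real (card S) -
    real (card (E \<inter> pairs (V - S))) + cyc (V - S) (E \<inter> pairs (V - S))"
proof -
  have "card (comps V E - {S}) = card (comps V E) - 1" using assms by simp
  moreover have "card (comps V E) > 0" using assms by (auto simp: card_gt_0_iff)
  ultimately have "real (card (comps V E)) = 1 + real (card (comps (V - S) (E \<inter> pairs (V - S))))"
    using comps_remove[OF assms(2,3)] by simp
  moreover have "real (card (V - S)) = real (card V) - real (card S)"
    using comps_subset[OF assms(3)] assms(1) by (simp add: card_Diff_subset card_mono finite_subset of_nat_diff)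
  ultimately show ?thesis by (simp add: cyc_def)
qed

lemma excess_edges_comps:
  assumes "E \<subseteq> pairs V"
  shows "real_of_int (excess_edges E S) = real (card (E \<inter> pairs S)) - real (card S) + 1"
proof -
  have "{e \<in> E. e \<subseteq> S} = E \<inter> pairs S" using assms by (auto simp: pairs_def)
  then show ?thesis by (simp add: excess_edges_def)
qed

context giant
begin

lemma near_bounds:
  assumes "0 < \<epsilon>"
  shows "\<forall>\<^sub>F n in sequentially. \<forall>s\<in>near n. 1 \<le> s \<and> s \<le> n \<and> \<bar>real s - \<beta> * real n\<bar> \<le> \<epsilon> * real n"
proof -
  have "(\<lambda>n. real n powr (-1/3)) \<longlonglongrightarrow> 0" by real_asymp
  then have "\<forall>\<^sub>F n in sequentially. real n powr (-1/3) < \<epsilon>" by (rule order_tendstoD) (rule assms)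
  then show ?thesis using eventually_ge_at_top[of 1]
  proof eventually_elim
    case (elim n)
    show ?case
    proof
      fix s assume s: "s \<in> near n"
      have n: "real n > 0" using elim by simp
      have "\<bar>real s / real n - \<beta>\<bar> \<le> \<epsilon>" using near_scale[OF elim(2) s] elim by linarith
      then have "\<bar>real s / real n - \<beta>\<bar> * real n \<le> \<epsilon> * real n" using n by (intro mult_right_mono) auto
      moreover have "\<bar>real s / real n - \<beta>\<bar> * real n = \<bar>(real s / real n - \<beta>) * real n\<bar>"
        using n by (simp add: abs_mult)
      moreover have "(real s / real n - \<beta>) * real n = real s - \<beta> * real n"
        using n by (simp add: left_diff_distrib)
      ultimately show "1 \<le> s \<and> s \<le> n \<and> \<bar>real s - \<beta> * real n\<bar> \<le> \<epsilon> * real n"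
        using s by (simp add: near_def)
    qed
  qed
qed

text \<open>The rest has n - s vertices and the same edge probability, so its rate is about c (1 -
  \<beta>) < 1, and \<open>cluster_law_mean_small\<close> applies with A = 0.\<close>

lemma dual_mean_small:
  assumes e: "0 < e"
  shows "\<forall>\<^sub>F n in sequentially. \<forall>s\<in>near n.
    (\<Sum>t=1..n - s. real t * cluster_wt (p n) (n - s) t) \<le> e * sqrt (real n)"
proof -
  obtain m0 where m0: "\<And>m h w. m \<ge> m0 \<Longrightarrow> cluster_law m h w \<Longrightarrow> 0 \<le> h \<Longrightarrow> h \<le> 1 \<Longrightarrow>
      (\<Sum>t=1..m. real t * w t) \<le> e * sqrt (real m)"
    using cluster_law_mean_small[of 0 e] e by auto
  \<comment> \<open>The first bound leaves at least a fixed fraction of the vertices outside; the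
    second keeps (1 - \<beta> + \<epsilon>) c \<le> 1 - \<tau>/2.\<close>
  define \<epsilon> where "\<epsilon> = min ((1 - \<beta>) / 2) (\<tau> / (2 * c))"
  have \<epsilon>: "0 < \<epsilon>" "\<epsilon> \<le> (1 - \<beta>) / 2" "\<epsilon> \<le> \<tau> / (2 * c)"
    using \<beta>(2) \<tau>_pos c_pos unfolding \<epsilon>_def by (simp, intro min.cobounded1, intro min.cobounded2)
  have "\<forall>\<^sub>F n in sequentially. (1 - \<beta> + \<epsilon>) * rate n < 1"
  proof -
    have "(\<lambda>n. (1 - \<beta> + \<epsilon>) * rate n) \<longlonglongrightarrow> (1 - \<beta> + \<epsilon>) * c" by (intro tendsto_intros rate_tendsto)
    moreover have "(1 - \<beta> + \<epsilon>) * c < 1"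
    proof -
      have "\<epsilon> * c \<le> \<tau> / (2 * c) * c" using \<epsilon>(3) c_pos by (intro mult_right_mono) auto
      also have "\<dots> = \<tau> / 2" using c_pos by simp
      finally have "\<epsilon> * c \<le> \<tau> / 2" .
      moreover have "(1 - \<beta> + \<epsilon>) * c = (1 - \<tau>) + \<epsilon> * c" by (simp add: \<tau>_def algebra_simps)
      ultimately show ?thesis using \<tau>_pos by linarith
    qed
    ultimately show ?thesis by (rule order_tendstoD)
  qed
  moreover have "\<forall>\<^sub>F n in sequentially. max 1 (real m0) \<le> (1 - \<beta>) / 2 * real n"
  proof -
    have "filterlim (\<lambda>n. (1 - \<beta>) / 2 * real n) at_top sequentially"
      using \<beta>(2) by (intro filterlim_tendsto_pos_mult_at_top[OF tendsto_const] filterlim_real_sequentially) auto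
    then show ?thesis unfolding filterlim_at_top by blast
  qed
  ultimately show ?thesis using near_bounds[OF \<epsilon>(1)] ev_p
  proof eventually_elim
    case (elim n)
    show ?case
    proof
      fix s assume s: "s \<in> near n"
      define m where "m = n - s"
      have n: "real n > 0" using elim by auto
      have sb: "s \<le> n" "\<bar>real s - \<beta> * real n\<bar> \<le> \<epsilon> * real n" using elim(3) s by auto
      have m: "real m = real n - real s" using sb(1) by (simp add: m_def of_nat_diff)
      have "\<epsilon> * real n \<le> (1 - \<beta>) / 2 * real n" using \<epsilon>(2) n by (intro mult_right_mono) auto
      moreover have "2 * ((1 - \<beta>) / 2 * real n) = real n - \<beta> * real n" by (simp add: field_simps)
      moreover have "real s - \<beta> * real n \<le> \<epsilon> * real n" using sb(2) by (simp add: abs_le_iff)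
      moreover have "k \<le> m'" if "e \<le> k" "2 * k = n' - b" "s' - b \<le> e" "m' = n' - s'" for k m' e n' b s' :: real
        using that by linarith
      ultimately have mlow: "(1 - \<beta>) / 2 * real n \<le> real m" using m by blast
      have mup: "real m \<le> (1 - \<beta> + \<epsilon>) * real n" using sb(2) m by (simp add: algebra_simps abs_le_iff)
      have m1: "m \<ge> 1" "m \<ge> m0" using mlow elim(2) by linarith+
      have law: "cluster_law m (- real m * ln (1 - p n)) (cluster_wt (p n) m)"
        using elim(4) m1 by (intro cluster_law_cluster_wt) auto
      have ln: "ln (1 - p n) \<le> 0" using elim(4) by simp
      have "- ln (1 - p n) * real m \<le> - ln (1 - p n) * ((1 - \<beta> + \<epsilon>) * real n)"
        using mup ln by (intro mult_left_mono) auto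
      also have "\<dots> = (1 - \<beta> + \<epsilon>) * rate n" by (simp add: rate_def)
      finally have "- real m * ln (1 - p n) \<le> 1" using elim(1) by (simp add: mult.commute)
      moreover have "0 \<le> - real m * ln (1 - p n)" using ln by (simp add: mult_nonneg_nonpos)
      ultimately have "(\<Sum>t=1..m. real t * cluster_wt (p n) m t) \<le> e * sqrt (real m)"
        by (intro m0[OF m1(2) law]) auto
      also have "\<dots> \<le> e * sqrt (real n)" using e by (intro mult_left_mono) (auto simp: m_def)
      finally show "(\<Sum>t=1..n - s. real t * cluster_wt (p n) (n - s) t) \<le> e * sqrt (real n)"
        by (simp add: m_def)
    qed
  qed
qed

abbreviation G :: "nat \<Rightarrow> (nat set set \<Rightarrow> real) \<Rightarrow> real" where "G n \<equiv> gexp (p n) (pairs {1..n})"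

definition nears :: "nat \<Rightarrow> nat set set \<Rightarrow> nat set set" where
  "nears n E = {S \<in> comps {1..n} E. card S \<in> near n}"

definition fars :: "nat \<Rightarrow> nat set set \<Rightarrow> nat set set" where
  "fars n E = {S \<in> comps {1..n} E. card S \<in> far (\<beta> / 2) n}"

lemma finite_nears [simp]: "finite (nears n E)" and finite_fars [simp]: "finite (fars n E)"
  by (simp_all add: nears_def fars_def)

lemma sum_nears: "(\<Sum>S\<in>nears n E. f S) = (\<Sum>S\<in>comps {1..n} E. of_bool (card S \<in> near n) * f S)"
  for f :: "nat set \<Rightarrow> real"
  unfolding nears_def by (intro sum.mono_neutral_cong_left) auto

lemma near_exp_nears:
  "near_exp n f = G n (\<lambda>E. \<Sum>S\<in>nears n E. f (card S) (real (card (E \<inter> pairs S))) (real (card (E \<inter> pairs ({1..n} - S)))))"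
  unfolding near_exp_def sum_nears ..

text \<open>Constant test functions in \<open>near_exp_product\<close>: the expected number of
  components of near size tends to 1.\<close>

lemma gexp_card_nears: "(\<lambda>n. G n (\<lambda>E. real (card (nears n E)))) \<longlonglongrightarrow> 1"
proof -
  have 1: "(\<integral>x. 1 \<partial>std_normal_distribution) = (1 :: real)"
    using prob_space.prob_space[OF prob_space_normal_density[of 1 0]] by simp
  have "(\<lambda>n. near_exp n (\<lambda>s e1 e2. 1 * 1 * 1)) \<longlonglongrightarrow> (\<integral>x. 1 \<partial>std_normal_distribution) * (\<integral>x. 1 \<partial>std_normal_distribution) * (\<integral>x. 1 \<partial>std_normal_distribution)"
    by (rule near_exp_product) auto
  then show ?thesis unfolding 1 near_exp_nears by simp
qed

lemma gexp_card_nears_eq: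
  "G n (\<lambda>E. real (card (nears n E))) = (\<Sum>s=1..n. real n / real s * cluster_wt (p n) n s * of_bool (s \<in> near n))"
proof -
  have "G n (\<lambda>E. real (card (nears n E))) = G n (\<lambda>E. \<Sum>S\<in>comps {1..n} E. of_bool (card S \<in> near n))"
    using sum_nears[of "\<lambda>_. 1" n] by simp
  also have "\<dots> = (\<Sum>s=1..card {1..n}. real (card {1..n}) / real s * cluster_wt (p n) (card {1..n}) s * of_bool (s \<in> near n))"
    by (rule gexp_sum_comps_card[where F="\<lambda>S E1 E2. of_bool (card S \<in> near n)"]) (auto simp: gexp_const)
  finally show ?thesis by simp
qed

text \<open>For sizes above \<beta> n/2 the factor n/s is at most 2/\<beta>, so the expected number
  is controlled by the probability in \<open>far_negligible\<close>.\<close>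

lemma gexp_card_fars: "(\<lambda>n. G n (\<lambda>E. real (card (fars n E)))) \<longlonglongrightarrow> 0"
proof (rule tendsto_sandwich[OF _ _ tendsto_const])
  have eq: "G n (\<lambda>E. real (card (fars n E))) =
      (\<Sum>s=1..n. real n / real s * cluster_wt (p n) n s * of_bool (s \<in> far (\<beta> / 2) n))" for n
  proof -
    have "real (card (fars n E)) = (\<Sum>S\<in>comps {1..n} E. of_bool (card S \<in> far (\<beta> / 2) n))" for E
      by (simp add: fars_def Int_def)
    then have "G n (\<lambda>E. real (card (fars n E))) = G n (\<lambda>E. \<Sum>S\<in>comps {1..n} E. of_bool (card S \<in> far (\<beta> / 2) n))"
      by simp
    also have "\<dots> = (\<Sum>s=1..card {1..n}. real (card {1..n}) / real s * cluster_wt (p n) (card {1..n}) s * of_bool (s \<in> far (\<beta> / 2) n))"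
      by (rule gexp_sum_comps_card[where F="\<lambda>S E1 E2. of_bool (card S \<in> far (\<beta> / 2) n)"]) (auto simp: gexp_const)
    finally show ?thesis by simp
  qed
  show "\<forall>\<^sub>F n in sequentially. 0 \<le> G n (\<lambda>E. real (card (fars n E)))"
    using ev_p by eventually_elim (auto intro!: gexp_nonneg)
  show "\<forall>\<^sub>F n in sequentially. G n (\<lambda>E. real (card (fars n E))) \<le> 2 / \<beta> * (\<Sum>s\<in>far (\<beta> / 2) n. cluster_wt (p n) n s)"
    using ev_p
  proof eventually_elim
    case (elim n)
    have "G n (\<lambda>E. real (card (fars n E))) \<le> (\<Sum>s=1..n. of_bool (s \<in> far (\<beta> / 2) n) * (2 / \<beta> * cluster_wt (p n) n s))"
      unfolding eq
    proof (rule sum_mono)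
      fix s assume s: "s \<in> {1..n}"
      show "real n / real s * cluster_wt (p n) n s * of_bool (s \<in> far (\<beta> / 2) n) \<le>
          of_bool (s \<in> far (\<beta> / 2) n) * (2 / \<beta> * cluster_wt (p n) n s)"
      proof (cases "s \<in> far (\<beta> / 2) n")
        case True
        then have "\<beta> / 2 * real n < real s" by (simp add: far_def)
        then have "real n / real s \<le> 2 / \<beta>" using s \<beta>(1) by (simp add: field_simps)
        then have "real n / real s * cluster_wt (p n) n s \<le> 2 / \<beta> * cluster_wt (p n) n s"
          using cluster_wt_nonneg[of "p n" n s] elim by (intro mult_right_mono) auto
        moreover have "of_bool (s \<in> far (\<beta> / 2) n) = (1 :: real)" using True by simp
        ultimately show ?thesis by (simp only: mult_1_left mult_1_right)
      qed simp
    qed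
    also have "\<dots> = (\<Sum>s\<in>far (\<beta> / 2) n. 2 / \<beta> * cluster_wt (p n) n s)"
      by (rule sum.mono_neutral_cong_right) (auto simp: far_def)
    finally show ?case by (simp add: sum_distrib_left)
  qed
  show "(\<lambda>n. 2 / \<beta> * (\<Sum>s\<in>far (\<beta> / 2) n. cluster_wt (p n) n s)) \<longlonglongrightarrow> 0"
    using tendsto_mult_right_zero[OF far_negligible[of "\<beta> / 2"]] \<beta>(1) by simp
qed

text \<open>Summed over near components, a functional of the rest has expectation at most its
  uniform bound times the expected number of near components, which is bounded.\<close>

lemma gexp_nears_rest:
  assumes F: "\<And>n E S. E \<subseteq> pairs {1..n} \<Longrightarrow> S \<in> nears n E \<Longrightarrow> 0 \<le> F n S (E \<inter> pairs ({1..n} - S))"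
    and b: "\<And>e. 0 < e \<Longrightarrow> \<forall>\<^sub>F n in sequentially. \<forall>S\<subseteq>{1..n}. card S \<in> near n \<longrightarrow>
      gexp (p n) (pairs ({1..n} - S)) (F n S) \<le> e"
  shows "(\<lambda>n. G n (\<lambda>E. \<Sum>S\<in>nears n E. F n S (E \<inter> pairs ({1..n} - S)))) \<longlonglongrightarrow> 0"
proof (rule tendstoI)
  fix e :: real assume e: "0 < e"
  have "0 < e / 3" using e by simp
  have "\<forall>\<^sub>F n in sequentially. G n (\<lambda>E. real (card (nears n E))) < 2"
    using gexp_card_nears by (rule order_tendstoD) simp
  then show "\<forall>\<^sub>F n in sequentially. dist (G n (\<lambda>E. \<Sum>S\<in>nears n E. F n S (E \<inter> pairs ({1..n} - S)))) 0 < e"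
    using b[OF \<open>0 < e / 3\<close>] ev_p
  proof eventually_elim
    case (elim n)
    have "G n (\<lambda>E. \<Sum>S\<in>nears n E. F n S (E \<inter> pairs ({1..n} - S))) \<le>
        e / 3 * (\<Sum>s=1..card {1..n}. real (card {1..n}) / real s * cluster_wt (p n) (card {1..n}) s * of_bool (s \<in> near n))"
      unfolding sum_nears
      by (rule gexp_sum_comps_le[where F="F n" and P="\<lambda>s. s \<in> near n"]) (use elim e in auto)
    also have "\<dots> = e / 3 * G n (\<lambda>E. real (card (nears n E)))" unfolding gexp_card_nears_eq by simp
    also have "\<dots> \<le> e / 3 * 2" using elim e by (intro mult_left_mono) auto
    finally have "G n (\<lambda>E. \<Sum>S\<in>nears n E. F n S (E \<inter> pairs ({1..n} - S))) < e" using e by linarith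
    moreover have "0 \<le> G n (\<lambda>E. \<Sum>S\<in>nears n E. F n S (E \<inter> pairs ({1..n} - S)))"
      using elim F by (intro gexp_nonneg sum_nonneg) auto
    ultimately show ?case by simp
  qed
qed

lemma gexp_cyc_rest:
  "(\<lambda>n. G n (\<lambda>E. \<Sum>S\<in>nears n E. cyc ({1..n} - S) (E \<inter> pairs ({1..n} - S)) / sqrt (real n))) \<longlonglongrightarrow> 0"
proof (rule gexp_nears_rest[where F="\<lambda>n S E. cyc ({1..n} - S) E / sqrt (real n)"])
  fix e :: real assume e: "0 < e"
  have "0 < e / (c + 1)" using e c_pos by simp
  have "\<forall>\<^sub>F n in sequentially. cn n < c + 1" using cn_tendsto by (rule order_tendstoD) simp
  then show "\<forall>\<^sub>F n in sequentially. \<forall>S\<subseteq>{1..n}. card S \<in> near n \<longrightarrow>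
      gexp (p n) (pairs ({1..n} - S)) (\<lambda>E. cyc ({1..n} - S) E / sqrt (real n)) \<le> e"
    using ev_p dual_mean_small[OF \<open>0 < e / (c + 1)\<close>]
  proof eventually_elim
    case (elim n)
    have n: "real n > 0" using elim by auto
    show ?case
    proof (intro allI impI)
      fix S assume S: "S \<subseteq> {1..n}" "card S \<in> near n"
      have m: "card ({1..n} - S) = n - card S" using S by (simp add: card_Diff_subset finite_subset)
      let ?T = "\<Sum>t=1..n - card S. real t * cluster_wt (p n) (n - card S) t"
      have T: "?T \<le> e / (c + 1) * sqrt (real n)" using elim e c_pos S by simp
      have T0: "0 \<le> ?T" using elim by (auto intro!: sum_nonneg mult_nonneg_nonneg cluster_wt_nonneg)
      have "gexp (p n) (pairs ({1..n} - S)) (cyc ({1..n} - S)) \<le> p n * real (n - card S) / 2 * ?T"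
        using gexp_cyc_le[of "{1..n} - S" "p n"] elim unfolding m by simp
      also have "\<dots> \<le> (c + 1) * (e / (c + 1) * sqrt (real n))"
      proof (rule mult_mono[OF _ T _ T0])
        have "p n * real (n - card S) \<le> p n * real n" using elim by (intro mult_left_mono) auto
        also have "\<dots> = cn n" using elim by (metis mult.commute)
        finally have "p n * real (n - card S) \<le> c + 1" using elim by linarith
        then show "p n * real (n - card S) / 2 \<le> c + 1" using c_pos by linarith
      qed (use c_pos in simp)
      also have "\<dots> = e * sqrt (real n)" using c_pos by simp
      finally show "gexp (p n) (pairs ({1..n} - S)) (\<lambda>E. cyc ({1..n} - S) E / sqrt (real n)) \<le> e"
        using n unfolding divide_inverse gexp_mult_right by (simp add: field_simps)
    qed
  qed
qed (auto intro!: divide_nonneg_nonneg cyc_nonneg)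

text \<open>A second near component would be one of order n in the subcritical rest. There the
  squared component sizes have expected sum at most n sqrt n, whereas each near component
  contributes at least (\<beta> n/2)^2.\<close>

lemma gexp_nears_pairs:
  "(\<lambda>n. G n (\<lambda>E. real (card (nears n E)) * (real (card (nears n E)) - 1))) \<longlonglongrightarrow> 0"
proof -
  define F where "F n S E = real (card {T \<in> comps ({1..n} - S) E. card T \<in> near n})" for n S E
  have eq: "real (card (nears n E)) * (real (card (nears n E)) - 1) = (\<Sum>S\<in>nears n E. F n S (E \<inter> pairs ({1..n} - S)))"
    if E: "E \<subseteq> pairs {1..n}" for n E
  proof -
    have "F n S (E \<inter> pairs ({1..n} - S)) = real (card (nears n E)) - 1" if S: "S \<in> nears n E" for S
    proof -
      have "{T \<in> comps ({1..n} - S) (E \<inter> pairs ({1..n} - S)). card T \<in> near n} = nears n E - {S}"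
        using S comps_remove[OF E, of S] by (auto simp: nears_def)
      moreover have "card (nears n E) > 0" using S by (auto simp: card_gt_0_iff)
      ultimately show ?thesis using S by (simp add: F_def of_nat_diff)
    qed
    then show ?thesis by simp
  qed
  have "(\<lambda>n. G n (\<lambda>E. \<Sum>S\<in>nears n E. F n S (E \<inter> pairs ({1..n} - S)))) \<longlonglongrightarrow> 0"
  proof (rule gexp_nears_rest)
    fix e :: real assume e: "0 < e"
    have "0 < \<beta> / 2" using \<beta>(1) by simp
    have "(\<lambda>n. 4 / \<beta>\<^sup>2 * (1 / sqrt (real n))) \<longlonglongrightarrow> 0" by real_asymp
    then have "\<forall>\<^sub>F n in sequentially. 4 / \<beta>\<^sup>2 * (1 / sqrt (real n)) < e" using e by (rule order_tendstoD)
    then show "\<forall>\<^sub>F n in sequentially. \<forall>S\<subseteq>{1..n}. card S \<in> near n \<longrightarrow>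
        gexp (p n) (pairs ({1..n} - S)) (F n S) \<le> e"
      using ev_p dual_mean_small[OF zero_less_one] near_bounds[OF \<open>0 < \<beta> / 2\<close>]
    proof eventually_elim
      case (elim n)
      have n: "real n > 0" using elim by auto
      have lo: "\<beta> / 2 * real n \<le> real s" if "s \<in> near n" for s
      proof -
        have "\<bar>real s - \<beta> * real n\<bar> \<le> \<beta> / 2 * real n" using elim that by blast
        moreover have "\<beta> * real n = 2 * (\<beta> / 2 * real n)" by simp
        ultimately show ?thesis by linarith
      qed
      show ?case
      proof (intro allI impI)
        fix S assume S: "S \<subseteq> {1..n}" "card S \<in> near n"
        let ?V = "{1..n} - S"
        let ?k = "\<beta> / 2 * real n"
        have k: "0 < ?k" using \<beta>(1) n by simp
        have m: "card ?V = n - card S" using S by (simp add: card_Diff_subset finite_subset)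
        have "gexp (p n) (pairs ?V) (F n S) \<le> gexp (p n) (pairs ?V) (\<lambda>E. (\<Sum>T\<in>comps ?V E. (real (card T))\<^sup>2) * (1 / ?k\<^sup>2))"
        proof (rule gexp_mono)
          fix E
          have "F n S E = (\<Sum>T\<in>{T \<in> comps ?V E. card T \<in> near n}. 1)" by (simp add: F_def)
          also have "\<dots> \<le> (\<Sum>T\<in>{T \<in> comps ?V E. card T \<in> near n}. (real (card T))\<^sup>2 * (1 / ?k\<^sup>2))"
          proof (rule sum_mono)
            fix T assume "T \<in> {T \<in> comps ?V E. card T \<in> near n}"
            then have "?k \<le> real (card T)" using lo by auto
            then have "?k\<^sup>2 \<le> (real (card T))\<^sup>2" using k by (intro power_mono) auto
            then show "1 \<le> (real (card T))\<^sup>2 * (1 / ?k\<^sup>2)"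
              using zero_less_power[OF k, of 2] by (simp only: times_divide_eq_right le_divide_eq mult_1_left mult_1_right simp_thms if_True)
          qed
          also have "\<dots> \<le> (\<Sum>T\<in>comps ?V E. (real (card T))\<^sup>2 * (1 / ?k\<^sup>2))" by (intro sum_mono2) auto
          also have "\<dots> = (\<Sum>T\<in>comps ?V E. (real (card T))\<^sup>2) * (1 / ?k\<^sup>2)" by (rule sum_distrib_right[symmetric])
          finally show "F n S E \<le> (\<Sum>T\<in>comps ?V E. (real (card T))\<^sup>2) * (1 / ?k\<^sup>2)" .
        qed (use elim in auto)
        also have "\<dots> = real (n - card S) * (\<Sum>t=1..n - card S. real t * cluster_wt (p n) (n - card S) t) * (1 / ?k\<^sup>2)"
          unfolding gexp_mult_right gexp_sum_card_sq[OF finite_Diff[OF finite_atLeastAtMost]] m ..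
        also have "\<dots> \<le> real n * (1 * sqrt (real n)) * (1 / ?k\<^sup>2)"
        proof (intro mult_right_mono mult_mono)
          show "(\<Sum>t=1..n - card S. real t * cluster_wt (p n) (n - card S) t) \<le> 1 * sqrt (real n)" using elim S by blast
          show "0 \<le> (\<Sum>t=1..n - card S. real t * cluster_wt (p n) (n - card S) t)"
            using elim by (auto intro!: sum_nonneg mult_nonneg_nonneg cluster_wt_nonneg)
        qed auto
        also have "\<dots> = 4 / \<beta>\<^sup>2 * (sqrt (real n) / real n)" using n \<beta>(1) by (simp add: field_simps power2_eq_square)
        also have "sqrt (real n) / real n = 1 / sqrt (real n)" using n by (simp add: sqrt_divide_self_eq inverse_eq_divide)
        finally show "gexp (p n) (pairs ?V) (F n S) \<le> e" using elim by linarith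
      qed
    qed
  qed (simp add: F_def)
  moreover have "G n (\<lambda>E. real (card (nears n E)) * (real (card (nears n E)) - 1)) =
      G n (\<lambda>E. \<Sum>S\<in>nears n E. F n S (E \<inter> pairs ({1..n} - S)))" for n
    by (rule gexp_cong) (auto simp: eq)
  ultimately show ?thesis by simp
qed

text \<open>With N the number of near components, (N - 1)^2 = N (N - 1) - N + 1, and the means of
  the three terms tend to 0, -1 and 1.\<close>

lemma gexp_nears_deviation: "(\<lambda>n. G n (\<lambda>E. (real (card (nears n E)) - 1)\<^sup>2)) \<longlonglongrightarrow> 0"
proof -
  have "G n (\<lambda>E. (real (card (nears n E)) - 1)\<^sup>2) =
      G n (\<lambda>E. real (card (nears n E)) * (real (card (nears n E)) - 1)) - G n (\<lambda>E. real (card (nears n E))) + 1" for n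
  proof -
    have "G n (\<lambda>E. (real (card (nears n E)) - 1)\<^sup>2) =
        G n (\<lambda>E. (real (card (nears n E)) * (real (card (nears n E)) - 1) - real (card (nears n E))) + 1)"
      by (rule gexp_cong) (auto simp: power2_eq_square algebra_simps)
    then show ?thesis by (simp only: gexp_add gexp_diff gexp_const finite_pairs finite_atLeastAtMost)
  qed
  then show ?thesis
    using tendsto_add[OF tendsto_diff[OF gexp_nears_pairs gexp_card_nears] tendsto_const[of 1]] by simp
qed

end

section \<open>The case without a giant component\<close>

lemma gexp_abs_le:
  assumes "0 \<le> p" "p \<le> 1"
  shows "\<bar>gexp p P f\<bar> \<le> gexp p P (\<lambda>E. \<bar>f E\<bar>)"
proof -
  have "gexp p P f \<le> gexp p P (\<lambda>E. \<bar>f E\<bar>)" by (rule gexp_mono[OF assms]) simp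
  moreover have "gexp p P (\<lambda>E. - 1 * f E) \<le> gexp p P (\<lambda>E. \<bar>f E\<bar>)" by (rule gexp_mono[OF assms]) simp
  ultimately show ?thesis unfolding gexp_cmult by (simp add: abs_le_iff)
qed

lemma sqrt_times_diff: "n > 0 \<Longrightarrow> sqrt (real n) * (x / real n - a) = (x - a * real n) / sqrt (real n)"
  by (simp add: field_simps)

context sparse
begin

text \<open>The edge count has mean near c n/2 + \<theta> sqrt n/2 and variance near c n/2. The sign
  is reversed because each edge outside a cycle lowers the number of components.\<close>

definition edge_dev :: "nat \<Rightarrow> nat set set \<Rightarrow> real" where
  "edge_dev n E = ((c / 2 * real n - real (card E)) / sqrt (real n) + \<theta> / 2) / sqrt (c / 2)"

text \<open>The binomial moment generating function is a power of \<open>rho\<close>, and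
  \<open>ln_rho\<close> gives its limit.\<close>

lemma gexp_exp_edge_dev:
  "(\<lambda>n. gexp (p n) (pairs {1..n}) (\<lambda>E. exp (t * edge_dev n E))) \<longlonglongrightarrow> exp (t\<^sup>2 / 2)"
proof -
  define k where "k = t / sqrt (c / 2)"
  have ck: "c * k\<^sup>2 = 2 * t\<^sup>2" using c_pos by (simp add: k_def power_divide)
  define u where "u n = (real n)\<^sup>2 * ln (rho (- k) n) - sqrt (real n) * (c * - k)" for n
  have u: "u \<longlonglongrightarrow> \<theta> * - k + c * k\<^sup>2 / 2" using ln_rho[of "- k"] by (simp add: u_def[abs_def])
  have "(\<lambda>n. c * k / 2 * (1 / sqrt (real n)) + u n / 2 - u n * (1 / (2 * real n)) + k * \<theta> / 2) \<longlonglongrightarrow>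
      c * k / 2 * 0 + (\<theta> * - k + c * k\<^sup>2 / 2) / 2 - (\<theta> * - k + c * k\<^sup>2 / 2) * 0 + k * \<theta> / 2"
    by (intro tendsto_intros u) (simp | real_asymp)+
  also have "c * k / 2 * 0 + (\<theta> * - k + c * k\<^sup>2 / 2) / 2 - (\<theta> * - k + c * k\<^sup>2 / 2) * 0 + k * \<theta> / 2 = t\<^sup>2 / 2"
    unfolding ck by (simp add: add_divide_distrib diff_divide_distrib)
  finally have "(\<lambda>n. exp (c * k / 2 * (1 / sqrt (real n)) + u n / 2 - u n * (1 / (2 * real n)) + k * \<theta> / 2)) \<longlonglongrightarrow> exp (t\<^sup>2 / 2)"
    by (rule tendsto_exp)
  moreover have "\<forall>\<^sub>F n in sequentially. exp (c * k / 2 * (1 / sqrt (real n)) + u n / 2 - u n * (1 / (2 * real n)) + k * \<theta> / 2) =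
      gexp (p n) (pairs {1..n}) (\<lambda>E. exp (t * edge_dev n E))"
    using ev_p rho_pos[of "- k"]
  proof eventually_elim
    case (elim n)
    define r where "r = exp (- k / sqrt (real n))"
    define s where "s = sqrt (real n)"
    have s: "s > 0" "real n = s\<^sup>2" using elim by (auto simp: s_def)
    have rho: "1 - p n + p n * r = rho (- k) n" by (simp add: rho_def r_def)
    have eq: "exp (t * edge_dev n E) = r ^ card E * exp (k * (c * s / 2 + \<theta> / 2))" for E
    proof -
      have "t * edge_dev n E = k * ((c / 2 * real n - real (card E)) / s + \<theta> / 2)"
        by (simp add: edge_dev_def k_def s_def)
      also have "\<dots> = real (card E) * (- k / s) + k * (c * s / 2 + \<theta> / 2)"
      proof -
        have "s\<^sup>2 / s = s" using s(1) by (simp add: power2_eq_square)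
        then have "(c / 2 * real n - real (card E)) / s = c / 2 * s - real (card E) / s"
          unfolding s(2) diff_divide_distrib by (simp only: times_divide_eq_right[symmetric])
        then show ?thesis by (simp only:) (simp add: algebra_simps)
      qed
      finally show ?thesis by (simp only: exp_add exp_of_nat_mult r_def s_def)
    qed
    have "gexp (p n) (pairs {1..n}) (\<lambda>E. exp (t * edge_dev n E)) =
        gexp (p n) (pairs {1..n}) (\<lambda>E. r ^ card E * exp (k * (c * s / 2 + \<theta> / 2)))" unfolding eq ..
    also have "\<dots> = rho (- k) n ^ card (pairs {1..n}) * exp (k * (c * s / 2 + \<theta> / 2))"
      using gexp_tilt[of "pairs {1..n}" "p n" r "\<lambda>E. exp (k * (c * s / 2 + \<theta> / 2))"] elim(2)
      unfolding rho by (simp add: gexp_const)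
    also have "rho (- k) n ^ card (pairs {1..n}) = exp (real n * (real n - 1) / 2 * ln (rho (- k) n))"
      using elim by (subst power_of_ln) (simp_all add: card_pairs real_choose_two)
    also have "real n * (real n - 1) / 2 * ln (rho (- k) n) = ((real n)\<^sup>2 * ln (rho (- k) n)) * (1 / 2 - 1 / (2 * real n))"
      using s by (simp add: field_simps power2_eq_square)
    also have "(real n)\<^sup>2 * ln (rho (- k) n) = u n - s * (c * k)" by (simp add: u_def s_def)
    also have "exp ((u n - s * (c * k)) * (1 / 2 - 1 / (2 * real n))) * exp (k * (c * s / 2 + \<theta> / 2)) =
        exp (c * k / 2 * (1 / s) + u n / 2 - u n * (1 / (2 * real n)) + k * \<theta> / 2)"
    proof -
      have "s * (1 / (2 * real n)) = 1 / s / 2" unfolding s(2) using s(1) by (simp add: power2_eq_square)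
      then have "s * (c * k) * (1 / (2 * real n)) = c * k / 2 * (1 / s)" by (metis (no_types, lifting) mult.commute mult.left_commute times_divide_eq_left times_divide_eq_right)
      then show ?thesis
        unfolding exp_add[symmetric] left_diff_distrib right_diff_distrib by (simp add: algebra_simps)
    qed
    finally show ?case by (simp add: s_def)
  qed
  ultimately show ?thesis by (rule Lim_transform_eventually)
qed

lemma gexp_edge_dev:
  assumes "continuous_on UNIV f" "\<And>x. \<bar>f x\<bar> \<le> B"
  shows "(\<lambda>n. gexp (p n) (pairs {1..n}) (\<lambda>E. f (edge_dev n E))) \<longlonglongrightarrow> (\<integral>x. f x \<partial>std_normal_distribution)"
proof -
  have "(\<lambda>n. \<Sum>E\<in>Pow (pairs {1..n}). (p n ^ card E * (1 - p n) ^ card (pairs {1..n} - E)) * f (edge_dev n E)) \<longlonglongrightarrow>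
      1 * (\<integral>x. f x \<partial>std_normal_distribution)"
  proof (rule mgf_convergence[where M=B])
    show "\<forall>\<^sub>F n in sequentially. \<forall>E\<in>Pow (pairs {1..n}). 0 \<le> p n ^ card E * (1 - p n) ^ card (pairs {1..n} - E)"
      using ev_p by eventually_elim auto
    show "(\<lambda>n. \<Sum>E\<in>Pow (pairs {1..n}). p n ^ card E * (1 - p n) ^ card (pairs {1..n} - E) * exp (t * edge_dev n E)) \<longlonglongrightarrow>
        1 * exp (t\<^sup>2 / 2)" for t
      using gexp_exp_edge_dev[of t] by (simp add: gexp_def)
  qed (use assms in auto)
  then show ?thesis by (simp add: gexp_def)
qed

text \<open>\<open>rate\<close> is at most 1 + (|\<theta>| + 1)/sqrt n for large \<open>n\<close>,
  also at c = 1, so the window of \<open>cluster_law_mean_small\<close> covers all of c \<le>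
  1.\<close>

lemma gexp_cyc_small:
  assumes "c \<le> 1"
  shows "(\<lambda>n. gexp (p n) (pairs {1..n}) (\<lambda>E. cyc {1..n} E / sqrt (real n))) \<longlonglongrightarrow> 0"
proof (rule tendstoI)
  fix e :: real assume e: "0 < e"
  define e' where "e' = e / 2 / (c + 1)"
  have e': "0 < e'" using e c_pos by (simp add: e'_def)
  have "0 \<le> \<bar>\<theta>\<bar> + 1" by simp
  from cluster_law_mean_small[OF this e'] obtain m0 where m0: "\<forall>n\<ge>m0. \<forall>h w. cluster_law n h w \<longrightarrow> 0 \<le> h \<longrightarrow>
      h \<le> 1 + (\<bar>\<theta>\<bar> + 1) / sqrt (real n) \<longrightarrow> (\<Sum>t=1..n. real t * w t) \<le> e' * sqrt (real n)" by blast
  have "\<forall>\<^sub>F n in sequentially. cn n < c + 1" using cn_tendsto by (rule order_tendstoD) simp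
  moreover have "\<forall>\<^sub>F n in sequentially. sqrt (real n) * (rate n - c) < \<bar>\<theta>\<bar> + 1"
    using rate_lim by (rule order_tendstoD) simp
  ultimately show "\<forall>\<^sub>F n in sequentially. dist (gexp (p n) (pairs {1..n}) (\<lambda>E. cyc {1..n} E / sqrt (real n))) 0 < e"
    using ev_p eventually_ge_at_top[of m0]
  proof eventually_elim
    case (elim n)
    have n: "real n > 0" using elim by auto
    let ?T = "\<Sum>t=1..n. real t * cluster_wt (p n) n t"
    have "rate n - c \<le> (\<bar>\<theta>\<bar> + 1) / sqrt (real n)" using elim(2) n by (simp add: field_simps)
    then have "rate n \<le> 1 + (\<bar>\<theta>\<bar> + 1) / sqrt (real n)" using assms by linarith
    moreover have "0 \<le> rate n" using elim(3) by (simp add: rate_def mult_nonneg_nonpos)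
    moreover have "cluster_law n (rate n) (cluster_wt (p n) n)"
      unfolding rate_def using elim(3) by (intro cluster_law_cluster_wt) auto
    ultimately have T: "?T \<le> e' * sqrt (real n)" using elim(4) m0 by blast
    have T0: "0 \<le> ?T" using elim by (auto intro!: sum_nonneg mult_nonneg_nonneg cluster_wt_nonneg)
    have "gexp (p n) (pairs {1..n}) (cyc {1..n}) \<le> p n * real n / 2 * ?T"
      using gexp_cyc_le[of "{1..n}" "p n"] elim by simp
    also have "\<dots> \<le> (c + 1) * (e' * sqrt (real n))"
    proof (rule mult_mono[OF _ T _ T0])
      have "p n * real n = cn n" using elim by (metis mult.commute)
      then have "p n * real n \<le> c + 1" using elim(1) by (simp only: less_imp_le)
      moreover have "0 \<le> p n * real n" using elim by simp
      ultimately show "p n * real n / 2 \<le> c + 1" by linarith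
    qed (use c_pos in simp)
    also have "(c + 1) * (e' * sqrt (real n)) = ((c + 1) * e') * sqrt (real n)" by (rule mult.assoc[symmetric])
    also have "(c + 1) * e' = e / 2"
    proof -
      have "d * (e / 2 / d) = e / 2" if "d \<noteq> 0" for d using that by simp
      moreover have "c + 1 \<noteq> 0" using c_pos by simp
      ultimately show ?thesis unfolding e'_def by blast
    qed
    finally have "gexp (p n) (pairs {1..n}) (cyc {1..n}) / sqrt (real n) \<le> e / 2"
      using n by (simp add: pos_divide_le_eq)
    moreover have "0 \<le> gexp (p n) (pairs {1..n}) (cyc {1..n}) / sqrt (real n)"
      using elim by (intro divide_nonneg_nonneg gexp_nonneg cyc_nonneg) auto
    ultimately show ?case using e unfolding divide_inverse gexp_mult_right by simp
  qed
qed

text \<open>The number of components is n minus the number of edges plus \<open>cyc\<close>, and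
  only the edges fluctuate on the scale sqrt n. Continuous step functions serve as tests because
  they are uniformly continuous and therefore tolerate a perturbation small in mean.\<close>

lemma subcritical_components:
  assumes c1: "c \<le> 1"
  shows "weak_conv_m (\<lambda>n. distr (random_graph n (p n)) borel
      (\<lambda>E. sqrt (real n) * (real (card (graph_components n E)) / real n - (1 - c / 2))))
    (normal_law (- \<theta> / 2) (sqrt (c / 2)))"
proof (rule integral_cts_step_conv_imp_weak_conv)
  let ?S = "\<lambda>n E. sqrt (real n) * (real (card (graph_components n E)) / real n - (1 - c / 2))"
  fix x y :: real assume xy: "x < y"
  define f where "f = cts_step x y"
  have bnd: "0 \<le> f t" "f t \<le> 1" for t using xy by (auto simp: f_def cts_step_def field_simps)
  have uc: "uniformly_continuous_on UNIV f" unfolding f_def using xy by (rule cts_step_uniformly_continuous)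
  define g where "g z = f (- \<theta> / 2 + sqrt (c / 2) * z)" for z
  have "continuous_on UNIV f" using uc by (rule uniformly_continuous_imp_continuous)
  then have "continuous_on UNIV g" unfolding g_def
    by (rule continuous_on_compose2) (auto intro!: continuous_intros)
  moreover have "\<bar>g z\<bar> \<le> 1" for z using bnd by (simp add: g_def)
  ultimately have lim: "(\<lambda>n. gexp (p n) (pairs {1..n}) (\<lambda>E. g (edge_dev n E))) \<longlonglongrightarrow> (\<integral>z. g z \<partial>std_normal_distribution)"
    by (rule gexp_edge_dev)
  have "(\<lambda>n. gexp (p n) (pairs {1..n}) (\<lambda>E. f (?S n E)) - gexp (p n) (pairs {1..n}) (\<lambda>E. g (edge_dev n E))) \<longlonglongrightarrow> 0"
  proof (rule tendstoI)
    fix e :: real assume e: "0 < e"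
    obtain \<delta> where \<delta>: "0 < \<delta>" "\<And>a b. \<bar>a - b\<bar> < \<delta> \<Longrightarrow> \<bar>f a - f b\<bar> < e / 2"
      using uc e unfolding uniformly_continuous_on_def dist_real_def
      by (metis UNIV_I abs_minus_commute half_gt_zero)
    have "\<forall>\<^sub>F n in sequentially. gexp (p n) (pairs {1..n}) (\<lambda>E. cyc {1..n} E / sqrt (real n)) < \<delta> * (e / 2)"
      using gexp_cyc_small[OF c1] by (rule order_tendstoD) (use e \<delta>(1) in simp)
    then show "\<forall>\<^sub>F n in sequentially. dist (gexp (p n) (pairs {1..n}) (\<lambda>E. f (?S n E)) -
        gexp (p n) (pairs {1..n}) (\<lambda>E. g (edge_dev n E))) 0 < e"
      using ev_p
    proof eventually_elim
      case (elim n)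
      have n0: "n > 0" using elim by auto
      \<comment> \<open>Either the perturbation is below \<delta>, and uniform continuity applies,
        or the last term is at least 1 and dominates the trivial bound. Its expectation is the
        Markov bound.\<close>
      have le: "\<bar>f (?S n E) - g (edge_dev n E)\<bar> \<le> e / 2 + cyc {1..n} E / sqrt (real n) * (1 / \<delta>)"
        if E: "E \<subseteq> pairs {1..n}" for E
      proof -
        define k where "k = cyc {1..n} E / sqrt (real n)"
        have k: "0 \<le> k" using E by (auto simp: k_def intro!: divide_nonneg_nonneg cyc_nonneg)
        have comps: "real (card (graph_components n E)) = real n - real (card E) + cyc {1..n} E"
          by (simp add: cyc_def graph_components_eq)
        have "?S n E = (c / 2 * real n - real (card E)) / sqrt (real n) + k"
          unfolding sqrt_times_diff[OF n0] comps k_def add_divide_distrib[symmetric]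
          by (intro arg_cong2[where f="(/)"] refl) (simp add: algebra_simps)
        then have eq: "?S n E = (- \<theta> / 2 + sqrt (c / 2) * edge_dev n E) + k"
          using c_pos by (simp add: edge_dev_def)
        show ?thesis
        proof (cases "k < \<delta>")
          case True
          then have "\<bar>f (?S n E) - g (edge_dev n E)\<bar> < e / 2"
            unfolding eq g_def using k by (intro \<delta>(2)) simp
          moreover have "0 \<le> k * (1 / \<delta>)" using k \<delta>(1) by simp
          ultimately show ?thesis unfolding k_def by linarith
        next
          case False
          then have "1 \<le> k * (1 / \<delta>)" using \<delta>(1) by (simp add: field_simps)
          moreover have "\<bar>f a - f b\<bar> \<le> 1" for a b using bnd[of a] bnd[of b] by (auto simp: abs_le_iff)
          then have "\<bar>f (?S n E) - g (edge_dev n E)\<bar> \<le> 1" unfolding g_def .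
          ultimately show ?thesis using e unfolding k_def by linarith
        qed
      qed
      have "\<bar>gexp (p n) (pairs {1..n}) (\<lambda>E. f (?S n E)) - gexp (p n) (pairs {1..n}) (\<lambda>E. g (edge_dev n E))\<bar> =
          \<bar>gexp (p n) (pairs {1..n}) (\<lambda>E. f (?S n E) - g (edge_dev n E))\<bar>" unfolding gexp_diff ..
      also have "\<dots> \<le> gexp (p n) (pairs {1..n}) (\<lambda>E. \<bar>f (?S n E) - g (edge_dev n E)\<bar>)"
        using elim by (intro gexp_abs_le) auto
      also have "\<dots> \<le> gexp (p n) (pairs {1..n}) (\<lambda>E. e / 2 + cyc {1..n} E / sqrt (real n) * (1 / \<delta>))"
        by (rule gexp_mono) (use elim le in auto)
      also have "\<dots> = e / 2 + gexp (p n) (pairs {1..n}) (\<lambda>E. cyc {1..n} E / sqrt (real n)) * (1 / \<delta>)"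
        unfolding gexp_add gexp_mult_right by (simp add: gexp_const)
      also have "\<dots> < e / 2 + \<delta> * (e / 2) * (1 / \<delta>)"
        using elim \<delta>(1) by (intro add_strict_left_mono mult_strict_right_mono) auto
      also have "\<dots> = e" using \<delta>(1) by simp
      finally show ?case by simp
    qed
  qed
  from tendsto_add[OF this lim]
  have "(\<lambda>n. gexp (p n) (pairs {1..n}) (\<lambda>E. f (?S n E))) \<longlonglongrightarrow> (\<integral>z. g z \<partial>std_normal_distribution)" by simp
  moreover have "\<forall>\<^sub>F n in sequentially. gexp (p n) (pairs {1..n}) (\<lambda>E. f (?S n E)) =
      integral\<^sup>L (distr (random_graph n (p n)) borel (?S n)) f"
    using ev_p
  proof eventually_elim
    case (elim n)
    have "f \<in> borel_measurable borel" using \<open>continuous_on UNIV f\<close> by (rule borel_measurable_continuous_onI)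
    then have "integral\<^sup>L (distr (random_graph n (p n)) borel (?S n)) f = measure_pmf.expectation (random_graph n (p n)) (\<lambda>E. f (?S n E))"
      by (subst integral_distr) auto
    then show ?case using expectation_random_graph[of "p n" n] elim by simp
  qed
  ultimately have "(\<lambda>n. integral\<^sup>L (distr (random_graph n (p n)) borel (?S n)) f) \<longlonglongrightarrow> (\<integral>z. g z \<partial>std_normal_distribution)"
    by (rule Lim_transform_eventually)
  also have "(\<integral>z. g z \<partial>std_normal_distribution) = integral\<^sup>L (normal_law (- \<theta> / 2) (sqrt (c / 2))) f"
    unfolding normal_law_def g_def
    by (subst integral_distr) (use \<open>continuous_on UNIV f\<close> in \<open>auto intro: borel_measurable_continuous_onI\<close>)
  finally show "(\<lambda>n. integral\<^sup>L (distr (random_graph n (p n)) borel (?S n)) (cts_step x y)) \<longlonglongrightarrow>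
      integral\<^sup>L (normal_law (- \<theta> / 2) (sqrt (c / 2))) (cts_step x y)" by (simp add: f_def)
qed (auto intro!: real_distribution_normal_law prob_space.real_distribution_distr measure_pmf.prob_space_axioms)

end

section \<open>The joint limit\<close>

locale giant_component = giant +
  fixes L :: "nat \<Rightarrow> nat set set \<Rightarrow> nat set"
  assumes L: "\<And>n E. n > 0 \<Longrightarrow> E \<subseteq> all_edges n \<Longrightarrow> is_largest_component n E (L n E)"
begin

definition comps_dev :: "nat \<Rightarrow> nat set set \<Rightarrow> real" where
  "comps_dev n E = sqrt (real n) * (real (card (graph_components n E)) / real n - \<alpha>)"

definition size_dev :: "nat \<Rightarrow> nat set set \<Rightarrow> real" where
  "size_dev n E = sqrt (real n) * (real (card (L n E)) / real n - \<beta>)"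

definition excess_dev :: "nat \<Rightarrow> nat set set \<Rightarrow> real" where
  "excess_dev n E = sqrt (real n) * (real_of_int (excess_edges E (L n E)) / real n - \<gamma>)"

text \<open>\<open>X1\<close>, \<open>X2\<close>, \<open>X3\<close> correspond to
  \<open>xi1\<close>, \<open>xi2\<close>, \<open>xi3\<close>, with the actual component count and
  the component chosen by \<open>L\<close>.\<close>

definition X1 :: "nat \<Rightarrow> nat set set \<Rightarrow> real" where "X1 n E = (size_dev n E - m2) / sd1"

definition X2 :: "nat \<Rightarrow> nat set set \<Rightarrow> real" where
  "X2 n E = (comps_dev n E - m1 + \<tau> * (size_dev n E - m2)) / sd2"

definition X3 :: "nat \<Rightarrow> nat set set \<Rightarrow> real" where
  "X3 n E = (excess_dev n E - m3 - (c - 1) * \<tau> * (size_dev n E - m2)) / sd3"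

text \<open>A largest component is at least as large as \<open>S\<close>, hence above \<beta> n/2,
  hence near or far; it is not far, and \<open>S\<close> is the only near one. Ties cannot
  matter.\<close>

lemma largest_near:
  assumes n: "n > 0" and E: "E \<subseteq> pairs {1..n}" and big: "\<And>s. s \<in> near n \<Longrightarrow> \<beta> / 2 * real n < real s"
    and nears: "nears n E = {S}" and fars: "fars n E = {}"
  shows "L n E = S"
proof -
  have S: "S \<in> comps {1..n} E" "card S \<in> near n" using nears by (auto simp: nears_def)
  have Lc: "L n E \<in> comps {1..n} E" "card S \<le> card (L n E)"
    using L[OF n, of E] E S(1) by (auto simp: is_largest_component_def graph_components_eq all_edges_eq)
  have "L n E \<subseteq> {1..n}" using Lc(1) by (rule comps_subset)
  then have "card (L n E) \<le> card {1..n}" by (intro card_mono) auto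
  moreover have "\<beta> / 2 * real n < real (card (L n E))" using big[OF S(2)] Lc(2) by linarith
  moreover have "0 \<le> \<beta> / 2 * real n" using \<beta>(1) by simp
  ultimately have "card (L n E) \<in> far (\<beta> / 2) n \<or> card (L n E) \<in> near n"
    by (auto simp: far_def)
  moreover have "card (L n E) \<notin> far (\<beta> / 2) n" using fars Lc(1) by (auto simp: fars_def)
  ultimately have "L n E \<in> nears n E" using Lc(1) by (simp add: nears_def)
  then show ?thesis using nears by simp
qed

lemma coordinates:
  assumes n: "n > 0" and E: "E \<subseteq> pairs {1..n}" and S: "S \<in> comps {1..n} E" "L n E = S"
  defines "e1 \<equiv> real (card (E \<inter> pairs S))" and "e2 \<equiv> real (card (E \<inter> pairs ({1..n} - S)))"
    and "k \<equiv> cyc ({1..n} - S) (E \<inter> pairs ({1..n} - S)) / sqrt (real n)"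
  shows "X1 n E = xi1 n (card S)" "X2 n E = xi2 n (card S) e2 + k / sd2" "X3 n E = xi3 n (card S) e1"
proof -
  have b: "size_dev n E = Vb n (card S)" unfolding size_dev_def Vb_def sqrt_times_diff[OF n] S(2) ..
  have a: "comps_dev n E = Va n (card S) e2 + k"
    unfolding comps_dev_def Va_def sqrt_times_diff[OF n] k_def e2_def graph_components_eq add_divide_distrib[symmetric]
    using cyc_comps[OF _ E S(1)] by (intro arg_cong2[where f="(/)"] refl) simp
  have c: "excess_dev n E = Vc n (card S) e1"
    unfolding excess_dev_def Vc_def sqrt_times_diff[OF n] S(2) excess_edges_comps[OF E] e1_def ..
  show "X1 n E = xi1 n (card S)" unfolding X1_def xi1_def b ..
  show "X2 n E = xi2 n (card S) e2 + k / sd2"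
    unfolding X2_def xi2_def a b by (simp add: add_divide_distrib diff_divide_distrib)
  show "X3 n E = xi3 n (card S) e1" unfolding X3_def xi3_def c b ..
qed

text \<open>If there is exactly one component of size near \<open>\<beta> n\<close> and no other large one, the two sides differ only
  through the cycles outside the giant; the first two terms of the bound dominate the remaining cases.\<close>

lemma near_comparison:
  assumes n: "n > 0" and E: "E \<subseteq> pairs {1..n}" and big: "\<And>s. s \<in> near n \<Longrightarrow> \<beta> / 2 * real n < real s"
    and bnd: "\<And>x. f x \<in> {0..1}" "\<And>x. g x \<in> {0..1}" "\<And>x. h x \<in> {0..(1::real)}"
    and uc: "\<And>x y. \<bar>x - y\<bar> < \<delta> \<Longrightarrow> \<bar>g x - g y\<bar> \<le> e" and \<delta>: "0 < \<delta>" and e: "0 \<le> e"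
  defines "F S \<equiv> f (xi1 n (card S)) * g (xi2 n (card S) (real (card (E \<inter> pairs ({1..n} - S))))) *
    h (xi3 n (card S) (real (card (E \<inter> pairs S))))"
    and "K S \<equiv> cyc ({1..n} - S) (E \<inter> pairs ({1..n} - S)) / sqrt (real n)"
  shows "\<bar>f (X1 n E) * g (X2 n E) * h (X3 n E) - (\<Sum>S\<in>nears n E. F S)\<bar> \<le>
    3 * (real (card (nears n E)) - 1)\<^sup>2 + 2 * real (card (fars n E)) +
    (\<Sum>S\<in>nears n E. e + K S * (1 / (\<delta> * sd2)))"
proof -
  let ?N = "real (card (nears n E))"
  let ?\<Phi> = "f (X1 n E) * g (X2 n E) * h (X3 n E)"
  let ?R = "\<Sum>S\<in>nears n E. e + K S * (1 / (\<delta> * sd2))"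
  have K: "0 \<le> K S" for S unfolding K_def by (intro divide_nonneg_nonneg cyc_nonneg) auto
  have R: "0 \<le> ?R" using e K \<delta> sd2(1) by (intro sum_nonneg add_nonneg_nonneg mult_nonneg_nonneg) auto
  have prod: "f x * g y * h z \<in> {0..1}" for x y z
  proof -
    have "f x * g y \<le> 1 * 1" using bnd(1)[of x] bnd(2)[of y] by (intro mult_mono) auto
    then have "f x * g y * h z \<le> 1 * 1" using bnd(1)[of x] bnd(2)[of y] bnd(3)[of z]
      by (intro mult_mono) auto
    then show ?thesis using bnd(1)[of x] bnd(2)[of y] bnd(3)[of z] by simp
  qed
  have F: "0 \<le> F S" "F S \<le> 1" for S using prod unfolding F_def by auto
  have \<Phi>: "0 \<le> ?\<Phi>" "?\<Phi> \<le> 1" using prod by auto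
  have sumF: "0 \<le> (\<Sum>S\<in>nears n E. F S)" "(\<Sum>S\<in>nears n E. F S) \<le> ?N"
  proof -
    show "0 \<le> (\<Sum>S\<in>nears n E. F S)" using F by (intro sum_nonneg) auto
    have "(\<Sum>S\<in>nears n E. F S) \<le> (\<Sum>S\<in>nears n E. 1)" using F by (intro sum_mono) auto
    then show "(\<Sum>S\<in>nears n E. F S) \<le> ?N" by simp
  qed
  have crude: "\<bar>?\<Phi> - (\<Sum>S\<in>nears n E. F S)\<bar> \<le> max 1 ?N"
    using \<Phi> sumF by (auto simp: abs_le_iff)
  consider "card (nears n E) \<noteq> 1" | "card (nears n E) = 1" "fars n E \<noteq> {}" | "card (nears n E) = 1" "fars n E = {}"
    by blast
  then show ?thesis
  proof cases
    case 1
    \<comment> \<open>For N = 0 the right side is 3, and for y = N - 1 \<ge> 1 it is 3 y^2 \<ge> y +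
      1: the squared deviation controls both absence and multiplicity.\<close>
    have sq: "max 1 ?N \<le> 3 * (?N - 1)\<^sup>2"
    proof (cases "card (nears n E) = 0")
      case False
      define y where "y = ?N - 1"
      have "2 \<le> card (nears n E)" using 1 False by linarith
      then have y: "1 \<le> y" by (simp add: y_def)
      then have "1 * y \<le> y * y" by (intro mult_right_mono) auto
      then have "y + 1 \<le> 3 * y\<^sup>2" using y unfolding power2_eq_square by linarith
      then show ?thesis using y by (simp add: y_def)
    qed simp
    show ?thesis using order_trans[OF crude sq] R of_nat_0_le_iff[of "card (fars n E)", where 'a=real] by linarith
  next
    case 2
    then have "1 \<le> card (fars n E)" by (simp add: Suc_le_eq card_gt_0_iff)
    then have "1 \<le> real (card (fars n E))" by simp
    moreover have "max 1 ?N = 1" using 2(1) by simp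
    ultimately show ?thesis using crude R zero_le_power2[of "?N - 1"] by linarith
  next
    case 3
    then obtain S where S: "nears n E = {S}" by (auto simp: card_1_singleton_iff)
    have LS: "L n E = S" by (rule largest_near[OF n E big S 3(2)])
    have "S \<in> comps {1..n} E" using S by (auto simp: nears_def)
    note co = coordinates[OF n E this LS]
    define a b d where "a = f (xi1 n (card S))" and "b = h (xi3 n (card S) (real (card (E \<inter> pairs S))))"
      and "d = xi2 n (card S) (real (card (E \<inter> pairs ({1..n} - S))))"
    have ab: "0 \<le> a * b" "a * b \<le> 1" using bnd mult_le_one[of a b] by (auto simp: a_def b_def)
    \<comment> \<open>Only the middle coordinate is perturbed, by the cycles outside the giant, so
      only \<open>g\<close> needs a modulus of continuity.\<close>
    have "?\<Phi> - (\<Sum>S\<in>nears n E. F S) = a * b * (g (d + K S / sd2) - g d)"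
      unfolding S F_def co by (simp add: a_def b_def d_def K_def algebra_simps)
    then have "\<bar>?\<Phi> - (\<Sum>S\<in>nears n E. F S)\<bar> = a * b * \<bar>g (d + K S / sd2) - g d\<bar>"
      using ab(1) by (simp only: abs_mult[of "a * b"] abs_of_nonneg)
    also have "\<dots> \<le> 1 * \<bar>g (d + K S / sd2) - g d\<bar>" using ab by (intro mult_right_mono) auto
    also have "\<dots> \<le> 1 * (e + K S * (1 / (\<delta> * sd2)))"
    proof (cases "K S / sd2 < \<delta>")
      case True
      then have "\<bar>g (d + K S / sd2) - g d\<bar> \<le> e" using K sd2(1) by (intro uc) simp
      moreover have "0 \<le> K S * (1 / (\<delta> * sd2))" using K \<delta> sd2(1) by simp
      ultimately show ?thesis by simp
    next
      case False
      then have "1 \<le> K S * (1 / (\<delta> * sd2))" using \<delta> sd2(1) by (simp add: field_simps)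
      moreover have "\<bar>g (d + K S / sd2) - g d\<bar> \<le> 1" using bnd(2)[of "d + K S / sd2"] bnd(2)[of d] by (auto simp: abs_le_iff)
      ultimately show ?thesis using e by simp
    qed
    finally show ?thesis using S 3(2) by simp
  qed
qed

lemma standardised_limit:
  assumes cont: "uniformly_continuous_on UNIV f" "uniformly_continuous_on UNIV g" "uniformly_continuous_on UNIV h"
    and bnd: "\<And>x. f x \<in> {0..1}" "\<And>x. g x \<in> {0..1}" "\<And>x. h x \<in> {0..(1::real)}"
  shows "(\<lambda>n. G n (\<lambda>E. f (X1 n E) * g (X2 n E) * h (X3 n E))) \<longlonglongrightarrow>
    (\<integral>x. f x \<partial>std_normal_distribution) * (\<integral>x. g x \<partial>std_normal_distribution) * (\<integral>x. h x \<partial>std_normal_distribution)"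
proof -
  define \<Phi> where "\<Phi> n E = f (X1 n E) * g (X2 n E) * h (X3 n E)" for n E
  define \<Psi> where "\<Psi> n E = (\<Sum>S\<in>nears n E. f (xi1 n (card S)) * g (xi2 n (card S) (real (card (E \<inter> pairs ({1..n} - S))))) *
    h (xi3 n (card S) (real (card (E \<inter> pairs S)))))" for n E
  have \<Psi>: "(\<lambda>n. G n (\<Psi> n)) \<longlonglongrightarrow>
    (\<integral>x. f x \<partial>std_normal_distribution) * (\<integral>x. g x \<partial>std_normal_distribution) * (\<integral>x. h x \<partial>std_normal_distribution)"
    using near_exp_product[OF cont[THEN uniformly_continuous_imp_continuous] bnd]
    unfolding near_exp_nears \<Psi>_def .
  have "(\<lambda>n. G n (\<Phi> n) - G n (\<Psi> n)) \<longlonglongrightarrow> 0"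
  proof (rule tendstoI)
    fix \<epsilon> :: real assume \<epsilon>: "0 < \<epsilon>"
    define e where "e = \<epsilon> / 2"
    have e: "0 < e" using \<epsilon> by (simp add: e_def)
    obtain \<delta> where \<delta>: "0 < \<delta>" "\<And>x y. \<bar>x - y\<bar> < \<delta> \<Longrightarrow> \<bar>g x - g y\<bar> < e"
      using cont(2) e unfolding uniformly_continuous_on_def dist_real_def by (metis UNIV_I abs_minus_commute)
    define k where "k = 1 / (\<delta> * sd2)"
    \<comment> \<open>A bound in terms of quantities with known expectations: in the limit only e =
      \<epsilon>/2 times the expected number of near components survives.\<close>
    define B where "B n E = 3 * (real (card (nears n E)) - 1)\<^sup>2 + 2 * real (card (fars n E)) +
      (e * real (card (nears n E)) + (\<Sum>S\<in>nears n E. cyc ({1..n} - S) (E \<inter> pairs ({1..n} - S)) / sqrt (real n)) * k)" for n E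
    have "(\<lambda>n. G n (B n)) \<longlonglongrightarrow> 3 * 0 + 2 * 0 + (e * 1 + 0 * k)"
      unfolding B_def gexp_add gexp_cmult gexp_mult_right
      by (intro tendsto_intros gexp_nears_deviation gexp_card_fars gexp_card_nears gexp_cyc_rest)
    then have "\<forall>\<^sub>F n in sequentially. G n (B n) < \<epsilon>" by (rule order_tendstoD) (use \<epsilon> in \<open>simp add: e_def\<close>)
    moreover have "0 < \<beta> / 4" using \<beta>(1) by simp
    note near_bounds[OF this]
    ultimately show "\<forall>\<^sub>F n in sequentially. dist (G n (\<Phi> n) - G n (\<Psi> n)) 0 < \<epsilon>"
      using ev_p near_bounds[OF \<open>0 < \<beta> / 4\<close>]
    proof eventually_elim
      case (elim n)
      have n: "n > 0" using elim by auto
      have big: "\<beta> / 2 * real n < real s" if s: "s \<in> near n" for s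
      proof -
        have "\<bar>real s - \<beta> * real n\<bar> \<le> \<beta> / 4 * real n" using elim s by blast
        then have "- (real s - \<beta> * real n) \<le> \<beta> / 4 * real n" by (simp only: abs_le_iff)
        moreover have "0 < \<beta> * real n" using n \<beta>(1) by simp
        ultimately show ?thesis by (simp add: field_simps)
      qed
      have le: "\<bar>\<Phi> n E - \<Psi> n E\<bar> \<le> B n E" if E: "E \<subseteq> pairs {1..n}" for E
      proof -
        have "\<bar>\<Phi> n E - \<Psi> n E\<bar> \<le> 3 * (real (card (nears n E)) - 1)\<^sup>2 + 2 * real (card (fars n E)) +
          (\<Sum>S\<in>nears n E. e + cyc ({1..n} - S) (E \<inter> pairs ({1..n} - S)) / sqrt (real n) * (1 / (\<delta> * sd2)))"
          unfolding \<Phi>_def \<Psi>_def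
          by (rule near_comparison[OF n E big bnd _ \<delta>(1)]) (use \<delta>(2) e less_imp_le in auto)
        also have "\<dots> = B n E" unfolding B_def k_def[symmetric] sum.distrib sum_distrib_right by simp
        finally show ?thesis .
      qed
      have "\<bar>G n (\<Phi> n) - G n (\<Psi> n)\<bar> = \<bar>G n (\<lambda>E. \<Phi> n E - \<Psi> n E)\<bar>" unfolding gexp_diff ..
      also have "\<dots> \<le> G n (\<lambda>E. \<bar>\<Phi> n E - \<Psi> n E\<bar>)" using elim by (intro gexp_abs_le) auto
      also have "\<dots> \<le> G n (B n)" by (rule gexp_mono) (use elim le in auto)
      also have "\<dots> < \<epsilon>" using elim by blast
      finally show ?case by simp
    qed
  qed
  from tendsto_add[OF this \<Psi>] show ?thesis by (simp add: \<Phi>_def[abs_def])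
qed

end

section \<open>Weak convergence of the triple and the moments of its limit\<close>

lemma weak_conv_law_map:
  fixes T :: "'a::euclidean_space \<Rightarrow> 'b::euclidean_space"
  assumes conv: "weak_conv_law M N" and sets: "\<And>n. sets (M n) = sets borel" "sets N = sets borel"
    and T: "continuous_on UNIV T"
  shows "weak_conv_law (\<lambda>n. distr (M n) borel T) (distr N borel T)"
  unfolding weak_conv_law_def
proof (intro allI impI)
  fix f :: "'b \<Rightarrow> real" assume f: "continuous_on UNIV f" "bounded (range f)"
  have eq: "integral\<^sup>L (distr P borel T) f = integral\<^sup>L P (\<lambda>x. f (T x))" if "sets P = sets borel" for P
  proof (rule integral_distr)
    show "T \<in> P \<rightarrow>\<^sub>M borel"
      using borel_measurable_continuous_onI[OF T] measurable_cong_sets[OF that refl] by blast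
    show "f \<in> borel_measurable borel" by (rule borel_measurable_continuous_onI[OF f(1)])
  qed
  have "continuous_on UNIV (\<lambda>x. f (T x))" using continuous_on_compose2[OF f(1) T] by simp
  moreover have "bounded (range (\<lambda>x. f (T x)))" using f(2) by (rule bounded_subset) auto
  ultimately show "(\<lambda>n. integral\<^sup>L (distr (M n) borel T) f) \<longlonglongrightarrow> integral\<^sup>L (distr N borel T) f"
    using conv unfolding eq[OF sets(1)] eq[OF sets(2)] weak_conv_law_def by blast
qed

lemma measurable_random_graph: "X \<in> measure_pmf (random_graph n q) \<rightarrow>\<^sub>M borel"
  by simp

lemma prod_UNIV_3: "prod f (UNIV :: 3 set) = f 1 * f 2 * (f 3 :: real)"
  unfolding UNIV_3 by (simp add: ac_simps)

context giant_component
begin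

text \<open>By \<open>weak_conv_product\<close> it suffices to test with products, whose integral
  under the standard Gaussian law is the product limit of \<open>standardised_limit\<close>.\<close>

lemma standardised_weak_limit:
  "weak_conv_law (\<lambda>n. distr (random_graph n (p n)) borel (\<lambda>E. vector [X1 n E, X2 n E, X3 n E] :: real ^ 3)) std_gauss"
proof (rule weak_conv_product)
  show "prob_space (distr (random_graph n (p n)) borel (\<lambda>E. vector [X1 n E, X2 n E, X3 n E] :: real ^ 3))" for n
    by (rule measure_pmf.prob_space_distr) simp
  show "prob_space (std_gauss :: (real ^ 3) measure)" by (rule prob_space_std_gauss)
  fix f :: "3 \<Rightarrow> real \<Rightarrow> real"
  assume uc: "\<And>i. uniformly_continuous_on UNIV (f i)" and bnd: "\<And>i t. 0 \<le> f i t \<and> f i t \<le> 1"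
  have cont: "continuous_on UNIV (f i)" for i using uc by (rule uniformly_continuous_imp_continuous)
  then have meas: "f i \<in> borel_measurable borel" for i by (rule borel_measurable_continuous_onI)
  have "(\<lambda>n. G n (\<lambda>E. f 1 (X1 n E) * f 2 (X2 n E) * f 3 (X3 n E))) \<longlonglongrightarrow>
    (\<integral>x. f 1 x \<partial>std_normal_distribution) * (\<integral>x. f 2 x \<partial>std_normal_distribution) * (\<integral>x. f 3 x \<partial>std_normal_distribution)"
    by (rule standardised_limit) (use uc bnd in auto)
  note lim = this
  have prod3: "(\<Prod>i\<in>UNIV. f i ((vector [a, b, d] :: real ^ 3) $ i)) = f 1 a * f 2 b * f 3 d" for a b d
    unfolding prod_UNIV_3 vector_3 ..
  note lim
  moreover have "\<forall>\<^sub>F n in sequentially. G n (\<lambda>E. f 1 (X1 n E) * f 2 (X2 n E) * f 3 (X3 n E)) =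
      (\<integral>x. (\<Prod>i\<in>UNIV. f i (x $ i)) \<partial>distr (random_graph n (p n)) borel (\<lambda>E. vector [X1 n E, X2 n E, X3 n E] :: real ^ 3))"
    using ev_p
  proof eventually_elim
    case (elim n)
    have "(\<lambda>x :: real ^ 3. \<Prod>i\<in>UNIV. f i (x $ i)) \<in> borel_measurable borel"
      by (intro borel_measurable_prod measurable_compose[OF measurable_nth meas])
    note meas_prod = this
    have "(\<integral>x. (\<Prod>i\<in>UNIV. f i (x $ i)) \<partial>distr (random_graph n (p n)) borel (\<lambda>E. vector [X1 n E, X2 n E, X3 n E] :: real ^ 3)) =
        measure_pmf.expectation (random_graph n (p n)) (\<lambda>E. f 1 (X1 n E) * f 2 (X2 n E) * f 3 (X3 n E))"
      unfolding prod3[symmetric] by (rule integral_distr[OF measurable_random_graph meas_prod])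
    then show ?case using expectation_random_graph[of "p n" n] elim by simp
  qed
  moreover have "(\<integral>x. (\<Prod>i\<in>UNIV. f i (x $ i)) \<partial>(std_gauss :: (real ^ 3) measure)) =
    (\<integral>x. f 1 x \<partial>std_normal_distribution) * (\<integral>x. f 2 x \<partial>std_normal_distribution) * (\<integral>x. f 3 x \<partial>std_normal_distribution)"
  proof -
    have "integrable std_normal_distribution (f i)" for i
    proof (rule std_normal.integrable_const_bound[where B=1])
      show "AE x in std_normal_distribution. norm (f i x) \<le> 1" using bnd by simp
      show "f i \<in> borel_measurable std_normal_distribution" using meas[of i] by simp
    qed
    from integral_prod_std_gauss[OF this, where 'n=3] show ?thesis unfolding prod_UNIV_3 .
  qed
  ultimately show "(\<lambda>n. \<integral>x. (\<Prod>i\<in>UNIV. f i (x $ i)) \<partial>distr (random_graph n (p n)) borel (\<lambda>E. vector [X1 n E, X2 n E, X3 n E] :: real ^ 3))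
      \<longlonglongrightarrow> (\<integral>x. (\<Prod>i\<in>UNIV. f i (x $ i)) \<partial>(std_gauss :: (real ^ 3) measure))"
    by (simp only: Lim_transform_eventually)
qed simp_all

definition limit_mean :: "real ^ 3" where "limit_mean = vector [m1, m2, m3]"

text \<open>The linear part of the inverse of the standardisation \<open>X1\<close>, \<open>X2\<close>, \<open>X3\<close>.\<close>

definition limit_root :: "3 \<Rightarrow> 3 \<Rightarrow> real" where
  "limit_root i j = (vector [vector [- (\<tau> * sd1), sd2, 0], vector [sd1, 0, 0], vector [(c - 1) * \<tau> * sd1, 0, sd3]] :: real ^ 3 ^ 3) $ i $ j"

text \<open>The continuous mapping principle for the affine map that undoes the
  standardisation.\<close>

lemma joint_limit:
  "weak_conv_law (\<lambda>n. distr (random_graph n (p n)) borel (\<lambda>E. vector [comps_dev n E, size_dev n E, excess_dev n E] :: real ^ 3))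
    (affine_gauss limit_mean limit_root)"
proof -
  let ?T = "\<lambda>x. \<chi> i. limit_mean $ i + lin (limit_root i) x"
  have T: "continuous_on UNIV ?T"
    unfolding lin_def by (intro continuous_on_vec_lambda continuous_intros)
  have eq: "?T (vector [X1 n E, X2 n E, X3 n E]) = vector [comps_dev n E, size_dev n E, excess_dev n E]" for n E
    using sd1(1) sd2(1) sd3(1)
    by (simp add: vec_eq_iff forall_3 lin_def sum_3 limit_mean_def limit_root_def X1_def X2_def X3_def)
  have "weak_conv_law (\<lambda>n. distr (distr (random_graph n (p n)) borel (\<lambda>E. vector [X1 n E, X2 n E, X3 n E] :: real ^ 3)) borel ?T)
      (distr std_gauss borel ?T)"
    by (rule weak_conv_law_map[OF standardised_weak_limit _ _ T]) simp_all
  then show ?thesis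
    unfolding affine_gauss_def
    by (simp add: distr_distr borel_measurable_continuous_onI[OF T] comp_def eq)
qed

lemma limit_covariance:
  "(\<Sum>j\<in>UNIV. (limit_root 1 j)\<^sup>2) = \<beta> * (1 - \<beta>) + c * (1 - \<beta>)\<^sup>2 / 2"
  "(\<Sum>j\<in>UNIV. (limit_root 2 j)\<^sup>2) = \<beta> * (1 - \<beta>) / \<tau>\<^sup>2"
  "(\<Sum>j\<in>UNIV. (limit_root 3 j)\<^sup>2) = \<beta> * (1 - \<beta>) + c * \<beta> * (3 * \<beta> / 2 - 1)"
  "(\<Sum>j\<in>UNIV. limit_root 1 j * limit_root 2 j) = - \<beta> * (1 - \<beta>) / \<tau>"
  "(\<Sum>j\<in>UNIV. limit_root 1 j * limit_root 3 j) = - \<beta> * (1 - \<beta>) * (c - 1)"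
  "(\<Sum>j\<in>UNIV. limit_root 2 j * limit_root 3 j) = \<beta> * (1 - \<beta>) * (c - 1) / \<tau>"
proof -
  have \<tau>: "\<tau>\<^sup>2 * sd1\<^sup>2 = \<beta> * (1 - \<beta>)" using sd1(2) \<tau>_pos by simp
  have \<tau>': "\<tau> * sd1\<^sup>2 = \<beta> * (1 - \<beta>) / \<tau>" using sd1(2) \<tau>_pos by (simp add: power2_eq_square)
  note simps = sum_3 limit_root_def power_mult_distrib
  show "(\<Sum>j\<in>UNIV. (limit_root 1 j)\<^sup>2) = \<beta> * (1 - \<beta>) + c * (1 - \<beta>)\<^sup>2 / 2"
    by (simp add: simps \<tau> sd2(2))
  show "(\<Sum>j\<in>UNIV. (limit_root 2 j)\<^sup>2) = \<beta> * (1 - \<beta>) / \<tau>\<^sup>2"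
    by (simp add: simps sd1(2))
  have "(\<Sum>j\<in>UNIV. (limit_root 3 j)\<^sup>2) = (c - 1)\<^sup>2 * (\<tau>\<^sup>2 * sd1\<^sup>2) + sd3\<^sup>2" by (simp add: simps)
  then show "(\<Sum>j\<in>UNIV. (limit_root 3 j)\<^sup>2) = \<beta> * (1 - \<beta>) + c * \<beta> * (3 * \<beta> / 2 - 1)"
    unfolding \<tau> sd3(2) by (simp add: field_simps power2_eq_square)
  have "(\<Sum>j\<in>UNIV. limit_root 1 j * limit_root 2 j) = - (\<tau> * sd1\<^sup>2)" by (simp add: simps power2_eq_square)
  then show "(\<Sum>j\<in>UNIV. limit_root 1 j * limit_root 2 j) = - \<beta> * (1 - \<beta>) / \<tau>" unfolding \<tau>' by simp
  have "(\<Sum>j\<in>UNIV. limit_root 1 j * limit_root 3 j) = - (\<tau>\<^sup>2 * sd1\<^sup>2) * (c - 1)"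
    by (simp add: simps power2_eq_square)
  then show "(\<Sum>j\<in>UNIV. limit_root 1 j * limit_root 3 j) = - \<beta> * (1 - \<beta>) * (c - 1)" unfolding \<tau> by simp
  have "(\<Sum>j\<in>UNIV. limit_root 2 j * limit_root 3 j) = (\<tau> * sd1\<^sup>2) * (c - 1)"
    by (simp add: simps power2_eq_square)
  then show "(\<Sum>j\<in>UNIV. limit_root 2 j * limit_root 3 j) = \<beta> * (1 - \<beta>) * (c - 1) / \<tau>" unfolding \<tau>' by simp
qed

lemma limit_moments:
  defines "N \<equiv> affine_gauss limit_mean limit_root"
  shows "prob_space.expectation N (\<lambda>x. x $ 1) = - \<theta> * (1 - \<beta>\<^sup>2) / 2"
    "prob_space.expectation N (\<lambda>x. x $ 2) = \<theta> * \<beta> * (1 - \<beta>) / (1 - c * (1 - \<beta>))"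
    "prob_space.expectation N (\<lambda>x. x $ 3) = \<theta> * \<beta>\<^sup>2 / 2"
    "prob_space.variance N (\<lambda>x. x $ 1) = \<beta> * (1 - \<beta>) + c * (1 - \<beta>)\<^sup>2 / 2"
    "prob_space.variance N (\<lambda>x. x $ 2) = \<beta> * (1 - \<beta>) / (1 - c * (1 - \<beta>))\<^sup>2"
    "prob_space.variance N (\<lambda>x. x $ 3) = \<beta> * (1 - \<beta>) + c * \<beta> * (3 * \<beta> / 2 - 1)"
    "covariance N (\<lambda>x. x $ 1) (\<lambda>x. x $ 2) = - \<beta> * (1 - \<beta>) / (1 - c * (1 - \<beta>))"
    "covariance N (\<lambda>x. x $ 1) (\<lambda>x. x $ 3) = - \<beta> * (1 - \<beta>) * (c - 1)"
    "covariance N (\<lambda>x. x $ 2) (\<lambda>x. x $ 3) = \<beta> * (1 - \<beta>) * (c - 1) / (1 - c * (1 - \<beta>))"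
proof -
  have m: "limit_mean $ 1 = - \<theta> * (1 - \<beta>\<^sup>2) / 2" "limit_mean $ 2 = \<theta> * \<beta> * (1 - \<beta>) / (1 - c * (1 - \<beta>))"
    "limit_mean $ 3 = \<theta> * \<beta>\<^sup>2 / 2"
    by (simp_all add: limit_mean_def m1_def m2_def m3_def \<tau>_def)
  note entries = limit_covariance[unfolded \<tau>_def]
  show "prob_space.expectation N (\<lambda>x. x $ 1) = - \<theta> * (1 - \<beta>\<^sup>2) / 2"
    unfolding N_def by (rule trans[OF affine_gauss_moments(1) m(1)])
  show "prob_space.expectation N (\<lambda>x. x $ 2) = \<theta> * \<beta> * (1 - \<beta>) / (1 - c * (1 - \<beta>))"
    unfolding N_def by (rule trans[OF affine_gauss_moments(1) m(2)])
  show "prob_space.expectation N (\<lambda>x. x $ 3) = \<theta> * \<beta>\<^sup>2 / 2"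
    unfolding N_def by (rule trans[OF affine_gauss_moments(1) m(3)])
  show "prob_space.variance N (\<lambda>x. x $ 1) = \<beta> * (1 - \<beta>) + c * (1 - \<beta>)\<^sup>2 / 2"
    unfolding N_def by (rule trans[OF affine_gauss_moments(3)[where i=1 and A=limit_root] entries(1)])
  show "prob_space.variance N (\<lambda>x. x $ 2) = \<beta> * (1 - \<beta>) / (1 - c * (1 - \<beta>))\<^sup>2"
    unfolding N_def by (rule trans[OF affine_gauss_moments(3)[where i=2 and A=limit_root] entries(2)])
  show "prob_space.variance N (\<lambda>x. x $ 3) = \<beta> * (1 - \<beta>) + c * \<beta> * (3 * \<beta> / 2 - 1)"
    unfolding N_def by (rule trans[OF affine_gauss_moments(3)[where i=3 and A=limit_root] entries(3)])
  show "covariance N (\<lambda>x. x $ 1) (\<lambda>x. x $ 2) = - \<beta> * (1 - \<beta>) / (1 - c * (1 - \<beta>))"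
    unfolding N_def by (rule trans[OF affine_gauss_moments(2)[where i=1 and j=2 and A=limit_root] entries(4)])
  show "covariance N (\<lambda>x. x $ 1) (\<lambda>x. x $ 3) = - \<beta> * (1 - \<beta>) * (c - 1)"
    unfolding N_def by (rule trans[OF affine_gauss_moments(2)[where i=1 and j=3 and A=limit_root] entries(5)])
  show "covariance N (\<lambda>x. x $ 2) (\<lambda>x. x $ 3) = \<beta> * (1 - \<beta>) * (c - 1) / (1 - c * (1 - \<beta>))"
    unfolding N_def by (rule trans[OF affine_gauss_moments(2)[where i=2 and j=3 and A=limit_root] entries(6)])
qed

text \<open>The first marginal of the joint limit, transferred to \<open>weak_conv_m\<close> by
  \<open>weak_conv_law_real_iff\<close>.\<close>

lemma supercritical_components:
  "weak_conv_m (\<lambda>n. distr (random_graph n (p n)) borel (comps_dev n))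
    (normal_law (- \<theta> * (1 - \<beta>\<^sup>2) / 2) (sqrt (\<beta> * (1 - \<beta>) + c * (1 - \<beta>)\<^sup>2 / 2)))"
proof -
  have nth: "continuous_on UNIV (\<lambda>x :: real ^ 3. x $ 1)" by (intro continuous_intros)
  have "weak_conv_law (\<lambda>n. distr (distr (random_graph n (p n)) borel (\<lambda>E. vector [comps_dev n E, size_dev n E, excess_dev n E] :: real ^ 3)) borel (\<lambda>x. x $ 1))
      (distr (affine_gauss limit_mean limit_root) borel (\<lambda>x. x $ 1))"
    by (rule weak_conv_law_map[OF joint_limit _ _ nth]) (simp_all add: affine_gauss_def)
  then have "weak_conv_law (\<lambda>n. distr (random_graph n (p n)) borel (comps_dev n))
      (normal_law (- \<theta> * (1 - \<beta>\<^sup>2) / 2) (sqrt (\<beta> * (1 - \<beta>) + c * (1 - \<beta>)\<^sup>2 / 2)))"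
    unfolding distr_affine_gauss_nth limit_covariance
    by (simp add: distr_distr comp_def limit_mean_def m1_def)
  then show ?thesis
    by (subst (asm) weak_conv_law_real_iff)
      (auto intro!: real_distribution_normal_law prob_space.real_distribution_distr measure_pmf.prob_space_axioms)
qed

end

theorem theorem2p2:
  fixes cn :: "nat \<Rightarrow> real" and c \<theta> \<alpha> \<beta> \<gamma> :: real
    and L :: "nat \<Rightarrow> nat set set \<Rightarrow> nat set"
  assumes c_pos: "c > 0"
    and edge_prob: "\<forall>\<^sub>F n in sequentially. cn n / real n \<in> {0..1}"
    and cn_lim: "(\<lambda>n. sqrt (real n) * (cn n - c)) \<longlonglongrightarrow> \<theta>"
    and beta_super: "c > 1 \<Longrightarrow> 0 < \<beta> \<and> \<beta> < 1 \<and> 1 - \<beta> = exp (- \<beta> * c)"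
    and beta_sub: "c \<le> 1 \<Longrightarrow> \<beta> = 0"
    and alpha: "\<alpha> = 1 - \<beta> - c * (1 - \<beta>)\<^sup>2 / 2"
    and gamma: "\<gamma> = (c - 1) * \<beta> - c * \<beta>\<^sup>2 / 2"
    and L_largest: "\<And>n E. n > 0 \<Longrightarrow> E \<subseteq> all_edges n \<Longrightarrow> is_largest_component n E (L n E)"
  shows
    "(\<exists>N :: real measure.
        gaussian_law N \<and>
        prob_space.expectation N (\<lambda>x. x) = - \<theta> * (1 - \<beta>\<^sup>2) / 2 \<and>
        prob_space.variance N (\<lambda>x. x) = \<beta> * (1 - \<beta>) + c * (1 - \<beta>)\<^sup>2 / 2 \<and>
        weak_conv_m
          (\<lambda>n. distr (random_graph n (cn n / real n)) borel
             (\<lambda>E. sqrt (real n) * (real (card (graph_components n E)) / real n - \<alpha>))) N) \<and>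
     (c > 1 \<longrightarrow>
      (\<exists>N :: (real ^ 3) measure.
        gaussian_law N \<and>
        prob_space.expectation N (\<lambda>x. x $ 1) = - \<theta> * (1 - \<beta>\<^sup>2) / 2 \<and>
        prob_space.expectation N (\<lambda>x. x $ 2) = \<theta> * \<beta> * (1 - \<beta>) / (1 - c * (1 - \<beta>)) \<and>
        prob_space.expectation N (\<lambda>x. x $ 3) = \<theta> * \<beta>\<^sup>2 / 2 \<and>
        prob_space.variance N (\<lambda>x. x $ 1) = \<beta> * (1 - \<beta>) + c * (1 - \<beta>)\<^sup>2 / 2 \<and>
        prob_space.variance N (\<lambda>x. x $ 2) = \<beta> * (1 - \<beta>) / (1 - c * (1 - \<beta>))\<^sup>2 \<and>
        prob_space.variance N (\<lambda>x. x $ 3) = \<beta> * (1 - \<beta>) + c * \<beta> * (3 * \<beta> / 2 - 1) \<and>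
        covariance N (\<lambda>x. x $ 1) (\<lambda>x. x $ 2) = - \<beta> * (1 - \<beta>) / (1 - c * (1 - \<beta>)) \<and>
        covariance N (\<lambda>x. x $ 1) (\<lambda>x. x $ 3) = - \<beta> * (1 - \<beta>) * (c - 1) \<and>
        covariance N (\<lambda>x. x $ 2) (\<lambda>x. x $ 3) =
          \<beta> * (1 - \<beta>) * (c - 1) / (1 - c * (1 - \<beta>)) \<and>
        weak_conv_law
          (\<lambda>n. distr (random_graph n (cn n / real n)) borel
             (\<lambda>E. vector
                [sqrt (real n) * (real (card (graph_components n E)) / real n - \<alpha>),
                 sqrt (real n) * (real (card (L n E)) / real n - \<beta>),
                 sqrt (real n) * (real_of_int (excess_edges E (L n E)) / real n - \<gamma>)])) N))"
proof -
  interpret sparse cn c \<theta> by unfold_locales (fact c_pos cn_lim)+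
  let ?m = "- \<theta> * (1 - \<beta>\<^sup>2) / 2" and ?v = "\<beta> * (1 - \<beta>) + c * (1 - \<beta>)\<^sup>2 / 2"
  have giant: "giant_component cn c \<theta> \<beta> \<alpha> \<gamma> L" if "1 < c"
    using beta_super[OF that] that alpha gamma L_largest by unfold_locales auto
  \<comment> \<open>Needed because the law is given by a standard deviation, and squaring sqrt
    \<open>?v\<close> must return \<open>?v\<close>.\<close>
  have v: "0 \<le> ?v"
  proof (cases "c \<le> 1")
    case True
    then show ?thesis using beta_sub c_pos by simp
  next
    case False
    then show ?thesis using beta_super c_pos by simp
  qed
  have conv: "weak_conv_m (\<lambda>n. distr (random_graph n (cn n / real n)) borel
      (\<lambda>E. sqrt (real n) * (real (card (graph_components n E)) / real n - \<alpha>))) (normal_law ?m (sqrt ?v))"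
  proof (cases "c \<le> 1")
    case True
    \<comment> \<open>With \<beta> = 0 the centring is 1 - c/2, the mean is -\<theta>/2 and the
      variance is c/2.\<close>
    then show ?thesis using subcritical_components beta_sub alpha by (simp add: p_def)
  next
    case False
    then interpret giant_component cn c \<theta> \<beta> \<alpha> \<gamma> L by (intro giant) simp
    show ?thesis using supercritical_components unfolding comps_dev_def[abs_def] p_def .
  qed
  show ?thesis
  proof (intro conjI impI)
    show "\<exists>N :: real measure.
        gaussian_law N \<and>
        prob_space.expectation N (\<lambda>x. x) = ?m \<and>
        prob_space.variance N (\<lambda>x. x) = ?v \<and>
        weak_conv_m
          (\<lambda>n. distr (random_graph n (cn n / real n)) borel
             (\<lambda>E. sqrt (real n) * (real (card (graph_components n E)) / real n - \<alpha>))) N"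
      using conv v normal_law_moments(2,4)[of ?m "sqrt ?v"]
      by (intro exI[of _ "normal_law ?m (sqrt ?v)"] conjI gaussian_normal_law) simp_all
  next
    assume "1 < c"
    then interpret giant_component cn c \<theta> \<beta> \<alpha> \<gamma> L by (rule giant)
    let ?N = "affine_gauss limit_mean limit_root"
    show "\<exists>N :: (real ^ 3) measure.
        gaussian_law N \<and>
        prob_space.expectation N (\<lambda>x. x $ 1) = ?m \<and>
        prob_space.expectation N (\<lambda>x. x $ 2) = \<theta> * \<beta> * (1 - \<beta>) / (1 - c * (1 - \<beta>)) \<and>
        prob_space.expectation N (\<lambda>x. x $ 3) = \<theta> * \<beta>\<^sup>2 / 2 \<and>
        prob_space.variance N (\<lambda>x. x $ 1) = ?v \<and>
        prob_space.variance N (\<lambda>x. x $ 2) = \<beta> * (1 - \<beta>) / (1 - c * (1 - \<beta>))\<^sup>2 \<and>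
        prob_space.variance N (\<lambda>x. x $ 3) = \<beta> * (1 - \<beta>) + c * \<beta> * (3 * \<beta> / 2 - 1) \<and>
        covariance N (\<lambda>x. x $ 1) (\<lambda>x. x $ 2) = - \<beta> * (1 - \<beta>) / (1 - c * (1 - \<beta>)) \<and>
        covariance N (\<lambda>x. x $ 1) (\<lambda>x. x $ 3) = - \<beta> * (1 - \<beta>) * (c - 1) \<and>
        covariance N (\<lambda>x. x $ 2) (\<lambda>x. x $ 3) =
          \<beta> * (1 - \<beta>) * (c - 1) / (1 - c * (1 - \<beta>)) \<and>
        weak_conv_law
          (\<lambda>n. distr (random_graph n (cn n / real n)) borel
             (\<lambda>E. vector
                [sqrt (real n) * (real (card (graph_components n E)) / real n - \<alpha>),
                 sqrt (real n) * (real (card (L n E)) / real n - \<beta>),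
                 sqrt (real n) * (real_of_int (excess_edges E (L n E)) / real n - \<gamma>)])) N"
    proof (rule exI[of _ ?N], intro conjI)
      show "gaussian_law ?N" by (rule gaussian_affine_gauss)
      show "weak_conv_law
          (\<lambda>n. distr (random_graph n (cn n / real n)) borel
             (\<lambda>E. vector
                [sqrt (real n) * (real (card (graph_components n E)) / real n - \<alpha>),
                 sqrt (real n) * (real (card (L n E)) / real n - \<beta>),
                 sqrt (real n) * (real_of_int (excess_edges E (L n E)) / real n - \<gamma>)])) ?N"
        by (rule joint_limit[unfolded comps_dev_def size_dev_def excess_dev_def p_def])
    qed (rule limit_moments)+
  qed
qed

end
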